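(* For the root lattice $\underline{D}_3$ one has $$J_{\mathrm{odd},\underline{D}_3}(1)=M_*(1)\,\eta^{15}\,\iota_1^*\vartheta_{\underline{\mathbb{Z}}^3},$$ $$J_{\mathrm{even},\underline{D}_3}(1)=M_*(1)\,\mathcal{E}_{4,\underline{D}_3,0}\;\oplus\;M_*(1)\,\mathcal{E}_{6,\underline{D}_3,0}\;\oplus\;M_*(1)\,\eta^{12}\,\iota_2^*\vartheta_{\underline{\mathbb{Z}}^4}.$$
   Context: Notation: $e(x)=e^{2\pi i x}$, $\mathbb{H}$ is the upper half plane, $q^a=e(a\tau)$ for $\tau\in\mathbb{H}$, $\eta(\tau)=q^{1/24}\prod_{m\ge1}(1-q^m)$. For an even positive definite lattice $\underline{L}=(L,\beta)$ ($L$ free $\mathbb{Z}$-module of rank $n$, $\beta$ a $\mathbb{Z}$-valued symmetric bilinear form with $\beta(x,x)$ even for all $x \in L$, extended bilinearly to $R\otimes L$), put $\beta(x)=\frac12\beta(x,x)$ and $L^\sharp=\{r\in\mathbb{Q}\otimes L:\beta(r,L)\subseteq\mathbb{Z}\}$. For $k\in\mathbb{Z}$, $J_{k,\underline{L}}(1)$ is the space of holomorphic functions $\phi(\tau,z)$ on $\mathbb{H}\times(\mathbb{C}\otimes L)$ such that: (i) for all $A=\begin{pmatrix}a&b\\c&d\end{pmatrix}\in\mathrm{SL}(2,\mathbb{Z})$, $\phi\bigl(A\tau,\frac z{c\tau+d}\bigr)e\bigl(\frac{-c\beta(z)}{c\tau+d}\bigr)(c\tau+d)^{-k}=\phi(\tau,z)$;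 (ii) for all $x,y\in L$, $\phi(\tau,z+x\tau+y)e(\tau\beta(x)+\beta(x,z))=\phi(\tau,z)$; (iii) $\phi$ has a Fourier expansion $\phi=\sum_{m\in\mathbb{Z}}\sum_{r\in L^\sharp,\,m\ge\beta(r)}c(m,r)q^me(\beta(z,r))$. $J_{\mathrm{even},\underline{L}}(1)=\bigoplus_{k\in 2\mathbb{Z}}J_{k,\underline{L}}(1)$ and $J_{\mathrm{odd},\underline{L}}(1)=\bigoplus_{k\in1+2\mathbb{Z}}J_{k,\underline{L}}(1)$. $M_*(1)=\bigoplus_{k\in2\mathbb{Z}}M_k(\mathrm{SL}(2,\mathbb{Z}))=\mathbb{C}[E_4,E_6]$, acting by multiplication. $\underline{\mathbb{Z}}^N$ is $\mathbb{Z}^N$ with the standard scalar product. $\underline{D}_3$ is the sublattice of $\underline{\mathbb{Z}}^3$ of vectors with even coordinate sum; $z_1,z_2,z_3$ denote the coordinate functions. $\iota_1:\underline{D}_3\to\underline{\mathbb{Z}}^3$ is the inclusion $(z_1,z_2,z_3)$, and $\iota_2:\underline{D}_3\to\underline{\mathbb{Z}}^4$ is the isometric embedding $\iota_2=\frac12(z_1+z_2-z_3,\;z_1-z_2+z_3,\;-z_1+z_2+z_3,\;-z_1-z_2-z_3)$. For an isometric map $\alpha:\underline{L}'\to\underline{L}$, $(\alpha^*\phi)(\tau,z)=\phi(\tau,\alpha(z))$ with $\alpha$ extended $\mathbb{C}$-linearly. With $\vartheta(\tau,z)=\sum_{r\in\mathbb{Z}}\bigl(\frac{-4}r\bigr)q^{r^2/8}e(rz/2)$,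 put $\vartheta_{\underline{\mathbb{Z}}^N}(\tau,(w_1,\dots,w_N))=\vartheta(\tau,w_1)\cdots\vartheta(\tau,w_N)$. $\underline{E}_8$ is the lattice of vectors $r$ in $\mathbb{Z}^8\cup\bigl((\frac12,\dots,\frac12)+\mathbb{Z}^8\bigr)$ with $r_1+\cdots+r_8\in2\mathbb{Z}$, with the standard scalar product, and $\vartheta_{\underline{E}_8}(\tau,z)=\sum_{r\in E_8}q^{r\cdot r/2}e(r\cdot z)$. Let $\alpha:\underline{D}_3\to\underline{E}_8$, $\alpha(x,y,z)=(0,0,0,0,x,y,z,0)$. Every $\phi\in J_{k,\underline{L}}(1)$ can be written uniquely as $\phi=\sum_{x\in L^\sharp/L}h_x(\tau)\,\vartheta_x(\tau,z)$ with $\vartheta_x(\tau,z)=\sum_{r\in x}q^{\beta(r)}e(\beta(r,z))$ and $h_x$ holomorphic on $\mathbb{H}$; put $\delta\phi=\sum_x\bigl(q\frac{d}{dq}h_x\bigr)\vartheta_x-\frac1{12}\bigl(k-\frac n2\bigr)E_2\,\phi$, where $E_2=1-24\sum_{m\ge1}\sigma_1(m)q^m$ and $n=\mathrm{rank}\,\underline{L}$. Then $\mathcal{E}_{4,\underline{D}_3,0}:=\alpha^*\vartheta_{\underline{E}_8}\in J_{4,\underline{D}_3}(1)$ and $\mathcal{E}_{6,\underline{D}_3,0}:=\delta\,\alpha^*\vartheta_{\underline{E}_8}$. *)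

theory Defs
  imports
    "HOL-Analysis.Analysis"
    "HOL-Library.Function_Algebras"
begin

text \<open>
  Modular and Jacobi forms are functions on the upper half plane (times a complex vector space).
  They are represented here by total functions that vanish when \<^term>\<open>Im \<tau> \<le> 0\<close>, so that
  equality of functions, and hence of spaces of functions, is equality on the actual domain.
\<close>

abbreviation upper_half_plane :: "complex set" where
  "upper_half_plane \<equiv> {\<tau>. Im \<tau> > 0}"

definition ee :: "complex \<Rightarrow> complex" where
  "ee x = exp (2 * of_real pi * \<i> * x)"

section \<open>Internal direct sums\<close>

definition family_sum :: "'i set \<Rightarrow> ('i \<Rightarrow> 'v::ab_group_add set) \<Rightarrow> 'v set" where
  "family_sum I V = {\<Sum>i\<in>F. v i | F v. finite F \<and> F \<subseteq> I \<and> (\<forall>i\<in>F. v i \<in> V i)}"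

definition independent_family :: "'i set \<Rightarrow> ('i \<Rightarrow> 'v::ab_group_add set) \<Rightarrow> bool" where
  "independent_family I V \<longleftrightarrow>
     (\<forall>F v. finite F \<longrightarrow> F \<subseteq> I \<longrightarrow> (\<forall>i\<in>F. v i \<in> V i) \<longrightarrow> (\<Sum>i\<in>F. v i) = 0 \<longrightarrow> (\<forall>i\<in>F. v i = 0))"

definition internal_direct_sum :: "'i set \<Rightarrow> ('i \<Rightarrow> 'v::ab_group_add set) \<Rightarrow> 'v set \<Rightarrow> bool" where
  "internal_direct_sum I V W \<longleftrightarrow> independent_family I V \<and> W = family_sum I V"

lemma internal_direct_sum_3:
  fixes A B C W :: "'v::ab_group_add set"
  assumes "0 \<in> A" "0 \<in> B" "0 \<in> C"
  shows "internal_direct_sum {..<3} ((!) [A, B, C]) W \<longleftrightarrow>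
    W = {a + b + c | a b c. a \<in> A \<and> b \<in> B \<and> c \<in> C} \<and>
    (\<forall>a\<in>A. \<forall>b\<in>B. \<forall>c\<in>C. a + b + c = 0 \<longrightarrow> a = 0 \<and> b = 0 \<and> c = 0)"
proof -
  have I: "{..<3::nat} = {0, 1, 2}" by auto
  have ext: "\<exists>a b c. a \<in> A \<and> b \<in> B \<and> c \<in> C \<and> (\<Sum>i\<in>F. v i) = a + b + c \<and>
        (0 \<in> F \<longrightarrow> v 0 = a) \<and> (1 \<in> F \<longrightarrow> v 1 = b) \<and> (2 \<in> F \<longrightarrow> v 2 = c)"
    if "F \<subseteq> {..<3}" "\<forall>i\<in>F. v i \<in> [A, B, C] ! i" for F and v :: "nat \<Rightarrow> 'v"
  proof -
    let ?w = "\<lambda>i. if i \<in> F then v i else 0"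
    have "(\<Sum>i\<in>F. v i) = (\<Sum>i\<in>{..<3}. ?w i)"
      using that(1) by (intro sum.mono_neutral_cong_left) auto
    also have "\<dots> = ?w 0 + ?w 1 + ?w 2" by (simp add: I add.assoc)
    finally have s: "(\<Sum>i\<in>F. v i) = ?w 0 + ?w 1 + ?w 2" .
    have "?w 0 \<in> A" "?w 1 \<in> B" "?w 2 \<in> C"
      using that(2)[rule_format, of 0] that(2)[rule_format, of 1] that(2)[rule_format, of 2] assms
      by (auto simp: numeral_2_eq_2)
    moreover have "0 \<in> F \<longrightarrow> v 0 = ?w 0" "1 \<in> F \<longrightarrow> v 1 = ?w 1" "2 \<in> F \<longrightarrow> v 2 = ?w 2"
      by auto
    ultimately show ?thesis using s by blast
  qed
  have tri: "\<exists>v. (\<forall>i\<in>{..<3}. v i \<in> [A, B, C] ! i) \<and> (\<Sum>i\<in>{..<3}. v i) = a + b + c \<and>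
        v 0 = a \<and> v 1 = b \<and> v 2 = c"
    if "a \<in> A" "b \<in> B" "c \<in> C" for a b c
    by (rule exI[of _ "(!) [a, b, c]"]) (use that in \<open>auto simp: I add.assoc numeral_2_eq_2\<close>)
  have "family_sum {..<3} ((!) [A, B, C]) = {a + b + c | a b c. a \<in> A \<and> b \<in> B \<and> c \<in> C}"
  proof (intro equalityI subsetI)
    fix x assume "x \<in> family_sum {..<3} ((!) [A, B, C])"
    then obtain F v where "x = (\<Sum>i\<in>F. v i)" "F \<subseteq> {..<3}" "\<forall>i\<in>F. v i \<in> [A, B, C] ! i"
      unfolding family_sum_def by blast
    then show "x \<in> {a + b + c | a b c. a \<in> A \<and> b \<in> B \<and> c \<in> C}" using ext[of F v] by blast
  next
    fix x assume "x \<in> {a + b + c | a b c. a \<in> A \<and> b \<in> B \<and> c \<in> C}"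
    then obtain v where "\<forall>i\<in>{..<3}. v i \<in> [A, B, C] ! i" "(\<Sum>i\<in>{..<3}. v i) = x"
      using tri by blast
    then show "x \<in> family_sum {..<3} ((!) [A, B, C])"
      unfolding family_sum_def by blast
  qed
  moreover have "independent_family {..<3} ((!) [A, B, C]) \<longleftrightarrow>
      (\<forall>a\<in>A. \<forall>b\<in>B. \<forall>c\<in>C. a + b + c = 0 \<longrightarrow> a = 0 \<and> b = 0 \<and> c = 0)"
  proof (intro iffI ballI impI)
    fix a b c assume ind: "independent_family {..<3} ((!) [A, B, C])"
      and abc: "a \<in> A" "b \<in> B" "c \<in> C" "a + b + c = 0"
    obtain v where v: "\<forall>i\<in>{..<3}. v i \<in> [A, B, C] ! i" "(\<Sum>i\<in>{..<3}. v i) = a + b + c"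
        "v 0 = a" "v 1 = b" "v 2 = c"
      using tri[OF abc(1-3)] by blast
    have "\<forall>i\<in>{..<3}. v i = 0"
      using ind[unfolded independent_family_def, rule_format, of "{..<3}" v] v(1,2) abc(4)
      by (metis finite_lessThan subset_refl)
    hence "v 0 = 0" "v 1 = 0" "v 2 = 0" unfolding I by blast+
    thus "a = 0 \<and> b = 0 \<and> c = 0" using v(3-5) by simp
  next
    assume R: "\<forall>a\<in>A. \<forall>b\<in>B. \<forall>c\<in>C. a + b + c = 0 \<longrightarrow> a = 0 \<and> b = 0 \<and> c = 0"
    show "independent_family {..<3} ((!) [A, B, C])"
      unfolding independent_family_def
    proof (intro allI impI ballI)
      fix F i and v :: "nat \<Rightarrow> 'v"
      assume F: "F \<subseteq> {..<3}" "\<forall>i\<in>F. v i \<in> [A, B, C] ! i" "(\<Sum>i\<in>F. v i) = 0" and i: "i \<in> F"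
      obtain a b c where abc: "a \<in> A" "b \<in> B" "c \<in> C" "(\<Sum>i\<in>F. v i) = a + b + c"
        and vi: "0 \<in> F \<longrightarrow> v 0 = a" "1 \<in> F \<longrightarrow> v 1 = b" "2 \<in> F \<longrightarrow> v 2 = c"
        using ext[OF F(1,2)] by blast
      from abc(4) F(3) have "a + b + c = 0" by simp
      with R abc(1-3) have "a = 0" "b = 0" "c = 0" by blast+
      moreover from F(1) i I have "i = 0 \<or> i = 1 \<or> i = 2" by blast
      ultimately show "v i = 0" using vi i by metis
    qed
  qed
  ultimately show ?thesis unfolding internal_direct_sum_def by (simp only: conj_commute)
qed

section \<open>Modular forms on the full modular group\<close>

text \<open>
  Invariance of \<^term>\<open>f\<close> under the weight \<^term>\<open>k\<close> action of SL(2,Z), holomorphy on the upper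
  half plane, and a Fourier expansion with non-negative exponents.
\<close>

definition modular_forms :: "int \<Rightarrow> (complex \<Rightarrow> complex) set" where
  "modular_forms k = {f.
     (\<forall>\<tau>. Im \<tau> \<le> 0 \<longrightarrow> f \<tau> = 0) \<and>
     f holomorphic_on upper_half_plane \<and>
     (\<forall>a b c d :: int. \<forall>\<tau>\<in>upper_half_plane. a * d - b * c = 1 \<longrightarrow>
        f ((of_int a * \<tau> + of_int b) / (of_int c * \<tau> + of_int d))
          * (of_int c * \<tau> + of_int d) powi (- k) = f \<tau>) \<and>
     (\<exists>a :: nat \<Rightarrow> complex. \<forall>\<tau>\<in>upper_half_plane. (\<lambda>m. a m * ee (of_nat m * \<tau>)) sums f \<tau>)}"

definition M_star :: "(complex \<Rightarrow> complex) set" where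
  "M_star = family_sum {k. even k} modular_forms"

definition M_star_multiples :: "(complex \<Rightarrow> 'z \<Rightarrow> complex) \<Rightarrow> (complex \<Rightarrow> 'z \<Rightarrow> complex) set" where
  "M_star_multiples g = {\<lambda>\<tau> z. f \<tau> * g \<tau> z | f. f \<in> M_star}"

definition eta :: "complex \<Rightarrow> complex" where
  "eta \<tau> = (if Im \<tau> > 0 then ee (\<tau> / 24) * prodinf (\<lambda>m. 1 - ee (of_nat (Suc m) * \<tau>)) else 0)"

definition E2 :: "complex \<Rightarrow> complex" where
  "E2 \<tau> = (if Im \<tau> > 0
     then 1 - 24 * (\<Sum>m. of_nat (\<Sum>d | d dvd Suc m. d) * ee (of_nat (Suc m) * \<tau>)) else 0)"

section \<open>Lattices\<close>

text \<open>
  A positive definite lattice of rank n is given as a subset of full rank of Euclidean n-space, its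
  bilinear form being the standard scalar product. A spanning additive subgroup on which the scalar
  product is integral is discrete, hence free of rank n.
\<close>

definition even_lattice :: "(real^'n) set \<Rightarrow> bool" where
  "even_lattice L \<longleftrightarrow>
     0 \<in> L \<and> (\<forall>x\<in>L. \<forall>y\<in>L. x - y \<in> L) \<and> span L = UNIV \<and>
     (\<forall>x\<in>L. \<forall>y\<in>L. x \<bullet> y \<in> \<int>) \<and> (\<forall>x\<in>L. x \<bullet> x / 2 \<in> \<int>)"

definition dual_lattice :: "(real^'n) set \<Rightarrow> (real^'n) set" where
  "dual_lattice L = {r. (\<exists>m::nat. m > 0 \<and> real m *\<^sub>R r \<in> L) \<and> (\<forall>x\<in>L. r \<bullet> x \<in> \<int>)}"

definition discriminant_cosets :: "(real^'n) set \<Rightarrow> (real^'n) set set" where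
  "discriminant_cosets L = (\<lambda>r. (+) r ` L) ` dual_lattice L"

definition cvec :: "real^'n \<Rightarrow> complex^'n" where
  "cvec x = (\<chi> i. of_real (x $ i))"

text \<open>The complex bilinear (not Hermitian) extension of the scalar product.\<close>

definition bil :: "complex^'n \<Rightarrow> complex^'n \<Rightarrow> complex" where
  "bil z w = (\<Sum>i\<in>UNIV. z $ i * w $ i)"

lemma bil_cvec: "bil (cvec x) (cvec y) = of_real (x \<bullet> y)"
  by (simp add: bil_def cvec_def inner_vec_def)

section \<open>Jacobi forms\<close>

text \<open>Holomorphy in several variables: complex Frechet differentiability at every point.\<close>

definition jacobi_holomorphic :: "(complex \<Rightarrow> complex^'n \<Rightarrow> complex) \<Rightarrow> bool" where
  "jacobi_holomorphic \<phi> \<longleftrightarrow>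
     (\<forall>\<tau>\<in>upper_half_plane. \<forall>z. \<exists>D.
        ((\<lambda>(t, w). \<phi> t w) has_derivative D) (at (\<tau>, z)) \<and>
        (\<forall>c t w. D (c * t, c *s w) = c * D (t, w)))"

definition jacobi_forms ::
  "int \<Rightarrow> (real^'n) set \<Rightarrow> (complex \<Rightarrow> complex^'n \<Rightarrow> complex) set" where
  "jacobi_forms k L = {\<phi>.
     (\<forall>\<tau> z. Im \<tau> \<le> 0 \<longrightarrow> \<phi> \<tau> z = 0) \<and>
     jacobi_holomorphic \<phi> \<and>
     (\<forall>a b c d :: int. \<forall>\<tau>\<in>upper_half_plane. \<forall>z. a * d - b * c = 1 \<longrightarrow>
        \<phi> ((of_int a * \<tau> + of_int b) / (of_int c * \<tau> + of_int d)) ((1 / (of_int c * \<tau> + of_int d)) *s z)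
          * ee (- of_int c * (bil z z / 2) / (of_int c * \<tau> + of_int d))
          * (of_int c * \<tau> + of_int d) powi (- k) = \<phi> \<tau> z) \<and>
     (\<forall>x\<in>L. \<forall>y\<in>L. \<forall>\<tau>\<in>upper_half_plane. \<forall>z.
        \<phi> \<tau> (z + \<tau> *s cvec x + cvec y) * ee (\<tau> * of_real (x \<bullet> x / 2) + bil (cvec x) z) = \<phi> \<tau> z) \<and>
     (\<exists>c :: int \<Rightarrow> real^'n \<Rightarrow> complex. \<forall>\<tau>\<in>upper_half_plane. \<forall>z.
        ((\<lambda>(m, r). c m r * ee (of_int m * \<tau>) * ee (bil z (cvec r))) has_sum \<phi> \<tau> z)
          {(m, r). r \<in> dual_lattice L \<and> of_int m \<ge> r \<bullet> r / 2})}"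

definition J_even :: "(real^'n) set \<Rightarrow> (complex \<Rightarrow> complex^'n \<Rightarrow> complex) set" where
  "J_even L = family_sum {k. even k} (\<lambda>k. jacobi_forms k L)"

definition J_odd :: "(real^'n) set \<Rightarrow> (complex \<Rightarrow> complex^'n \<Rightarrow> complex) set" where
  "J_odd L = family_sum {k. odd k} (\<lambda>k. jacobi_forms k L)"

text \<open>
  Forms of different weights are linearly independent, so the internal sums over all weights used
  above are the direct sums of the graded components.
\<close>

lemma nat_mult_add_1_nonzero:
  assumes "Im \<tau> > 0"
  shows "of_nat n * \<tau> + 1 \<noteq> 0"
proof
  assume h: "of_nat n * \<tau> + 1 = 0"
  hence "Im (of_nat n * \<tau> + 1) = 0" by simp
  hence "n = 0" using assms by simp
  with h show False by simp
qed

lemma cocycle_powers_independent: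
  fixes a :: "int \<Rightarrow> complex"
  assumes F: "finite F" and \<tau>: "Im \<tau> > 0"
    and sum0: "\<And>n::nat. (\<Sum>k\<in>F. a k * (of_nat n * \<tau> + 1) powi k) = 0"
    and k: "k \<in> F"
  shows "a k = 0"
proof -
  define N where "N = Min F"
  have N: "N \<le> j" if "j \<in> F" for j using F that by (simp add: N_def)
  define p where "p = (\<Sum>j\<in>F. monom (a j) (nat (j - N)))"
  note nz = nat_mult_add_1_nonzero[OF \<tau>]
  have root: "poly p (of_nat n * \<tau> + 1) = 0" for n
  proof -
    let ?x = "of_nat n * \<tau> + 1"
    have "poly p ?x = (\<Sum>j\<in>F. a j * ?x ^ nat (j - N))"
      by (simp add: p_def poly_sum poly_monom)
    also have "\<dots> = (\<Sum>j\<in>F. ?x powi (- N) * (a j * ?x powi j))"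
    proof (intro sum.cong refl)
      fix j assume "j \<in> F"
      hence "?x ^ nat (j - N) = ?x powi (j - N)" using N by (simp add: power_int_def)
      also have "\<dots> = ?x powi (- N) * ?x powi j"
        using nz by (simp flip: power_int_add)
      finally show "a j * ?x ^ nat (j - N) = ?x powi (- N) * (a j * ?x powi j)" by simp
    qed
    also have "\<dots> = 0" by (simp only: sum_distrib_left[symmetric] sum0 mult_zero_right)
    finally show ?thesis .
  qed
  have "inj (\<lambda>n::nat. of_nat n * \<tau> + 1)"
    using \<tau> by (auto intro!: injI)
  hence "infinite (range (\<lambda>n::nat. of_nat n * \<tau> + 1))"
    using finite_imageD by blast
  moreover have "range (\<lambda>n::nat. of_nat n * \<tau> + 1) \<subseteq> {x. poly p x = 0}"
    using root by auto
  ultimately have "p = 0" using poly_roots_finite finite_subset by blast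
  hence "0 = coeff p (nat (k - N))" by simp
  also have "\<dots> = (\<Sum>j\<in>F. if j = k then a j else 0)"
    unfolding p_def coeff_sum
    by (intro sum.cong refl) (use N k in \<open>auto simp: eq_nat_nat_iff\<close>)
  also have "\<dots> = a k" using F k by simp
  finally show ?thesis by simp
qed

lemma sum_fun_apply1: "(\<Sum>i\<in>F. v i) x = (\<Sum>i\<in>F. v i x)"
  for v :: "'i \<Rightarrow> 'a \<Rightarrow> 'b::ab_group_add"
  by (induction F rule: infinite_finite_induct) auto

lemma independent_modular_forms: "independent_family UNIV modular_forms"
  unfolding independent_family_def
proof (intro allI impI ballI ext)
  fix F :: "int set" and v and k \<tau>
  assume F: "finite F" and v: "\<forall>k\<in>F. v k \<in> modular_forms k" and s: "sum v F = 0" and k: "k \<in> F"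
  show "v k \<tau> = 0 \<tau>"
  proof (cases "Im \<tau> > 0")
    case False
    thus ?thesis using v k by (auto simp: modular_forms_def)
  next
    case True
    have "v k \<tau> = 0"
    proof (rule cocycle_powers_independent[OF F True _ k, where a = "\<lambda>j. v j \<tau>"])
      fix n :: nat
      let ?x = "of_nat n * \<tau> + 1"
      have "v j \<tau> * ?x powi j = v j (\<tau> / ?x)" if j: "j \<in> F" for j
      proof -
        have "\<forall>a b c d :: int. \<forall>\<tau>\<in>upper_half_plane. a * d - b * c = 1 \<longrightarrow>
          v j ((of_int a * \<tau> + of_int b) / (of_int c * \<tau> + of_int d))
          * (of_int c * \<tau> + of_int d) powi (- j) = v j \<tau>"
          using v j unfolding modular_forms_def by blast
        from this[rule_format, of \<tau> 1 1 0 "int n"] True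
        have "v j \<tau> = v j (\<tau> / ?x) * ?x powi (- j)" by simp
        thus ?thesis using nat_mult_add_1_nonzero[OF True, of n]
          by (simp add: power_int_minus field_simps)
      qed
      hence "(\<Sum>j\<in>F. v j \<tau> * ?x powi j) = (\<Sum>j\<in>F. v j (\<tau> / ?x))" by simp
      also have "\<dots> = (sum v F) (\<tau> / ?x)" by (simp add: sum_fun_apply1)
      finally show "(\<Sum>j\<in>F. v j \<tau> * ?x powi j) = 0" by (simp add: s)
    qed
    thus ?thesis by simp
  qed
qed

lemma independent_jacobi_forms: "independent_family UNIV (\<lambda>k. jacobi_forms k L)"
  unfolding independent_family_def
proof (intro allI impI ballI ext)
  fix F :: "int set" and v and k \<tau> z
  assume F: "finite F" and v: "\<forall>k\<in>F. v k \<in> jacobi_forms k L" and s: "sum v F = 0" and k: "k \<in> F"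
  show "v k \<tau> z = 0 \<tau> z"
  proof (cases "Im \<tau> > 0")
    case False
    thus ?thesis using v k by (auto simp: jacobi_forms_def)
  next
    case True
    have "v k \<tau> z = 0"
    proof (rule cocycle_powers_independent[OF F True _ k, where a = "\<lambda>j. v j \<tau> z"])
      fix n :: nat
      let ?x = "of_nat n * \<tau> + 1"
      define u where "u = ee (- of_int (int n) * (bil z z / 2) / ?x)"
      have "v j \<tau> z * ?x powi j = v j (\<tau> / ?x) ((1 / ?x) *s z) * u" if j: "j \<in> F" for j
      proof -
        have "\<forall>a b c d :: int. \<forall>\<tau>\<in>upper_half_plane. \<forall>z. a * d - b * c = 1 \<longrightarrow>
          v j ((of_int a * \<tau> + of_int b) / (of_int c * \<tau> + of_int d)) ((1 / (of_int c * \<tau> + of_int d)) *s z)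
          * ee (- of_int c * (bil z z / 2) / (of_int c * \<tau> + of_int d))
          * (of_int c * \<tau> + of_int d) powi (- j) = v j \<tau> z"
          using v j unfolding jacobi_forms_def by blast
        from this[rule_format, of \<tau> 1 1 0 "int n" z] True
        have "v j \<tau> z = v j (\<tau> / ?x) ((1 / ?x) *s z) * u * ?x powi (- j)" by (simp add: u_def)
        thus ?thesis using nat_mult_add_1_nonzero[OF True, of n]
          by (simp add: power_int_minus field_simps)
      qed
      hence "(\<Sum>j\<in>F. v j \<tau> z * ?x powi j) = (\<Sum>j\<in>F. v j (\<tau> / ?x) ((1 / ?x) *s z)) * u"
        by (simp add: sum_distrib_right)
      also have "(\<Sum>j\<in>F. v j (\<tau> / ?x) ((1 / ?x) *s z)) = (sum v F) (\<tau> / ?x) ((1 / ?x) *s z)"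
        by (simp add: sum_fun_apply1)
      finally show "(\<Sum>j\<in>F. v j \<tau> z * ?x powi j) = 0" by (simp add: s)
    qed
    thus ?thesis by simp
  qed
qed

section \<open>Theta functions\<close>

text \<open>
  Lattice sums are \<^const>\<open>infsum\<close>; for \<^term>\<open>Im \<tau> > 0\<close> they converge absolutely.
\<close>

definition theta_sum :: "(real^'n) set \<Rightarrow> complex \<Rightarrow> complex^'n \<Rightarrow> complex" where
  "theta_sum X \<tau> z = (if Im \<tau> > 0
     then \<Sum>\<^sub>\<infinity>r\<in>X. ee (of_real (r \<bullet> r / 2) * \<tau>) * ee (bil (cvec r) z) else 0)"

definition kronecker_minus4 :: "int \<Rightarrow> complex" where
  "kronecker_minus4 r = (if r mod 4 = 1 then 1 else if r mod 4 = 3 then -1 else 0)"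

definition jacobi_theta :: "complex \<Rightarrow> complex \<Rightarrow> complex" where
  "jacobi_theta \<tau> w = (if Im \<tau> > 0
     then \<Sum>\<^sub>\<infinity>r\<in>UNIV. kronecker_minus4 r * ee (of_int (r\<^sup>2) / 8 * \<tau>) * ee (of_int r * w / 2) else 0)"

definition theta_ZN :: "complex \<Rightarrow> complex^'N \<Rightarrow> complex" where
  "theta_ZN \<tau> w = (\<Prod>i\<in>UNIV. jacobi_theta \<tau> (w $ i))"

definition pullback ::
  "(complex^'n \<Rightarrow> complex^'m) \<Rightarrow> (complex \<Rightarrow> complex^'m \<Rightarrow> complex) \<Rightarrow> complex \<Rightarrow> complex^'n \<Rightarrow> complex" where
  "pullback \<alpha> \<phi> \<tau> z = \<phi> \<tau> (\<alpha> z)"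

section \<open>The heat operator\<close>

definition is_theta_decomposition ::
  "(real^'n) set \<Rightarrow> (complex \<Rightarrow> complex^'n \<Rightarrow> complex) \<Rightarrow> ((real^'n) set \<Rightarrow> complex \<Rightarrow> complex) \<Rightarrow> bool" where
  "is_theta_decomposition L \<phi> h \<longleftrightarrow>
     (\<forall>X\<in>discriminant_cosets L. h X holomorphic_on upper_half_plane) \<and>
     (\<forall>\<tau>\<in>upper_half_plane. \<forall>z. \<phi> \<tau> z = (\<Sum>X\<in>discriminant_cosets L. h X \<tau> * theta_sum X \<tau> z))"

text \<open>
  The components are unique on cosets of the lattice in its dual and on the upper half plane; the
  choice operator only affects irrelevant values of \<^term>\<open>h\<close>. The derivation q d/dq is
  1/(2 pi i) times the derivative with respect to \<^term>\<open>\<tau>\<close>.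
\<close>

definition theta_components ::
  "(real^'n) set \<Rightarrow> (complex \<Rightarrow> complex^'n \<Rightarrow> complex) \<Rightarrow> (real^'n) set \<Rightarrow> complex \<Rightarrow> complex" where
  "theta_components L \<phi> = (SOME h. is_theta_decomposition L \<phi> h)"

definition heat_delta ::
  "int \<Rightarrow> (real^'n) set \<Rightarrow> (complex \<Rightarrow> complex^'n \<Rightarrow> complex) \<Rightarrow> complex \<Rightarrow> complex^'n \<Rightarrow> complex" where
  "heat_delta k L \<phi> \<tau> z = (if Im \<tau> > 0
     then (\<Sum>X\<in>discriminant_cosets L.
             deriv (theta_components L \<phi> X) \<tau> / (2 * of_real pi * \<i>) * theta_sum X \<tau> z)
          - 1 / 12 * (of_int k - of_nat CARD('n) / 2) * E2 \<tau> * \<phi> \<tau> z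
     else 0)"

section \<open>The lattices and embeddings\<close>

definition lattice_D3 :: "(real^3) set" where
  "lattice_D3 = {x. (\<forall>i. x $ i \<in> \<int>) \<and> (\<Sum>i\<in>UNIV. x $ i) / 2 \<in> \<int>}"

definition lattice_E8 :: "(real^8) set" where
  "lattice_E8 = {r. ((\<forall>i. r $ i \<in> \<int>) \<or> (\<forall>i. r $ i - 1 / 2 \<in> \<int>)) \<and> (\<Sum>i\<in>UNIV. r $ i) / 2 \<in> \<int>}"

text \<open>
  The maps are written over an arbitrary field, so that the same formula gives the embedding of
  lattices and its complex linear extension.
\<close>

definition iota1 :: "'a::field^3 \<Rightarrow> 'a^3" where
  "iota1 z = vector [z $ 1, z $ 2, z $ 3]"

definition iota2 :: "'a::field^3 \<Rightarrow> 'a^4" where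
  "iota2 z = vector [(z $ 1 + z $ 2 - z $ 3) / 2, (z $ 1 - z $ 2 + z $ 3) / 2,
     (- z $ 1 + z $ 2 + z $ 3) / 2, (- z $ 1 - z $ 2 - z $ 3) / 2]"

definition embed_E8 :: "'a::field^3 \<Rightarrow> 'a^8" where
  "embed_E8 z = vector [0, 0, 0, 0, z $ 1, z $ 2, z $ 3, 0]"

definition jacobi_E4_D3 :: "complex \<Rightarrow> complex^3 \<Rightarrow> complex" where
  "jacobi_E4_D3 = pullback embed_E8 (theta_sum lattice_E8)"

definition jacobi_E6_D3 :: "complex \<Rightarrow> complex^3 \<Rightarrow> complex" where
  "jacobi_E6_D3 = heat_delta 4 lattice_D3 jacobi_E4_D3"

lemma vector_4:
  "(vector [a, b, c, d] :: 'a::zero^4) $ 1 = a"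
  "(vector [a, b, c, d] :: 'a::zero^4) $ 2 = b"
  "(vector [a, b, c, d] :: 'a::zero^4) $ 3 = c"
  "(vector [a, b, c, d] :: 'a::zero^4) $ 4 = d"
  by (simp_all add: vector_def)

lemma UNIV_8: "(UNIV :: 8 set) = {1, 2, 3, 4, 5, 6, 7, 8}"
proof (intro equalityI subsetI)
  fix x :: 8
  show "x \<in> {1, 2, 3, 4, 5, 6, 7, 8}"
  proof (induct x)
    case (of_int z)
    hence "z \<in> {0, 1, 2, 3, 4, 5, 6, 7}" by auto
    thus ?case by auto
  qed
qed auto

lemma sum_8: "(\<Sum>i\<in>(UNIV :: 8 set). f i) = f 1 + f 2 + f 3 + f 4 + f 5 + f 6 + f 7 + f 8"
  unfolding UNIV_8 by (simp add: ac_simps)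

lemma vector_8:
  "(vector [a, b, c, d, e, f, g, h] :: 'a::zero^8) $ 1 = a"
  "(vector [a, b, c, d, e, f, g, h] :: 'a::zero^8) $ 2 = b"
  "(vector [a, b, c, d, e, f, g, h] :: 'a::zero^8) $ 3 = c"
  "(vector [a, b, c, d, e, f, g, h] :: 'a::zero^8) $ 4 = d"
  "(vector [a, b, c, d, e, f, g, h] :: 'a::zero^8) $ 5 = e"
  "(vector [a, b, c, d, e, f, g, h] :: 'a::zero^8) $ 6 = f"
  "(vector [a, b, c, d, e, f, g, h] :: 'a::zero^8) $ 7 = g"
  "(vector [a, b, c, d, e, f, g, h] :: 'a::zero^8) $ 8 = h"
  by (simp_all add: vector_def)

lemma forall_8: "(\<forall>i::8. P i) \<longleftrightarrow> P 1 \<and> P 2 \<and> P 3 \<and> P 4 \<and> P 5 \<and> P 6 \<and> P 7 \<and> P 8"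
proof -
  have "(\<forall>i::8. P i) \<longleftrightarrow> (\<forall>i\<in>{1, 2, 3, 4, 5, 6, 7, 8}. P i)"
    using UNIV_8 by (metis UNIV_I)
  thus ?thesis by simp
qed

lemma iota1_id: "iota1 z = z"
  by (simp add: iota1_def vec_eq_iff forall_3)

lemma iota2_isometry: "iota2 x \<bullet> iota2 y = x \<bullet> y" for x y :: "real^3"
  by (simp add: iota2_def inner_vec_def sum_4 sum_3 vector_4 field_simps)

lemma iota2_integral:
  assumes "x \<in> lattice_D3"
  shows "iota2 x $ i \<in> \<int>"
proof -
  from assms have x: "x $ 1 \<in> \<int>" "x $ 2 \<in> \<int>" "x $ 3 \<in> \<int>" "(x $ 1 + x $ 2 + x $ 3) / 2 \<in> \<int>"
    by (auto simp: lattice_D3_def sum_3)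
  let ?s = "(x $ 1 + x $ 2 + x $ 3) / 2"
  have eq: "(x $ 1 + x $ 2 - x $ 3) / 2 = ?s - x $ 3" "(x $ 1 - x $ 2 + x $ 3) / 2 = ?s - x $ 2"
    "(- x $ 1 + x $ 2 + x $ 3) / 2 = ?s - x $ 1" "(- x $ 1 - x $ 2 - x $ 3) / 2 = - ?s"
    by (simp_all add: field_simps)
  have "\<forall>i. iota2 x $ i \<in> \<int>"
    unfolding forall_4 iota2_def vector_4 eq
    using x by (intro conjI Ints_diff Ints_minus) auto
  thus ?thesis by blast
qed

lemma embed_E8_isometry: "embed_E8 x \<bullet> embed_E8 y = x \<bullet> y" for x y :: "real^3"
  by (simp add: embed_E8_def inner_vec_def sum_8 sum_3 vector_8)

lemma embed_E8_mem: "x \<in> lattice_D3 \<Longrightarrow> embed_E8 x \<in> lattice_E8"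
  by (simp add: embed_E8_def lattice_D3_def lattice_E8_def sum_8 sum_3 vector_8 forall_8 forall_3)

lemma iota2_cvec: "iota2 (cvec x) = cvec (iota2 x)"
  by (simp add: iota2_def cvec_def vec_eq_iff forall_4 vector_4)

lemma embed_E8_cvec: "embed_E8 (cvec x) = cvec (embed_E8 x)"
  by (simp add: embed_E8_def cvec_def vec_eq_iff forall_8 vector_8)

lemma even_lattice_D3: "even_lattice lattice_D3"
proof -
  have span: "span lattice_D3 = UNIV"
  proof -
    have mem: "vector [1, 1, 0] \<in> lattice_D3" "vector [1, -1, 0] \<in> lattice_D3"
      "vector [0, 1, 1] \<in> lattice_D3"
      by (auto simp: lattice_D3_def sum_3 forall_3)
    have "x \<in> span lattice_D3" for x :: "real^3"
    proof -
      have "x = ((x $ 1 + x $ 2 - x $ 3) / 2) *\<^sub>R vector [1, 1, 0]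
          + ((x $ 1 - x $ 2 + x $ 3) / 2) *\<^sub>R vector [1, -1, 0] + (x $ 3) *\<^sub>R vector [0, 1, 1]"
        by (simp add: vec_eq_iff forall_3 field_simps)
      also have "\<dots> \<in> span lattice_D3"
        by (intro span_add span_scale span_base mem)
      finally show ?thesis .
    qed
    thus ?thesis by auto
  qed
  have sq: "x \<bullet> x / 2 \<in> \<int>" if x: "x \<in> lattice_D3" for x
  proof -
    from x obtain a b c s :: int
      where "x $ 1 = of_int a" "x $ 2 = of_int b" "x $ 3 = of_int c"
        "(x $ 1 + x $ 2 + x $ 3) / 2 = of_int s"
      unfolding lattice_D3_def mem_Collect_eq sum_3 by (metis Ints_cases)
    note e = this
    have "x \<bullet> x / 2 = 2 * of_int s * of_int s - of_int a * of_int b - of_int a * of_int c - of_int b * of_int c"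
    proof -
      have "2 * real_of_int s = of_int a + of_int b + of_int c" using e by simp
      hence "(2 * real_of_int s) * (2 * of_int s) =
          (of_int a + of_int b + of_int c) * (of_int a + of_int b + of_int c)" by simp
      thus ?thesis by (simp add: inner_vec_def sum_3 e field_simps)
    qed
    also have "\<dots> \<in> \<int>" by (intro Ints_diff Ints_mult) auto
    finally show ?thesis .
  qed
  have int: "x \<bullet> y \<in> \<int>" if "x \<in> lattice_D3" "y \<in> lattice_D3" for x y
    using that by (auto simp: lattice_D3_def inner_vec_def sum_3 intro!: Ints_add Ints_mult)
  have diff: "x - y \<in> lattice_D3" if "x \<in> lattice_D3" "y \<in> lattice_D3" for x y
    using that by (auto simp: lattice_D3_def sum_subtractf diff_divide_distrib)
  show ?thesis
    unfolding even_lattice_def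
    using span sq int diff by (auto simp: lattice_D3_def)
qed

end

theory Submission
  imports Defs "HOL-Complex_Analysis.Complex_Analysis"
begin

text \<open>
  The cosets of D3 in its dual form a cyclic group of order four, with representatives of minimal half
  norm 0, 1/2, 3/8 and 3/8. Comparing Fourier coefficients in the quasi-periodicity law shows that a
  Jacobi form is a combination of the four theta series of the cosets, with coefficients that are
  fixed fractional powers of \<open>q\<close> times power series in \<open>q\<close> (\<open>jacobi_form_expansion\<close>); conversely, such a
  combination is a Jacobi form once it transforms correctly (\<open>jacobi_formsI\<close>). The matrix \<open>-1\<close> acts by
  \<open>z \<mapsto> -z\<close> and exchanges the two half-integral cosets. So in odd weight only the difference of their
  theta series occurs, and the problem has rank one; in even weight it has rank three.

  In odd weight, that difference is the product of three odd Jacobi theta functions. The component of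
  the generator is the 15th power of the Euler product, which has no zeros in the unit disc, so every
  form is the generator times a function of \<open>q\<close> that is holomorphic on the whole disc, hence times a
  modular form (\<open>jacobi_odd_decomposition\<close>).

  In even weight, the components of the three generators form a 3 by 3 matrix of power series in \<open>q\<close>.
  Its determinant does not vanish anywhere in the disc (\<open>even_generators\<close>): the value at 0 is \<open>-15\<close>, and
  the eighth power of the determinant divided by the 216th power of the Euler product is invariant
  under the modular group, hence constant by the maximum modulus principle (\<open>weight_zero_constant\<close>).
  Cramer's rule then gives coefficients that are holomorphic up to the cusp, and since the generators
  are linearly independent at each point \<open>\<tau>\<close>, the coefficients are unique, transform like modular forms,
  and the sum is direct (\<open>jacobi_even_decomposition\<close>, \<open>coefficient_modular\<close>).

  All this requires explicit transformation laws. In every generator, the coefficients are polynomials in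
  theta constants, their Serre derivatives and eta, and the functions of \<open>z\<close> are products over the
  coordinates of one of the four Jacobi theta functions; for the pullback along \<^const>\<open>iota2\<close> this is a theta relation of Riemann, which comes from
  triality of D4 (\<open>theta_ZN_iota2\<close>). The triple product gives the zeros of the odd theta function and its
  derivative at 0, so by Liouville's theorem this function is determined by its quasi-periods
  (\<open>jacobi_theta_unique\<close>); that yields its inversion formula up to a factor \<open>C\<close> depending on \<open>\<tau>\<close>. The heat
  equation implies \<open>C' = C / (2 \<tau>)\<close>, and the fixed point \<open>\<tau> = i\<close> gives \<open>C\<^sup>2 = i \<tau>\<close> (\<open>theta_factor_square\<close>). The
  inversion formulas of eta, \<^const>\<open>E2\<close> and the even theta functions follow from this one.
\<close>

section \<open>Theta series in one variable\<close>

lemma ee_add: "ee (x + y) = ee x * ee y"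
  by (simp add: ee_def distrib_left exp_add)

lemma ee_0 [simp]: "ee 0 = 1"
  by (simp add: ee_def)

lemma ee_minus: "ee (- x) = inverse (ee x)"
  by (simp add: ee_def exp_minus)

lemma ee_diff: "ee (x - y) = ee x / ee y"
  by (simp add: ee_def right_diff_distrib exp_diff)

lemma ee_nonzero [simp]: "ee x \<noteq> 0"
  by (simp add: ee_def)

lemma norm_ee: "norm (ee x) = exp (- 2 * pi * Im x)"
  by (simp add: ee_def)

lemma ee_eq_1_iff: "ee x = 1 \<longleftrightarrow> x \<in> \<int>"
proof
  assume "ee x = 1"
  then obtain n :: int where "Re x = of_int n" "Im x = 0"
    by (auto simp: ee_def exp_eq_1)
  hence "x = of_int n" by (simp add: complex_eq_iff)
  thus "x \<in> \<int>" by simp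
next
  assume "x \<in> \<int>"
  then obtain n where "x = of_int n" by (elim Ints_cases)
  thus "ee x = 1" by (auto simp: ee_def exp_eq_1)
qed

lemma ee_of_int [simp]: "ee (of_int n) = 1"
  by (simp add: ee_eq_1_iff)

lemma ee_1 [simp]: "ee 1 = 1"
  using ee_of_int[of 1] by simp

lemma ee_of_nat_mult: "ee (of_nat n * x) = ee x ^ n"
  by (simp add: ee_def mult_ac flip: exp_of_nat_mult)

lemma ee_half [simp]: "ee (1 / 2) = - 1"
  by (simp add: ee_def)

lemma ee_quarter [simp]: "ee (1 / 4) = \<i>"
proof -
  have "ee (1 / 4) = exp (\<i> * of_real (pi / 2))" by (simp add: ee_def)
  also have "\<dots> = cis (pi / 2)" by (rule cis_conv_exp[symmetric])
  finally show ?thesis by simp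
qed

lemma has_field_derivative_ee [derivative_intros]:
  assumes "(f has_field_derivative f') (at x within S)"
  shows "((\<lambda>x. ee (f x)) has_field_derivative 2 * of_real pi * \<i> * f' * ee (f x)) (at x within S)"
  unfolding ee_def by (rule derivative_eq_intros assms refl | simp)+

lemma continuous_on_ee [continuous_intros]:
  "continuous_on S f \<Longrightarrow> continuous_on S (\<lambda>x. ee (f x))"
  unfolding ee_def by (intro continuous_intros)

lemma holomorphic_on_ee [holomorphic_intros]:
  "f holomorphic_on S \<Longrightarrow> (\<lambda>x. ee (f x)) holomorphic_on S"
  unfolding ee_def by (intro holomorphic_intros)

lemma norm_ee_less_1 [simp]: "norm (ee \<tau>) < 1 \<longleftrightarrow> Im \<tau> > 0"
  by (simp add: norm_ee zero_less_mult_iff)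

lemma ee_surj:
  assumes "q \<noteq> 0"
  obtains \<tau> where "ee \<tau> = q"
proof
  show "ee (Ln q / (2 * of_real pi * \<i>)) = q"
    using assms by (simp add: ee_def)
qed

definition Zs :: "real \<Rightarrow> real set" where
  "Zs a = {r. r - a \<in> \<int>}"

text \<open>
  The theta series with characteristic \<open>a\<close>. The weights \<open>r^k\<close> make the family closed under
  differentiation in both variables, up to constants; \<open>k = 0\<close> is the theta function itself.
\<close>

definition theta_term :: "nat \<Rightarrow> complex \<Rightarrow> complex \<Rightarrow> real \<Rightarrow> complex" where
  "theta_term k \<tau> w r = of_real r ^ k * (ee (of_real (r\<^sup>2 / 2) * \<tau>) * ee (of_real r * w))"

definition Th :: "real \<Rightarrow> nat \<Rightarrow> complex \<Rightarrow> complex \<Rightarrow> complex" where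
  "Th a k \<tau> w = (\<Sum>\<^sub>\<infinity>r\<in>Zs a. theta_term k \<tau> w r)"

lemma Zs_eq_image: "Zs a = range (\<lambda>n. of_int n + a)"
proof (intro equalityI subsetI)
  fix r assume "r \<in> Zs a"
  then obtain n where "r - a = of_int n" by (auto simp: Zs_def elim: Ints_cases)
  thus "r \<in> range (\<lambda>n. of_int n + a)" by (auto intro: image_eqI[of _ _ n])
qed (auto simp: Zs_def)

lemma bij_betw_Zs: "bij_betw (\<lambda>n. of_int n + a) UNIV (Zs a)"
  unfolding bij_betw_def Zs_eq_image by (auto intro!: injI)

lemma summable_on_int_exp: "(\<lambda>n::int. exp (- \<bar>real_of_int n\<bar>)) summable_on UNIV"
proof -
  have "summable (\<lambda>n. exp (-1::real) ^ n)" by (intro summable_geometric) simp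
  hence nat: "(\<lambda>n::nat. exp (- real n)) summable_on UNIV"
    by (intro norm_summable_imp_summable_on) (simp flip: exp_of_nat_mult)
  have "(\<lambda>n::int. exp (- \<bar>real_of_int n\<bar>)) summable_on range int"
    by (subst summable_on_reindex) (auto simp: o_def nat)
  moreover have "(\<lambda>n::int. exp (- \<bar>real_of_int n\<bar>)) summable_on range (\<lambda>n. - int n)"
    by (subst summable_on_reindex) (auto simp: o_def nat intro!: injI)
  ultimately have "(\<lambda>n::int. exp (- \<bar>real_of_int n\<bar>)) summable_on (range int \<union> range (\<lambda>n. - int n))"
    by (rule summable_on_union)
  also have "range int \<union> range (\<lambda>n. - int n) = UNIV"
    by (auto simp: image_iff) (metis int_cases2)
  finally show ?thesis .
qed

lemma summable_on_Zs_exp: "(\<lambda>r. exp (- \<bar>r\<bar>)) summable_on Zs a"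
proof -
  have "(\<lambda>n. exp \<bar>a\<bar> * exp (- \<bar>real_of_int n\<bar>)) summable_on UNIV"
    by (intro summable_on_cmult_right summable_on_int_exp)
  hence "(\<lambda>n. exp (- \<bar>real_of_int n + a\<bar>)) summable_on UNIV"
    by (rule summable_on_comparison_test) (auto simp flip: exp_add)
  thus ?thesis
    using summable_on_reindex_bij_betw[OF bij_betw_Zs, of "\<lambda>r. exp (- \<bar>r\<bar>)" a] by simp
qed

lemma power_le_fact_exp:
  assumes "(y::real) \<ge> 0"
  shows "y ^ k \<le> fact k * exp y"
proof -
  have "(\<Sum>n\<in>{k}. y ^ n /\<^sub>R fact n) \<le> (\<Sum>n. y ^ n /\<^sub>R fact n)"
    using assms by (intro sum_le_suminf summable_exp_generic) auto
  thus ?thesis by (simp add: exp_def field_simps)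
qed

text \<open>
  A Gaussian beats every exponential, so on a strip \<^term>\<open>\<bar>Im w\<bar> \<le> R\<close> over a half plane
  \<^term>\<open>Im \<tau> \<ge> e\<close> the theta series and all its derivatives have one common summable majorant.
  All interchanges of limits below rest on this bound.
\<close>

lemma theta_term_majorant:
  assumes e: "e > 0"
  shows "\<exists>M. M summable_on Zs a \<and>
    (\<forall>r \<tau> w. Im \<tau> \<ge> e \<longrightarrow> \<bar>Im w\<bar> \<le> R \<longrightarrow> norm (theta_term k \<tau> w r) \<le> M r)"
proof -
  \<comment> \<open>The maximum of a quadratic exponent with linear coefficient \<open>2 pi R + 2\<close>: one unit pays for
    \<open>y ^ k \<le> k! exp y\<close>, the other one leaves the summable factor \<open>exp (- y)\<close>.\<close>
  define B where "B = fact k * exp ((2 * pi * R + 2)\<^sup>2 / (4 * (pi * e)))"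
  have "(\<lambda>r. B * exp (- \<bar>r\<bar>)) summable_on Zs a"
    by (intro summable_on_cmult_right summable_on_Zs_exp)
  moreover have "norm (theta_term k \<tau> w r) \<le> B * exp (- \<bar>r\<bar>)"
    if \<tau>: "Im \<tau> \<ge> e" and w: "\<bar>Im w\<bar> \<le> R" for r :: real and \<tau> w :: complex
  proof -
  define y where "y = \<bar>r\<bar>"
  have y: "y \<ge> 0" by (simp add: y_def)
  have "norm (theta_term k \<tau> w r) = y ^ k * exp (- pi * Im \<tau> * y\<^sup>2 - 2 * pi * (r * Im w))"
    by (simp add: theta_term_def norm_mult norm_power norm_ee y_def flip: exp_add)
  also have "\<dots> \<le> (fact k * exp y) * exp (- pi * e * y\<^sup>2 + 2 * pi * (y * R))"
  proof (intro mult_mono)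
    have "e * y\<^sup>2 \<le> Im \<tau> * y\<^sup>2" using \<tau> by (intro mult_right_mono) auto
    moreover have "- (r * Im w) \<le> y * R"
    proof -
      have "- (r * Im w) \<le> \<bar>r\<bar> * \<bar>Im w\<bar>" by (simp flip: abs_mult)
      also have "\<dots> \<le> y * R" using w y by (auto simp: y_def intro: mult_left_mono)
      finally show ?thesis .
    qed
    ultimately have "pi * (e * y\<^sup>2 + 2 * - (y * R)) \<le> pi * (Im \<tau> * y\<^sup>2 + 2 * (r * Im w))"
      by (intro mult_left_mono) auto
    thus "exp (- pi * Im \<tau> * y\<^sup>2 - 2 * pi * (r * Im w)) \<le> exp (- pi * e * y\<^sup>2 + 2 * pi * (y * R))"
      by (simp only: exp_le_cancel_iff) (simp add: distrib_left right_diff_distrib mult.assoc mult.left_commute)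
  qed (use y power_le_fact_exp in auto)
  also have "\<dots> = fact k * exp (- (pi * e) * y\<^sup>2 + (2 * pi * R + 2) * y) * exp (- y)"
  proof -
    have "y + (- pi * e * y\<^sup>2 + 2 * pi * (y * R)) = - (pi * e) * y\<^sup>2 + (2 * pi * R + 2) * y + - y"
      by (simp add: algebra_simps)
    thus ?thesis by (simp only: mult.assoc exp_add[symmetric])
  qed
  also have "\<dots> \<le> B * exp (- y)"
  proof -
    define c where "c = pi * e"
    define b where "b = 2 * pi * R + 2"
    have c: "c > 0" using e by (simp add: c_def)
    have "0 \<le> (2 * c * y - b)\<^sup>2 / (4 * c)" using c by simp
    also have "\<dots> = c * y\<^sup>2 - b * y + b\<^sup>2 / (4 * c)"
      using c by (simp add: field_simps power2_eq_square)
    finally show ?thesis by (simp add: B_def flip: b_def c_def)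
  qed
  finally show ?thesis by (simp add: y_def)
  qed
  ultimately show ?thesis by (intro exI[of _ "\<lambda>r. B * exp (- \<bar>r\<bar>)"]) blast
qed

lemma theta_term_abs_summable:
  assumes "Im \<tau> > 0"
  shows "(\<lambda>r. norm (theta_term k \<tau> w r)) summable_on Zs a"
proof -
  obtain M where M: "M summable_on Zs a \<and> (\<forall>r \<tau>' w'. Im \<tau>' \<ge> Im \<tau> \<longrightarrow> \<bar>Im w'\<bar> \<le> \<bar>Im w\<bar> \<longrightarrow>
      norm (theta_term k \<tau>' w' r) \<le> M r)"
    using theta_term_majorant[OF assms, of a "\<bar>Im w\<bar>" k] by (rule exE)
  have "norm (norm (theta_term k \<tau> w r)) \<le> M r" for r
    using M by simp
  thus ?thesis
    by (intro summable_on_comparison_test[OF conjunct1[OF M]]) simp_all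
qed

lemma Th_has_sum:
  assumes "Im \<tau> > 0"
  shows "(theta_term k \<tau> w has_sum Th a k \<tau> w) (Zs a)"
  unfolding Th_def
  by (rule has_sum_infsum, rule abs_summable_summable, rule theta_term_abs_summable[OF assms])

lemma theta_box_uniform_limit:
  assumes "e > 0"
  shows "uniform_limit ({\<tau>. Im \<tau> \<ge> e} \<times> {w. \<bar>Im w\<bar> \<le> R})
           (\<lambda>X (\<tau>, w). \<Sum>r\<in>X. theta_term k \<tau> w r) (\<lambda>(\<tau>, w). Th a k \<tau> w) (finite_subsets_at_top (Zs a))"
proof -
  obtain M where "M summable_on Zs a \<and>
    (\<forall>r \<tau> w. Im \<tau> \<ge> e \<longrightarrow> \<bar>Im w\<bar> \<le> R \<longrightarrow> norm (theta_term k \<tau> w r) \<le> M r)"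
    using theta_term_majorant[OF assms, of a R k] by (rule exE)
  hence M: "M summable_on Zs a"
    "\<And>r \<tau> w. Im \<tau> \<ge> e \<Longrightarrow> \<bar>Im w\<bar> \<le> R \<Longrightarrow> norm (theta_term k \<tau> w r) \<le> M r"
    by simp_all
  have "uniform_limit ({\<tau>. Im \<tau> \<ge> e} \<times> {w. \<bar>Im w\<bar> \<le> R})
       (\<lambda>X p. \<Sum>r\<in>X. theta_term k (fst p) (snd p) r) (\<lambda>p. Th a k (fst p) (snd p)) (finite_subsets_at_top (Zs a))"
  proof (rule Weierstrass_m_test_general'[OF _ _ M(1)])
    show "((\<lambda>x. theta_term k (fst y) (snd y) x) has_sum Th a k (fst y) (snd y)) (Zs a)"
      if "y \<in> {\<tau>. Im \<tau> \<ge> e} \<times> {w. \<bar>Im w\<bar> \<le> R}" for y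
      using that assms by (intro Th_has_sum) auto
  qed (use M(2) in auto)
  thus ?thesis by (simp add: case_prod_unfold)
qed

lemma open_upper_half_plane: "open upper_half_plane"
  by (rule open_halfspace_Im_gt)

lemma continuous_on_Th:
  "continuous_on (upper_half_plane \<times> UNIV) (\<lambda>(\<tau>, w). Th a k \<tau> w)"
proof -
  have "isCont (\<lambda>(\<tau>, w). Th a k \<tau> w) (\<tau>0, w0)" if "Im \<tau>0 > 0" for \<tau>0 w0
  proof -
    let ?U = "{\<tau>. Im \<tau> > Im \<tau>0 / 2} \<times> {w. \<bar>Im w\<bar> < \<bar>Im w0\<bar> + 1}"
    have "continuous_on ({\<tau>. Im \<tau> \<ge> Im \<tau>0 / 2} \<times> {w. \<bar>Im w\<bar> \<le> \<bar>Im w0\<bar> + 1}) (\<lambda>(\<tau>, w). Th a k \<tau> w)"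
    proof (rule uniform_limit_theorem[OF _ theta_box_uniform_limit])
      show "\<forall>\<^sub>F X in finite_subsets_at_top (Zs a). continuous_on
         ({\<tau>. Im \<tau> \<ge> Im \<tau>0 / 2} \<times> {w. \<bar>Im w\<bar> \<le> \<bar>Im w0\<bar> + 1}) (\<lambda>(\<tau>, w). \<Sum>r\<in>X. theta_term k \<tau> w r)"
        unfolding theta_term_def case_prod_unfold
        by (intro always_eventually allI continuous_intros)
    qed (use that in auto)
    hence "continuous_on ?U (\<lambda>(\<tau>, w). Th a k \<tau> w)"
      by (rule continuous_on_subset) auto
    moreover have "open ?U"
    proof (rule open_Times)
      have "{w. \<bar>Im w\<bar> < \<bar>Im w0\<bar> + 1} = {w. Im w < \<bar>Im w0\<bar> + 1} \<inter> {w. - (\<bar>Im w0\<bar> + 1) < Im w}"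
        by auto
      thus "open {w. \<bar>Im w\<bar> < \<bar>Im w0\<bar> + 1}"
        by (simp add: open_Int open_halfspace_Im_lt open_halfspace_Im_gt)
    qed (rule open_halfspace_Im_gt)
    ultimately show ?thesis
      using that by (simp add: continuous_on_eq_continuous_at)
  qed
  thus ?thesis by (auto intro!: continuous_at_imp_continuous_on)
qed

lemma Th_has_field_derivative_w:
  assumes \<tau>: "Im \<tau> > 0"
  shows "((\<lambda>w. Th a k \<tau> w) has_field_derivative 2 * of_real pi * \<i> * Th a (Suc k) \<tau> w) (at w)"
proof -
  let ?U = "ball w 1"
  have ul: "uniform_limit ?U (\<lambda>X w. \<Sum>r\<in>X. theta_term k \<tau> w r) (\<lambda>w. Th a k \<tau> w) (finite_subsets_at_top (Zs a))"
  proof -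
    have "\<bar>Im x\<bar> \<le> \<bar>Im w\<bar> + 1" if "x \<in> ball w 1" for x
    proof -
      have "\<bar>Im (x - w)\<bar> \<le> norm (x - w)" by (rule abs_Im_le_cmod)
      thus ?thesis using that by (auto simp: dist_norm norm_minus_commute)
    qed
    thus ?thesis
      using uniform_limit_compose'[OF theta_box_uniform_limit[OF \<tau>, of k "\<bar>Im w\<bar> + 1" a], of "\<lambda>w. (\<tau>, w)" ?U]
      by (auto simp: Pi_iff)
  qed
  have hol: "(\<lambda>w. \<Sum>r\<in>X. theta_term k \<tau> w r) holomorphic_on ?U" for X
    unfolding theta_term_def by (intro holomorphic_intros)
  have der: "deriv (\<lambda>w. \<Sum>r\<in>X. theta_term k \<tau> w r) w = 2 * of_real pi * \<i> * (\<Sum>r\<in>X. theta_term (Suc k) \<tau> w r)" for X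
    unfolding theta_term_def sum_distrib_left
    by (rule DERIV_imp_deriv) (rule derivative_eq_intros refl sum.cong | simp)+
  have "((\<lambda>X. deriv (\<lambda>w. \<Sum>r\<in>X. theta_term k \<tau> w r) w) \<longlongrightarrow> deriv (\<lambda>w. Th a k \<tau> w) w) (finite_subsets_at_top (Zs a))"
    by (rule deriv_complex_uniform_limit[OF ul]) (auto simp: hol)
  moreover have "((\<lambda>X. deriv (\<lambda>w. \<Sum>r\<in>X. theta_term k \<tau> w r) w) \<longlongrightarrow> 2 * of_real pi * \<i> * Th a (Suc k) \<tau> w)
      (finite_subsets_at_top (Zs a))"
    unfolding der using Th_has_sum[OF \<tau>, of "Suc k" w a] by (intro tendsto_intros) (simp add: has_sum_def)
  ultimately have "deriv (\<lambda>w. Th a k \<tau> w) w = 2 * of_real pi * \<i> * Th a (Suc k) \<tau> w"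
    by (rule tendsto_unique[rotated]) simp
  moreover have "(\<lambda>w. Th a k \<tau> w) holomorphic_on ball w (1/2)"
    by (rule holomorphic_uniform_limit[OF _ uniform_limit_on_subset[OF ul]])
       (auto intro!: always_eventually holomorphic_on_imp_continuous_on holomorphic_on_subset[OF hol])
  ultimately show ?thesis
    using holomorphic_derivI[of _ "ball w (1/2)" w] by fastforce
qed

lemma Th_has_field_derivative_tau:
  assumes \<tau>: "Im \<tau> > 0"
  shows "((\<lambda>\<tau>. Th a k \<tau> w) has_field_derivative of_real pi * \<i> * Th a (Suc (Suc k)) \<tau> w) (at \<tau>)"
proof -
  let ?U = "ball \<tau> (Im \<tau> / 2)"
  have ul: "uniform_limit ?U (\<lambda>X \<tau>. \<Sum>r\<in>X. theta_term k \<tau> w r) (\<lambda>\<tau>. Th a k \<tau> w) (finite_subsets_at_top (Zs a))"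
  proof -
    have "Im x \<ge> Im \<tau> / 2" if "x \<in> ?U" for x
    proof -
      have "\<bar>Im (x - \<tau>)\<bar> \<le> norm (x - \<tau>)" by (rule abs_Im_le_cmod)
      moreover have "norm (x - \<tau>) < Im \<tau> / 2" using that by (simp add: dist_norm norm_minus_commute)
      ultimately have "\<bar>Im x - Im \<tau>\<bar> < Im \<tau> / 2" by simp
      thus ?thesis by linarith
    qed
    thus ?thesis
      using uniform_limit_compose'[OF theta_box_uniform_limit[of "Im \<tau> / 2" k "\<bar>Im w\<bar>" a], of "\<lambda>\<tau>. (\<tau>, w)" ?U] \<tau>
      by (auto simp: Pi_iff)
  qed
  have hol: "(\<lambda>\<tau>. \<Sum>r\<in>X. theta_term k \<tau> w r) holomorphic_on ?U" for X
    unfolding theta_term_def by (intro holomorphic_intros)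
  have der: "deriv (\<lambda>\<tau>. \<Sum>r\<in>X. theta_term k \<tau> w r) \<tau> = of_real pi * \<i> * (\<Sum>r\<in>X. theta_term (Suc (Suc k)) \<tau> w r)" for X
    unfolding theta_term_def sum_distrib_left
    by (rule DERIV_imp_deriv) (rule derivative_eq_intros refl sum.cong | simp add: power2_eq_square)+
  have "((\<lambda>X. deriv (\<lambda>\<tau>. \<Sum>r\<in>X. theta_term k \<tau> w r) \<tau>) \<longlongrightarrow> deriv (\<lambda>\<tau>. Th a k \<tau> w) \<tau>) (finite_subsets_at_top (Zs a))"
    by (rule deriv_complex_uniform_limit[OF ul]) (use \<tau> in \<open>auto simp: hol\<close>)
  moreover have "((\<lambda>X. deriv (\<lambda>\<tau>. \<Sum>r\<in>X. theta_term k \<tau> w r) \<tau>) \<longlongrightarrow> of_real pi * \<i> * Th a (Suc (Suc k)) \<tau> w)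
      (finite_subsets_at_top (Zs a))"
    unfolding der using Th_has_sum[OF \<tau>, of "Suc (Suc k)" w a] by (intro tendsto_intros) (simp add: has_sum_def)
  ultimately have "deriv (\<lambda>\<tau>. Th a k \<tau> w) \<tau> = of_real pi * \<i> * Th a (Suc (Suc k)) \<tau> w"
    by (rule tendsto_unique[rotated]) simp
  moreover have "(\<lambda>\<tau>. Th a k \<tau> w) holomorphic_on ball \<tau> (Im \<tau> / 4)"
    by (rule holomorphic_uniform_limit[OF _ uniform_limit_on_subset[OF ul]])
       (use \<tau> in \<open>auto intro!: always_eventually holomorphic_on_imp_continuous_on holomorphic_on_subset[OF hol]\<close>)
  ultimately show ?thesis
    using holomorphic_derivI[of _ "ball \<tau> (Im \<tau> / 4)" \<tau>] \<tau> by fastforce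
qed

text \<open>The two partial derivatives are jointly continuous, hence the series is jointly differentiable.\<close>

lemma Th_has_derivative:
  assumes \<tau>: "Im \<tau> > 0"
  shows "((\<lambda>(\<tau>, w). Th a k \<tau> w) has_derivative
     (\<lambda>(t, u). of_real pi * \<i> * Th a (Suc (Suc k)) \<tau> w * t + 2 * of_real pi * \<i> * Th a (Suc k) \<tau> w * u)) (at (\<tau>, w))"
proof -
  have "((\<lambda>(\<tau>, w). Th a k \<tau> w) has_derivative
     (\<lambda>(t, u). of_real pi * \<i> * Th a (Suc (Suc k)) \<tau> w * t
        + blinfun_apply (blinfun_mult_right (2 * of_real pi * \<i> * Th a (Suc k) \<tau> w)) u))
     (at (\<tau>, w) within upper_half_plane \<times> UNIV)"
  proof (rule has_derivative_partialsI)
    show "((\<lambda>\<tau>. Th a k \<tau> w) has_derivative (*) (of_real pi * \<i> * Th a (Suc (Suc k)) \<tau> w)) (at \<tau> within upper_half_plane)"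
      using Th_has_field_derivative_tau[OF \<tau>, of a k w] has_derivative_at_withinI
      by (auto simp: has_field_derivative_def)
    show "((\<lambda>w. Th a k x w) has_derivative
       blinfun_apply (blinfun_mult_right (2 * of_real pi * \<i> * Th a (Suc k) x y))) (at y within UNIV)"
      if "x \<in> upper_half_plane" for x y
      using Th_has_field_derivative_w[of x a k y] that by (auto simp: has_field_derivative_def)
    have "continuous_on (upper_half_plane \<times> UNIV)
        (\<lambda>p. blinfun_mult_right (2 * of_real pi * \<i> * (case p of (\<tau>, w) \<Rightarrow> Th a (Suc k) \<tau> w)))"
      by (intro continuous_intros continuous_on_Th bounded_linear.continuous_on[OF bounded_linear_blinfun_mult_right])
    thus "continuous (at (\<tau>, w) within upper_half_plane \<times> UNIV)
        (\<lambda>(\<tau>, w). blinfun_mult_right (2 * of_real pi * \<i> * Th a (Suc k) \<tau> w))"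
      using \<tau> by (auto simp: continuous_on_eq_continuous_within case_prod_unfold)
  qed auto
  moreover have "at (\<tau>, w) within upper_half_plane \<times> UNIV = at (\<tau>, w)"
    by (rule at_within_open) (use \<tau> in \<open>auto intro!: open_Times open_upper_half_plane\<close>)
  ultimately show ?thesis by simp
qed

lemma tannery_infsum:
  fixes f :: "'a \<Rightarrow> 'b \<Rightarrow> complex"
  assumes lim: "\<And>x. x \<in> X \<Longrightarrow> ((\<lambda>n. f x n) \<longlongrightarrow> g x) F"
    and bound: "\<And>x n. x \<in> X \<Longrightarrow> norm (f x n) \<le> M x" and M: "M summable_on X"
    and F: "F \<noteq> bot"
  shows "((\<lambda>n. \<Sum>\<^sub>\<infinity>x\<in>X. f x n) \<longlongrightarrow> (\<Sum>\<^sub>\<infinity>x\<in>X. g x)) F"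
proof (rule swap_uniform_limit')
  show "uniform_limit UNIV (\<lambda>Y n. \<Sum>x\<in>Y. f x n) (\<lambda>n. \<Sum>\<^sub>\<infinity>x\<in>X. f x n) (finite_subsets_at_top X)"
    by (rule Weierstrass_m_test_general[OF _ M]) (use bound in auto)
  have "norm (g x) \<le> M x" if "x \<in> X" for x
    using tendsto_upperbound[OF tendsto_norm[OF lim[OF that]] _ F] bound[OF that] by simp
  hence "(\<lambda>x. norm (g x)) summable_on X"
    by (intro summable_on_comparison_test[OF M]) auto
  hence "(g has_sum (\<Sum>\<^sub>\<infinity>x\<in>X. g x)) X"
    by (rule has_sum_infsum[OF abs_summable_summable])
  thus "((\<lambda>Y. \<Sum>x\<in>Y. g x) \<longlongrightarrow> (\<Sum>\<^sub>\<infinity>x\<in>X. g x)) (finite_subsets_at_top X)"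
    by (simp add: has_sum_def)
  show "\<forall>\<^sub>F Y in finite_subsets_at_top X. ((\<lambda>n. \<Sum>x\<in>Y. f x n) \<longlongrightarrow> (\<Sum>x\<in>Y. g x)) F"
    by (rule eventually_finite_subsets_at_top_weakI) (auto intro!: tendsto_sum lim)
  show "\<forall>\<^sub>F n in F. n \<in> UNIV" by simp
qed simp

section \<open>The triple product\<close>

text \<open>
  The infinite q-Pochhammer symbol \<open>(x; q)\<close>; for \<open>x = q\<close> it is the Euler product.
\<close>

definition qpoch :: "complex \<Rightarrow> complex \<Rightarrow> complex" where
  "qpoch q x = prodinf (\<lambda>n. 1 - q ^ n * x)"

lemma convergent_prod_qpoch:
  assumes "norm q < 1"
  shows "convergent_prod (\<lambda>n. 1 - q ^ n * (x::complex))"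
proof -
  have "summable (\<lambda>n. norm (1 - q ^ n * x - 1))"
    using assms by (auto simp: norm_mult norm_power intro!: summable_mult2 summable_geometric)
  thus ?thesis
    by (intro abs_convergent_prod_imp_convergent_prod summable_imp_abs_convergent_prod)
qed

lemma qpoch_tendsto:
  assumes "norm q < 1"
  shows "(\<lambda>N. \<Prod>n<N. 1 - q ^ n * x) \<longlonglongrightarrow> qpoch q x"
  using convergent_prod_LIMSEQ[OF convergent_prod_qpoch[OF assms, of x]]
  unfolding qpoch_def by (simp add: LIMSEQ_lessThan_iff_atMost)

lemma qpoch_eq_0_iff:
  assumes "norm q < 1"
  shows "qpoch q x = 0 \<longleftrightarrow> (\<exists>n. q ^ n * x = 1)"
proof -
  have "(\<lambda>n. 1 - q ^ n * x) has_prod qpoch q x"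
    using convergent_prod_has_prod[OF convergent_prod_qpoch[OF assms]] by (simp add: qpoch_def)
  moreover have "1 - y = 0 \<longleftrightarrow> y = 1" for y :: complex by auto
  ultimately show ?thesis using has_prod_eq_0_iff by fastforce
qed

lemma qpoch_q_nonzero:
  assumes "norm q < 1"
  shows "qpoch q q \<noteq> 0"
proof -
  have "norm (q ^ n * q) < 1" for n
    using power_Suc_less_one[of "norm q" n] assms by (cases "q = 0") (auto simp: norm_mult norm_power mult.commute)
  hence "q ^ n * q \<noteq> 1" for n by (metis norm_one less_irrefl)
  thus ?thesis by (simp add: qpoch_eq_0_iff[OF assms])
qed

lemma qpoch_rec:
  assumes "norm q < 1"
  shows "qpoch q x = (1 - x) * qpoch q (q * x)"
proof -
  have "(\<lambda>N. \<Prod>n<Suc N. 1 - q ^ n * x) \<longlonglongrightarrow> qpoch q x"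
    using qpoch_tendsto[OF assms] LIMSEQ_Suc by blast
  moreover have "(\<Prod>n<Suc N. 1 - q ^ n * x) = (1 - x) * (\<Prod>n<N. 1 - q ^ n * (q * x))" for N
    by (subst prod.lessThan_Suc_shift) (simp add: mult_ac)
  ultimately have "(\<lambda>N. (1 - x) * (\<Prod>n<N. 1 - q ^ n * (q * x))) \<longlonglongrightarrow> qpoch q x"
    by simp
  moreover have "(\<lambda>N. (1 - x) * (\<Prod>n<N. 1 - q ^ n * (q * x))) \<longlonglongrightarrow> (1 - x) * qpoch q (q * x)"
    by (intro tendsto_intros qpoch_tendsto assms)
  ultimately show ?thesis by (rule LIMSEQ_unique)
qed

lemma qpoch_continuous:
  assumes q: "norm q < 1"
  shows "isCont (qpoch q) x"
proof -
  have "uniformly_convergent_on (cball x 1) (\<lambda>N x. \<Prod>n<N. 1 - q ^ n * x)"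
  proof (rule uniformly_convergent_on_prod')
    show "uniformly_convergent_on (cball x 1) (\<lambda>N x. \<Sum>n<N. norm (1 - q ^ n * x - 1))"
    proof (rule Weierstrass_m_test'_ev[OF always_eventually])
      show "\<forall>n. \<forall>y\<in>cball x 1. norm (norm (1 - q ^ n * y - 1)) \<le> norm q ^ n * (norm x + 1)"
      proof (intro allI ballI)
        fix n y assume that: "y \<in> cball x 1"
        have "norm y \<le> norm x + 1"
          using that norm_triangle_ineq2[of y x] by (simp add: dist_norm norm_minus_commute)
        thus "norm (norm (1 - q ^ n * y - 1)) \<le> norm q ^ n * (norm x + 1)"
          by (simp add: norm_mult norm_power mult_left_mono)
      qed
      show "summable (\<lambda>n. norm q ^ n * (norm x + 1))"
        using q by (intro summable_mult2 summable_geometric) simp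
    qed
  qed (auto intro!: continuous_intros)
  then obtain l where l: "uniform_limit (cball x 1) (\<lambda>N x. \<Prod>n<N. 1 - q ^ n * x) l sequentially"
    by (auto simp: uniformly_convergent_on_def)
  have eq: "l y = qpoch q y" if "y \<in> cball x 1" for y
    by (rule LIMSEQ_unique[OF tendsto_uniform_limitI[OF l that] qpoch_tendsto[OF q]])
  have "continuous_on (cball x 1) l"
    by (rule uniform_limit_theorem[OF _ l]) (auto intro!: always_eventually continuous_intros)
  hence "continuous_on (cball x 1) (qpoch q)"
    by (rule continuous_on_eq) (rule eq)
  hence "continuous_on (ball x 1) (qpoch q)" by (rule continuous_on_subset) auto
  thus ?thesis by (simp add: continuous_on_eq_continuous_at)
qed

definition qfact :: "complex \<Rightarrow> nat \<Rightarrow> complex" where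
  "qfact q n = (\<Prod>k<n. 1 - q ^ Suc k)"

lemma qfact_Suc: "qfact q (Suc n) = (1 - q ^ Suc n) * qfact q n"
  by (simp add: qfact_def)

lemma qfact_0 [simp]: "qfact q 0 = 1"
  by (simp add: qfact_def)

lemma qfact_nonzero:
  assumes "norm q < 1"
  shows "qfact q n \<noteq> 0"
proof -
  have "q ^ Suc k \<noteq> 1" for k
  proof
    assume "q ^ Suc k = 1"
    hence "norm q ^ Suc k = 1" by (metis norm_power norm_one)
    thus False using assms power_less_one_iff[of "norm q" "Suc k"] by simp
  qed
  thus ?thesis by (auto simp: qfact_def)
qed

lemma qfact_tendsto:
  assumes "norm q < 1"
  shows "qfact q \<longlonglongrightarrow> qpoch q q"
  using qpoch_tendsto[OF assms, of q] by (simp add: qfact_def[abs_def] mult.commute)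

lemma choose_2_Suc: "Suc j choose 2 = (j choose 2) + j"
  by (simp add: numeral_2_eq_2)

text \<open>
  The Gaussian binomial theorem. The coefficients are written with \<^const>\<open>qfact\<close> because each factor then
  has a limit, which is what the passage to infinite products uses.
\<close>

lemma q_binomial:
  assumes q: "norm q < 1"
  shows "(\<Prod>k<n. 1 - q ^ k * y) =
    (\<Sum>j\<le>n. (- 1) ^ j * q ^ (j choose 2) * (qfact q n / (qfact q j * qfact q (n - j))) * y ^ j)"
proof (induction n)
  case 0
  thus ?case by (simp add: numeral_2_eq_2)
next
  case (Suc n)
  define B where "B n j = (if j \<le> n then qfact q n / (qfact q j * qfact q (n - j)) else 0)" for n j
  define t where "t n j = (- 1) ^ j * q ^ (j choose 2) * B n j * y ^ j" for n j
  note nz = qfact_nonzero[OF q]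
  \<comment> \<open>the q-analogue of Pascal's rule\<close>
  have B_rec: "B (Suc n) (Suc j) = B n (Suc j) + q ^ (n - j) * B n j" if "j \<le> n" for j
  proof (cases "j = n")
    case True
    thus ?thesis using nz by (simp add: B_def)
  next
    case False
    with that obtain d where d: "n = Suc (j + d)" by (metis add_Suc_right le_neq_implies_less less_iff_Suc_add)
    have s: "n - j = Suc d" "n - Suc j = d" "Suc n - Suc j = Suc d" by (auto simp: d)
    have nz1: "1 - q ^ Suc i \<noteq> 0" for i using nz[of "Suc i"] by (simp only: qfact_Suc) simp
    define c where "c = qfact q n / (qfact q (Suc j) * qfact q (Suc d))"
    have B1: "B (Suc n) (Suc j) = (1 - q ^ Suc n) * c"
      using that by (simp add: B_def s qfact_Suc c_def)
    have B2: "B n (Suc j) = (1 - q ^ Suc d) * c"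
      using d nz1[of d] by (simp add: B_def s qfact_Suc[of q d] c_def)
    have B3: "B n j = (1 - q ^ Suc j) * c"
      using that nz1[of j] by (simp add: B_def s qfact_Suc[of q j] c_def)
    have "(1 - q ^ Suc n) = (1 - q ^ Suc d) + q ^ (n - j) * (1 - q ^ Suc j)"
      unfolding s by (simp add: d algebra_simps power_add)
    thus ?thesis unfolding B1 B2 B3 by (simp only: distrib_right mult.assoc)
  qed
  have t_rec: "t (Suc n) (Suc j) = t n (Suc j) - q ^ n * y * t n j" if "j \<le> n" for j
  proof -
    have "q ^ (Suc j choose 2) * q ^ (n - j) = q ^ n * q ^ (j choose 2)"
      using that by (simp add: choose_2_Suc mult.commute flip: power_add)
    note pw = this
    have "t (Suc n) (Suc j) = t n (Suc j)
        + (- 1) ^ Suc j * y ^ Suc j * B n j * (q ^ (Suc j choose 2) * q ^ (n - j))"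
      unfolding t_def B_rec[OF that] by (simp only: ring_distribs mult_ac)
    also have "(- 1) ^ Suc j * y ^ Suc j * B n j * (q ^ (Suc j choose 2) * q ^ (n - j)) = - (q ^ n * y * t n j)"
      unfolding pw t_def by (simp add: mult_ac)
    finally show ?thesis by simp
  qed
  have "(\<Prod>k<Suc n. 1 - q ^ k * y) = (1 - q ^ n * y) * (\<Sum>j\<le>n. t n j)"
    using Suc.IH by (simp add: t_def B_def mult.commute)
  also have "\<dots> = (\<Sum>j\<le>n. t n j) + t n (Suc n) - q ^ n * y * (\<Sum>j\<le>n. t n j)"
    by (simp add: t_def B_def algebra_simps)
  also have "(\<Sum>j\<le>n. t n j) + t n (Suc n) = t n 0 + (\<Sum>j\<le>n. t n (Suc j))"
    by (simp only: sum.atMost_Suc[symmetric] sum.atMost_Suc_shift)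
  also have "t n 0 + (\<Sum>j\<le>n. t n (Suc j)) - q ^ n * y * (\<Sum>j\<le>n. t n j) = t n 0 + (\<Sum>j\<le>n. t (Suc n) (Suc j))"
    by (simp add: t_rec sum_subtractf sum_distrib_left)
  also have "t n 0 = t (Suc n) 0" using nz by (simp add: t_def B_def)
  also have "t (Suc n) 0 + (\<Sum>j\<le>n. t (Suc n) (Suc j)) = (\<Sum>j\<le>Suc n. t (Suc n) j)"
    by (simp only: sum.atMost_Suc_shift)
  also have "\<dots> = (\<Sum>j\<le>Suc n. (- 1) ^ j * q ^ (j choose 2) *
      (qfact q (Suc n) / (qfact q j * qfact q (Suc n - j))) * y ^ j)"
    by (intro sum.cong refl) (simp add: t_def B_def)
  finally show ?case .
qed

lemma of_nat_choose_2: "of_nat (j choose 2) = (of_nat j * (of_nat j - 1) / 2 :: complex)"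
proof (induction j)
  case (Suc j)
  thus ?case by (simp add: choose_2_Suc field_simps)
qed (simp add: numeral_2_eq_2)

lemma minus_1_power_eq_ee: "(- 1) ^ n = ee (of_nat n / 2)"
  using ee_of_nat_mult[of n "1 / 2"] by simp

definition triple_term :: "complex \<Rightarrow> complex \<Rightarrow> int \<Rightarrow> complex" where
  "triple_term \<tau> w m = ee (of_int m / 2 + of_int (m * (m - 1)) / 2 * \<tau> + of_int m * w)"

text \<open>
  The finite form of the triple product is the Gaussian binomial theorem for an even exponent
  \<^term>\<open>2 * N\<close>, recentred: half of the factors are turned around, which shifts the summation
  range to \<^term>\<open>{- int N..int N}\<close> and leaves a common monomial on both sides.
\<close>

lemma finite_triple_product:
  fixes N :: nat
  assumes \<tau>: "Im \<tau> > 0"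
  defines "q \<equiv> ee \<tau>"
  shows "(\<Prod>k<N. 1 - q ^ k * ee w) * (\<Prod>k<N. 1 - q ^ k * (q / ee w)) =
    (\<Sum>m\<in>{- int N..int N}. triple_term \<tau> w m *
       (qfact q (2 * N) / (qfact q (nat (int N + m)) * qfact q (nat (int N - m)))))"
    (is "?L = ?R")
proof -
  define y where "y = ee (w - of_nat N * \<tau>)"
  define K where "K = ee (of_nat N / 2 + of_nat N * w - of_nat N * (of_nat N + 1) / 2 * \<tau>)"
  have q: "norm q < 1" using \<tau> by (simp add: q_def)
  have qp: "q ^ n = ee (of_nat n * \<tau>)" for n by (simp add: q_def ee_of_nat_mult)
  have "(\<Prod>k<2 * N. 1 - q ^ k * y) = (\<Prod>k<N. 1 - q ^ k * y) * (\<Prod>k<N. 1 - q ^ (N + k) * y)"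
  proof -
    have "(\<Prod>k<M + N. f k) = (\<Prod>k<M. f k) * (\<Prod>k<N. f (M + k))" for M N and f :: "nat \<Rightarrow> complex"
      by (induction N) (auto simp: mult_ac)
    from this[where M = N and N = N] show ?thesis by (simp add: mult_2)
  qed
  also have "(\<Prod>k<N. 1 - q ^ (N + k) * y) = (\<Prod>k<N. 1 - q ^ k * ee w)"
    by (intro prod.cong refl) (simp add: qp y_def algebra_simps flip: ee_add)
  also have "(\<Prod>k<N. 1 - q ^ k * y) = (\<Prod>k<N. 1 - q ^ (N - Suc k) * y)"
    by (rule prod.nat_diff_reindex[symmetric])
  also have "\<dots> = (\<Prod>k<N. ee (1 / 2 + w - of_nat (Suc k) * \<tau>) * (1 - q ^ k * (q / ee w)))"
  proof (intro prod.cong refl)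
    fix k assume "k \<in> {..<N}"
    hence "q ^ (N - Suc k) * y = ee (w - of_nat (Suc k) * \<tau>)"
      by (simp add: qp y_def of_nat_diff algebra_simps flip: ee_add)
    moreover have "q ^ k * (q / ee w) = inverse (ee (w - of_nat (Suc k) * \<tau>))"
      unfolding qp unfolding q_def ee_add[symmetric] ee_diff[symmetric] ee_minus[symmetric]
      by (rule arg_cong[of _ _ ee]) (simp add: algebra_simps)
    moreover have "ee (1 / 2 + w - of_nat (Suc k) * \<tau>) = - ee (w - of_nat (Suc k) * \<tau>)"
      using ee_add[of "1 / 2" "w - of_nat (Suc k) * \<tau>"] by (simp add: algebra_simps)
    ultimately show "1 - q ^ (N - Suc k) * y =
        ee (1 / 2 + w - of_nat (Suc k) * \<tau>) * (1 - q ^ k * (q / ee w))"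
      by (simp add: right_diff_distrib)
  qed
  also have "\<dots> = K * (\<Prod>k<N. 1 - q ^ k * (q / ee w))"
  proof -
    have "(\<Prod>k<N. ee (1 / 2 + w - of_nat (Suc k) * \<tau>)) = K"
      unfolding K_def
    proof (induction N)
      case (Suc N)
      show ?case unfolding prod.lessThan_Suc Suc.IH ee_add[symmetric]
        by (rule arg_cong[of _ _ ee]) (simp add: field_simps)
    qed simp
    thus ?thesis by (simp only: prod.distrib)
  qed
  finally have L: "(\<Prod>k<2 * N. 1 - q ^ k * y) = K * ?L" by (simp only: mult_ac)
  have "(\<Prod>k<2 * N. 1 - q ^ k * y) =
      (\<Sum>j\<le>2 * N. (- 1) ^ j * q ^ (j choose 2) * (qfact q (2 * N) / (qfact q j * qfact q (2 * N - j))) * y ^ j)"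
    by (rule q_binomial[OF q])
  also have "\<dots> = (\<Sum>m\<in>{- int N..int N}. K * (triple_term \<tau> w m *
       (qfact q (2 * N) / (qfact q (nat (int N + m)) * qfact q (nat (int N - m))))))"
  proof (rule sum.reindex_bij_witness[of _ "\<lambda>m. nat (int N + m)" "\<lambda>j. int j - int N"])
    fix j assume "j \<in> {..2 * N}"
    hence n: "nat (int N + (int j - int N)) = j" "nat (int N - (int j - int N)) = 2 * N - j"
      by auto
    have "(- 1) ^ j * q ^ (j choose 2) * y ^ j = K * triple_term \<tau> w (int j - int N)"
      unfolding minus_1_power_eq_ee qp y_def K_def triple_term_def of_nat_choose_2 ee_of_nat_mult[symmetric] ee_add[symmetric]
      by (rule arg_cong[of _ _ ee]) (simp add: field_simps)
    hence "(- 1) ^ j * q ^ (j choose 2) * y ^ j * (qfact q (2 * N) / (qfact q j * qfact q (2 * N - j))) =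
       K * triple_term \<tau> w (int j - int N) * (qfact q (2 * N) / (qfact q j * qfact q (2 * N - j)))" by simp
    thus "K * (triple_term \<tau> w (int j - int N) * (qfact q (2 * N) / (qfact q (nat (int N + (int j - int N))) *
          qfact q (nat (int N - (int j - int N)))))) =
       (- 1) ^ j * q ^ (j choose 2) * (qfact q (2 * N) / (qfact q j * qfact q (2 * N - j))) * y ^ j"
      unfolding n by (simp only: mult_ac)
  qed auto
  finally have "K * ?L = K * ?R" unfolding L by (simp only: sum_distrib_left)
  thus ?thesis by (simp add: K_def)
qed

lemma triple_term_eq_theta_term:
  "triple_term \<tau> w m = ee (1 / 4 + w / 2 - \<tau> / 8) * theta_term 0 \<tau> (w + 1 / 2) (of_int m - 1 / 2)"
  unfolding theta_term_def triple_term_def power_0 mult_1 ee_add[symmetric]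
  by (rule arg_cong[of _ _ ee]) (simp add: field_simps power2_eq_square)

lemma bij_betw_Zs_half: "bij_betw (\<lambda>m. of_int m - 1 / 2) UNIV (Zs (1 / 2))"
proof -
  have "Zs (1 / 2) = Zs (- 1 / 2)"
  proof -
    have "r - 1 / 2 \<in> \<int> \<longleftrightarrow> r + 1 / 2 \<in> \<int>" for r :: real
      using Ints_add[of "r - 1 / 2" 1] Ints_diff[of "r + 1 / 2" 1] by (auto simp: add.commute)
    thus ?thesis by (simp add: Zs_def)
  qed
  thus ?thesis using bij_betw_Zs[of "- 1 / 2"] by simp
qed

text \<open>
  Letting \<open>N\<close> tend to infinity in the finite form: the Gaussian coefficients are bounded and tend to the
  inverse Euler product, so dominated convergence applies.
\<close>

theorem jacobi_triple_product:
  assumes \<tau>: "Im \<tau> > 0"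
  defines "q \<equiv> ee \<tau>"
  shows "(\<Sum>\<^sub>\<infinity>m\<in>UNIV. triple_term \<tau> w m) = qpoch q q * qpoch q (ee w) * qpoch q (q / ee w)"
proof -
  have q: "norm q < 1" using \<tau> by (simp add: q_def)
  define c where "c = qpoch q q"
  have c: "c \<noteq> 0" using qpoch_q_nonzero[OF q] by (simp add: c_def)
  have lim: "qfact q \<longlonglongrightarrow> c" unfolding c_def by (rule qfact_tendsto[OF q])
  define B where "B N m = (if m \<in> {- int N..int N} then
      qfact q (2 * N) / (qfact q (nat (int N + m)) * qfact q (nat (int N - m))) else 0)" for N m
  obtain K1 where K1: "\<And>n. norm (qfact q n) \<le> K1"
    using convergent_imp_Bseq[OF convergentI[OF lim]] by (auto simp: Bseq_def)
  obtain K2 where K2: "\<And>n. norm (inverse (qfact q n)) \<le> K2"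
    using convergent_imp_Bseq[OF convergentI[OF tendsto_inverse[OF lim c]]] by (auto simp: Bseq_def)
  have K0: "0 \<le> K1" "0 \<le> K2" using K1[of 0] K2[of 0] norm_ge_zero order_trans by blast+
  have bound: "norm (B N m) \<le> K1 * (K2 * K2)" for N m
  proof (cases "m \<in> {- int N..int N}")
    case True
    hence "norm (B N m) = norm (qfact q (2 * N)) *
        (norm (inverse (qfact q (nat (int N + m)))) * norm (inverse (qfact q (nat (int N - m)))))"
      by (simp add: B_def norm_divide norm_mult norm_inverse divide_inverse)
    also have "\<dots> \<le> K1 * (K2 * K2)" by (intro mult_mono K1 K2 mult_nonneg_nonneg K0) auto
    finally show ?thesis .
  qed (use K0 in \<open>auto simp: B_def\<close>)
  have B_lim: "(\<lambda>N. B N m) \<longlonglongrightarrow> inverse c" for m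
  proof (rule Lim_transform_eventually)
    have fl: "filterlim (\<lambda>N::nat. nat (int N + k)) sequentially sequentially" for k
    proof (rule filterlim_at_top_mono[OF filterlim_minus_const_nat_at_top[of "nat \<bar>k\<bar>"]])
      show "\<forall>\<^sub>F N in sequentially. N - nat \<bar>k\<bar> \<le> nat (int N + k)"
        by (auto intro!: always_eventually)
    qed
    have "(\<lambda>N. qfact q (2 * N) / (qfact q (nat (int N + m)) * qfact q (nat (int N + (- m))))) \<longlonglongrightarrow> c / (c * c)"
      by (intro tendsto_intros filterlim_compose[OF lim] fl mult_nat_left_at_top) (use c in auto)
    thus "(\<lambda>N. qfact q (2 * N) / (qfact q (nat (int N + m)) * qfact q (nat (int N + (- m))))) \<longlonglongrightarrow> inverse c"
      using c by (simp add: field_simps)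
    show "\<forall>\<^sub>F N in sequentially. qfact q (2 * N) / (qfact q (nat (int N + m)) * qfact q (nat (int N + (- m)))) = B N m"
      using eventually_ge_at_top[of "nat \<bar>m\<bar>"] by eventually_elim (auto simp: B_def)
  qed
  have summ: "(\<lambda>m. norm (triple_term \<tau> w m)) summable_on UNIV"
  proof -
    have "(\<lambda>m. norm (theta_term 0 \<tau> (w + 1 / 2) (of_int m - 1 / 2))) summable_on UNIV"
      using summable_on_reindex_bij_betw[OF bij_betw_Zs_half, of "\<lambda>r. norm (theta_term 0 \<tau> (w + 1 / 2) r)"]
        theta_term_abs_summable[OF \<tau>] by simp
    thus ?thesis unfolding triple_term_eq_theta_term norm_mult by (rule summable_on_cmult_right)
  qed
  have "(\<lambda>N. \<Sum>\<^sub>\<infinity>m\<in>UNIV. triple_term \<tau> w m * B N m) \<longlonglongrightarrow> (\<Sum>\<^sub>\<infinity>m\<in>UNIV. triple_term \<tau> w m * inverse c)"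
  proof (rule tannery_infsum[where M = "\<lambda>m. norm (triple_term \<tau> w m) * (K1 * (K2 * K2))"])
    show "norm (triple_term \<tau> w m * B n m) \<le> norm (triple_term \<tau> w m) * (K1 * (K2 * K2))" for m n
      unfolding norm_mult by (intro mult_left_mono bound) auto
  qed (auto intro!: tendsto_intros B_lim summable_on_cmult_left summ)
  moreover have "(\<Sum>\<^sub>\<infinity>m\<in>UNIV. triple_term \<tau> w m * B N m) =
      (\<Prod>k<N. 1 - q ^ k * ee w) * (\<Prod>k<N. 1 - q ^ k * (q / ee w))" for N
  proof -
    have "(\<Sum>\<^sub>\<infinity>m\<in>UNIV. triple_term \<tau> w m * B N m) = (\<Sum>\<^sub>\<infinity>m\<in>{- int N..int N}. triple_term \<tau> w m * B N m)"
      by (rule infsum_cong_neutral) (auto simp: B_def)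
    also have "\<dots> = (\<Sum>m\<in>{- int N..int N}. triple_term \<tau> w m * B N m)" by simp
    also have "\<dots> = (\<Prod>k<N. 1 - q ^ k * ee w) * (\<Prod>k<N. 1 - q ^ k * (q / ee w))"
      unfolding q_def finite_triple_product[OF \<tau>] by (intro sum.cong refl) (simp add: B_def q_def)
    finally show ?thesis .
  qed
  moreover have "(\<lambda>N. (\<Prod>k<N. 1 - q ^ k * ee w) * (\<Prod>k<N. 1 - q ^ k * (q / ee w)))
      \<longlonglongrightarrow> qpoch q (ee w) * qpoch q (q / ee w)"
    by (intro tendsto_intros qpoch_tendsto q)
  ultimately have "(\<Sum>\<^sub>\<infinity>m\<in>UNIV. triple_term \<tau> w m * inverse c) = qpoch q (ee w) * qpoch q (q / ee w)"
    using LIMSEQ_unique by fastforce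
  hence "(\<Sum>\<^sub>\<infinity>m\<in>UNIV. triple_term \<tau> w m) * inverse c = qpoch q (ee w) * qpoch q (q / ee w)"
    by (simp add: infsum_cmult_left')
  thus ?thesis using c by (simp add: c_def[symmetric] field_simps)
qed

lemma Th_half_product:
  assumes "Im \<tau> > 0"
  shows "Th (1 / 2) 0 \<tau> (w + 1 / 2) =
    ee (\<tau> / 8 - w / 2 - 1 / 4) * (qpoch (ee \<tau>) (ee \<tau>) * qpoch (ee \<tau>) (ee w) * qpoch (ee \<tau>) (ee \<tau> / ee w))"
proof -
  have "Th (1 / 2) 0 \<tau> (w + 1 / 2) = (\<Sum>\<^sub>\<infinity>m\<in>UNIV. theta_term 0 \<tau> (w + 1 / 2) (of_int m - 1 / 2))"
    unfolding Th_def by (rule infsum_reindex_bij_betw[OF bij_betw_Zs_half, symmetric])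
  also have "\<dots> = (\<Sum>\<^sub>\<infinity>m\<in>UNIV. ee (\<tau> / 8 - w / 2 - 1 / 4) * triple_term \<tau> w m)"
    unfolding triple_term_eq_theta_term by (simp add: algebra_simps flip: mult.assoc ee_add)
  also have "\<dots> = ee (\<tau> / 8 - w / 2 - 1 / 4) * (\<Sum>\<^sub>\<infinity>m\<in>UNIV. triple_term \<tau> w m)"
    by (rule infsum_cmult_right')
  finally show ?thesis unfolding jacobi_triple_product[OF assms] by simp
qed

lemma ee_of_int_half: "ee (of_int n / 2) = (if even n then 1 else - 1)"
proof (cases "even n")
  case True
  then obtain k where "n = 2 * k" by blast
  thus ?thesis by simp
next
  case False
  then obtain k where k: "n = 2 * k + 1" by (auto elim: oddE)
  have "ee (of_int n / 2) = ee (of_int k + 1 / 2)" by (simp add: k field_simps)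
  thus ?thesis using False by (simp only: ee_add ee_of_int ee_half) simp
qed

lemma kronecker_minus4_odd: "kronecker_minus4 (2 * n + 1) = ee (of_int n / 2)"
proof (cases "even n")
  case True
  then obtain k where "n = 2 * k" by blast
  hence "(2 * n + 1) mod 4 = 1" by presburger
  thus ?thesis using True by (simp add: kronecker_minus4_def ee_of_int_half)
next
  case False
  hence "(2 * n + 1) mod 4 = 3" by presburger
  thus ?thesis using False by (simp add: kronecker_minus4_def ee_of_int_half)
qed

lemma jacobi_theta_eq_Th:
  assumes "Im \<tau> > 0"
  shows "jacobi_theta \<tau> w = - \<i> * Th (1 / 2) 0 \<tau> (w + 1 / 2)"
proof -
  let ?f = "\<lambda>r. kronecker_minus4 r * ee (of_int (r\<^sup>2) / 8 * \<tau>) * ee (of_int r * w / 2)"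
  have "jacobi_theta \<tau> w = infsum ?f UNIV" using assms by (simp add: jacobi_theta_def)
  also have "\<dots> = infsum ?f (range (\<lambda>n. 2 * n + 1))"
  proof (rule infsum_cong_neutral)
    fix r :: int assume "r \<in> UNIV - range (\<lambda>n. 2 * n + 1)"
    hence "even r" by (metis DiffE oddE rangeI)
    hence "r mod 4 \<noteq> 1" "r mod 4 \<noteq> 3" by presburger+
    thus "?f r = 0" by (simp add: kronecker_minus4_def)
  qed auto
  also have "\<dots> = (\<Sum>\<^sub>\<infinity>n\<in>UNIV. ?f (2 * n + 1))"
    by (subst infsum_reindex) (auto simp: o_def intro!: injI)
  also have "\<dots> = (\<Sum>\<^sub>\<infinity>n\<in>UNIV. - \<i> * theta_term 0 \<tau> (w + 1 / 2) (of_int n + 1 / 2))"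
  proof (rule infsum_cong)
    fix n :: int
    have "ee (of_int n / 2) = - \<i> * ee (of_int n / 2 + 1 / 4)"
      by (simp add: ee_add mult.left_commute[of \<i>])
    hence "?f (2 * n + 1) = - \<i> * (ee (of_int n / 2 + 1 / 4) * ee (of_int ((2 * n + 1)\<^sup>2) / 8 * \<tau>) * ee (of_int (2 * n + 1) * w / 2))"
      by (simp only: kronecker_minus4_odd mult.assoc)
    also have "ee (of_int n / 2 + 1 / 4) * ee (of_int ((2 * n + 1)\<^sup>2) / 8 * \<tau>) * ee (of_int (2 * n + 1) * w / 2) =
        theta_term 0 \<tau> (w + 1 / 2) (of_int n + 1 / 2)"
      unfolding theta_term_def power_0 mult_1 ee_add[symmetric]
      by (rule arg_cong[of _ _ ee]) (simp add: field_simps power2_eq_square)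
    finally show "?f (2 * n + 1) = - \<i> * theta_term 0 \<tau> (w + 1 / 2) (of_int n + 1 / 2)" .
  qed
  also have "\<dots> = - \<i> * (\<Sum>\<^sub>\<infinity>n\<in>UNIV. theta_term 0 \<tau> (w + 1 / 2) (of_int n + 1 / 2))"
    by (rule infsum_cmult_right')
  also have "(\<Sum>\<^sub>\<infinity>n\<in>UNIV. theta_term 0 \<tau> (w + 1 / 2) (of_int n + 1 / 2)) = Th (1 / 2) 0 \<tau> (w + 1 / 2)"
    unfolding Th_def by (rule infsum_reindex_bij_betw[OF bij_betw_Zs])
  finally show ?thesis .
qed

lemma jacobi_theta_product:
  assumes \<tau>: "Im \<tau> > 0"
  shows "jacobi_theta \<tau> w = - ee (\<tau> / 8 - w / 2) *
    (qpoch (ee \<tau>) (ee \<tau>) * qpoch (ee \<tau>) (ee w) * qpoch (ee \<tau>) (ee \<tau> / ee w))"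
proof -
  have "ee (\<tau> / 8 - w / 2) = \<i> * ee (\<tau> / 8 - w / 2 - 1 / 4)"
    using ee_add[of "1 / 4" "\<tau> / 8 - w / 2 - 1 / 4"] by simp
  thus ?thesis unfolding jacobi_theta_eq_Th[OF \<tau>] Th_half_product[OF \<tau>] by simp
qed

lemma jacobi_theta_eq_0D:
  assumes \<tau>: "Im \<tau> > 0" and "jacobi_theta \<tau> w = 0"
  obtains m n :: int where "w = of_int m + of_int n * \<tau>"
proof -
  have q: "norm (ee \<tau>) < 1" using \<tau> by simp
  have "qpoch (ee \<tau>) (ee w) = 0 \<or> qpoch (ee \<tau>) (ee \<tau> / ee w) = 0"
    using assms(2) qpoch_q_nonzero[OF q] by (auto simp: jacobi_theta_product[OF \<tau>])
  then obtain n where "ee \<tau> ^ n * ee w = 1 \<or> ee \<tau> ^ n * (ee \<tau> / ee w) = 1"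
    using qpoch_eq_0_iff[OF q] by auto
  thus thesis
  proof
    assume "ee \<tau> ^ n * ee w = 1"
    hence "ee (of_nat n * \<tau> + w) = 1" by (simp add: ee_of_nat_mult ee_add)
    then obtain m where "of_nat n * \<tau> + w = of_int m" by (auto simp: ee_eq_1_iff elim: Ints_cases)
    hence "w = of_int m + of_int (- int n) * \<tau>" by (simp add: algebra_simps)
    thus thesis by (rule that)
  next
    assume "ee \<tau> ^ n * (ee \<tau> / ee w) = 1"
    hence "ee (of_nat n * \<tau> + (\<tau> - w)) = 1" by (simp only: ee_of_nat_mult ee_add ee_diff)
    then obtain m where "of_nat n * \<tau> + (\<tau> - w) = of_int m" by (auto simp: ee_eq_1_iff elim: Ints_cases)
    hence "w = of_int (- m) + of_int (int n + 1) * \<tau>" by (simp add: algebra_simps)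
    thus thesis by (rule that)
  qed
qed

lemma eta_eq_qpoch:
  assumes "Im \<tau> > 0"
  shows "eta \<tau> = ee (\<tau> / 24) * qpoch (ee \<tau>) (ee \<tau>)"
  using assms by (simp only: eta_def qpoch_def ee_of_nat_mult power_Suc2 if_True)

lemma eta_nonzero:
  assumes "Im \<tau> > 0"
  shows "eta \<tau> \<noteq> 0"
  using assms by (simp add: eta_eq_qpoch qpoch_q_nonzero)

lemma jacobi_theta_0 [simp]: "jacobi_theta \<tau> 0 = 0"
proof (cases "Im \<tau> > 0")
  case True
  hence "qpoch (ee \<tau>) 1 = 0" by (subst qpoch_eq_0_iff) (auto intro: exI[of _ 0])
  thus ?thesis using True by (simp add: jacobi_theta_product)
qed (simp add: jacobi_theta_def)

text \<open>
  Removing from the triple product the factor that vanishes at \<^term>\<open>w = 0\<close> leaves three copies of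
  the Euler product, so that the derivative at 0 is a multiple of \<^term>\<open>eta \<tau> ^ 3\<close>.
\<close>

lemma jacobi_theta_deriv_0:
  assumes \<tau>: "Im \<tau> > 0"
  shows "(jacobi_theta \<tau> has_field_derivative 2 * of_real pi * \<i> * eta \<tau> ^ 3) (at 0)"
proof -
  define q where "q = ee \<tau>"
  have q: "norm q < 1" using \<tau> by (simp add: q_def)
  define R where "R w = - ee (\<tau> / 8 - w / 2) * (qpoch q q * qpoch q (q * ee w) * qpoch q (q / ee w))" for w
  have eq: "jacobi_theta \<tau> w = (1 - ee w) * R w" for w
    unfolding jacobi_theta_product[OF \<tau>] R_def q_def[symmetric] qpoch_rec[OF q, of "ee w"] by simp
  have "isCont (\<lambda>w. - ee (\<tau> / 8 - w / 2) * (qpoch q q * qpoch q (q * ee w) * qpoch q (q / ee w))) 0"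
    unfolding ee_def
    by (intro continuous_intros isCont_o2[OF _ qpoch_continuous[OF q]]) auto
  hence R: "R \<midarrow>0\<rightarrow> R 0" by (simp add: R_def[abs_def] isCont_def)
  have "((\<lambda>w. 1 - ee w) has_field_derivative - (2 * of_real pi * \<i>)) (at 0)"
    by (rule derivative_eq_intros refl | simp)+
  hence "(\<lambda>h. (1 - ee h) / h) \<midarrow>0\<rightarrow> - (2 * of_real pi * \<i>)"
    by (simp add: has_field_derivative_iff)
  hence "(\<lambda>h. (1 - ee h) / h * R h) \<midarrow>0\<rightarrow> - (2 * of_real pi * \<i>) * R 0"
    by (rule tendsto_mult) (rule R)
  moreover have "- (2 * of_real pi * \<i>) * R 0 = 2 * of_real pi * \<i> * eta \<tau> ^ 3"
  proof -
    have "ee (\<tau> / 8) = ee (\<tau> / 24) ^ 3" using ee_of_nat_mult[of 3 "\<tau> / 24"] by simp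
    thus ?thesis unfolding R_def eta_eq_qpoch[OF \<tau>] q_def[symmetric]
      by (simp add: power3_eq_cube)
  qed
  ultimately have "(\<lambda>h. (1 - ee h) / h * R h) \<midarrow>0\<rightarrow> 2 * of_real pi * \<i> * eta \<tau> ^ 3"
    by (simp only:)
  thus ?thesis unfolding has_field_derivative_iff by (simp add: eq)
qed

lemma Th_half_deriv_eq_eta:
  assumes \<tau>: "Im \<tau> > 0"
  shows "Th (1 / 2) 1 \<tau> (1 / 2) = \<i> * eta \<tau> ^ 3"
proof -
  have "((\<lambda>w. Th (1 / 2) 0 \<tau> (w + 1 / 2)) has_field_derivative
      2 * of_real pi * \<i> * Th (1 / 2) 1 \<tau> (0 + 1 / 2)) (at 0)"
    using DERIV_shift[of "Th (1 / 2) 0 \<tau>" "2 * of_real pi * \<i> * Th (1 / 2) 1 \<tau> (0 + 1 / 2)" 0 "1 / 2"]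
      Th_has_field_derivative_w[OF \<tau>, of "1 / 2" 0 "0 + 1 / 2"] by simp
  hence "((\<lambda>w. - \<i> * Th (1 / 2) 0 \<tau> (w + 1 / 2)) has_field_derivative
      - \<i> * (2 * of_real pi * \<i> * Th (1 / 2) 1 \<tau> (0 + 1 / 2))) (at 0)"
    by (rule DERIV_cmult)
  hence "(jacobi_theta \<tau> has_field_derivative
      - \<i> * (2 * of_real pi * \<i> * Th (1 / 2) 1 \<tau> (0 + 1 / 2))) (at 0)"
    by (simp add: jacobi_theta_eq_Th[OF \<tau>, abs_def])
  note E = DERIV_unique[OF this jacobi_theta_deriv_0[OF \<tau>]]
  define t where "t = Th (1 / 2) 1 \<tau> (1 / 2)"
  have "t = - \<i> * (2 * of_real pi * \<i> * t) / (2 * of_real pi)" by simp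
  also have "\<dots> = 2 * of_real pi * \<i> * eta \<tau> ^ 3 / (2 * of_real pi)"
    using E unfolding t_def by (simp only: add_0)
  also have "\<dots> = \<i> * eta \<tau> ^ 3" by simp
  finally show ?thesis by (simp only: t_def)
qed

section \<open>The logarithmic derivative of the Dedekind eta function\<close>

lemma uniform_limit_euler:
  assumes "0 \<le> r" "r < 1"
  shows "uniform_limit (cball 0 r) (\<lambda>N q. \<Prod>n<N. 1 - q ^ n * q) (\<lambda>q. qpoch q q) sequentially"
proof -
  have "uniformly_convergent_on (cball 0 r) (\<lambda>N q. \<Prod>n<N. 1 - q ^ n * (q::complex))"
  proof (rule uniformly_convergent_on_prod')
    show "uniformly_convergent_on (cball 0 r) (\<lambda>N q. \<Sum>n<N. norm (1 - q ^ n * (q::complex) - 1))"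
    proof (rule Weierstrass_m_test'_ev[OF always_eventually])
      have "norm q ^ n * norm q \<le> \<bar>r\<bar> ^ n * \<bar>r\<bar>" if "q \<in> cball 0 r" for n and q :: complex
        using that by (intro mult_mono power_mono) auto
      thus "\<forall>n. \<forall>q\<in>cball 0 r. norm (norm (1 - q ^ n * q - 1 :: complex)) \<le> \<bar>r\<bar> ^ n * \<bar>r\<bar>"
        by (simp add: norm_mult norm_power)
      show "summable (\<lambda>n. \<bar>r\<bar> ^ n * \<bar>r\<bar>)"
        using assms by (intro summable_mult2 summable_geometric) auto
    qed
  qed (auto intro!: continuous_intros)
  then obtain l where l: "uniform_limit (cball 0 r) (\<lambda>N q. \<Prod>n<N. 1 - q ^ n * (q::complex)) l sequentially"
    by (auto simp: uniformly_convergent_on_def)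
  have eq: "l q = qpoch q q" if "q \<in> cball 0 r" for q
    by (rule LIMSEQ_unique[OF tendsto_uniform_limitI[OF l that] qpoch_tendsto]) (use that assms in auto)
  show ?thesis by (rule iffD1[OF uniform_limit_cong' l]) (simp_all add: eq)
qed

lemma euler_holomorphic: "(\<lambda>q. qpoch q q) holomorphic_on ball 0 1"
proof (rule holomorphic_on_open[THEN iffD2, OF open_ball], intro ballI)
  fix q :: complex assume "q \<in> ball 0 1"
  then obtain r where r: "norm q < r" "r < 1" using dense[of "norm q" 1] by auto
  have "(\<lambda>q. qpoch q q) holomorphic_on ball 0 r"
    by (rule holomorphic_uniform_limit[OF _ uniform_limit_euler[OF order.trans[OF norm_ge_zero less_imp_le[OF r(1)]] r(2)]])
       (auto intro!: always_eventually continuous_intros holomorphic_intros)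
  thus "\<exists>f'. ((\<lambda>q. qpoch q q) has_field_derivative f') (at q)"
    using r by (auto simp: holomorphic_on_open)
qed

lemma euler_log_derivative:
  assumes q: "norm q < 1"
  shows "(\<lambda>k. - (of_nat (Suc k) * q ^ k / (1 - q ^ Suc k))) sums (deriv (\<lambda>q. qpoch q q) q / qpoch q q)"
proof -
  obtain r where r: "norm q < r" "r < 1" using dense[OF q] by auto
  have "(\<lambda>k. deriv (\<lambda>q. 1 - q ^ k * q) q / (1 - q ^ k * q)) sums (deriv (\<lambda>q. qpoch q q) q / qpoch q q)"
  proof (rule logderiv_prodinf_complex_uniform_limit[where A = "ball 0 r"])
    show "uniform_limit (ball 0 r) (\<lambda>n q. \<Prod>k<n. 1 - q ^ k * q) (\<lambda>q. qpoch q q) sequentially"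
      by (rule uniform_limit_on_subset[OF uniform_limit_euler[OF order.trans[OF norm_ge_zero less_imp_le[OF r(1)]] r(2)]]) auto
  qed (use r q in \<open>auto intro!: holomorphic_intros simp: qpoch_q_nonzero\<close>)
  moreover have "deriv (\<lambda>q. 1 - q ^ k * q) q = - (of_nat (Suc k) * q ^ k)" for k
  proof (rule DERIV_imp_deriv)
    have "((\<lambda>q. 1 - q ^ Suc k) has_field_derivative - (of_nat (Suc k) * q ^ k)) (at q)"
      by (rule derivative_eq_intros refl | simp)+
    thus "((\<lambda>q. 1 - q ^ k * q) has_field_derivative - (of_nat (Suc k) * q ^ k)) (at q)"
      by (simp add: mult.commute)
  qed
  ultimately show ?thesis by (simp add: mult.commute)
qed

lemma has_sum_geometric_multiples:
  fixes z :: "'a :: {real_normed_field, banach}"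
  assumes z: "norm z < 1"
  shows "((\<lambda>j. of_nat (Suc k) * z ^ (Suc k * Suc j)) has_sum of_nat (Suc k) * z ^ Suc k / (1 - z ^ Suc k)) UNIV"
proof -
  have "norm z ^ Suc k < 1" using z power_less_one_iff[of "norm z" "Suc k"] by simp
  hence n: "norm (z ^ Suc k) < 1" by (simp only: norm_power)
  have "((\<lambda>j. (z ^ Suc k) ^ j) has_sum 1 / (1 - z ^ Suc k)) UNIV"
    using n by (intro norm_summable_imp_has_sum geometric_sums) (simp add: norm_power summable_geometric)
  hence "((\<lambda>j. of_nat (Suc k) * z ^ Suc k * (z ^ Suc k) ^ j) has_sum of_nat (Suc k) * z ^ Suc k * (1 / (1 - z ^ Suc k))) UNIV"
    by (rule has_sum_cmult_right)
  moreover have "of_nat (Suc k) * z ^ Suc k * (z ^ Suc k) ^ j = of_nat (Suc k) * z ^ (Suc k * Suc j)" for j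
  proof -
    have "Suc k * Suc j = Suc k + Suc k * j" by simp
    thus ?thesis by (simp only: power_add power_mult mult.assoc)
  qed
  ultimately show ?thesis by (simp only: times_divide_eq_right mult_1_right)
qed

text \<open>Both sides are the double series of \<open>k q\<^bsup>k j\<^esup>\<close> over positive \<open>k\<close>, \<open>j\<close>, summed by rows or by products.\<close>

lemma lambert_series:
  fixes q :: complex
  assumes q: "norm q < 1"
  shows "(\<Sum>k. of_nat (Suc k) * q ^ Suc k / (1 - q ^ Suc k)) = (\<Sum>m. of_nat (\<Sum>d | d dvd Suc m. d) * q ^ Suc m)"
proof -
  define f where "f = (\<lambda>(k, j). of_nat (Suc k) * q ^ (Suc k * Suc j))"
  have qk: "norm q ^ Suc k \<le> norm q" for k
    using power_decreasing[of 1 "Suc k" "norm q"] q by simp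
  note geo = has_sum_geometric_multiples
  have nf: "norm (f (k, j)) = real (Suc k) * norm q ^ (Suc k * Suc j)" for k j
    by (simp only: f_def prod.case norm_mult norm_power norm_of_nat)
  have nrm: "((\<lambda>j. norm (f (k, j))) has_sum real (Suc k) * norm q ^ Suc k / (1 - norm q ^ Suc k)) UNIV" for k
    unfolding nf by (rule geo) (use q in simp)
  have "(\<lambda>p. norm (f p)) summable_on UNIV \<times> UNIV"
  proof (rule summable_on_SigmaI[OF nrm])
    have "(\<lambda>k. real (Suc k) * norm q ^ Suc k) summable_on UNIV"
    proof (rule norm_summable_imp_summable_on)
      have "summable (\<lambda>k. of_nat (Suc k) * norm q ^ k * norm q)"
        using geometric_deriv_sums[of "norm q"] q by (intro summable_mult2) (auto simp: sums_iff)
      thus "summable (\<lambda>k. norm (real (Suc k) * norm q ^ Suc k))"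
        by (simp add: abs_mult mult_ac del: of_nat_Suc)
    qed
    hence "(\<lambda>k. real (Suc k) * norm q ^ Suc k * (1 / (1 - norm q))) summable_on UNIV"
      by (rule summable_on_cmult_left)
    thus "(\<lambda>k. real (Suc k) * norm q ^ Suc k / (1 - norm q ^ Suc k)) summable_on UNIV"
    proof (rule summable_on_comparison_test)
      fix k :: nat
      have "1 / (1 - norm q ^ Suc k) \<le> 1 / (1 - norm q)"
        using qk[of k] q by (intro divide_left_mono mult_pos_pos) (auto intro: le_less_trans[OF qk])
      hence "real (Suc k) * norm q ^ Suc k * (1 / (1 - norm q ^ Suc k)) \<le> real (Suc k) * norm q ^ Suc k * (1 / (1 - norm q))"
        by (intro mult_left_mono) auto
      thus "real (Suc k) * norm q ^ Suc k / (1 - norm q ^ Suc k) \<le> real (Suc k) * norm q ^ Suc k * (1 / (1 - norm q))"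
        by simp
    next
      fix k :: nat
      show "0 \<le> real (Suc k) * norm q ^ Suc k / (1 - norm q ^ Suc k)"
        using q qk[of k] by (intro divide_nonneg_nonneg mult_nonneg_nonneg) auto
    qed
  qed auto
  note abs = this
  hence summ: "(f has_sum infsum f (UNIV \<times> UNIV)) (UNIV \<times> UNIV)"
    by (rule has_sum_infsum[OF abs_summable_summable])
  have 1: "((\<lambda>k. of_nat (Suc k) * q ^ Suc k / (1 - q ^ Suc k)) has_sum infsum f (UNIV \<times> UNIV)) UNIV"
    by (rule has_sum_SigmaD[OF summ]) (use geo[OF q] in \<open>simp add: f_def\<close>)
  define S where "S = Sigma UNIV (\<lambda>m::nat. {d. d dvd Suc m})"
  have bij: "bij_betw (\<lambda>(m, d). (d - 1, Suc m div d - 1)) S (UNIV \<times> UNIV)"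
  proof (rule bij_betwI[of _ _ _ "\<lambda>(k, j). (Suc k * Suc j - 1, Suc k)"])
    fix p assume "p \<in> S"
    then obtain m d where p: "p = (m, d)" "d dvd Suc m" by (auto simp: S_def)
    then obtain e where e: "Suc m = d * e" by blast
    hence "d > 0" "e > 0" by (metis Suc_neq_Zero mult_is_0 not_gr_zero)+
    then obtain d' e' where de: "d = Suc d'" "e = Suc e'" by (metis gr0_implies_Suc)
    have "Suc m div d = e" using \<open>d > 0\<close> unfolding e by simp
    moreover have "Suc d' * Suc e' - 1 = m" using e by (simp add: de)
    ultimately show "(case case p of (m, d) \<Rightarrow> (d - 1, Suc m div d - 1) of (k, j) \<Rightarrow> (Suc k * Suc j - 1, Suc k)) = p"
      by (simp only: p prod.case de diff_Suc_1)
  next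
    fix p :: "nat \<times> nat"
    obtain k j where p: "p = (k, j)" by (cases p)
    have "Suc (Suc k * Suc j - 1) = Suc k * Suc j" by simp
    thus "(case case p of (k, j) \<Rightarrow> (Suc k * Suc j - 1, Suc k) of (m, d) \<Rightarrow> (d - 1, Suc m div d - 1)) = p"
      by (simp only: p prod.case nonzero_mult_div_cancel_left[OF nat.distinct(2)] diff_Suc_1)
  next
    have "Suc (Suc k * Suc j - 1) = Suc k * Suc j" for k j by simp
    hence "Suc k dvd Suc (Suc k * Suc j - 1)" for k j by (simp only: dvd_triv_left)
    thus "(\<lambda>(k, j). (Suc k * Suc j - 1, Suc k)) \<in> UNIV \<times> UNIV \<rightarrow> S"
      unfolding S_def by (intro Pi_I) (simp only: case_prod_unfold mem_Sigma_iff UNIV_I mem_Collect_eq simp_thms)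
  qed simp
  have fS: "(\<lambda>p. f (case p of (m, d) \<Rightarrow> (d - 1, Suc m div d - 1))) (m, d) = of_nat d * q ^ Suc m" if "d dvd Suc m" for m d
  proof -
    obtain e where e: "Suc m = d * e" using \<open>d dvd Suc m\<close> by blast
    hence "d > 0" "e > 0" by (metis Suc_neq_Zero mult_is_0 not_gr_zero)+
    then obtain d' e' where de: "d = Suc d'" "e = Suc e'" by (metis gr0_implies_Suc)
    have "Suc m div d = e" using \<open>d > 0\<close> unfolding e by simp
    thus ?thesis by (simp only: prod.case f_def de e diff_Suc_1)
  qed
  have inner: "((\<lambda>d. f (case (m, d) of (m, d) \<Rightarrow> (d - 1, Suc m div d - 1))) has_sum of_nat (\<Sum>d | d dvd Suc m. d) * q ^ Suc m) {d. d dvd Suc m}" for m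
  proof (rule has_sum_finiteI)
    show "of_nat (\<Sum>d | d dvd Suc m. d) * q ^ Suc m = (\<Sum>d | d dvd Suc m. f (case (m, d) of (m, d) \<Rightarrow> (d - 1, Suc m div d - 1)))"
      using fS[of _ m] by (simp add: sum_distrib_right)
  qed simp
  have "((\<lambda>p. f (case p of (m, d) \<Rightarrow> (d - 1, Suc m div d - 1))) has_sum infsum f (UNIV \<times> UNIV)) S"
    using summ by (subst has_sum_reindex_bij_betw[OF bij])
  from has_sum_SigmaD[OF this[unfolded S_def] inner]
  have 2: "((\<lambda>m. of_nat (\<Sum>d | d dvd Suc m. d) * q ^ Suc m) has_sum infsum f (UNIV \<times> UNIV)) UNIV" .
  show "(\<Sum>k. of_nat (Suc k) * q ^ Suc k / (1 - q ^ Suc k)) = (\<Sum>m. of_nat (\<Sum>d | d dvd Suc m. d) * q ^ Suc m)"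
    using has_sum_imp_sums[OF 1] has_sum_imp_sums[OF 2] by (simp add: sums_iff)
qed

lemma E2_eq_euler:
  assumes \<tau>: "Im \<tau> > 0"
  defines "q \<equiv> ee \<tau>"
  shows "E2 \<tau> = 1 + 24 * q * (deriv (\<lambda>q. qpoch q q) q / qpoch q q)"
proof -
  have q: "norm q < 1" using \<tau> by (simp add: q_def)
  have "(\<lambda>k. q * - (of_nat (Suc k) * q ^ k / (1 - q ^ Suc k))) sums (q * (deriv (\<lambda>q. qpoch q q) q / qpoch q q))"
    by (rule sums_mult[OF euler_log_derivative[OF q]])
  hence "(\<lambda>k. - (of_nat (Suc k) * q ^ Suc k / (1 - q ^ Suc k))) sums (q * (deriv (\<lambda>q. qpoch q q) q / qpoch q q))"
    by (simp add: mult_ac)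
  hence "(\<lambda>k. of_nat (Suc k) * q ^ Suc k / (1 - q ^ Suc k)) sums (- (q * (deriv (\<lambda>q. qpoch q q) q / qpoch q q)))"
    using sums_minus by fastforce
  hence "(\<Sum>m. of_nat (\<Sum>d | d dvd Suc m. d) * q ^ Suc m) = - (q * (deriv (\<lambda>q. qpoch q q) q / qpoch q q))"
    using lambert_series[OF q] by (simp add: sums_iff)
  moreover have "ee (of_nat (Suc m) * \<tau>) = q ^ Suc m" for m by (simp only: ee_of_nat_mult q_def)
  ultimately show ?thesis using \<tau> by (simp only: E2_def if_True) (simp add: algebra_simps)
qed

lemma eta_has_field_derivative:
  assumes \<tau>: "Im \<tau> > 0"
  shows "(eta has_field_derivative 2 * of_real pi * \<i> * (E2 \<tau> / 24 * eta \<tau>)) (at \<tau>)"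
proof -
  define P where "P = (\<lambda>q. qpoch q q)"
  have "P holomorphic_on ball 0 1" unfolding P_def by (rule euler_holomorphic)
  hence P: "(P has_field_derivative deriv P (ee \<tau>)) (at (ee \<tau>))"
    by (rule holomorphic_derivI) (use \<tau> in auto)
  have "(ee has_field_derivative 2 * of_real pi * \<i> * 1 * ee \<tau>) (at \<tau>)"
    by (rule has_field_derivative_ee) (rule DERIV_ident)
  from DERIV_chain2[OF P this]
  have "((\<lambda>\<tau>. ee (\<tau> / 24) * P (ee \<tau>)) has_field_derivative
      2 * of_real pi * \<i> * (1 / 24) * ee (\<tau> / 24) * P (ee \<tau>)
      + deriv P (ee \<tau>) * (2 * of_real pi * \<i> * 1 * ee \<tau>) * ee (\<tau> / 24)) (at \<tau>)"
    by (intro DERIV_mult has_field_derivative_ee) (auto intro!: derivative_eq_intros)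
  also have "2 * of_real pi * \<i> * (1 / 24) * ee (\<tau> / 24) * P (ee \<tau>)
      + deriv P (ee \<tau>) * (2 * of_real pi * \<i> * 1 * ee \<tau>) * ee (\<tau> / 24) = 2 * of_real pi * \<i> * (E2 \<tau> / 24 * eta \<tau>)"
  proof -
    have "qpoch (ee \<tau>) (ee \<tau>) \<noteq> 0" using \<tau> by (simp add: qpoch_q_nonzero)
    thus ?thesis unfolding E2_eq_euler[OF \<tau>] eta_eq_qpoch[OF \<tau>] P_def
      by (simp add: field_simps)
  qed
  finally show ?thesis
    by (rule has_field_derivative_transform_within_open[OF _ open_upper_half_plane])
       (use \<tau> in \<open>auto simp: eta_eq_qpoch P_def\<close>)
qed

section \<open>Quasi-periodicity of theta series\<close>

text \<open>Completing the square in the exponent.\<close>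

lemma Th_shift:
  "Th a 0 \<tau> (w + of_real b * \<tau>) = ee (- ((of_real b)\<^sup>2 / 2 * \<tau> + of_real b * w)) * Th (a + b) 0 \<tau> w"
proof -
  have bij: "bij_betw (\<lambda>r. r + b) (Zs a) (Zs (a + b))"
    by (rule bij_betwI[of _ _ _ "\<lambda>r. r - b"]) (auto simp: Zs_def algebra_simps)
  have "Th a 0 \<tau> (w + of_real b * \<tau>) =
      (\<Sum>\<^sub>\<infinity>r\<in>Zs a. ee (- ((of_real b)\<^sup>2 / 2 * \<tau> + of_real b * w)) * theta_term 0 \<tau> w (r + b))"
    unfolding Th_def
  proof (rule infsum_cong)
    fix r
    show "theta_term 0 \<tau> (w + of_real b * \<tau>) r =
        ee (- ((of_real b)\<^sup>2 / 2 * \<tau> + of_real b * w)) * theta_term 0 \<tau> w (r + b)"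
      unfolding theta_term_def power_0 mult_1 ee_add[symmetric]
      by (rule arg_cong[of _ _ ee]) (simp add: field_simps power2_eq_square)
  qed
  also have "\<dots> = ee (- ((of_real b)\<^sup>2 / 2 * \<tau> + of_real b * w)) * (\<Sum>\<^sub>\<infinity>r\<in>Zs a. theta_term 0 \<tau> w (r + b))"
    by (rule infsum_cmult_right')
  also have "(\<Sum>\<^sub>\<infinity>r\<in>Zs a. theta_term 0 \<tau> w (r + b)) = Th (a + b) 0 \<tau> w"
    unfolding Th_def by (rule infsum_reindex_bij_betw[OF bij])
  finally show ?thesis .
qed

lemma Zs_plus_1 [simp]: "Zs (a + 1) = Zs a"
proof -
  have "r - (a + 1) \<in> \<int> \<longleftrightarrow> r - a \<in> \<int>" for r
    using Ints_add[of "r - (a + 1)" 1] Ints_diff[of "r - a" 1] by (auto simp: algebra_simps)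
  thus ?thesis by (simp add: Zs_def)
qed

lemma Th_plus_tau: "Th a 0 \<tau> (w + \<tau>) = ee (- (\<tau> / 2 + w)) * Th a 0 \<tau> w"
  using Th_shift[of a \<tau> w 1] by (simp add: Th_def)

lemma Th_plus_1: "Th a k \<tau> (w + 1) = ee (of_real a) * Th a k \<tau> w"
proof -
  have "Th a k \<tau> (w + 1) = (\<Sum>\<^sub>\<infinity>r\<in>Zs a. ee (of_real a) * theta_term k \<tau> w r)"
    unfolding Th_def
  proof (rule infsum_cong)
    fix r assume "r \<in> Zs a"
    then obtain n where "r = a + of_int n" by (auto simp: Zs_eq_image)
    hence "ee (of_real r) = ee (of_real a)" by (simp add: ee_add)
    thus "theta_term k \<tau> (w + 1) r = ee (of_real a) * theta_term k \<tau> w r"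
      by (simp add: theta_term_def distrib_left ee_add)
  qed
  thus ?thesis by (simp only: Th_def infsum_cmult_right')
qed

lemma Th_0_plus_1 [simp]: "Th 0 k \<tau> (w + 1) = Th 0 k \<tau> w"
  by (simp add: Th_plus_1)

lemma Th_half_plus_1: "Th (1 / 2) k \<tau> (w + 1) = - Th (1 / 2) k \<tau> w"
  by (simp add: Th_plus_1)

lemma Th_0_tau_plus_1: "Th 0 k (\<tau> + 1) w = Th 0 k \<tau> (w + 1 / 2)"
  unfolding Th_def
proof (rule infsum_cong)
  fix r assume "r \<in> Zs 0"
  then obtain n where n: "r = of_int n" by (auto simp: Zs_eq_image)
  have "even (n\<^sup>2 - n)" by simp
  then obtain l where "n\<^sup>2 - n = 2 * l" by blast
  hence "of_int (n\<^sup>2 - n) = (of_int (2 * l) :: complex)" by (rule arg_cong)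
  hence l: "(of_int n)\<^sup>2 = (of_int n + 2 * of_int l :: complex)" by (simp add: algebra_simps)
  have "of_real (r\<^sup>2 / 2) * (\<tau> + 1) + of_real r * w =
      of_real (r\<^sup>2 / 2) * \<tau> + of_real r * (w + 1 / 2) + of_int l"
    by (simp add: n l field_simps)
  hence "ee (of_real (r\<^sup>2 / 2) * (\<tau> + 1) + of_real r * w) = ee (of_real (r\<^sup>2 / 2) * \<tau> + of_real r * (w + 1 / 2))"
    by (simp only: ee_add ee_of_int mult_1_right)
  thus "theta_term k (\<tau> + 1) w r = theta_term k \<tau> (w + 1 / 2) r"
    by (simp only: theta_term_def ee_add)
qed

lemma Th_half_tau_plus_1: "Th (1 / 2) k (\<tau> + 1) w = ee (1 / 8) * Th (1 / 2) k \<tau> w"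
proof -
  have "Th (1 / 2) k (\<tau> + 1) w = (\<Sum>\<^sub>\<infinity>r\<in>Zs (1 / 2). ee (1 / 8) * theta_term k \<tau> w r)"
    unfolding Th_def
  proof (rule infsum_cong)
    fix r assume "r \<in> Zs (1 / 2 :: real)"
    then obtain n where n: "r = of_int n + 1 / 2" by (auto simp: Zs_eq_image)
    have "even (n\<^sup>2 + n)" by simp
    then obtain l where "n\<^sup>2 + n = 2 * l" by blast
    hence "of_int (n\<^sup>2 + n) = (of_int (2 * l) :: complex)" by (rule arg_cong)
    hence l: "(of_int n)\<^sup>2 = (2 * of_int l - of_int n :: complex)" by (simp add: algebra_simps)
    have "complex_of_real (r\<^sup>2 / 2) = 1 / 8 + of_int l"
      by (simp add: n power2_sum l field_simps)
    hence "of_real (r\<^sup>2 / 2) * (\<tau> + 1) = of_real (r\<^sup>2 / 2) * \<tau> + 1 / 8 + of_int l"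
      by (simp add: distrib_left)
    hence "ee (of_real (r\<^sup>2 / 2) * (\<tau> + 1)) = ee (of_real (r\<^sup>2 / 2) * \<tau>) * ee (1 / 8)"
      by (simp only: ee_add ee_of_int mult_1_right)
    thus "theta_term k (\<tau> + 1) w r = ee (1 / 8) * theta_term k \<tau> w r"
      by (simp add: theta_term_def)
  qed
  thus ?thesis by (simp only: Th_def infsum_cmult_right')
qed

lemma jacobi_theta_plus_1:
  assumes "Im \<tau> > 0"
  shows "jacobi_theta \<tau> (w + 1) = - jacobi_theta \<tau> w"
  using Th_half_plus_1[of 0 \<tau> "w + 1 / 2"] assms by (simp add: jacobi_theta_eq_Th add_ac)

lemma jacobi_theta_plus_tau:
  assumes "Im \<tau> > 0"
  shows "jacobi_theta \<tau> (w + \<tau>) = - ee (- (\<tau> / 2 + w)) * jacobi_theta \<tau> w"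
proof -
  have "ee (- (\<tau> / 2 + (w + 1 / 2))) = - ee (- (\<tau> / 2 + w))"
    using ee_diff[of "- (\<tau> / 2 + w)" "1 / 2"] by (simp add: algebra_simps)
  thus ?thesis
    using Th_plus_tau[of "1 / 2" \<tau> "w + 1 / 2"] assms by (simp add: jacobi_theta_eq_Th add_ac)
qed

lemma jacobi_theta_holomorphic:
  assumes "Im \<tau> > 0"
  shows "jacobi_theta \<tau> holomorphic_on UNIV"
proof -
  have "Th (1 / 2) 0 \<tau> holomorphic_on UNIV"
    using Th_has_field_derivative_w[OF assms] by (auto simp: holomorphic_on_open)
  hence "(\<lambda>w. - \<i> * Th (1 / 2) 0 \<tau> (w + 1 / 2)) holomorphic_on UNIV"
    by (intro holomorphic_intros holomorphic_on_compose[of "\<lambda>w. w + 1 / 2" UNIV, unfolded o_def]) (auto intro: holomorphic_intros)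
  moreover have "jacobi_theta \<tau> = (\<lambda>w. - \<i> * Th (1 / 2) 0 \<tau> (w + 1 / 2))"
    using assms by (simp add: fun_eq_iff jacobi_theta_eq_Th)
  ultimately show ?thesis by simp
qed

lemma periodic_int:
  fixes f :: "complex \<Rightarrow> 'a"
  assumes "\<And>w. f (w + p) = f w"
  shows "f (w + of_int n * p) = f w"
proof -
  have nat: "f (w + of_nat k * p) = f w" for w k
  proof (induction k)
    case (Suc k)
    have "f (w + of_nat (Suc k) * p) = f (w + of_nat k * p + p)" by (simp add: algebra_simps)
    thus ?case using assms Suc by simp
  qed simp
  show ?thesis
  proof (cases n rule: int_cases2)
    case (nonneg k)
    thus ?thesis using nat by simp
  next
    case (nonpos k)
    thus ?thesis using nat[of "w + of_int n * p" k] by simp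
  qed
qed

text \<open>
  An entire function with the quasi-periods of \<^const>\<open>jacobi_theta\<close> that vanishes at 0 vanishes on the
  whole period lattice, and there \<^const>\<open>jacobi_theta\<close> has only simple zeros; the quotient is an
  entire elliptic function.
\<close>

lemma jacobi_theta_unique:
  assumes \<tau>: "Im \<tau> > 0" and hol: "G holomorphic_on UNIV" and G0: "G 0 = 0"
    and G1: "\<And>w. G (w + 1) = - G w" and G\<tau>: "\<And>w. G (w + \<tau>) = - ee (- (\<tau> / 2 + w)) * G w"
  obtains C where "\<And>w. G w = C * jacobi_theta \<tau> w"
proof -
  let ?th = "jacobi_theta \<tau>"
  define c where "c = deriv G 0 / (2 * of_real pi * \<i> * eta \<tau> ^ 3)"
  define Q where "Q w = (if ?th w = 0 then c else G w / ?th w)" for w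
  note th1 = jacobi_theta_plus_1[OF \<tau>] and th\<tau> = jacobi_theta_plus_tau[OF \<tau>]
  note th_hol = jacobi_theta_holomorphic[OF \<tau>]
  have Q1: "Q (w + 1) = Q w" and Q\<tau>: "Q (w + \<tau>) = Q w" for w
    by (simp_all add: Q_def th1 th\<tau> G1 G\<tau>)
  have Qper: "Q (w + (of_int m + of_int n * \<tau>)) = Q w" for w m n
    using periodic_int[where f = Q, OF Q\<tau>, of "w + of_int m" n] periodic_int[where f = Q, OF Q1, of w m] by (simp add: add.assoc)
  have limG: "((\<lambda>w. G w / w) \<longlongrightarrow> deriv G 0) (at 0)"
    using holomorphic_derivI[OF hol open_UNIV, of 0] by (simp add: has_field_derivative_iff G0)
  have limth: "((\<lambda>w. ?th w / w) \<longlongrightarrow> 2 * of_real pi * \<i> * eta \<tau> ^ 3) (at 0)"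
    using jacobi_theta_deriv_0[OF \<tau>] by (simp add: has_field_derivative_iff)
  have nz: "2 * of_real pi * \<i> * eta \<tau> ^ 3 \<noteq> 0" using eta_nonzero[OF \<tau>] by simp
  have "\<forall>\<^sub>F w in at 0. ?th w / w \<noteq> 0"
    by (rule tendsto_imp_eventually_ne[OF limth nz])
  hence "\<forall>\<^sub>F w in at 0. ?th w \<noteq> 0" by eventually_elim auto
  then obtain e where e: "e > 0" "\<And>w. w \<noteq> 0 \<Longrightarrow> norm w < e \<Longrightarrow> ?th w \<noteq> 0"
    by (auto simp: eventually_at dist_norm)
  have Q0: "Q holomorphic_on ball 0 e"
  proof (rule no_isolated_singularity')
    have "((\<lambda>w. (G w / w) / (?th w / w)) \<longlongrightarrow> c) (at 0)"
      unfolding c_def by (intro tendsto_divide limG limth nz)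
    moreover have "\<forall>\<^sub>F w in at 0. (G w / w) / (?th w / w) = Q w"
      using eventually_at_in_open'[of "ball 0 e" 0] e
      by (auto simp: eventually_at_filter Q_def elim!: eventually_mono)
    ultimately have "(Q \<longlongrightarrow> c) (at 0)" by (rule Lim_transform_eventually)
    thus "(Q \<longlongrightarrow> Q z) (at z within ball 0 e)" if "z \<in> {0}" for z
      using that by (auto simp: Q_def intro: tendsto_within_subset)
    have "(\<lambda>w. G w / ?th w) holomorphic_on ball 0 e - {0}"
      by (intro holomorphic_on_divide holomorphic_on_subset[OF hol] holomorphic_on_subset[OF th_hol]) (use e in auto)
    thus "Q holomorphic_on ball 0 e - {0}"
      by (rule holomorphic_transform) (use e in \<open>auto simp: Q_def\<close>)
  qed auto
  have "Q field_differentiable at p" for p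
  proof (cases "?th p = 0")
    case True
    then obtain m n :: int where p: "p = of_int m + of_int n * \<tau>"
      using jacobi_theta_eq_0D[OF \<tau>] by metis
    have "(\<lambda>w. w - p) field_differentiable at p"
      by (intro field_differentiable_diff field_differentiable_ident field_differentiable_const)
    moreover have "Q field_differentiable at (p - p)"
      using holomorphic_on_imp_differentiable_at[OF Q0 open_ball, of 0] e(1) by simp
    ultimately have "(\<lambda>w. Q (w - p)) field_differentiable at p"
      using field_differentiable_compose[of "\<lambda>w. w - p" p Q] by (simp add: o_def)
    moreover have "Q (w - p) = Q w" for w
      using Qper[of "w - p" m n] by (simp add: p)
    ultimately show ?thesis by simp
  next
    case False
    let ?U = "- (?th -` {0})"
    have "open ?U"
      using continuous_closed_vimage[of "{0}" ?th] holomorphic_on_imp_continuous_on[OF th_hol]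
      by (auto simp: continuous_on_eq_continuous_at)
    moreover have "(\<lambda>w. G w / ?th w) holomorphic_on ?U"
      by (intro holomorphic_on_divide holomorphic_on_subset[OF hol] holomorphic_on_subset[OF th_hol]) auto
    hence "Q holomorphic_on ?U" by (rule holomorphic_transform) (auto simp: Q_def)
    ultimately show ?thesis using False holomorphic_on_imp_differentiable_at by blast
  qed
  hence Qhol: "Q holomorphic_on UNIV" by (simp add: holomorphic_on_def)
  let ?K = "(\<lambda>(x, y). of_real x + of_real y * \<tau>) ` ({0..1} \<times> {0..1})"
  have "compact ?K"
    unfolding case_prod_unfold by (intro compact_continuous_image continuous_intros compact_Times compact_Icc)
  hence "compact (Q ` ?K)"
    by (rule compact_continuous_image[OF continuous_on_subset[OF holomorphic_on_imp_continuous_on[OF Qhol] subset_UNIV]])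
  moreover have "range Q \<subseteq> Q ` ?K"
  proof safe
    fix w
    define y where "y = Im w / Im \<tau>"
    define x where "x = Re (w - of_real y * \<tau>)"
    have "w = of_real x + of_real y * \<tau>"
      using \<tau> by (simp add: complex_eq_iff x_def y_def)
    hence "w = (of_real (frac x) + of_real (frac y) * \<tau>) + (of_int \<lfloor>x\<rfloor> + of_int \<lfloor>y\<rfloor> * \<tau>)"
      by (simp add: frac_def algebra_simps)
    hence "Q w = Q (of_real (frac x) + of_real (frac y) * \<tau>)" using Qper by metis
    moreover have "frac x \<in> {0..1}" "frac y \<in> {0..1}"
      using frac_lt_1[of x] frac_lt_1[of y] by auto
    hence "of_real (frac x) + of_real (frac y) * \<tau> \<in> ?K"
      by (intro image_eqI[of _ _ "(frac x, frac y)"]) auto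
    ultimately show "Q w \<in> Q ` ?K" by blast
  qed
  ultimately have "bounded (range Q)"
    using compact_imp_bounded bounded_subset by blast
  then obtain C where C: "\<And>w. Q w = C"
    using Liouville_theorem[OF Qhol] by (auto simp: constant_on_def)
  have "G w = C * ?th w" for w
  proof (cases "?th w = 0")
    case True
    then obtain m n :: int where w: "w = of_int m + of_int n * \<tau>"
      using jacobi_theta_eq_0D[OF \<tau>] by metis
    have "G (v + 1) = 0 \<longleftrightarrow> G v = 0" "G (v + \<tau>) = 0 \<longleftrightarrow> G v = 0" for v by (simp_all add: G1 G\<tau>)
    hence "(G (0 + of_int m * 1 + of_int n * \<tau>) = 0) = (G 0 = 0)"
      using periodic_int[where f = "\<lambda>v. G v = 0" and p = \<tau> and w = "0 + of_int m * 1" and n = n]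
        periodic_int[where f = "\<lambda>v. G v = 0" and p = 1 and w = 0 and n = m] by blast
    thus ?thesis using True G0 w by simp
  next
    case False
    thus ?thesis using C[of w] by (simp add: Q_def field_simps)
  qed
  thus thesis by (rule that)
qed

section \<open>Inversion of the theta functions\<close>

text \<open>The automorphy factor of \<^const>\<open>jacobi_theta\<close>, read off from the derivatives at 0.\<close>

definition theta_factor :: "complex \<Rightarrow> complex" where
  "theta_factor \<tau> = eta (- 1 / \<tau>) ^ 3 / (\<tau> * eta \<tau> ^ 3)"

lemma Im_minus_inverse: "Im (- 1 / \<tau>) = Im \<tau> / (norm \<tau>)\<^sup>2"
  by (simp add: Im_divide cmod_power2)

lemma Im_minus_inverse_pos:
  assumes "Im \<tau> > 0"
  shows "Im (- 1 / \<tau>) > 0"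
  using assms unfolding Im_minus_inverse by (intro divide_pos_pos) auto

text \<open>
  Divided by the exponential factor, the left-hand side has the quasi-periods of \<^term>\<open>jacobi_theta \<tau>\<close> and
  vanishes at 0, so the two are proportional; the derivatives at 0 give the constant.
\<close>

lemma jacobi_theta_inversion:
  assumes \<tau>: "Im \<tau> > 0"
  shows "jacobi_theta (- 1 / \<tau>) (z / \<tau>) = theta_factor \<tau> * ee (z\<^sup>2 / (2 * \<tau>)) * jacobi_theta \<tau> z"
proof -
  define \<tau>' where "\<tau>' = - 1 / \<tau>"
  have \<tau>': "Im \<tau>' > 0" unfolding \<tau>'_def by (rule Im_minus_inverse_pos[OF \<tau>])
  have nz: "\<tau> \<noteq> 0" using \<tau> by auto
  define G where "G z = jacobi_theta \<tau>' (z / \<tau>) * ee (- z\<^sup>2 / (2 * \<tau>))" for z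
  have hol: "G holomorphic_on UNIV"
    unfolding G_def
    by (intro holomorphic_intros holomorphic_on_compose[of "\<lambda>z. z / \<tau>" UNIV, unfolded o_def]
        holomorphic_on_subset[OF jacobi_theta_holomorphic[OF \<tau>']]) (use nz in auto)
  have G1: "G (w + 1) = - G w" for w
  proof -
    have a: "w / \<tau> = (w + 1) / \<tau> + \<tau>'" using nz by (simp add: \<tau>'_def field_simps)
    have "jacobi_theta \<tau>' (w / \<tau>) = - ee (- (\<tau>' / 2 + (w + 1) / \<tau>)) * jacobi_theta \<tau>' ((w + 1) / \<tau>)"
      unfolding a by (rule jacobi_theta_plus_tau[OF \<tau>'])
    moreover have "ee (- (\<tau>' / 2 + (w + 1) / \<tau>)) * ee (- w\<^sup>2 / (2 * \<tau>)) = ee (- (w + 1)\<^sup>2 / (2 * \<tau>))"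
      unfolding ee_add[symmetric]
      by (rule arg_cong[of _ _ ee]) (use nz in \<open>simp add: \<tau>'_def field_simps power2_eq_square\<close>)
    ultimately show ?thesis by (simp add: G_def)
  qed
  have G\<tau>: "G (w + \<tau>) = - ee (- (\<tau> / 2 + w)) * G w" for w
  proof -
    have a: "(w + \<tau>) / \<tau> = w / \<tau> + 1" using nz by (simp add: field_simps)
    have "ee (- (\<tau> / 2 + w)) * ee (- w\<^sup>2 / (2 * \<tau>)) = ee (- (w + \<tau>)\<^sup>2 / (2 * \<tau>))"
      unfolding ee_add[symmetric]
      by (rule arg_cong[of _ _ ee]) (use nz in \<open>simp add: field_simps power2_eq_square\<close>)
    thus ?thesis unfolding G_def a jacobi_theta_plus_1[OF \<tau>'] by simp
  qed
  obtain C where C: "\<And>w. G w = C * jacobi_theta \<tau> w"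
    using jacobi_theta_unique[OF \<tau> hol _ G1 G\<tau>] by (auto simp: G_def)
  have "(jacobi_theta \<tau>' has_field_derivative 2 * of_real pi * \<i> * eta \<tau>' ^ 3) (at (0 / \<tau>))"
    using jacobi_theta_deriv_0[OF \<tau>'] by simp
  moreover have "((\<lambda>z. z / \<tau>) has_field_derivative 1 / \<tau>) (at 0)"
    by (rule DERIV_cdivide) (rule DERIV_ident)
  ultimately have "((\<lambda>z. jacobi_theta \<tau>' (z / \<tau>)) has_field_derivative 2 * of_real pi * \<i> * eta \<tau>' ^ 3 * (1 / \<tau>)) (at 0)"
    by (rule DERIV_chain2)
  moreover have "((\<lambda>z. ee (- z\<^sup>2 / (2 * \<tau>))) has_field_derivative 0) (at 0)"
    by (rule derivative_eq_intros refl | use nz in simp)+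
  ultimately have "(G has_field_derivative (2 * of_real pi * \<i> * eta \<tau>' ^ 3 * (1 / \<tau>)) * ee (- 0\<^sup>2 / (2 * \<tau>)) +
      0 * jacobi_theta \<tau>' (0 / \<tau>)) (at 0)"
    unfolding G_def[abs_def] by (rule DERIV_mult)
  moreover have "(G has_field_derivative C * (2 * of_real pi * \<i> * eta \<tau> ^ 3)) (at 0)"
    unfolding C[abs_def] by (rule DERIV_cmult[OF jacobi_theta_deriv_0[OF \<tau>]])
  ultimately have "(2 * of_real pi * \<i> * eta \<tau>' ^ 3 * (1 / \<tau>)) * ee (- 0\<^sup>2 / (2 * \<tau>)) +
      0 * jacobi_theta \<tau>' (0 / \<tau>) = C * (2 * of_real pi * \<i> * eta \<tau> ^ 3)"
    by (rule DERIV_unique)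
  hence "2 * of_real pi * \<i> * (eta \<tau>' ^ 3 / \<tau>) = 2 * of_real pi * \<i> * (C * eta \<tau> ^ 3)"
    by (simp add: mult_ac)
  hence "eta \<tau>' ^ 3 / \<tau> = C * eta \<tau> ^ 3"
    by (subst (asm) mult_left_cancel) simp
  hence "C = theta_factor \<tau>"
    using eta_nonzero[OF \<tau>] nz by (simp add: theta_factor_def \<tau>'_def field_simps)
  moreover have "jacobi_theta \<tau>' (z / \<tau>) = G z * ee (z\<^sup>2 / (2 * \<tau>))"
    by (simp add: G_def mult.assoc flip: ee_add)
  ultimately show ?thesis using C[of z] by (simp add: \<tau>'_def mult_ac)
qed

lemma eta_cube_inversion:
  assumes \<tau>: "Im \<tau> > 0"
  shows "eta (- 1 / \<tau>) ^ 3 = \<tau> * theta_factor \<tau> * eta \<tau> ^ 3"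
  using eta_nonzero[OF \<tau>] \<tau> by (auto simp: theta_factor_def)

lemma Th_half_inversion:
  assumes \<tau>: "Im \<tau> > 0"
  shows "Th (1 / 2) 0 (- 1 / \<tau>) (z / \<tau> + 1 / 2) = theta_factor \<tau> * ee (z\<^sup>2 / (2 * \<tau>)) * Th (1 / 2) 0 \<tau> (z + 1 / 2)"
  using jacobi_theta_inversion[OF \<tau>, of z]
  unfolding jacobi_theta_eq_Th[OF \<tau>] jacobi_theta_eq_Th[OF Im_minus_inverse_pos[OF \<tau>]] by simp

text \<open>
  Third derivatives at 0 of the inversion formula. Since the series satisfies the heat equation, the
  third derivative in \<^term>\<open>z\<close> is the \<^term>\<open>\<tau>\<close>-derivative of the first, and comparing it with the
  differentiated transformation law of the first gives a differential equation for the factor.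
\<close>

lemma Th_half_3_inversion:
  assumes \<tau>: "Im \<tau> > 0"
  defines "c \<equiv> 2 * of_real pi * \<i>"
  shows "Th (1 / 2) 3 (- 1 / \<tau>) (1 / 2) / \<tau> ^ 3 - 3 * Th (1 / 2) 1 (- 1 / \<tau>) (1 / 2) / (c * \<tau>\<^sup>2) =
    theta_factor \<tau> * Th (1 / 2) 3 \<tau> (1 / 2)"
proof -
  define \<tau>' where "\<tau>' = - 1 / \<tau>"
  have \<tau>': "Im \<tau>' > 0" unfolding \<tau>'_def by (rule Im_minus_inverse_pos[OF \<tau>])
  have nz: "\<tau> \<noteq> 0" and c: "c \<noteq> 0" using \<tau> by (auto simp: c_def)
  define T where "T k z = Th (1 / 2) k \<tau>' (z / \<tau> + 1 / 2)" for k z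
  define S where "S k z = theta_factor \<tau> * Th (1 / 2) k \<tau> (z + 1 / 2)" for k z
  define E where "E z = ee (- z\<^sup>2 / (2 * \<tau>))" for z
  have eq0: "T 0 z * E z = S 0 z" for z
    using Th_half_inversion[OF \<tau>, of z] by (simp add: T_def S_def E_def \<tau>'_def mult_ac flip: ee_add)
  have dT: "(T k has_field_derivative c / \<tau> * T (Suc k) z) (at z)" for k z
  proof -
    have "((\<lambda>z. z / \<tau> + 1 / 2) has_field_derivative 1 / \<tau>) (at z)"
      by (rule derivative_eq_intros refl | use nz in simp)+
    from DERIV_chain2[OF Th_has_field_derivative_w[OF \<tau>', of "1 / 2" k "z / \<tau> + 1 / 2"] this]
    show ?thesis by (simp add: T_def[abs_def] c_def mult_ac)
  qed
  have dS: "(S k has_field_derivative c * S (Suc k) z) (at z)" for k z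
  proof -
    have "((\<lambda>z. z + 1 / 2) has_field_derivative 1) (at z)"
      by (rule derivative_eq_intros refl | simp)+
    from DERIV_cmult[OF DERIV_chain2[OF Th_has_field_derivative_w[OF \<tau>, of "1 / 2" k "z + 1 / 2"] this], of "theta_factor \<tau>"]
    show ?thesis by (simp add: S_def[abs_def] c_def mult_ac)
  qed
  have dE: "(E has_field_derivative c / \<tau> * (- z * E z)) (at z)" for z
    unfolding E_def[abs_def] by (rule derivative_eq_intros refl | use nz in \<open>simp add: c_def\<close>)+
  have eq1: "(T 1 z - z * T 0 z) * E z = \<tau> * S 1 z" for z
  proof -
    have "((\<lambda>z. T 0 z * E z) has_field_derivative c / \<tau> * T (Suc 0) z * E z + c / \<tau> * (- z * E z) * T 0 z) (at z)"
      by (rule DERIV_mult[OF dT dE])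
    hence "(S 0 has_field_derivative c / \<tau> * T (Suc 0) z * E z + c / \<tau> * (- z * E z) * T 0 z) (at z)"
      by (simp only: eq0)
    from DERIV_unique[OF this dS] have "c * ((T 1 z - z * T 0 z) * E z) = c * (\<tau> * S 1 z)"
      using nz by (simp add: field_simps)
    thus ?thesis by (simp only: mult_left_cancel[OF c])
  qed
  have eq2: "(c * T 2 z - \<tau> * T 0 z - 2 * c * z * T 1 z + c * z\<^sup>2 * T 0 z) * E z = c * \<tau>\<^sup>2 * S 2 z" for z
  proof -
    have "((\<lambda>z. (T 1 z - z * T 0 z) * E z) has_field_derivative
        (c / \<tau> * T (Suc 1) z - (1 * T 0 z + c / \<tau> * T (Suc 0) z * z)) * E z + c / \<tau> * (- z * E z) * (T 1 z - z * T 0 z)) (at z)"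
      by (intro DERIV_mult DERIV_diff dT dE DERIV_ident)
    hence "((\<lambda>z. \<tau> * S 1 z) has_field_derivative
        (c / \<tau> * T (Suc 1) z - (1 * T 0 z + c / \<tau> * T (Suc 0) z * z)) * E z + c / \<tau> * (- z * E z) * (T 1 z - z * T 0 z)) (at z)"
      by (simp only: eq1)
    from DERIV_unique[OF this DERIV_cmult[OF dS]]
    have "\<tau> * ((c * T 2 z - \<tau> * T 0 z - 2 * c * z * T 1 z + c * z\<^sup>2 * T 0 z) * E z) = \<tau> * (c * \<tau>\<^sup>2 * S 2 z)"
      using nz by (simp add: field_simps power2_eq_square numeral_2_eq_2)
    thus ?thesis by (simp only: mult_left_cancel[OF nz])
  qed
  have "((\<lambda>z. (c * T 2 z - \<tau> * T 0 z - 2 * c * z * T 1 z + c * z\<^sup>2 * T 0 z) * E z) has_field_derivative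
      c / \<tau> * (c * T 3 0) - c * T 1 0 - 2 * c * T 1 0) (at 0)"
  proof -
    have dT2: "(T 2 has_field_derivative c / \<tau> * T 3 z) (at z)" and dT1: "(T 1 has_field_derivative c / \<tau> * T 2 z) (at z)"
      and dT0: "(T 0 has_field_derivative c / \<tau> * T 1 z) (at z)" for z
      using dT[of 2 z] dT[of 1 z] dT[of 0 z] by (simp_all add: numeral_3_eq_3 numeral_2_eq_2)
    have E0: "E 0 = 1" by (simp add: E_def)
    show ?thesis
      by (rule derivative_eq_intros dT2 dT1 dT0 dE refl)+ (use nz in \<open>simp add: E0 field_simps\<close>)
  qed
  hence "((\<lambda>z. c * \<tau>\<^sup>2 * S 2 z) has_field_derivative c / \<tau> * (c * T 3 0) - c * T 1 0 - 2 * c * T 1 0) (at 0)"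
    by (simp only: eq2)
  from DERIV_unique[OF this DERIV_cmult[OF dS]]
  have "c / \<tau> * (c * T 3 0) - c * T 1 0 - 2 * c * T 1 0 = c * \<tau>\<^sup>2 * (c * S 3 0)"
    by (simp add: numeral_3_eq_3 numeral_2_eq_2)
  hence "c * (c * T 3 0) = c * (\<tau> ^ 3 * (c * S 3 0) + 3 * \<tau> * T 1 0)"
    using nz by (simp add: field_simps power2_eq_square power3_eq_cube)
  hence "c * T 3 0 = \<tau> ^ 3 * (c * S 3 0) + 3 * \<tau> * T 1 0"
    by (simp only: mult_left_cancel[OF c])
  hence "T 3 0 / \<tau> ^ 3 - 3 * T 1 0 / (c * \<tau>\<^sup>2) = S 3 0"
    using nz c by (simp add: field_simps power2_eq_square power3_eq_cube)
  thus ?thesis by (simp add: T_def S_def \<tau>'_def)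
qed

lemma has_field_derivative_compose_inversion:
  assumes \<tau>: "Im \<tau> > 0" and f: "(f has_field_derivative D) (at (- 1 / \<tau>))"
  shows "((\<lambda>\<tau>. f (- 1 / \<tau>)) has_field_derivative D / \<tau>\<^sup>2) (at \<tau>)"
proof -
  have nz: "\<tau> \<noteq> 0" using \<tau> by auto
  have "((\<lambda>\<tau>. - 1 / \<tau>) has_field_derivative 1 / \<tau>\<^sup>2) (at \<tau>)"
    by (rule derivative_eq_intros refl | use nz in \<open>simp add: power2_eq_square\<close>)+
  from DERIV_chain2[OF f this] show ?thesis by simp
qed

lemma theta_factor_has_field_derivative:
  assumes \<tau>: "Im \<tau> > 0"
  shows "(theta_factor has_field_derivative theta_factor \<tau> / (2 * \<tau>)) (at \<tau>)"
proof -
  define a where "a k \<tau> = Th (1 / 2) k \<tau> (1 / 2)" for k \<tau>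
  have nz: "\<tau> \<noteq> 0" using \<tau> by auto
  have a1: "a 1 \<tau> = \<i> * eta \<tau> ^ 3" if "Im \<tau> > 0" for \<tau>
    unfolding a_def by (rule Th_half_deriv_eq_eta[OF that])
  have da: "(a 1 has_field_derivative of_real pi * \<i> * a 3 \<tau>) (at \<tau>)" if "Im \<tau> > 0" for \<tau>
    using Th_has_field_derivative_tau[OF that, of "1 / 2" 1 "1 / 2"] by (simp add: a_def[abs_def] numeral_3_eq_3)
  have F: "theta_factor \<tau> = a 1 (- 1 / \<tau>) / (\<tau> * a 1 \<tau>)" if "Im \<tau> > 0" for \<tau>
    unfolding theta_factor_def a1[OF that] a1[OF Im_minus_inverse_pos[OF that]] by simp
  have a_nz: "a 1 \<tau> \<noteq> 0" using a1[OF \<tau>] eta_nonzero[OF \<tau>] by simp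
  define b1 where "b1 = a 1 (- 1 / \<tau>)"
  define b3 where "b3 = a 3 (- 1 / \<tau>)"
  have "((\<lambda>\<tau>. a 1 (- 1 / \<tau>)) has_field_derivative of_real pi * \<i> * b3 / \<tau>\<^sup>2) (at \<tau>)"
    unfolding b3_def by (rule has_field_derivative_compose_inversion[OF \<tau> da[OF Im_minus_inverse_pos[OF \<tau>]]])
  moreover have "((\<lambda>\<tau>. \<tau> * a 1 \<tau>) has_field_derivative 1 * a 1 \<tau> + of_real pi * \<i> * a 3 \<tau> * \<tau>) (at \<tau>)"
    by (intro DERIV_mult DERIV_ident da \<tau>)
  ultimately have "((\<lambda>\<tau>. a 1 (- 1 / \<tau>) / (\<tau> * a 1 \<tau>)) has_field_derivative
      (of_real pi * \<i> * b3 / \<tau>\<^sup>2 * (\<tau> * a 1 \<tau>) - b1 * (1 * a 1 \<tau> + of_real pi * \<i> * a 3 \<tau> * \<tau>)) / ((\<tau> * a 1 \<tau>) * (\<tau> * a 1 \<tau>))) (at \<tau>)"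
    unfolding b1_def by (rule DERIV_divide) (use nz a_nz in simp)
  moreover have "(of_real pi * \<i> * b3 / \<tau>\<^sup>2 * (\<tau> * a 1 \<tau>) - b1 * (1 * a 1 \<tau> + of_real pi * \<i> * a 3 \<tau> * \<tau>)) / ((\<tau> * a 1 \<tau>) * (\<tau> * a 1 \<tau>))
     = theta_factor \<tau> / (2 * \<tau>)"
  proof -
    define p where "p = complex_of_real pi * \<i>"
    have p: "p \<noteq> 0" by (simp add: p_def)
    have "b3 / \<tau> ^ 3 - 3 * b1 / (2 * p * \<tau>\<^sup>2) = theta_factor \<tau> * a 3 \<tau>"
      using Th_half_3_inversion[OF \<tau>] by (simp add: b1_def b3_def a_def p_def mult.assoc)
    also have "theta_factor \<tau> = b1 / (\<tau> * a 1 \<tau>)" using F[OF \<tau>] by (simp add: b1_def)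
    finally have "b3 / \<tau> ^ 3 = b1 * a 3 \<tau> / (\<tau> * a 1 \<tau>) + 3 * b1 / (2 * p * \<tau>\<^sup>2)"
      by (simp add: algebra_simps)
    hence b3: "b3 = \<tau>\<^sup>2 * b1 * a 3 \<tau> / a 1 \<tau> + 3 * b1 * \<tau> / (2 * p)"
      using nz p a_nz by (simp add: field_simps power2_eq_square power3_eq_cube)
    show ?thesis unfolding p_def[symmetric] b3 F[OF \<tau>] b1_def[symmetric]
      using nz p a_nz by (simp add: field_simps power2_eq_square)
  qed
  ultimately have "((\<lambda>\<tau>. a 1 (- 1 / \<tau>) / (\<tau> * a 1 \<tau>)) has_field_derivative theta_factor \<tau> / (2 * \<tau>)) (at \<tau>)"
    by simp
  thus ?thesis
    by (rule has_field_derivative_transform_within_open[OF _ open_upper_half_plane]) (use \<tau> F in auto)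
qed

lemma convex_upper_half_plane: "convex upper_half_plane"
  by (rule convex_halfspace_Im_gt)

text \<open>
  By the differential equation, \<open>C\<^sup>2 / \<tau>\<close> is constant. It is evaluated at the fixed point \<open>\<tau> = i\<close> of the inversion,
  where the two values of eta in the definition of the factor cancel.
\<close>

lemma theta_factor_square:
  assumes \<tau>: "Im \<tau> > 0"
  shows "theta_factor \<tau> ^ 2 = \<i> * \<tau>"
proof -
  have "((\<lambda>\<tau>. theta_factor \<tau> ^ 2 / \<tau>) has_field_derivative 0) (at \<tau> within upper_half_plane)"
    if "\<tau> \<in> upper_half_plane" for \<tau>
  proof -
    have \<tau>: "Im \<tau> > 0" and nz: "\<tau> \<noteq> 0" using that by auto
    have "((\<lambda>\<tau>. theta_factor \<tau> ^ 2 / \<tau>) has_field_derivative 0) (at \<tau>)"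
      by (rule derivative_eq_intros theta_factor_has_field_derivative[OF \<tau>] refl
          | use nz in \<open>simp add: power2_eq_square\<close>)+
    thus ?thesis by (rule has_field_derivative_at_within)
  qed
  then obtain c where c: "\<And>\<tau>. Im \<tau> > 0 \<Longrightarrow> theta_factor \<tau> ^ 2 / \<tau> = c"
    using has_field_derivative_zero_constant[OF convex_upper_half_plane, of "\<lambda>\<tau>. theta_factor \<tau> ^ 2 / \<tau>"]
    by auto
  have "theta_factor \<i> = - \<i>"
    using eta_nonzero[of \<i>] by (simp add: theta_factor_def)
  hence "c = \<i>" using c[of \<i>] by simp
  moreover have "\<tau> \<noteq> 0" using \<tau> by auto
  ultimately show ?thesis using c[OF \<tau>] by (simp only: divide_eq_eq if_False if_True not_False_eq_True)
qed

text \<open>The logarithmic derivative of the inversion formula for the cube of eta.\<close>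

lemma E2_inversion:
  assumes \<tau>: "Im \<tau> > 0"
  shows "E2 (- 1 / \<tau>) = \<tau>\<^sup>2 * E2 \<tau> + 12 * \<tau> / (2 * of_real pi * \<i>)"
proof -
  define c where "c = 2 * complex_of_real pi * \<i>"
  define h where "h \<tau> = eta \<tau> ^ 3" for \<tau>
  have c: "c \<noteq> 0" and nz: "\<tau> \<noteq> 0" and h: "h \<tau> \<noteq> 0" using \<tau> eta_nonzero[OF \<tau>] by (auto simp: c_def h_def)
  have F: "theta_factor \<tau> \<noteq> 0" using theta_factor_square[OF \<tau>] nz by auto
  have dh: "(h has_field_derivative c * E2 \<tau> / 8 * h \<tau>) (at \<tau>)" if "Im \<tau> > 0" for \<tau>
    unfolding h_def[abs_def]
    by (rule derivative_eq_intros eta_has_field_derivative[OF that] refl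
        | simp add: c_def power2_eq_square power3_eq_cube)+
  have "((\<lambda>\<tau>. h (- 1 / \<tau>)) has_field_derivative c * E2 (- 1 / \<tau>) / 8 * h (- 1 / \<tau>) / \<tau>\<^sup>2) (at \<tau>)"
    by (rule has_field_derivative_compose_inversion[OF \<tau> dh[OF Im_minus_inverse_pos[OF \<tau>]]])
  moreover have "((\<lambda>\<tau>. \<tau> * theta_factor \<tau> * h \<tau>) has_field_derivative
      (1 * theta_factor \<tau> + theta_factor \<tau> / (2 * \<tau>) * \<tau>) * h \<tau> + c * E2 \<tau> / 8 * h \<tau> * (\<tau> * theta_factor \<tau>)) (at \<tau>)"
    by (intro DERIV_mult DERIV_ident theta_factor_has_field_derivative dh \<tau>)
  hence "((\<lambda>\<tau>. h (- 1 / \<tau>)) has_field_derivative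
      (1 * theta_factor \<tau> + theta_factor \<tau> / (2 * \<tau>) * \<tau>) * h \<tau> + c * E2 \<tau> / 8 * h \<tau> * (\<tau> * theta_factor \<tau>)) (at \<tau>)"
    by (rule has_field_derivative_transform_within_open[OF _ open_upper_half_plane])
       (use \<tau> in \<open>simp_all only: h_def eta_cube_inversion mem_Collect_eq\<close>)
  ultimately have "c * E2 (- 1 / \<tau>) / 8 * h (- 1 / \<tau>) / \<tau>\<^sup>2 =
      (1 * theta_factor \<tau> + theta_factor \<tau> / (2 * \<tau>) * \<tau>) * h \<tau> + c * E2 \<tau> / 8 * h \<tau> * (\<tau> * theta_factor \<tau>)"
    by (rule DERIV_unique)
  also have "h (- 1 / \<tau>) = \<tau> * theta_factor \<tau> * h \<tau>"
    unfolding h_def by (rule eta_cube_inversion[OF \<tau>])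
  finally have "(theta_factor \<tau> * h \<tau> / (8 * \<tau>)) * (c * E2 (- 1 / \<tau>)) =
      (theta_factor \<tau> * h \<tau> / (8 * \<tau>)) * (12 * \<tau> + c * \<tau>\<^sup>2 * E2 \<tau>)"
    using nz by (simp add: field_simps power2_eq_square)
  hence "c * E2 (- 1 / \<tau>) = 12 * \<tau> + c * \<tau>\<^sup>2 * E2 \<tau>"
    by (subst (asm) mult_left_cancel) (use F h nz in auto)
  hence "E2 (- 1 / \<tau>) = \<tau>\<^sup>2 * E2 \<tau> + 12 * \<tau> / c" using c by (simp add: field_simps)
  thus ?thesis by (simp add: c_def)
qed

lemma E2_plus_1:
  assumes \<tau>: "Im \<tau> > 0"
  shows "E2 (\<tau> + 1) = E2 \<tau>"
  using assms by (simp add: E2_eq_euler ee_add)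

text \<open>
  Up to exponential factors, the even theta functions are translates of the odd one by half-periods,
  and the inversion permutes the half-periods.
\<close>

lemma Th_even_inversion:
  fixes z :: complex
  assumes \<tau>: "Im \<tau> > 0"
  defines "\<kappa> \<equiv> \<i> * theta_factor \<tau> * ee (z\<^sup>2 / (2 * \<tau>))"
  shows "Th (1 / 2) 0 (- 1 / \<tau>) (z / \<tau>) = \<kappa> * Th 0 0 \<tau> (z + 1 / 2)"
    and "Th 0 0 (- 1 / \<tau>) (z / \<tau> + 1 / 2) = \<kappa> * Th (1 / 2) 0 \<tau> z"
    and "Th 0 0 (- 1 / \<tau>) (z / \<tau>) = \<kappa> * Th 0 0 \<tau> z"
proof -
  define F where "F = theta_factor \<tau>"
  have nz: "\<tau> \<noteq> 0" using \<tau> by auto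
  have half: "Th (1 / 2) 0 t (w - t / 2) = ee (w / 2 - t / 8) * Th 0 0 t w" for t w
  proof -
    have "Th (1 / 2) 0 t (w - t / 2) = ee (- (1 / 8 * t - w / 2)) * Th (1 / 2 + - 1 / 2) 0 t w"
      using Th_shift[of "1 / 2" t w "- 1 / 2"] by (simp add: power2_eq_square)
    thus ?thesis by (simp add: algebra_simps)
  qed
  note inv = Th_half_inversion[OF \<tau>, folded F_def]
  have i: "\<i> = ee (1 / 4)" by simp
  have "Th (1 / 2) 0 (- 1 / \<tau>) (z / \<tau>) = Th (1 / 2) 0 (- 1 / \<tau>) ((z - \<tau> / 2) / \<tau> + 1 / 2)"
    using nz by (simp add: diff_divide_distrib)
  also have "\<dots> = F * ee ((z - \<tau> / 2)\<^sup>2 / (2 * \<tau>)) * Th (1 / 2) 0 \<tau> ((z + 1 / 2) - \<tau> / 2)"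
    unfolding inv by (simp add: algebra_simps)
  also have "\<dots> = F * (ee ((z - \<tau> / 2)\<^sup>2 / (2 * \<tau>)) * ee ((z + 1 / 2) / 2 - \<tau> / 8)) * Th 0 0 \<tau> (z + 1 / 2)"
    unfolding half by (simp only: mult.assoc)
  also have "ee ((z - \<tau> / 2)\<^sup>2 / (2 * \<tau>)) * ee ((z + 1 / 2) / 2 - \<tau> / 8) = \<i> * ee (z\<^sup>2 / (2 * \<tau>))"
    unfolding i ee_add[symmetric]
    by (rule arg_cong[of _ _ ee]) (use nz in \<open>simp add: field_simps power2_eq_square\<close>)
  finally show "Th (1 / 2) 0 (- 1 / \<tau>) (z / \<tau>) = \<kappa> * Th 0 0 \<tau> (z + 1 / 2)"
    by (simp only: \<kappa>_def F_def mult_ac)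

  have half': "Th 0 0 t w = ee (t / 8 - w / 2) * Th (1 / 2) 0 t (w - t / 2)" for t w
    unfolding half by (simp flip: mult.assoc ee_add)
  have "Th 0 0 (- 1 / \<tau>) (z / \<tau> + 1 / 2) =
      ee ((- 1 / \<tau>) / 8 - (z / \<tau> + 1 / 2) / 2) * Th (1 / 2) 0 (- 1 / \<tau>) ((z + 1 / 2) / \<tau> + 1 / 2)"
    unfolding half'[of "- 1 / \<tau>"] using nz by (simp add: field_simps)
  also have "\<dots> = F * (ee ((- 1 / \<tau>) / 8 - (z / \<tau> + 1 / 2) / 2) * ee ((z + 1 / 2)\<^sup>2 / (2 * \<tau>))) * Th (1 / 2) 0 \<tau> (z + 1)"
  proof -
    have "z + 1 / 2 + 1 / 2 = z + 1" by simp
    thus ?thesis unfolding inv by (simp only: mult_ac)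
  qed
  also have "ee ((- 1 / \<tau>) / 8 - (z / \<tau> + 1 / 2) / 2) * ee ((z + 1 / 2)\<^sup>2 / (2 * \<tau>)) = ee (z\<^sup>2 / (2 * \<tau>)) * inverse \<i>"
    unfolding i ee_add[symmetric] ee_minus[symmetric]
    by (rule arg_cong[of _ _ ee]) (use nz in \<open>simp add: field_simps power2_eq_square\<close>)
  finally show "Th 0 0 (- 1 / \<tau>) (z / \<tau> + 1 / 2) = \<kappa> * Th (1 / 2) 0 \<tau> z"
    unfolding Th_half_plus_1 by (simp add: \<kappa>_def F_def)

  have "Th 0 0 (- 1 / \<tau>) (z / \<tau>) = ee ((- 1 / \<tau>) / 8 - (z / \<tau>) / 2) * Th (1 / 2) 0 (- 1 / \<tau>) ((z + 1 / 2 - \<tau> / 2) / \<tau> + 1 / 2)"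
  proof -
    have "(z + 1 / 2 - \<tau> / 2) / \<tau> + 1 / 2 = z / \<tau> - (- 1 / \<tau>) / 2"
      using nz by (simp add: field_simps)
    thus ?thesis by (simp only: half'[of "- 1 / \<tau>" "z / \<tau>"])
  qed
  also have "\<dots> = F * (ee ((- 1 / \<tau>) / 8 - (z / \<tau>) / 2) * ee ((z + 1 / 2 - \<tau> / 2)\<^sup>2 / (2 * \<tau>))) *
      Th (1 / 2) 0 \<tau> ((z + 1) - \<tau> / 2)"
  proof -
    have "z + 1 / 2 - \<tau> / 2 + 1 / 2 = z + 1 - \<tau> / 2" by simp
    thus ?thesis unfolding inv by (simp only: mult_ac)
  qed
  also have "\<dots> = F * (ee ((- 1 / \<tau>) / 8 - (z / \<tau>) / 2) * ee ((z + 1 / 2 - \<tau> / 2)\<^sup>2 / (2 * \<tau>)) * ee ((z + 1) / 2 - \<tau> / 8)) * Th 0 0 \<tau> z"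
    unfolding half by (simp add: mult_ac)
  also have "ee ((- 1 / \<tau>) / 8 - (z / \<tau>) / 2) * ee ((z + 1 / 2 - \<tau> / 2)\<^sup>2 / (2 * \<tau>)) * ee ((z + 1) / 2 - \<tau> / 8) = \<i> * ee (z\<^sup>2 / (2 * \<tau>))"
    unfolding i ee_add[symmetric]
    by (rule arg_cong[of _ _ ee]) (use nz in \<open>simp add: field_simps power2_eq_square\<close>)
  finally show "Th 0 0 (- 1 / \<tau>) (z / \<tau>) = \<kappa> * Th 0 0 \<tau> z"
    by (simp only: \<kappa>_def F_def mult_ac)
qed

text \<open>The symbol \<open>$\<close> is reserved for the components of vectors.\<close>

no_notation fps_nth (infixl "$" 75)

section \<open>Theta functions of cosets of integral vectors\<close>

definition lattice_term :: "complex \<Rightarrow> complex^'n \<Rightarrow> real^'n \<Rightarrow> complex" where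
  "lattice_term \<tau> z r = ee (of_real (r \<bullet> r / 2) * \<tau>) * ee (bil (cvec r) z)"

definition Zvec :: "real \<Rightarrow> (real^'n) set" where
  "Zvec a = {r. \<forall>i. r $ i \<in> Zs a}"

text \<open>
  One parity class of a coset of the integral lattice. In dimensions 3, 4 and 8 these classes make up
  the cosets of D3, those of D4, and E8.
\<close>

definition Zpar :: "real \<Rightarrow> real \<Rightarrow> (real^'n) set" where
  "Zpar a b = {r \<in> Zvec a. ((\<Sum>i\<in>UNIV. r $ i) - b) / 2 \<in> \<int>}"

lemma ee_sum: "finite A \<Longrightarrow> ee (sum f A) = (\<Prod>x\<in>A. ee (f x))"
  by (induction A rule: finite_induct) (simp_all add: ee_add)

lemma lattice_term_eq_prod:
  "lattice_term \<tau> z r = (\<Prod>i\<in>UNIV. theta_term 0 \<tau> (z $ i) (r $ i))"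
proof -
  have "of_real (r \<bullet> r / 2) * \<tau> = (\<Sum>i\<in>UNIV. of_real ((r $ i)\<^sup>2 / 2) * \<tau>)"
    by (simp add: inner_vec_def power2_eq_square sum_divide_distrib sum_distrib_right)
  moreover have "bil (cvec r) z = (\<Sum>i\<in>UNIV. of_real (r $ i) * z $ i)"
    by (simp add: bil_def cvec_def)
  ultimately show ?thesis
    by (simp only: lattice_term_def ee_sum finite theta_term_def power_0 mult_1 prod.distrib)
qed

lemma bij_betw_Zvec: "bij_betw vec_lambda (PiE UNIV (\<lambda>_. Zs a)) (Zvec a :: (real^'n) set)"
  by (rule bij_betwI[of _ _ _ vec_nth]) (auto simp: Zvec_def)

lemma countable_Zs: "countable (Zs a)"
  unfolding Zs_eq_image by simp

lemma lattice_term_abs_summable: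
  assumes "Im \<tau> > 0"
  shows "(\<lambda>r. norm (lattice_term \<tau> z r)) summable_on (Zvec a :: (real^'n) set)"
proof -
  have "(\<lambda>g. norm (\<Prod>i\<in>UNIV. theta_term 0 \<tau> (z $ i) (g i))) summable_on (PiE UNIV (\<lambda>_::'n. Zs a))"
    unfolding abs_summable_equivalent
    by (intro abs_summable_on_prod_PiE finite countable_Zs)
       (use theta_term_abs_summable[OF assms] in \<open>simp add: abs_summable_equivalent\<close>)
  thus ?thesis
    unfolding lattice_term_eq_prod
    using summable_on_reindex_bij_betw[OF bij_betw_Zvec, of "\<lambda>r. norm (\<Prod>i\<in>UNIV. theta_term 0 \<tau> (z $ i) (r $ i))" a]
    by simp
qed

lemma lattice_term_has_sum_prod:
  assumes "Im \<tau> > 0"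
  shows "(lattice_term \<tau> z has_sum (\<Prod>i\<in>UNIV. Th a 0 \<tau> (z $ i))) (Zvec a)"
proof -
  have "infsum (lattice_term \<tau> z) (Zvec a) = infsum (\<lambda>g. lattice_term \<tau> z (vec_lambda g)) (PiE UNIV (\<lambda>_. Zs a))"
    by (rule infsum_reindex_bij_betw[OF bij_betw_Zvec, symmetric])
  also have "\<dots> = infsum (\<lambda>g. \<Prod>i\<in>UNIV. theta_term 0 \<tau> (z $ i) (g i)) (PiE UNIV (\<lambda>_. Zs a))"
    by (simp add: lattice_term_eq_prod)
  also have "\<dots> = (\<Prod>i\<in>UNIV. infsum (theta_term 0 \<tau> (z $ i)) (Zs a))"
    by (rule infsum_prod_PiE_abs) (simp_all add: theta_term_abs_summable[OF assms])
  finally have "infsum (lattice_term \<tau> z) (Zvec a) = (\<Prod>i\<in>UNIV. Th a 0 \<tau> (z $ i))"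
    by (simp add: Th_def)
  moreover have "(lattice_term \<tau> z has_sum infsum (lattice_term \<tau> z) (Zvec a)) (Zvec a)"
    by (rule has_sum_infsum[OF abs_summable_summable[OF lattice_term_abs_summable[OF assms]]])
  ultimately show ?thesis by simp
qed

lemma theta_sum_eq_infsum: "Im \<tau> > 0 \<Longrightarrow> theta_sum X \<tau> z = infsum (lattice_term \<tau> z) X"
  by (simp only: theta_sum_def lattice_term_def[abs_def] if_True)

lemma lattice_term_has_sum:
  assumes "Im \<tau> > 0" and "X \<subseteq> Zvec a"
  shows "(lattice_term \<tau> z has_sum theta_sum X \<tau> z) X"
  unfolding theta_sum_eq_infsum[OF assms(1)]
  by (rule has_sum_infsum[OF summable_on_subset[OF abs_summable_summable[OF lattice_term_abs_summable[OF assms(1)]] assms(2)]])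

lemma sum_Zvec:
  assumes "r \<in> (Zvec a :: (real^'n) set)"
  shows "(\<Sum>i\<in>UNIV. r $ i) - of_nat CARD('n) * a \<in> \<int>"
proof -
  have "(\<Sum>i\<in>UNIV. r $ i - a) \<in> \<int>"
    using assms by (intro Ints_sum) (auto simp: Zvec_def Zs_def)
  thus ?thesis by (simp add: sum_subtractf)
qed

text \<open>
  Translating all coordinates of \<^term>\<open>z\<close> by 1/2 multiplies the terms by a sign that depends on the
  parity of the coordinate sum; averaging selects the vectors of one parity.
\<close>

lemma theta_sum_Zpar:
  fixes z :: "complex^'n"
  assumes \<tau>: "Im \<tau> > 0" and b: "of_nat CARD('n) * a - b \<in> \<int>"
  shows "theta_sum (Zpar a b) \<tau> z =
    ((\<Prod>i\<in>UNIV. Th a 0 \<tau> (z $ i)) + ee (- of_real b / 2) * (\<Prod>i\<in>UNIV. Th a 0 \<tau> (z $ i + 1 / 2))) / 2"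
proof -
  let ?z' = "\<chi> i. z $ i + 1 / 2"
  have "((\<lambda>r. lattice_term \<tau> z r * (1 / 2) + ee (- of_real b / 2) / 2 * lattice_term \<tau> ?z' r) has_sum
     (\<Prod>i\<in>UNIV. Th a 0 \<tau> (z $ i)) * (1 / 2) + ee (- of_real b / 2) / 2 * (\<Prod>i\<in>UNIV. Th a 0 \<tau> (?z' $ i))) (Zvec a)"
    by (intro has_sum_add has_sum_cmult_left has_sum_cmult_right lattice_term_has_sum_prod \<tau>)
  also have "?this \<longleftrightarrow> (lattice_term \<tau> z has_sum
     (\<Prod>i\<in>UNIV. Th a 0 \<tau> (z $ i)) * (1 / 2) + ee (- of_real b / 2) / 2 * (\<Prod>i\<in>UNIV. Th a 0 \<tau> (?z' $ i))) (Zpar a b)"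
  proof (rule has_sum_cong_neutral)
    have eq: "lattice_term \<tau> z r * (1 / 2) + ee (- of_real b / 2) / 2 * lattice_term \<tau> ?z' r =
        lattice_term \<tau> z r * (1 + ee (of_real (((\<Sum>i\<in>UNIV. r $ i) - b) / 2))) / 2" for r
    proof -
      have "bil (cvec r) ?z' = bil (cvec r) z + of_real ((\<Sum>i\<in>UNIV. r $ i) / 2)"
        by (simp add: bil_def cvec_def distrib_left sum.distrib sum_divide_distrib)
      hence "lattice_term \<tau> ?z' r = lattice_term \<tau> z r * ee (of_real ((\<Sum>i\<in>UNIV. r $ i) / 2))"
        by (simp add: lattice_term_def ee_add)
      moreover have "of_real (((\<Sum>i\<in>UNIV. r $ i) - b) / 2) = (of_real ((\<Sum>i\<in>UNIV. r $ i) / 2) + - of_real b / 2 :: complex)"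
        by (simp add: diff_divide_distrib)
      ultimately show ?thesis by (simp only: ee_add) (simp add: algebra_simps)
    qed
    show "lattice_term \<tau> z r * (1 / 2) + ee (- of_real b / 2) / 2 * lattice_term \<tau> ?z' r = 0"
      if r: "r \<in> Zvec a - Zpar a b" for r
    proof -
      have "((\<Sum>i\<in>UNIV. r $ i) - of_nat CARD('n) * a) + (of_nat CARD('n) * a - b) \<in> \<int>"
        using r b by (intro Ints_add sum_Zvec) auto
      then obtain k where k: "(\<Sum>i\<in>UNIV. r $ i) - b = of_int k"
        by (auto elim: Ints_cases)
      have "odd k"
      proof
        assume "even k"
        then obtain l where "k = 2 * l" by blast
        hence "((\<Sum>i\<in>UNIV. r $ i) - b) / 2 = of_int l" by (simp add: k)
        hence "((\<Sum>i\<in>UNIV. r $ i) - b) / 2 \<in> \<int>" by (metis Ints_of_int)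
        thus False using r by (simp add: Zpar_def)
      qed
      hence "ee (of_real (((\<Sum>i\<in>UNIV. r $ i) - b) / 2)) = - 1"
        using ee_of_int_half[of k] by (simp add: k)
      thus ?thesis unfolding eq by simp
    qed
    show "lattice_term \<tau> z r * (1 / 2) + ee (- of_real b / 2) / 2 * lattice_term \<tau> ?z' r = lattice_term \<tau> z r"
      if r: "r \<in> Zvec a \<inter> Zpar a b" for r
    proof -
      have "((\<Sum>i\<in>UNIV. r $ i) - b) / 2 \<in> \<int>" using r by (simp add: Zpar_def)
      then obtain k where "((\<Sum>i\<in>UNIV. r $ i) - b) / 2 = of_int k" by (elim Ints_cases)
      thus ?thesis unfolding eq by simp
    qed
  qed (auto simp: Zpar_def)
  finally have "(lattice_term \<tau> z has_sum
     (\<Prod>i\<in>UNIV. Th a 0 \<tau> (z $ i)) * (1 / 2) + ee (- of_real b / 2) / 2 * (\<Prod>i\<in>UNIV. Th a 0 \<tau> (?z' $ i))) (Zpar a b)" .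
  from has_sum_unique[OF lattice_term_has_sum[OF \<tau>, of "Zpar a b" a] this] show ?thesis
    by (simp add: Zpar_def add_divide_distrib)
qed

subsection \<open>The lattice of type D3 and its dual\<close>

lemma Ints_half_cases:
  fixes x :: real
  assumes "2 * x \<in> \<int>"
  obtains "x \<in> Zs 0" | "x \<in> Zs (1 / 2)"
proof -
  obtain n where n: "2 * x = of_int n" using assms by (elim Ints_cases)
  show thesis
  proof (cases "even n")
    case True
    then obtain k where "n = 2 * k" by blast
    hence "x = of_int k" using n by simp
    thus thesis using that(1) by (simp add: Zs_def)
  next
    case False
    then obtain k where "n = 2 * k + 1" by (auto elim: oddE)
    hence "x - 1 / 2 = of_int k" using n by simp
    hence "x - 1 / 2 \<in> \<int>" by simp
    thus thesis using that(2) by (simp add: Zs_def)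
  qed
qed

lemma lattice_D3_eq: "lattice_D3 = Zpar 0 0"
  by (simp add: lattice_D3_def Zpar_def Zvec_def Zs_def)

text \<open>
  Pairing with the roots makes all sums and differences of two coordinates integral, so the
  coordinates lie in \<open>Zs 0\<close> or in \<open>Zs (1 / 2)\<close>, all in the same one.
\<close>

lemma dual_lattice_D3: "dual_lattice lattice_D3 = Zvec 0 \<union> Zvec (1 / 2)"
proof (intro equalityI subsetI)
  fix r assume r: "r \<in> dual_lattice lattice_D3"
  have mem: "vector [1, 1, 0] \<in> lattice_D3" "vector [1, -1, 0] \<in> lattice_D3"
      "vector [1, 0, 1] \<in> lattice_D3" "vector [1, 0, -1] \<in> lattice_D3"
    by (auto simp: lattice_D3_def sum_3 forall_3)
  have int: "r \<bullet> x \<in> \<int>" if "x \<in> lattice_D3" for x using r that by (simp add: dual_lattice_def)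
  have 1: "r $ 1 + r $ 2 \<in> \<int>" "r $ 1 - r $ 2 \<in> \<int>" "r $ 1 + r $ 3 \<in> \<int>" "r $ 1 - r $ 3 \<in> \<int>"
    using mem[THEN int] by (simp_all add: inner_vec_def sum_3)
  have "2 * r $ 1 \<in> \<int>" using Ints_add[OF 1(1,2)] by simp
  thus "r \<in> Zvec 0 \<union> Zvec (1 / 2)"
  proof (cases rule: Ints_half_cases)
    assume *: "r $ 1 \<in> Zs 0"
    hence "r $ 2 \<in> \<int>" "r $ 3 \<in> \<int>"
      using Ints_diff[of "r $ 1", OF _ 1(2)] Ints_diff[of "r $ 1", OF _ 1(4)] by (simp_all add: Zs_def)
    thus ?thesis using * by (simp add: Zvec_def forall_3 Zs_def)
  next
    assume *: "r $ 1 \<in> Zs (1 / 2)"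
    have "r $ 1 - 1 / 2 - (r $ 1 - r $ 2) \<in> \<int>" "r $ 1 - 1 / 2 - (r $ 1 - r $ 3) \<in> \<int>"
      using * by (intro Ints_diff[OF _ 1(2)] Ints_diff[OF _ 1(4)]; simp add: Zs_def)+
    thus ?thesis using * by (simp add: Zvec_def forall_3 Zs_def)
  qed
next
  fix r :: "real^3" assume r: "r \<in> Zvec 0 \<union> Zvec (1 / 2)"
  have d: "2 * r $ i \<in> \<int>" for i
  proof -
    have "r $ i \<in> \<int> \<or> r $ i - 1 / 2 \<in> \<int>" using r by (auto simp: Zvec_def Zs_def)
    thus ?thesis
    proof
      assume "r $ i - 1 / 2 \<in> \<int>"
      hence "2 * (r $ i - 1 / 2) + 1 \<in> \<int>" by (intro Ints_add Ints_mult) auto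
      thus ?thesis by simp
    qed auto
  qed
  have "4 *\<^sub>R r \<in> lattice_D3"
  proof -
    have "4 * r $ i \<in> \<int>" for i using Ints_add[OF d d, of i i] by simp
    moreover have "(4 * r $ 1 + 4 * r $ 2 + 4 * r $ 3) / 2 \<in> \<int>"
    proof -
      have "(4 * r $ 1 + 4 * r $ 2 + 4 * r $ 3) / 2 = 2 * r $ 1 + 2 * r $ 2 + 2 * r $ 3" by simp
      also have "\<dots> \<in> \<int>" by (intro Ints_add d)
      finally show ?thesis .
    qed
    ultimately show ?thesis by (simp add: lattice_D3_def sum_3)
  qed
  hence "\<exists>m::nat. m > 0 \<and> real m *\<^sub>R r \<in> lattice_D3" by (intro exI[of _ 4]) simp
  moreover have "r \<bullet> x \<in> \<int>" if x: "x \<in> lattice_D3" for x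
  proof -
    have xi: "x $ i \<in> \<int>" "(x $ 1 + x $ 2 + x $ 3) / 2 \<in> \<int>" for i using x by (auto simp: lattice_D3_def sum_3)
    from r show ?thesis
    proof
      assume "r \<in> Zvec 0"
      thus ?thesis unfolding inner_vec_def inner_real_def
        by (intro Ints_sum Ints_mult xi) (simp add: Zvec_def Zs_def)
    next
      assume "r \<in> Zvec (1 / 2)"
      hence "(\<Sum>i\<in>UNIV. (r $ i - 1 / 2) * x $ i) + (x $ 1 + x $ 2 + x $ 3) / 2 \<in> \<int>"
        by (intro Ints_add Ints_sum Ints_mult xi) (simp add: Zvec_def Zs_def)
      also have "(\<Sum>i\<in>UNIV. (r $ i - 1 / 2) * x $ i) + (x $ 1 + x $ 2 + x $ 3) / 2 = r \<bullet> x"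
        by (simp add: inner_vec_def sum_3 field_simps)
      finally show ?thesis .
    qed
  qed
  ultimately show "r \<in> dual_lattice lattice_D3" by (simp add: dual_lattice_def)
qed

lemma Zvec_split:
  assumes "c - b = 1 \<or> c - b = - 1" "of_nat CARD('n) * a - b \<in> \<int>"
  shows "(Zvec a :: (real^'n) set) = Zpar a b \<union> Zpar a c" "(Zpar a b :: (real^'n) set) \<inter> Zpar a c = {}"
proof -
  have "r \<in> Zpar a b \<longleftrightarrow> r \<notin> Zpar a c" if r: "r \<in> Zvec a" for r :: "real^'n"
  proof -
    have "((\<Sum>i\<in>UNIV. r $ i) - of_nat CARD('n) * a) + (of_nat CARD('n) * a - b) \<in> \<int>"
      using assms(2) r by (intro Ints_add sum_Zvec)
    then obtain k where k: "(\<Sum>i\<in>UNIV. r $ i) - b = of_int k"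
      by (auto elim: Ints_cases)
    have half: "real_of_int l / 2 \<in> \<int> \<longleftrightarrow> even l" for l
    proof
      assume "real_of_int l / 2 \<in> \<int>"
      then obtain j where "real_of_int l / 2 = of_int j" by (elim Ints_cases)
      hence "real_of_int l = of_int (2 * j)" by simp
      hence "l = 2 * j" by (simp only: of_int_eq_iff)
      thus "even l" by simp
    qed auto
    from assms(1) obtain e where e: "c - b = of_int e" "odd e"
      by (metis odd_one of_int_1 of_int_minus even_minus)
    have "(\<Sum>i\<in>UNIV. r $ i) - c = of_int (k - e)" using k e by simp
    hence "r \<in> Zpar a c \<longleftrightarrow> even (k - e)" using r by (simp only: Zpar_def mem_Collect_eq half simp_thms)
    moreover have "r \<in> Zpar a b \<longleftrightarrow> even k" using r k by (simp only: Zpar_def mem_Collect_eq half simp_thms)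
    ultimately show ?thesis using e(2) by simp
  qed
  moreover have "Zpar a b \<subseteq> (Zvec a :: (real^'n) set)" "Zpar a c \<subseteq> (Zvec a :: (real^'n) set)" by (auto simp: Zpar_def)
  ultimately show "(Zvec a :: (real^'n) set) = Zpar a b \<union> Zpar a c" "(Zpar a b :: (real^'n) set) \<inter> Zpar a c = {}"
    by blast+
qed

subsection \<open>Uniqueness of Fourier coefficients\<close>

lemma has_sum_finite_sum:
  fixes f :: "'b \<Rightarrow> 'a \<Rightarrow> complex"
  assumes "finite I" "\<And>i. i \<in> I \<Longrightarrow> (f i has_sum s i) A"
  shows "((\<lambda>x. \<Sum>i\<in>I. f i x) has_sum (\<Sum>i\<in>I. s i)) A"
  using assms by (induction I rule: finite_induct) (auto intro!: has_sum_add)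

lemma sum_roots_of_unity:
  fixes k :: int and N :: nat
  assumes "0 < \<bar>k\<bar>" "\<bar>k\<bar> < int N"
  shows "(\<Sum>j<N. ee (of_int k * of_nat j / of_nat N)) = 0"
proof -
  define x where "x = ee (of_int k / of_nat N)"
  have N: "real N > 0" using assms by linarith
  have "x \<noteq> 1"
  proof
    assume "x = 1"
    then obtain l where "of_int k / of_nat N = (of_int l :: complex)"
      by (auto simp: x_def ee_eq_1_iff elim: Ints_cases)
    hence "of_int k = (of_int (l * int N) :: complex)" using N by (simp add: field_simps)
    hence "k = l * int N" by (simp only: of_int_eq_iff)
    moreover have "1 * int N \<le> \<bar>l\<bar> * int N"
      using assms(1) \<open>k = l * int N\<close> by (intro mult_right_mono) auto
    ultimately show False using assms(2) by (simp add: abs_mult)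
  qed
  moreover have "x ^ N = 1"
    using N by (simp add: x_def flip: ee_of_nat_mult)
  moreover have "ee (of_int k * of_nat j / of_nat N) = x ^ j" for j
    by (simp add: x_def mult.commute flip: ee_of_nat_mult)
  ultimately show ?thesis using sum_gp_strict[of x N] by simp
qed

text \<open>
  The coefficient at \<^term>\<open>s\<close> is extracted by averaging over finer and finer grids: the averages of
  the characters converge to the indicator function of \<^term>\<open>s\<close>, boundedly.
\<close>

lemma fourier_unique:
  fixes a :: "real^'n \<Rightarrow> complex"
  assumes half: "\<And>r i. r \<in> X \<Longrightarrow> 2 * r $ i \<in> \<int>"
    and summ: "(\<lambda>r. norm (a r)) summable_on X"
    and zero: "\<And>z. ((\<lambda>r. a r * ee (bil (cvec r) z)) has_sum 0) X"
    and s: "s \<in> X"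
  shows "a s = 0"
proof -
  define G where "G N = (PiE UNIV (\<lambda>_. {..<N}) :: ('n \<Rightarrow> nat) set)" for N
  define u where "u N g = (\<chi> i. (2 * of_nat (g i) / of_nat N :: complex))" for N and g :: "'n \<Rightarrow> nat"
  define m where "m N r = (\<Prod>i\<in>UNIV. (\<Sum>j<N. ee (of_real (2 * (r $ i - s $ i)) * of_nat j / of_nat N)) / of_nat N)" for N r
  have fin: "finite (G N)" for N unfolding G_def by (intro finite_PiE) auto
  have m_eq: "m N r = (\<Sum>g\<in>G N. ee (bil (cvec r) (u N g)) * (ee (- bil (cvec s) (u N g)) / of_nat N ^ CARD('n)))" for N r
  proof -
    have "m N r = (\<Prod>i\<in>UNIV. (\<Sum>j<N. ee (of_real (2 * (r $ i - s $ i)) * of_nat j / of_nat N))) / of_nat N ^ CARD('n)"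
      by (simp add: m_def prod_dividef)
    also have "(\<Prod>i\<in>UNIV. (\<Sum>j<N. ee (of_real (2 * (r $ i - s $ i)) * of_nat j / of_nat N))) =
        (\<Sum>g\<in>G N. \<Prod>i\<in>UNIV. ee (of_real (2 * (r $ i - s $ i)) * of_nat (g i) / of_nat N))"
      unfolding G_def by (rule prod_sum_PiE) auto
    also have "\<dots> = (\<Sum>g\<in>G N. ee (bil (cvec r) (u N g)) * ee (- bil (cvec s) (u N g)))"
      by (intro sum.cong refl)
         (simp add: bil_def cvec_def u_def ee_sum[symmetric] sum_subtractf[symmetric] algebra_simps diff_divide_distrib flip: ee_diff ee_add)
    finally show ?thesis by (simp add: sum_divide_distrib)
  qed
  have "((\<lambda>r. a r * m N r) has_sum 0) X" for N
  proof -
    have "((\<lambda>r. \<Sum>g\<in>G N. a r * ee (bil (cvec r) (u N g)) * (ee (- bil (cvec s) (u N g)) / of_nat N ^ CARD('n)))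
        has_sum (\<Sum>g\<in>G N. 0 * (ee (- bil (cvec s) (u N g)) / of_nat N ^ CARD('n)))) X"
      by (intro has_sum_finite_sum fin has_sum_cmult_left zero)
    thus ?thesis by (simp add: m_eq sum_distrib_left mult.assoc)
  qed
  hence avg: "(\<Sum>\<^sub>\<infinity>r\<in>X. a r * m N r) = 0" for N by (rule infsumI)
  have "(\<lambda>N. \<Sum>\<^sub>\<infinity>r\<in>X. a r * m N r) \<longlonglongrightarrow> (\<Sum>\<^sub>\<infinity>r\<in>X. a r * (if r = s then 1 else 0))"
  proof (rule tannery_infsum[OF _ _ summ])
    fix r N assume "r \<in> X"
    have "norm ((\<Sum>j<N. ee (of_real (2 * (r $ i - s $ i)) * of_nat j / of_nat N)) / of_nat N) \<le> 1" for i
    proof -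
      have "norm (\<Sum>j<N. ee (of_real (2 * (r $ i - s $ i)) * of_nat j / of_nat N)) \<le> (\<Sum>j<N. 1)"
        by (rule sum_norm_le) (simp add: norm_ee)
      thus ?thesis by (cases "N = 0") (simp_all add: norm_divide divide_le_eq)
    qed
    hence "norm (m N r) \<le> 1" unfolding m_def prod_norm[symmetric] by (intro prod_le_1) auto
    thus "norm (a r * m N r) \<le> norm (a r)" unfolding norm_mult by (intro mult_left_le) auto
  next
    fix r assume r: "r \<in> X"
    have "\<forall>\<^sub>F N in sequentially. m N r = (if r = s then 1 else 0)"
    proof (cases "r = s")
      case True
      show ?thesis using eventually_gt_at_top[of 0]
        by eventually_elim (simp add: True m_def)
    next
      case False
      then obtain i where i: "r $ i \<noteq> s $ i" by (auto simp: vec_eq_iff)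
      have "2 * r $ i - 2 * s $ i \<in> \<int>" by (intro Ints_diff half r s)
      then obtain k where k: "2 * (r $ i - s $ i) = of_int k" by (auto simp: algebra_simps elim: Ints_cases)
      have "k \<noteq> 0" using k i by auto
      show ?thesis using eventually_gt_at_top[of "nat \<bar>k\<bar>"]
      proof eventually_elim
        case (elim N)
        hence "(\<Sum>j<N. ee (of_int k * of_nat j / of_nat N)) = 0"
          using \<open>k \<noteq> 0\<close> by (intro sum_roots_of_unity) auto
        hence "(\<Sum>j<N. ee (of_real (2 * (r $ i - s $ i)) * of_nat j / of_nat N)) / of_nat N = 0"
          unfolding k of_real_of_int_eq by simp
        hence "m N r = 0" unfolding m_def by (intro prod_zero) (auto intro!: bexI[of _ i])
        thus ?case using False by simp
      qed
    qed
    thus "(\<lambda>N. a r * m N r) \<longlonglongrightarrow> a r * (if r = s then 1 else 0)"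
      by (rule tendsto_mult[OF tendsto_const tendsto_eventually])
  qed simp
  hence "(\<Sum>\<^sub>\<infinity>r\<in>X. a r * (if r = s then 1 else 0)) = 0"
    unfolding avg LIMSEQ_const_iff by (rule sym)
  moreover have "(\<Sum>\<^sub>\<infinity>r\<in>X. a r * (if r = s then 1 else 0)) = (\<Sum>\<^sub>\<infinity>r\<in>{s}. a r)"
    by (rule infsum_cong_neutral) (use s in auto)
  ultimately show ?thesis by simp
qed

section \<open>Theta functions attached to D3\<close>

text \<open>
  Products over the coordinates of the four Jacobi theta functions in their classical numbering, the
  first one up to a constant factor, and the corresponding theta constants; the first theta constant
  is zero.
\<close>

definition A1 :: "complex \<Rightarrow> complex^'n \<Rightarrow> complex" where
  "A1 \<tau> z = (\<Prod>i\<in>UNIV. Th (1 / 2) 0 \<tau> (z $ i + 1 / 2))"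
definition A2 :: "complex \<Rightarrow> complex^'n \<Rightarrow> complex" where
  "A2 \<tau> z = (\<Prod>i\<in>UNIV. Th (1 / 2) 0 \<tau> (z $ i))"
definition A3 :: "complex \<Rightarrow> complex^'n \<Rightarrow> complex" where
  "A3 \<tau> z = (\<Prod>i\<in>UNIV. Th 0 0 \<tau> (z $ i))"
definition A4 :: "complex \<Rightarrow> complex^'n \<Rightarrow> complex" where
  "A4 \<tau> z = (\<Prod>i\<in>UNIV. Th 0 0 \<tau> (z $ i + 1 / 2))"

abbreviation (input) t2 :: "complex \<Rightarrow> complex" where "t2 \<tau> \<equiv> Th (1 / 2) 0 \<tau> 0"
abbreviation (input) t3 :: "complex \<Rightarrow> complex" where "t3 \<tau> \<equiv> Th 0 0 \<tau> 0"
abbreviation (input) t4 :: "complex \<Rightarrow> complex" where "t4 \<tau> \<equiv> Th 0 0 \<tau> (1 / 2)"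

abbreviation D3v :: "(real^3) set" where "D3v \<equiv> Zpar 0 1"
abbreviation D3s :: "(real^3) set" where "D3s \<equiv> Zpar (1 / 2) (3 / 2)"
abbreviation D3c :: "(real^3) set" where "D3c \<equiv> Zpar (1 / 2) (1 / 2)"

lemma theta_D3:
  assumes \<tau>: "Im \<tau> > 0"
  shows "theta_sum lattice_D3 \<tau> z = (A3 \<tau> z + A4 \<tau> z) / 2"
    and "theta_sum D3v \<tau> z = (A3 \<tau> z - A4 \<tau> z) / 2"
    and "theta_sum D3s \<tau> z = (A2 \<tau> z + \<i> * A1 \<tau> z) / 2"
    and "theta_sum D3c \<tau> z = (A2 \<tau> z - \<i> * A1 \<tau> z) / 2"
proof -
  have e: "ee (- of_real 1 / 2) = - 1" "ee (- of_real (3 / 2) / 2) = \<i>" "ee (- of_real (1 / 2) / 2) = - \<i>"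
  proof -
    show "ee (- of_real 1 / 2) = - 1" using ee_minus[of "1 / 2"] by simp
    have "ee (- of_real (3 / 2) / 2) = ee (1 / 4 - 1)" by simp
    also have "\<dots> = \<i>" unfolding ee_diff by simp
    finally show "ee (- of_real (3 / 2) / 2) = \<i>" .
    show "ee (- of_real (1 / 2) / 2) = - \<i>" using ee_minus[of "1 / 4"] by simp
  qed
  show "theta_sum lattice_D3 \<tau> z = (A3 \<tau> z + A4 \<tau> z) / 2"
    unfolding lattice_D3_eq by (subst theta_sum_Zpar[OF \<tau>]) (simp_all add: A3_def A4_def)
  show "theta_sum D3v \<tau> z = (A3 \<tau> z - A4 \<tau> z) / 2"
    by (subst theta_sum_Zpar[OF \<tau>]) (simp_all only: e, simp_all add: A3_def A4_def)
  show "theta_sum D3s \<tau> z = (A2 \<tau> z + \<i> * A1 \<tau> z) / 2"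
    by (subst theta_sum_Zpar[OF \<tau>]) (simp_all only: e, simp_all add: A2_def A1_def)
  show "theta_sum D3c \<tau> z = (A2 \<tau> z - \<i> * A1 \<tau> z) / 2"
    by (subst theta_sum_Zpar[OF \<tau>]) (simp_all only: e, simp_all add: A2_def A1_def)
qed

lemma Th_half_half_0:
  assumes "Im \<tau> > 0"
  shows "Th (1 / 2) 0 \<tau> (1 / 2) = 0"
  using jacobi_theta_eq_Th[OF assms, of 0] by simp

lemma theta_ZN_3:
  fixes z :: "complex^3"
  assumes "Im \<tau> > 0"
  shows "theta_ZN \<tau> z = \<i> * A1 \<tau> z"
proof -
  have "theta_ZN \<tau> z = (\<Prod>i\<in>(UNIV :: 3 set). (- \<i>) * Th (1 / 2) 0 \<tau> (z $ i + 1 / 2))"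
    unfolding theta_ZN_def jacobi_theta_eq_Th[OF assms] ..
  also have "\<dots> = (- \<i>) ^ 3 * A1 \<tau> z"
    unfolding A1_def prod.distrib by simp
  also have "(- \<i>) ^ 3 = \<i>" by (simp add: power3_eq_cube)
  finally show ?thesis .
qed

lemma prod_8: "(\<Prod>i\<in>(UNIV :: 8 set). f i) = f 1 * f 2 * f 3 * f 4 * f 5 * f 6 * f 7 * f 8"
  for f :: "8 \<Rightarrow> complex"
  unfolding UNIV_8 by (simp add: ac_simps)

lemma prod_3: "(\<Prod>i\<in>(UNIV :: 3 set). f i) = f 1 * f 2 * f 3" for f :: "3 \<Rightarrow> complex"
  unfolding UNIV_3 by (simp add: ac_simps)

lemma prod_4: "(\<Prod>i\<in>(UNIV :: 4 set). f i) = f 1 * f 2 * f 3 * f 4" for f :: "4 \<Rightarrow> complex"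
  unfolding UNIV_4 by (simp add: ac_simps)

text \<open>
  E8 consists of two parity classes, each of which contributes two products of eight theta functions.
  Five of the eight coordinates of the argument vanish and contribute theta constants; since the odd
  theta constant is zero, three of the four products remain.
\<close>

lemma jacobi_E4_D3_eq:
  assumes \<tau>: "Im \<tau> > 0"
  shows "jacobi_E4_D3 \<tau> z = (t3 \<tau> ^ 5 * A3 \<tau> z + t4 \<tau> ^ 5 * A4 \<tau> z + t2 \<tau> ^ 5 * A2 \<tau> z) / 2"
proof -
  let ?w = "embed_E8 z"
  have E8: "lattice_E8 = Zpar 0 0 \<union> Zpar (1 / 2) 0"
    by (auto simp: lattice_E8_def Zpar_def Zvec_def Zs_def)
  have disj: "Zpar 0 0 \<inter> (Zpar (1 / 2) 0 :: (real^8) set) = {}"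
  proof -
    have False if "r $ 1 \<in> \<int>" "r $ 1 - 1 / 2 \<in> \<int>" for r :: "real^8"
    proof -
      have "r $ 1 - (r $ 1 - 1 / 2) \<in> \<int>" using that by (rule Ints_diff)
      hence "1 / 2 \<in> (\<int> :: real set)" by simp
      then obtain n where "(1 / 2 :: real) = of_int n" by (elim Ints_cases)
      hence "of_int (2 * n) = (of_int 1 :: real)" by simp
      hence "2 * n = 1" by (simp only: of_int_eq_iff)
      thus False by presburger
    qed
    thus ?thesis by (auto simp: Zpar_def Zvec_def Zs_def)
  qed
  have "theta_sum lattice_E8 \<tau> ?w = theta_sum (Zpar 0 0) \<tau> ?w + theta_sum (Zpar (1 / 2) 0) \<tau> ?w"
    unfolding E8 theta_sum_eq_infsum[OF \<tau>]
    by (rule infsumI, rule has_sum_Un_disjoint[OF _ _ disj];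
        (subst theta_sum_eq_infsum[OF \<tau>, symmetric], rule lattice_term_has_sum[OF \<tau>])) (auto simp: Zpar_def)
  also have "theta_sum (Zpar 0 0) \<tau> ?w = (t3 \<tau> ^ 5 * A3 \<tau> z + t4 \<tau> ^ 5 * A4 \<tau> z) / 2"
    by (subst theta_sum_Zpar[OF \<tau>])
       (simp_all add: prod_8 prod_3 embed_E8_def vector_8 A3_def A4_def power_numeral_reduce)
  also have "theta_sum (Zpar (1 / 2) 0) \<tau> ?w = t2 \<tau> ^ 5 * A2 \<tau> z / 2"
    by (subst theta_sum_Zpar[OF \<tau>])
       (simp_all add: prod_8 prod_3 embed_E8_def vector_8 A2_def Th_half_half_0[OF \<tau>] power_numeral_reduce)
  finally show ?thesis by (simp add: jacobi_E4_D3_def pullback_def add_divide_distrib)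
qed

text \<open>
  The orthogonal map of 4-space whose first three rows are the columns of \<^const>\<open>iota2\<close>. Being
  a triality of D4, it maps the two classes of half-integral vectors to the odd integral vectors
  and to one class of half-integral vectors; this is the source of the Riemann theta relation below.
\<close>

definition triality :: "real^4 \<Rightarrow> real^4" where
  "triality r = vector [(r $ 1 + r $ 2 - r $ 3 - r $ 4) / 2, (r $ 1 - r $ 2 + r $ 3 - r $ 4) / 2,
     (- r $ 1 + r $ 2 + r $ 3 - r $ 4) / 2, (r $ 1 + r $ 2 + r $ 3 + r $ 4) / 2]"

definition triality_inv :: "real^4 \<Rightarrow> real^4" where
  "triality_inv s = vector [(s $ 1 + s $ 2 - s $ 3 + s $ 4) / 2, (s $ 1 - s $ 2 + s $ 3 + s $ 4) / 2,
     (- s $ 1 + s $ 2 + s $ 3 + s $ 4) / 2, (- s $ 1 - s $ 2 - s $ 3 + s $ 4) / 2]"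

lemma triality_inverse [simp]: "triality_inv (triality r) = r" "triality (triality_inv s) = s"
  by (simp_all add: triality_def triality_inv_def vec_eq_iff forall_4 vector_4 field_simps)

lemma Zpar_4_iff:
  fixes r :: "real^4"
  shows "r \<in> Zpar a b \<longleftrightarrow> (\<forall>i. r $ i - a \<in> \<int>) \<and> (r $ 1 + r $ 2 + r $ 3 + r $ 4 - b) / 2 \<in> \<int>"
  by (simp add: Zpar_def Zvec_def Zs_def sum_4)

lemma Zpar_4D:
  fixes r :: "real^4"
  assumes "r \<in> Zpar a b"
  obtains m1 m2 m3 m4 m :: int where
    "r $ 1 = of_int m1 + a" "r $ 2 = of_int m2 + a" "r $ 3 = of_int m3 + a" "r $ 4 = of_int m4 + a"
    "r $ 1 + r $ 2 + r $ 3 + r $ 4 = 2 * of_int m + b"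
proof -
  have 1: "\<exists>k::int. r $ i = of_int k + a" for i
    using assms unfolding Zpar_4_iff by (metis Ints_cases diff_add_cancel)
  have "\<exists>k::int. r $ 1 + r $ 2 + r $ 3 + r $ 4 = 2 * of_int k + b"
  proof -
    have "(r $ 1 + r $ 2 + r $ 3 + r $ 4 - b) / 2 \<in> \<int>" using assms by (simp add: Zpar_4_iff)
    then obtain k where "(r $ 1 + r $ 2 + r $ 3 + r $ 4 - b) / 2 = of_int k" by (elim Ints_cases)
    thus ?thesis by (intro exI[of _ k]) simp
  qed
  thus thesis using 1[of 1] 1[of 2] 1[of 3] 1[of 4] that by blast
qed

lemma Zpar_4I:
  fixes r :: "real^4" and m1 m2 m3 m4 m :: int
  assumes "r $ 1 = of_int m1 + a" "r $ 2 = of_int m2 + a" "r $ 3 = of_int m3 + a" "r $ 4 = of_int m4 + a"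
    "r $ 1 + r $ 2 + r $ 3 + r $ 4 = 2 * of_int m + b"
  shows "r \<in> Zpar a b"
  unfolding Zpar_4_iff using assms by (auto simp: forall_4)

lemma bij_betw_triality:
  "bij_betw triality (Zpar (1 / 2) 0) (Zpar 0 1)"
  "bij_betw triality (Zpar (1 / 2) 1) (Zpar (1 / 2) 0)"
proof -
  have 1: "triality r \<in> Zpar 0 1" if r: "r \<in> Zpar (1 / 2) 0" for r
  proof -
    obtain m1 m2 m3 m4 m :: int where m: "r $ 1 = of_int m1 + 1 / 2" "r $ 2 = of_int m2 + 1 / 2"
      "r $ 3 = of_int m3 + 1 / 2" "r $ 4 = of_int m4 + 1 / 2" "r $ 1 + r $ 2 + r $ 3 + r $ 4 = 2 * of_int m + 0"
      using r by (rule Zpar_4D)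
    show ?thesis
      by (rule Zpar_4I[of _ "m - m3 - m4 - 1" _ "m - m2 - m4 - 1" "m - m1 - m4 - 1" m "m - m4 - 1"])
         (use m in \<open>simp_all add: triality_def vector_4 field_simps\<close>)
  qed
  have 2: "triality_inv s \<in> Zpar (1 / 2) 0" if s: "s \<in> Zpar 0 1" for s
  proof -
    obtain m1 m2 m3 m4 m :: int where m: "s $ 1 = of_int m1 + 0" "s $ 2 = of_int m2 + 0"
      "s $ 3 = of_int m3 + 0" "s $ 4 = of_int m4 + 0" "s $ 1 + s $ 2 + s $ 3 + s $ 4 = 2 * of_int m + 1"
      using s by (rule Zpar_4D)
    show ?thesis
      by (rule Zpar_4I[of _ "m - m3" _ "m - m2" "m - m1" "m4 - m - 1" m4])
         (use m in \<open>simp_all add: triality_inv_def vector_4 field_simps\<close>)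
  qed
  have 3: "triality r \<in> Zpar (1 / 2) 0" if r: "r \<in> Zpar (1 / 2) 1" for r
  proof -
    obtain m1 m2 m3 m4 m :: int where m: "r $ 1 = of_int m1 + 1 / 2" "r $ 2 = of_int m2 + 1 / 2"
      "r $ 3 = of_int m3 + 1 / 2" "r $ 4 = of_int m4 + 1 / 2" "r $ 1 + r $ 2 + r $ 3 + r $ 4 = 2 * of_int m + 1"
      using r by (rule Zpar_4D)
    show ?thesis
      by (rule Zpar_4I[of _ "m - m3 - m4 - 1" _ "m - m2 - m4 - 1" "m - m1 - m4 - 1" m "m - m4"])
         (use m in \<open>simp_all add: triality_def vector_4 field_simps\<close>)
  qed
  have 4: "triality_inv s \<in> Zpar (1 / 2) 1" if s: "s \<in> Zpar (1 / 2) 0" for s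
  proof -
    obtain m1 m2 m3 m4 m :: int where m: "s $ 1 = of_int m1 + 1 / 2" "s $ 2 = of_int m2 + 1 / 2"
      "s $ 3 = of_int m3 + 1 / 2" "s $ 4 = of_int m4 + 1 / 2" "s $ 1 + s $ 2 + s $ 3 + s $ 4 = 2 * of_int m + 0"
      using s by (rule Zpar_4D)
    show ?thesis
      by (rule Zpar_4I[of _ "m - m3 - 1" _ "m - m2 - 1" "m - m1 - 1" "m4 - m" m4])
         (use m in \<open>simp_all add: triality_inv_def vector_4 field_simps\<close>)
  qed
  show "bij_betw triality (Zpar (1 / 2) 0) (Zpar 0 1)"
    by (rule bij_betwI[of _ _ _ triality_inv]) (use 1 2 in auto)
  show "bij_betw triality (Zpar (1 / 2) 1) (Zpar (1 / 2) 0)"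
    by (rule bij_betwI[of _ _ _ triality_inv]) (use 3 4 in auto)
qed

lemma lattice_term_iota2:
  fixes z :: "complex^3"
  shows "lattice_term \<tau> (iota2 z) r = lattice_term \<tau> (vector [z $ 1, z $ 2, z $ 3, 0]) (triality r)"
proof -
  have "triality r \<bullet> triality r = r \<bullet> r"
    by (simp add: triality_def inner_vec_def sum_4 vector_4 field_simps)
  moreover have "bil (cvec r) (iota2 z) = bil (cvec (triality r)) (vector [z $ 1, z $ 2, z $ 3, 0])"
    by (simp add: bil_def cvec_def iota2_def triality_def sum_4 vector_4 field_simps)
  ultimately show ?thesis by (simp only: lattice_term_def)
qed

text \<open>
  The product of four odd theta functions is the difference of the theta series of the two classes of
  half-integral vectors. After applying the triality, the fourth coordinate of the argument is zero, and
  the product containing the odd theta constant disappears.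
\<close>

lemma theta_ZN_iota2:
  fixes z :: "complex^3"
  assumes \<tau>: "Im \<tau> > 0"
  shows "theta_ZN \<tau> (iota2 z :: complex^4) = (t3 \<tau> * A3 \<tau> z - t4 \<tau> * A4 \<tau> z - t2 \<tau> * A2 \<tau> z) / 2"
proof -
  let ?w = "iota2 z :: complex^4" and ?z = "vector [z $ 1, z $ 2, z $ 3, 0] :: complex^4"
  have e: "ee (- of_real 1 / 2) = - 1" using ee_minus[of "1 / 2"] by simp
  have "theta_ZN \<tau> ?w = (\<Prod>i\<in>(UNIV :: 4 set). (- \<i>) * Th (1 / 2) 0 \<tau> (?w $ i + 1 / 2))"
    unfolding theta_ZN_def jacobi_theta_eq_Th[OF \<tau>] ..
  also have "\<dots> = (- \<i>) ^ 4 * A1 \<tau> ?w"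
    unfolding A1_def prod.distrib by simp
  also have "\<dots> = A1 \<tau> ?w" by simp
  also have "\<dots> = theta_sum (Zpar (1 / 2) 0) \<tau> ?w - theta_sum (Zpar (1 / 2) 1) \<tau> ?w"
    by (subst (1 2) theta_sum_Zpar[OF \<tau>]) (simp_all only: e, simp_all add: A1_def field_simps)
  also have "theta_sum (Zpar (1 / 2) 0) \<tau> ?w = theta_sum (Zpar 0 1) \<tau> ?z"
    unfolding theta_sum_eq_infsum[OF \<tau>] lattice_term_iota2[abs_def]
    by (rule infsum_reindex_bij_betw[OF bij_betw_triality(1)])
  also have "theta_sum (Zpar (1 / 2) 1) \<tau> ?w = theta_sum (Zpar (1 / 2) 0) \<tau> ?z"
    unfolding theta_sum_eq_infsum[OF \<tau>] lattice_term_iota2[abs_def]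
    by (rule infsum_reindex_bij_betw[OF bij_betw_triality(2)])
  also have "theta_sum (Zpar 0 1) \<tau> ?z = (t3 \<tau> * A3 \<tau> z - t4 \<tau> * A4 \<tau> z) / 2"
    by (subst theta_sum_Zpar[OF \<tau>]) (simp_all only: e, simp_all add: prod_4 prod_3 vector_4 A3_def A4_def mult_ac)
  also have "theta_sum (Zpar (1 / 2) 0) \<tau> ?z = t2 \<tau> * A2 \<tau> z / 2"
    by (subst theta_sum_Zpar[OF \<tau>])
       (simp_all add: prod_4 prod_3 vector_4 A2_def Th_half_half_0[OF \<tau>] mult_ac)
  finally show ?thesis by (simp add: diff_divide_distrib)
qed

subsection \<open>Behaviour under the generators of the modular group\<close>

lemma A_inversion:
  fixes z :: "complex^3"
  assumes \<tau>: "Im \<tau> > 0"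
  defines "\<kappa> \<equiv> (\<i> * theta_factor \<tau>) ^ 3 * ee (bil z z / 2 / \<tau>)"
  shows "A2 (- 1 / \<tau>) ((1 / \<tau>) *s z) = \<kappa> * A4 \<tau> z"
    and "A4 (- 1 / \<tau>) ((1 / \<tau>) *s z) = \<kappa> * A2 \<tau> z"
    and "A3 (- 1 / \<tau>) ((1 / \<tau>) *s z) = \<kappa> * A3 \<tau> z"
    and "A1 (- 1 / \<tau>) ((1 / \<tau>) *s z) = theta_factor \<tau> ^ 3 * ee (bil z z / 2 / \<tau>) * A1 \<tau> z"
proof -
  have k: "(\<Prod>i\<in>UNIV. c * ee ((z $ i)\<^sup>2 / (2 * \<tau>)) * f i) = c ^ 3 * ee (bil z z / 2 / \<tau>) * (\<Prod>i\<in>UNIV. f i)"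
    for c and f :: "3 \<Rightarrow> complex"
  proof -
    have "bil z z / 2 / \<tau> = (\<Sum>i\<in>UNIV. (z $ i)\<^sup>2 / (2 * \<tau>))"
      by (simp add: bil_def power2_eq_square sum_divide_distrib)
    thus ?thesis by (simp add: prod.distrib ee_sum)
  qed
  have d: "((1 / \<tau>) *s z) $ i = z $ i / \<tau>" for i by simp
  show "A2 (- 1 / \<tau>) ((1 / \<tau>) *s z) = \<kappa> * A4 \<tau> z"
    unfolding A2_def A4_def d Th_even_inversion(1)[OF \<tau>] k \<kappa>_def ..
  show "A4 (- 1 / \<tau>) ((1 / \<tau>) *s z) = \<kappa> * A2 \<tau> z"
    unfolding A2_def A4_def d Th_even_inversion(2)[OF \<tau>] k \<kappa>_def ..
  show "A3 (- 1 / \<tau>) ((1 / \<tau>) *s z) = \<kappa> * A3 \<tau> z"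
    unfolding A3_def d Th_even_inversion(3)[OF \<tau>] k \<kappa>_def ..
  show "A1 (- 1 / \<tau>) ((1 / \<tau>) *s z) = theta_factor \<tau> ^ 3 * ee (bil z z / 2 / \<tau>) * A1 \<tau> z"
    unfolding A1_def d Th_half_inversion[OF \<tau>] k ..
qed

lemma A_translation:
  fixes z :: "complex^3"
  shows "A2 (\<tau> + 1) z = ee (3 / 8) * A2 \<tau> z" "A3 (\<tau> + 1) z = A4 \<tau> z" "A4 (\<tau> + 1) z = A3 \<tau> z"
    "A1 (\<tau> + 1) z = ee (3 / 8) * A1 \<tau> z"
proof -
  have e: "ee (1 / 8) ^ 3 = ee (3 / 8)" using ee_of_nat_mult[of 3 "1 / 8"] by simp
  show "A2 (\<tau> + 1) z = ee (3 / 8) * A2 \<tau> z" "A1 (\<tau> + 1) z = ee (3 / 8) * A1 \<tau> z"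
    by (simp_all add: A1_def A2_def Th_half_tau_plus_1 prod.distrib e)
  show "A3 (\<tau> + 1) z = A4 \<tau> z" "A4 (\<tau> + 1) z = A3 \<tau> z"
    by (simp_all add: A3_def A4_def Th_0_tau_plus_1 add.assoc)
qed

section \<open>Power series on the unit disc\<close>

text \<open>Collecting equal exponents turns a theta constant into a power series.\<close>

lemma exponent_series:
  fixes e :: "'a \<Rightarrow> nat"
  assumes summ: "\<And>x::complex. norm x < 1 \<Longrightarrow> x \<noteq> 0 \<Longrightarrow> (\<lambda>i. norm (x ^ e i)) summable_on I"
    and fin: "\<And>k. finite {i \<in> I. e i = k}"
  obtains F where "F holomorphic_on ball 0 1" "F 0 = of_nat (card {i \<in> I. e i = 0})"
    "deriv F 0 = of_nat (card {i \<in> I. e i = 1})"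
    "\<And>x. norm x < 1 \<Longrightarrow> x \<noteq> 0 \<Longrightarrow> F x = (\<Sum>\<^sub>\<infinity>i\<in>I. x ^ e i)"
proof -
  define c where "c k = (of_nat (card {i \<in> I. e i = k}) :: complex)" for k
  define F where "F x = (\<Sum>k. c k * x ^ k)" for x
  have sums: "(\<lambda>k. c k * x ^ k) sums (\<Sum>\<^sub>\<infinity>i\<in>I. x ^ e i)" if x: "norm x < 1" "x \<noteq> 0" for x
  proof -
    let ?S = "Sigma UNIV (\<lambda>k. {i \<in> I. e i = k})"
    have bij: "bij_betw snd ?S I"
      by (rule bij_betwI[of _ _ _ "\<lambda>i. (e i, i)"]) auto
    have "((\<lambda>i. x ^ e i) has_sum (\<Sum>\<^sub>\<infinity>i\<in>I. x ^ e i)) I"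
      by (rule has_sum_infsum[OF abs_summable_summable[OF summ[OF x]]])
    hence "((\<lambda>p. x ^ e (snd p)) has_sum (\<Sum>\<^sub>\<infinity>i\<in>I. x ^ e i)) ?S"
      by (subst has_sum_reindex_bij_betw[OF bij, of "\<lambda>i. x ^ e i"])
    moreover have "((\<lambda>i. x ^ e (snd (k, i))) has_sum c k * x ^ k) {i \<in> I. e i = k}" for k
      by (rule has_sum_finiteI) (use fin in \<open>simp_all add: c_def\<close>)
    ultimately have "((\<lambda>k. c k * x ^ k) has_sum (\<Sum>\<^sub>\<infinity>i\<in>I. x ^ e i)) UNIV"
      by (rule has_sum_SigmaD)
    thus ?thesis by (rule has_sum_imp_sums)
  qed
  have summable: "summable (\<lambda>k. c k * x ^ k)" if "norm x < 1" for x
  proof (cases "x = 0")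
    case False
    thus ?thesis using sums[OF that] by (simp add: sums_iff)
  qed auto
  show thesis
  proof (rule that[of F])
    show "F holomorphic_on ball 0 1"
      by (rule power_series_holomorphic[of _ _ c]) (use summable in \<open>simp add: F_def summable_sums\<close>)
    show "F 0 = of_nat (card {i \<in> I. e i = 0})" by (simp add: F_def c_def)
    have "(F has_field_derivative (\<Sum>n. diffs c n * 0 ^ n)) (at 0)"
      unfolding F_def[abs_def] by (rule termdiffs_strong[of _ "1 / 2"]) (use summable[of "1 / 2"] in auto)
    moreover have "(\<Sum>n. diffs c n * 0 ^ n) = diffs c 0" by (rule powser_zero)
    ultimately have "(F has_field_derivative diffs c 0) (at 0)" by simp
    from DERIV_imp_deriv[OF this]
    show "deriv F 0 = of_nat (card {i \<in> I. e i = 1})" by (simp add: diffs_def c_def)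
    show "F x = (\<Sum>\<^sub>\<infinity>i\<in>I. x ^ e i)" if "norm x < 1" "x \<noteq> 0" for x
      using sums[OF that] by (simp add: F_def sums_iff)
  qed
qed

lemma holomorphic_abs_summable:
  assumes F: "F holomorphic_on ball 0 1"
  obtains a :: "nat \<Rightarrow> complex" where "\<And>x. norm x < 1 \<Longrightarrow> ((\<lambda>n. a n * x ^ n) has_sum F x) UNIV"
    "a 0 = F 0" "a 1 = deriv F 0"
proof -
  define a where "a n = (deriv ^^ n) F 0 / fact n" for n
  have sums: "(\<lambda>n. a n * x ^ n) sums F x" if "norm x < 1" for x
    using holomorphic_power_series[OF F, of x] that by (simp add: a_def)
  have "summable (\<lambda>n. norm (a n * x ^ n))" if x: "norm x < 1" for x
  proof -
    obtain r where r: "norm x < r" "r < 1" using dense[OF x] by auto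
    hence "norm (of_real r :: complex) < 1" "norm x < norm (of_real r :: complex)"
      using order.strict_trans1[OF norm_ge_zero[of x] r(1)] by auto
    thus ?thesis using powser_insidea sums by (metis sums_summable)
  qed
  hence "((\<lambda>n. a n * x ^ n) has_sum F x) UNIV" if "norm x < 1" for x
    using sums that by (intro norm_summable_imp_has_sum) auto
  thus thesis by (rule that) (simp_all add: a_def)
qed

text \<open>With \<open>x\<close> the square root of \<open>q\<close>, this separates the integral from the half-integral powers of \<open>q\<close>.\<close>

lemma even_odd_parts:
  assumes g: "g holomorphic_on ball 0 1"
  obtains G H where "G holomorphic_on ball 0 1" "H holomorphic_on ball 0 1"
    "G 0 = g 0" "H 0 = deriv g 0"
    "\<And>x. norm x < 1 \<Longrightarrow> g x = G (x\<^sup>2) + x * H (x\<^sup>2)"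
proof -
  obtain a where a: "\<And>x. norm x < 1 \<Longrightarrow> ((\<lambda>n. a n * x ^ n) has_sum g x) UNIV"
    "a 0 = g 0" "a 1 = deriv g 0" using holomorphic_abs_summable[OF g] by blast
  define G where "G y = (\<Sum>\<^sub>\<infinity>n\<in>UNIV. a (2 * n) * y ^ n)" for y
  define H where "H y = (\<Sum>\<^sub>\<infinity>n\<in>UNIV. a (2 * n + 1) * y ^ n)" for y
  have root: "\<exists>x. x\<^sup>2 = y \<and> norm x < 1" if "norm y < 1" for y :: complex
  proof -
    have "norm (csqrt y) ^ 2 < 1" using that by (simp flip: norm_power)
    hence "\<not> 1 \<le> norm (csqrt y)" using one_le_power[of "norm (csqrt y)" 2] by linarith
    thus ?thesis by (intro exI[of _ "csqrt y"]) simp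
  qed
  have ev: "((\<lambda>n. a (2 * n) * (x\<^sup>2) ^ n) has_sum G (x\<^sup>2)) UNIV" if x: "norm x < 1" for x
  proof -
    have "(\<lambda>n. a n * x ^ n) summable_on range ((*) 2)"
      by (rule summable_on_subset[OF has_sum_imp_summable[OF a(1)[OF x]] subset_UNIV])
    hence "(\<lambda>n. a (2 * n) * x ^ (2 * n)) summable_on UNIV"
      by (subst (asm) summable_on_reindex) (auto simp: o_def inj_on_def)
    thus ?thesis unfolding G_def power_mult by (rule has_sum_infsum)
  qed
  have od: "((\<lambda>n. a (2 * n + 1) * x ^ (2 * n + 1)) has_sum x * H (x\<^sup>2)) UNIV" if x: "norm x < 1" for x
  proof -
    have "(\<lambda>n. a n * x ^ n) summable_on range (\<lambda>n. 2 * n + 1)"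
      by (rule summable_on_subset[OF has_sum_imp_summable[OF a(1)[OF x]] subset_UNIV])
    hence s: "(\<lambda>n. a (2 * n + 1) * x ^ (2 * n + 1)) summable_on UNIV"
      by (subst (asm) summable_on_reindex) (auto simp: o_def inj_on_def)
    show ?thesis
    proof (cases "x = 0")
      case True
      thus ?thesis by simp
    next
      case False
      have "(\<lambda>n. inverse x * (a (2 * n + 1) * x ^ (2 * n + 1))) summable_on UNIV"
        by (rule summable_on_cmult_right[OF s])
      also have "(\<lambda>n. inverse x * (a (2 * n + 1) * x ^ (2 * n + 1))) = (\<lambda>n. a (2 * n + 1) * (x\<^sup>2) ^ n)"
        using False by (simp add: fun_eq_iff power_mult[symmetric])
      finally have "((\<lambda>n. x * (a (2 * n + 1) * (x\<^sup>2) ^ n)) has_sum x * H (x\<^sup>2)) UNIV"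
        unfolding H_def by (intro has_sum_cmult_right has_sum_infsum)
      thus ?thesis by (simp add: power_mult[symmetric] mult_ac)
    qed
  qed
  have H_sums: "((\<lambda>n. a (2 * n + 1) * y ^ n) sums H y)" if y: "norm y < 1" for y
  proof -
    obtain x where x: "x\<^sup>2 = y" "norm x < 1" using root[OF y] by blast
    have "(\<lambda>n. a (2 * n + 1) * y ^ n) summable_on UNIV"
    proof (cases "y = 0")
      case True
      have "(\<lambda>n. a (2 * n + 1) * y ^ n) summable_on {0}" by simp
      thus ?thesis by (rule summable_on_cong_neutral[THEN iffD1, rotated 3]) (auto simp: True)
    next
      case False
      hence x0: "x \<noteq> 0" using x by auto
      have "(\<lambda>n. a (2 * n + 1) * x ^ (2 * n + 1)) summable_on UNIV"
        by (rule has_sum_imp_summable[OF od[OF x(2)]])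
      hence "(\<lambda>n. inverse x * (a (2 * n + 1) * x ^ (2 * n + 1))) summable_on UNIV"
        by (rule summable_on_cmult_right)
      also have "(\<lambda>n. inverse x * (a (2 * n + 1) * x ^ (2 * n + 1))) = (\<lambda>n. a (2 * n + 1) * y ^ n)"
        using x0 by (simp add: x(1)[symmetric] fun_eq_iff power_mult[symmetric])
      finally show ?thesis .
    qed
    thus ?thesis unfolding H_def by (intro has_sum_imp_sums has_sum_infsum)
  qed
  have Hhol: "H holomorphic_on ball 0 1"
    by (rule power_series_holomorphic[of _ _ "\<lambda>n. a (2 * n + 1)"]) (use H_sums in simp)
  have H0: "H 0 = a 1"
    using sums_unique2[OF H_sums[of 0] powser_sums_zero] by simp
  have G_sums: "((\<lambda>n. a (2 * n) * y ^ n) sums G y)" if y: "norm y < 1" for y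
    using root[OF y] ev has_sum_imp_sums by blast
  have Ghol: "G holomorphic_on ball 0 1"
    by (rule power_series_holomorphic[of _ _ "\<lambda>n. a (2 * n)"]) (use G_sums in simp)
  have G0: "G 0 = a 0"
    using sums_unique2[OF G_sums[of 0] powser_sums_zero] by simp
  have eq: "g x = G (x\<^sup>2) + x * H (x\<^sup>2)" if x: "norm x < 1" for x
  proof -
    have "((\<lambda>n. a n * x ^ n) has_sum G (x\<^sup>2)) (range ((*) 2))"
      using ev[OF x] by (subst has_sum_reindex) (auto simp: o_def inj_on_def power_mult)
    moreover have "((\<lambda>n. a n * x ^ n) has_sum x * H (x\<^sup>2)) (range (\<lambda>n. 2 * n + 1))"
      using od[OF x] by (subst has_sum_reindex) (auto simp: o_def inj_on_def)
    ultimately have "((\<lambda>n. a n * x ^ n) has_sum G (x\<^sup>2) + x * H (x\<^sup>2)) (range ((*) 2) \<union> range (\<lambda>n. 2 * n + 1))"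
      by (rule has_sum_Un_disjoint) (auto, presburger)
    also have "range ((*) 2) \<union> range (\<lambda>n. 2 * n + 1) = (UNIV :: nat set)"
      by (auto simp: image_iff) presburger
    finally show ?thesis using a(1)[OF x] has_sum_unique by blast
  qed
  show thesis
  proof (rule that[OF Ghol Hhol])
    show "G 0 = g 0" "H 0 = deriv g 0" by (simp_all only: G0 H0 a(2,3))
  qed (rule eq)
qed

text \<open>
  Both theta constants are values of the series of \<open>x\<close> to the power \<open>n\<^sup>2\<close>, since translating \<open>\<tau>\<close> by 1
  exchanges them and changes the sign of \<open>x\<close>, the square root of \<open>q\<close>.
\<close>

lemma Th_3_4_nome:
  obtains F where "F holomorphic_on ball 0 1" "F 0 = 1" "deriv F 0 = 2"
    "\<And>\<tau>. Im \<tau> > 0 \<Longrightarrow> Th 0 0 \<tau> 0 = F (ee (\<tau> / 2))"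
    "\<And>\<tau>. Im \<tau> > 0 \<Longrightarrow> Th 0 0 \<tau> (1 / 2) = F (- ee (\<tau> / 2))"
proof -
  have bij: "bij_betw real_of_int UNIV (Zs 0)" using bij_betw_Zs[of 0] by simp
  have tm: "theta_term 0 \<tau> 0 (real_of_int n) = ee (\<tau> / 2) ^ nat (n\<^sup>2)" for \<tau> n
  proof -
    have "of_real ((real_of_int n)\<^sup>2 / 2) * \<tau> = of_nat (nat (n\<^sup>2)) * (\<tau> / 2)" by simp
    thus ?thesis by (simp only: theta_term_def ee_of_nat_mult) simp
  qed
  have summ: "(\<lambda>n. norm (x ^ nat (n\<^sup>2))) summable_on (UNIV :: int set)" if x: "norm x < 1" "x \<noteq> 0" for x :: complex
  proof -
    obtain t where t: "ee t = x" using x(2) by (rule ee_surj)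
    hence "Im (2 * t) > 0" using x(1) norm_ee_less_1[of t] by simp
    from theta_term_abs_summable[OF this, of 0 0 0]
    have "(\<lambda>n. norm (theta_term 0 (2 * t) 0 (real_of_int n))) summable_on UNIV"
      using summable_on_reindex_bij_betw[OF bij, of "\<lambda>r. norm (theta_term 0 (2 * t) 0 r)"] by simp
    thus ?thesis by (simp add: tm t)
  qed
  have sq: "{n \<in> UNIV. nat (n\<^sup>2) = k} \<subseteq> {- int k..int k}" for k
  proof
    fix n :: int assume "n \<in> {n \<in> UNIV. nat (n\<^sup>2) = k}"
    hence "n\<^sup>2 = int k" by auto
    moreover have "\<bar>n\<bar> \<le> n\<^sup>2"
    proof (cases "n = 0")
      case False
      hence "1 * \<bar>n\<bar> \<le> \<bar>n\<bar> * \<bar>n\<bar>" by (intro mult_right_mono) auto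
      thus ?thesis by (simp add: power2_eq_square)
    qed simp
    ultimately show "n \<in> {- int k..int k}" by auto
  qed
  have fin: "finite {n \<in> UNIV. nat (n\<^sup>2) = k}" for k by (rule finite_subset[OF sq]) simp
  have sol: "{n \<in> UNIV. nat (n\<^sup>2) = 0} = {0::int}" "{n \<in> UNIV. nat (n\<^sup>2) = 1} = {1, - 1::int}"
    by (auto simp: nat_eq_iff power2_eq_1_iff)
  obtain F where F: "F holomorphic_on ball 0 1" "F 0 = of_nat (card {n::int \<in> UNIV. nat (n\<^sup>2) = 0})"
    "deriv F 0 = of_nat (card {n::int \<in> UNIV. nat (n\<^sup>2) = 1})"
    "\<And>x. norm x < 1 \<Longrightarrow> x \<noteq> 0 \<Longrightarrow> F x = (\<Sum>\<^sub>\<infinity>n\<in>(UNIV::int set). x ^ nat (n\<^sup>2))"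
    using exponent_series[where I = UNIV and e = "\<lambda>n::int. nat (n\<^sup>2)", OF summ fin] by blast
  show thesis
  proof (rule that[OF F(1)])
    show "F 0 = 1" "deriv F 0 = 2" using F(2,3) unfolding sol by simp_all
    have *: "Th 0 0 t 0 = F (ee (t / 2))" if "Im t > 0" for t
    proof -
      have "Th 0 0 t 0 = (\<Sum>\<^sub>\<infinity>n\<in>UNIV. theta_term 0 t 0 (real_of_int n))"
        unfolding Th_def by (rule infsum_reindex_bij_betw[OF bij, symmetric])
      thus ?thesis unfolding tm using F(4)[of "ee (t / 2)"] that by simp
    qed
    fix \<tau> :: complex assume \<tau>: "Im \<tau> > 0"
    show "Th 0 0 \<tau> 0 = F (ee (\<tau> / 2))" by (rule *[OF \<tau>])
    have "ee ((\<tau> + 1) / 2) = - ee (\<tau> / 2)" by (simp add: add_divide_distrib ee_add)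
    moreover have "Th 0 0 (\<tau> + 1) 0 = F (ee ((\<tau> + 1) / 2))" by (rule *) (use \<tau> in simp)
    ultimately show "Th 0 0 \<tau> (1 / 2) = F (- ee (\<tau> / 2))"
      using Th_0_tau_plus_1[of 0 \<tau> 0] by simp
  qed
qed

lemma Th_2_nome:
  obtains F where "F holomorphic_on ball 0 1" "F 0 = 2"
    "\<And>\<tau>. Im \<tau> > 0 \<Longrightarrow> Th (1 / 2) 0 \<tau> 0 = ee (\<tau> / 8) * F (ee \<tau>)"
proof -
  \<comment> \<open>half the square of \<open>n + 1 / 2\<close> minus 1/8; every value is taken at \<open>n\<close> and at \<open>- n - 1\<close>\<close>
  define e where "e n = nat (n * (n + 1) div 2)" for n :: int
  note bij = bij_betw_Zs[of "1 / 2"]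
  have tm: "theta_term 0 \<tau> 0 (of_int n + 1 / 2) = ee (\<tau> / 8) * ee \<tau> ^ e n" for \<tau> n
  proof -
    have "even (n * (n + 1))" by simp
    then obtain l where l: "n * (n + 1) = 2 * l" by blast
    have "0 \<le> n * (n + 1)" by (cases "n \<ge> 0") (auto simp: zero_le_mult_iff)
    hence "int (e n) = l" using l by (simp add: e_def)
    hence "of_nat (e n) = (of_int l :: complex)" by (metis of_int_of_nat_eq)
    moreover have "complex_of_real ((of_int n + 1 / 2)\<^sup>2 / 2) = of_int (n * (n + 1)) / 2 + 1 / 8"
      by (simp add: power2_eq_square field_simps)
    ultimately have "complex_of_real ((of_int n + 1 / 2)\<^sup>2 / 2) = of_nat (e n) + 1 / 8" by (simp add: l)
    hence "of_real ((of_int n + 1 / 2)\<^sup>2 / 2) * \<tau> = \<tau> / 8 + of_nat (e n) * \<tau>"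
      by (simp only: distrib_right) simp
    thus ?thesis by (simp only: theta_term_def ee_add ee_of_nat_mult) simp
  qed
  have summ: "(\<lambda>n. norm (x ^ e n)) summable_on (UNIV :: int set)" if x: "norm x < 1" "x \<noteq> 0" for x :: complex
  proof -
    obtain t where t: "ee t = x" using x(2) by (rule ee_surj)
    hence "Im t > 0" using x(1) norm_ee_less_1[of t] by simp
    from theta_term_abs_summable[OF this, of 0 0 "1 / 2"]
    have "(\<lambda>n. norm (theta_term 0 t 0 (of_int n + 1 / 2))) summable_on UNIV"
      using summable_on_reindex_bij_betw[OF bij, of "\<lambda>r. norm (theta_term 0 t 0 r)"] by simp
    hence "(\<lambda>n. norm (inverse (ee (t / 8))) * norm (theta_term 0 t 0 (of_int n + 1 / 2))) summable_on UNIV"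
      by (rule summable_on_cmult_right)
    moreover have "norm (inverse (ee (t / 8))) * norm (theta_term 0 t 0 (of_int n + 1 / 2)) = norm (x ^ e n)" for n
      by (simp add: tm t norm_mult norm_inverse)
    ultimately show ?thesis by simp
  qed
  have bnd: "{n \<in> UNIV. e n = k} \<subseteq> {- 2 * int k - 2..2 * int k + 2}" for k
  proof
    fix n :: int assume "n \<in> {n \<in> UNIV. e n = k}"
    hence "n * (n + 1) div 2 \<le> int k" by (simp add: e_def)
    hence le: "n * (n + 1) \<le> 2 * int k + 1" by linarith
    have "n \<le> n * (n + 1)" if "n \<ge> 0" using that by (simp add: algebra_simps)
    moreover have "- (n + 1) \<le> n * (n + 1)" if "n < 0"
    proof -
      have "0 \<le> (n + 1) * (n + 1)" by simp
      thus ?thesis using that by (simp add: algebra_simps)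
    qed
    ultimately show "n \<in> {- 2 * int k - 2..2 * int k + 2}" using le by (cases "n \<ge> 0") auto
  qed
  have fin: "finite {n \<in> UNIV. e n = k}" for k by (rule finite_subset[OF bnd]) simp
  have sol: "{n \<in> UNIV. e n = 0} = {0, - 1}"
  proof (intro equalityI subsetI)
    fix n assume n: "n \<in> {n \<in> UNIV. e n = 0}"
    hence "n \<in> {- 2..2}" using bnd[of 0] by auto
    hence "n = - 2 \<or> n = - 1 \<or> n = 0 \<or> n = 1 \<or> n = 2" by auto
    thus "n \<in> {0, - 1}" using n by (auto simp: e_def)
  qed (auto simp: e_def)
  obtain F where F: "F holomorphic_on ball 0 1" "F 0 = of_nat (card {n \<in> UNIV. e n = 0})"
    "deriv F 0 = of_nat (card {n \<in> UNIV. e n = 1})"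
    "\<And>x. norm x < 1 \<Longrightarrow> x \<noteq> 0 \<Longrightarrow> F x = (\<Sum>\<^sub>\<infinity>n\<in>UNIV. x ^ e n)"
    using exponent_series[where I = UNIV and e = e, OF summ fin] by blast
  show thesis
  proof (rule that[OF F(1)])
    show "F 0 = 2" using F(2) unfolding sol by simp
    fix \<tau> :: complex assume \<tau>: "Im \<tau> > 0"
    have "Th (1 / 2) 0 \<tau> 0 = (\<Sum>\<^sub>\<infinity>n\<in>UNIV. theta_term 0 \<tau> 0 (of_int n + 1 / 2))"
      unfolding Th_def by (rule infsum_reindex_bij_betw[OF bij, symmetric])
    also have "\<dots> = ee (\<tau> / 8) * (\<Sum>\<^sub>\<infinity>n\<in>UNIV. ee \<tau> ^ e n)"
      unfolding tm by (rule infsum_cmult_right')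
    finally show "Th (1 / 2) 0 \<tau> 0 = ee (\<tau> / 8) * F (ee \<tau>)" using F(4)[of "ee \<tau>"] \<tau> by simp
  qed
qed

section \<open>Modular functions of weight zero\<close>

text \<open>
  Below height 1/2, moving the real part into \<open>[- 1 / 2, 1 / 2]\<close> and then inverting at least doubles the
  imaginary part.
\<close>

lemma exists_equivalent_high:
  assumes S: "\<And>\<tau>. Im \<tau> > 0 \<Longrightarrow> f (- 1 / \<tau>) = f \<tau>" and T: "\<And>\<tau>. f (\<tau> + 1) = f \<tau>"
    and \<tau>: "Im \<tau> > 0"
  shows "\<exists>\<tau>'. Im \<tau>' \<ge> 1 / 2 \<and> f \<tau>' = f \<tau>"
proof -
  have "\<exists>\<tau>'. Im \<tau>' \<ge> 1 / 2 \<and> f \<tau>' = f \<tau>" if "Im \<tau> \<ge> 1 / 2 ^ Suc n" "Im \<tau> > 0" for n \<tau>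
    using that
  proof (induction n arbitrary: \<tau>)
    case 0
    thus ?case by auto
  next
    case (Suc n)
    show ?case
    proof (cases "Im \<tau> \<ge> 1 / 2")
      case False
      define k where "k = - round (Re \<tau>)"
      define \<sigma> where "\<sigma> = \<tau> + of_int k"
      have f\<sigma>: "f \<sigma> = f \<tau>" using periodic_int[where f = f and p = 1, OF T, of \<tau> k] by (simp add: \<sigma>_def)
      have Im: "Im \<sigma> = Im \<tau>" by (simp add: \<sigma>_def)
      have "\<bar>Re \<sigma>\<bar> \<le> 1 / 2" using of_int_round_abs_le[of "Re \<tau>"] by (simp add: \<sigma>_def k_def abs_minus_commute)
      hence "(Re \<sigma>)\<^sup>2 \<le> (1 / 2)\<^sup>2" by (simp only: abs_le_square_iff[symmetric])
      moreover have "(Im \<sigma>)\<^sup>2 \<le> (1 / 2)\<^sup>2" using False Suc.prems Im by (intro power_mono) auto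
      ultimately have "(Re \<sigma>)\<^sup>2 + (Im \<sigma>)\<^sup>2 \<le> 1 / 2" by (simp add: power_divide)
      hence n: "(norm \<sigma>)\<^sup>2 \<le> 1 / 2" by (simp only: cmod_power2)
      have pos: "(norm \<sigma>)\<^sup>2 > 0" using Suc.prems Im by auto
      have "Im (- 1 / \<sigma>) \<ge> 2 * Im \<tau>"
      proof -
        have "2 * Im \<tau> * (norm \<sigma>)\<^sup>2 \<le> 2 * Im \<tau> * (1 / 2)" using n Suc.prems by (intro mult_left_mono) auto
        thus ?thesis unfolding Im_minus_inverse Im using pos by (simp add: field_simps)
      qed
      moreover have "2 * Im \<tau> \<ge> 1 / 2 ^ Suc n" using Suc.prems(1) by (simp add: field_simps)
      ultimately have "\<exists>\<tau>'. Im \<tau>' \<ge> 1 / 2 \<and> f \<tau>' = f (- 1 / \<sigma>)"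
        using Suc.prems by (intro Suc.IH) auto
      moreover have "f (- 1 / \<sigma>) = f \<sigma>" by (rule S) (use Suc.prems Im in simp)
      ultimately show ?thesis using f\<sigma> by simp
    qed auto
  qed
  moreover obtain n where "1 / 2 ^ Suc n \<le> Im \<tau>"
  proof -
    obtain n where "(1 / 2) ^ n < Im \<tau>" using real_arch_pow_inv[OF \<tau>, of "1 / 2"] by auto
    moreover have "1 / 2 ^ Suc n \<le> (1 / 2 :: real) ^ n" by (simp add: power_one_over divide_le_cancel frac_le)
    ultimately have "1 / 2 ^ Suc n \<le> Im \<tau>" by linarith
    thus ?thesis by (rule that)
  qed
  ultimately show ?thesis using \<tau> by blast
qed

text \<open>
  Every orbit meets the half plane \<^term>\<open>Im \<tau> \<ge> 1 / 2\<close>, so the values on the unit disc are already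
  attained on a smaller closed disc, and the maximum modulus principle applies.
\<close>

lemma weight_zero_constant:
  assumes g: "g holomorphic_on ball 0 1"
    and S: "\<And>\<tau>. Im \<tau> > 0 \<Longrightarrow> g (ee (- 1 / \<tau>)) = g (ee \<tau>)" and x: "norm x < 1"
  shows "g x = g 0"
proof -
  \<comment> \<open>the absolute value of \<open>q\<close> at height 1/2\<close>
  define r where "r = exp (- pi)"
  have r: "0 \<le> r" "r < 1" by (auto simp: r_def)
  have "continuous_on (cball 0 r) (\<lambda>x. norm (g x))"
    using r by (intro continuous_on_norm holomorphic_on_imp_continuous_on holomorphic_on_subset[OF g]) auto
  moreover have "compact (cball (0::complex) r)" "cball (0::complex) r \<noteq> {}" using r by auto
  ultimately obtain \<xi> where \<xi>: "\<xi> \<in> cball 0 r" "\<And>y. y \<in> cball 0 r \<Longrightarrow> norm (g y) \<le> norm (g \<xi>)"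
    using continuous_attains_sup by metis
  have "norm (g y) \<le> norm (g \<xi>)" if y: "y \<in> ball 0 1" for y
  proof (cases "y = 0")
    case True
    thus ?thesis using \<xi>(2)[of 0] r by simp
  next
    case False
    then obtain \<tau> where \<tau>: "ee \<tau> = y" by (rule ee_surj)
    hence "Im \<tau> > 0" using y norm_ee_less_1[of \<tau>] by simp
    hence "\<exists>\<tau>'. Im \<tau>' \<ge> 1 / 2 \<and> g (ee \<tau>') = g (ee \<tau>)"
      by (intro exists_equivalent_high[of "\<lambda>\<tau>. g (ee \<tau>)"] S) (simp_all add: ee_add)
    then obtain \<tau>' where \<tau>': "Im \<tau>' \<ge> 1 / 2" "g (ee \<tau>') = g y" using \<tau> by auto
    have "pi * (1 / 2) \<le> pi * Im \<tau>'" using \<tau>'(1) by (intro mult_left_mono) auto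
    hence "ee \<tau>' \<in> cball 0 r" by (simp add: norm_ee r_def)
    thus ?thesis using \<xi>(2) \<tau>'(2) by metis
  qed
  hence "g constant_on ball 0 1"
    using \<xi>(1) r by (intro maximum_modulus_principle[OF g open_ball _ open_ball order_refl, of \<xi>]) auto
  thus ?thesis using x by (auto simp: constant_on_def)
qed

section \<open>Generation of the modular group\<close>

definition jacobi_invariant ::
  "int \<Rightarrow> (complex \<Rightarrow> complex^'n \<Rightarrow> complex) \<Rightarrow> int \<Rightarrow> int \<Rightarrow> int \<Rightarrow> int \<Rightarrow> bool" where
  "jacobi_invariant k \<phi> a b c d \<longleftrightarrow> (\<forall>\<tau>\<in>upper_half_plane. \<forall>z.
     \<phi> ((of_int a * \<tau> + of_int b) / (of_int c * \<tau> + of_int d)) ((1 / (of_int c * \<tau> + of_int d)) *s z)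
       * ee (- of_int c * (bil z z / 2) / (of_int c * \<tau> + of_int d))
       * (of_int c * \<tau> + of_int d) powi (- k) = \<phi> \<tau> z)"

lemma moebius_denominator_nonzero:
  fixes a b c d :: int
  assumes "Im \<tau> > 0" and "a * d - b * c = 1"
  shows "of_int c * \<tau> + of_int d \<noteq> 0"
proof
  assume h: "of_int c * \<tau> + of_int d = 0"
  hence "Im (of_int c * \<tau> + of_int d) = 0" by simp
  hence "c = 0" using assms(1) by simp
  with h have "d = 0" by simp
  with \<open>c = 0\<close> assms(2) show False by simp
qed

lemma moebius_numerator_nonzero:
  fixes a b c d :: int
  assumes "Im \<tau> > 0" and "a * d - b * c = 1"
  shows "of_int a * \<tau> + of_int b \<noteq> 0"
proof (rule moebius_denominator_nonzero[OF assms(1)])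
  show "(- c) * b - (- d) * a = 1" using assms(2) by (simp add: algebra_simps)
qed

lemma Im_moebius_pos:
  fixes a b c d :: int
  assumes \<tau>: "Im \<tau> > 0" and det: "a * d - b * c = 1"
  shows "Im ((of_int a * \<tau> + of_int b) / (of_int c * \<tau> + of_int d)) > 0"
proof -
  have "(real_of_int a * Im \<tau>) * (of_int c * Re \<tau> + of_int d) - (of_int a * Re \<tau> + of_int b) * (of_int c * Im \<tau>)
     = of_int (a * d - b * c) * Im \<tau>" by (simp add: algebra_simps)
  also have "\<dots> = Im \<tau>" by (simp only: det of_int_1 mult_1)
  finally have n: "(real_of_int a * Im \<tau>) * (of_int c * Re \<tau> + of_int d) - (of_int a * Re \<tau> + of_int b) * (of_int c * Im \<tau>) = Im \<tau>" .
  have "Im ((of_int a * \<tau> + of_int b) / (of_int c * \<tau> + of_int d)) = Im \<tau> / (norm (of_int c * \<tau> + of_int d))\<^sup>2"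
    unfolding Im_divide cmod_power2 using n by simp
  thus ?thesis using \<tau> moebius_denominator_nonzero[OF assms] by simp
qed

lemma bil_scale: "bil (c *s z) (c *s z) = c\<^sup>2 * bil z z"
  by (simp add: bil_def sum_distrib_left power2_eq_square mult_ac)

text \<open>
  The Euclidean algorithm on the first column writes every matrix as a word in the translation and
  the inversion; invariance is inherited along the word because the automorphy factor is a cocycle.
\<close>

theorem jacobi_invariant_generators:
  assumes T: "\<And>\<tau> z. \<phi> (\<tau> + 1) z = \<phi> \<tau> z"
    and S: "\<And>\<tau> z. Im \<tau> > 0 \<Longrightarrow> \<phi> (- 1 / \<tau>) ((1 / \<tau>) *s z) = \<tau> powi k * ee (bil z z / 2 / \<tau>) * \<phi> \<tau> z"
    and det: "a * d - b * c = 1"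
  shows "jacobi_invariant k \<phi> a b c d"
proof -
  have shift: "jacobi_invariant k \<phi> (a + n * c) (b + n * d) c d"
    if inv: "jacobi_invariant k \<phi> a b c d" and det: "a * d - b * c = 1" for a b c d n :: int
    unfolding jacobi_invariant_def
  proof (intro ballI allI)
    fix \<tau> and z :: "complex^'a" assume \<tau>: "\<tau> \<in> upper_half_plane"
    have nz: "of_int c * \<tau> + of_int d \<noteq> 0" using \<tau> det by (intro moebius_denominator_nonzero) auto
    have "(of_int (a + n * c) * \<tau> + of_int (b + n * d)) / (of_int c * \<tau> + of_int d) =
        (of_int a * \<tau> + of_int b) / (of_int c * \<tau> + of_int d) + of_int n * 1"
      using nz by (simp add: field_simps)
    hence "\<phi> ((of_int (a + n * c) * \<tau> + of_int (b + n * d)) / (of_int c * \<tau> + of_int d)) w =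
        \<phi> ((of_int a * \<tau> + of_int b) / (of_int c * \<tau> + of_int d)) w" for w
      using periodic_int[where f = "\<lambda>\<tau>. \<phi> \<tau> w" and p = 1, OF T] by simp
    thus "\<phi> ((of_int (a + n * c) * \<tau> + of_int (b + n * d)) / (of_int c * \<tau> + of_int d)) ((1 / (of_int c * \<tau> + of_int d)) *s z)
       * ee (- of_int c * (bil z z / 2) / (of_int c * \<tau> + of_int d))
       * (of_int c * \<tau> + of_int d) powi (- k) = \<phi> \<tau> z"
      using inv \<tau> unfolding jacobi_invariant_def by simp
  qed
  have invert: "jacobi_invariant k \<phi> (- c) (- d) a b"
    if inv: "jacobi_invariant k \<phi> a b c d" and det: "a * d - b * c = 1" for a b c d :: int
    unfolding jacobi_invariant_def
  proof (intro ballI allI)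
    fix \<tau> and z :: "complex^'a" assume "\<tau> \<in> upper_half_plane"
    hence \<tau>: "Im \<tau> > 0" by simp
    define J where "J = of_int c * \<tau> + of_int d"
    define N where "N = of_int a * \<tau> + of_int b"
    have J: "J \<noteq> 0" and N: "N \<noteq> 0"
      unfolding J_def N_def using moebius_denominator_nonzero[OF \<tau> det] moebius_numerator_nonzero[OF \<tau> det] by auto
    have Im: "Im (N / J) > 0" unfolding J_def N_def by (rule Im_moebius_pos[OF \<tau> det])
    have "of_int (- c) * \<tau> + of_int (- d) = - J" by (simp add: J_def)
    hence arg1: "(of_int (- c) * \<tau> + of_int (- d)) / N = - 1 / (N / J)" by simp
    have arg2: "(1 / N) *s z = (1 / (N / J)) *s ((1 / J) *s z)" using J by simp
    have arg3: "bil ((1 / J) *s z) ((1 / J) *s z) / 2 / (N / J) = bil z z / (2 * J * N)"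
      using J N by (simp add: bil_scale power2_eq_square)
    have 1: "\<phi> ((of_int (- c) * \<tau> + of_int (- d)) / N) ((1 / N) *s z) =
        (N / J) powi k * ee (bil z z / (2 * J * N)) * \<phi> (N / J) ((1 / J) *s z)"
      unfolding arg1 arg2 S[OF Im] arg3 ..
    have 2: "\<phi> (N / J) ((1 / J) *s z) * ee (- of_int c * (bil z z / 2) / J) * J powi (- k) = \<phi> \<tau> z"
      using inv \<tau> unfolding jacobi_invariant_def J_def N_def by simp
    have "of_int a * J - of_int c * N = 1"
    proof -
      have "of_int a * J - of_int c * N = of_int (a * d - b * c)" by (simp add: J_def N_def algebra_simps)
      thus ?thesis by (simp only: det) simp
    qed
    hence "bil z z * (of_int a * J - of_int c * N) = bil z z" by simp
    hence "bil z z / (2 * J * N) + - of_int a * (bil z z / 2) / N = - of_int c * (bil z z / 2) / J"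
      using J N by (simp add: field_simps)
    hence 3: "ee (bil z z / (2 * J * N)) * ee (- of_int a * (bil z z / 2) / N) = ee (- of_int c * (bil z z / 2) / J)"
      by (simp only: ee_add[symmetric])
    have 4: "(N / J) powi k * N powi (- k) = J powi (- k)"
      using J N by (simp add: power_int_divide_distrib power_int_minus field_simps)
    have "\<phi> ((of_int (- c) * \<tau> + of_int (- d)) / N) ((1 / N) *s z) * ee (- of_int a * (bil z z / 2) / N) * N powi (- k) =
        \<phi> (N / J) ((1 / J) *s z) * (ee (bil z z / (2 * J * N)) * ee (- of_int a * (bil z z / 2) / N)) * ((N / J) powi k * N powi (- k))"
      unfolding 1 by (simp only: mult_ac)
    also have "\<dots> = \<phi> \<tau> z" unfolding 3 4 by (rule 2)
    finally show "\<phi> ((of_int (- c) * \<tau> + of_int (- d)) / (of_int a * \<tau> + of_int b)) ((1 / (of_int a * \<tau> + of_int b)) *s z)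
       * ee (- of_int a * (bil z z / 2) / (of_int a * \<tau> + of_int b))
       * (of_int a * \<tau> + of_int b) powi (- k) = \<phi> \<tau> z" by (simp only: N_def)
  qed
  have id: "jacobi_invariant k \<phi> 1 0 0 1" by (simp add: jacobi_invariant_def)
  have "jacobi_invariant k \<phi> 0 (- 1) 1 0" using invert[OF id] by simp
  from invert[OF this] have mid: "jacobi_invariant k \<phi> (- 1) 0 0 (- 1)" by simp
  show ?thesis using det
  proof (induction "nat \<bar>c\<bar>" arbitrary: a b c d rule: less_induct)
    case less
    show ?case
    proof (cases "c = 0")
      case True
      with less.prems have "a * d = 1" by simp
      hence "a = 1 \<and> d = 1 \<or> a = - 1 \<and> d = - 1" by (simp add: zmult_eq_1_iff)
      thus ?thesis
      proof
        assume "a = 1 \<and> d = 1"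
        thus ?thesis using shift[OF id, of b] True by simp
      next
        assume "a = - 1 \<and> d = - 1"
        thus ?thesis using shift[OF mid, of "- b"] True by simp
      qed
    next
      case False
      define n where "n = a div c"
      have a: "a = a mod c + n * c" by (simp add: n_def)
      have "\<bar>a mod c\<bar> < \<bar>c\<bar>" using False by (rule abs_mod_less)
      hence lt: "nat \<bar>- (a mod c)\<bar> < nat \<bar>c\<bar>" by simp
      have det': "(a mod c) * d - (b - n * d) * c = 1"
      proof -
        have "(a mod c) * d - (b - n * d) * c = (a mod c + n * c) * d - b * c" by (simp add: algebra_simps)
        thus ?thesis using less.prems by (simp only: a[symmetric])
      qed
      have "jacobi_invariant k \<phi> c d (- (a mod c)) (- (b - n * d))"
        by (rule less.hyps[OF lt]) (use det' in \<open>simp add: algebra_simps\<close>)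
      from invert[OF this] have "jacobi_invariant k \<phi> (a mod c) (b - n * d) c d"
        using det' by (simp add: algebra_simps)
      from shift[OF this det', of n] show ?thesis by (simp only: a[symmetric] diff_add_cancel)
    qed
  qed
qed

section \<open>Joint holomorphy\<close>

definition complex_differentiable_at ::
  "(complex \<times> (complex^'n) \<Rightarrow> complex) \<Rightarrow> complex \<times> (complex^'n) \<Rightarrow> bool" where
  "complex_differentiable_at f p \<longleftrightarrow>
     (\<exists>D. (f has_derivative D) (at p) \<and> (\<forall>c t w. D (c * t, c *s w) = c * D (t, w)))"

lemma complex_differentiable_add:
  assumes "complex_differentiable_at f p" "complex_differentiable_at g p"
  shows "complex_differentiable_at (\<lambda>x. f x + g x) p"
proof -
  obtain D E where D: "(f has_derivative D) (at p)" "\<forall>c t w. D (c * t, c *s w) = c * D (t, w)"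
    and E: "(g has_derivative E) (at p)" "\<forall>c t w. E (c * t, c *s w) = c * E (t, w)"
    using assms unfolding complex_differentiable_at_def by blast
  have "((\<lambda>x. f x + g x) has_derivative (\<lambda>h. D h + E h)) (at p)"
    by (rule has_derivative_add[OF D(1) E(1)])
  moreover have "\<forall>c t w. D (c * t, c *s w) + E (c * t, c *s w) = c * (D (t, w) + E (t, w))"
    unfolding D(2)[rule_format] E(2)[rule_format] by (simp add: distrib_left)
  ultimately show ?thesis unfolding complex_differentiable_at_def by blast
qed

lemma complex_differentiable_mult:
  assumes "complex_differentiable_at f p" "complex_differentiable_at g p"
  shows "complex_differentiable_at (\<lambda>x. f x * g x) p"
proof -
  obtain D E where D: "(f has_derivative D) (at p)" "\<forall>c t w. D (c * t, c *s w) = c * D (t, w)"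
    and E: "(g has_derivative E) (at p)" "\<forall>c t w. E (c * t, c *s w) = c * E (t, w)"
    using assms unfolding complex_differentiable_at_def by blast
  have "((\<lambda>x. f x * g x) has_derivative (\<lambda>h. f p * E h + D h * g p)) (at p)"
    by (rule has_derivative_mult[OF D(1) E(1)])
  moreover have "\<forall>c t w. f p * E (c * t, c *s w) + D (c * t, c *s w) * g p = c * (f p * E (t, w) + D (t, w) * g p)"
    unfolding D(2)[rule_format] E(2)[rule_format] by (simp add: algebra_simps)
  ultimately show ?thesis unfolding complex_differentiable_at_def by blast
qed

lemma complex_differentiable_prod:
  assumes "finite I" "\<And>i. i \<in> I \<Longrightarrow> complex_differentiable_at (f i) p"
  shows "complex_differentiable_at (\<lambda>x. \<Prod>i\<in>I. f i x) p"
  using assms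
proof (induction I rule: finite_induct)
  case empty
  have "((\<lambda>x. 1 :: complex) has_derivative (\<lambda>h. 0)) (at p)" by (rule has_derivative_const)
  thus ?case unfolding complex_differentiable_at_def by (auto intro!: exI[of _ "\<lambda>h. 0"])
next
  case (insert i I)
  thus ?case by (simp add: complex_differentiable_mult)
qed

lemma complex_differentiable_fst:
  assumes "f holomorphic_on upper_half_plane" "Im \<tau> > 0"
  shows "complex_differentiable_at (\<lambda>x. f (fst x)) (\<tau>, z)"
proof -
  have "(f has_field_derivative deriv f \<tau>) (at (fst (\<tau>, z)))"
    using holomorphic_derivI[OF assms(1) open_upper_half_plane] assms(2) by simp
  hence "(f has_derivative (*) (deriv f \<tau>)) (at (fst (\<tau>, z)))" by (simp add: has_field_derivative_def)
  from has_derivative_compose[OF has_derivative_fst[OF has_derivative_ident] this]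
  have "((\<lambda>x. f (fst x)) has_derivative (\<lambda>h. deriv f \<tau> * fst h)) (at (\<tau>, z))" by simp
  thus ?thesis unfolding complex_differentiable_at_def by (intro exI[of _ "\<lambda>h. deriv f \<tau> * fst h"]) simp
qed

lemma complex_differentiable_Th:
  assumes "Im \<tau> > 0"
  shows "complex_differentiable_at (\<lambda>x. Th a 0 (fst x) (snd x $ i + c)) (\<tau>, z)"
proof -
  define A B where "A = of_real pi * \<i> * Th a (Suc (Suc 0)) \<tau> (z $ i + c)" and "B = 2 * of_real pi * \<i> * Th a (Suc 0) \<tau> (z $ i + c)"
  have "((\<lambda>(\<tau>, w). Th a 0 \<tau> w) has_derivative (\<lambda>(t, u). A * t + B * u)) (at (\<tau>, z $ i + c))"
    unfolding A_def B_def by (rule Th_has_derivative[OF assms])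
  hence 1: "((\<lambda>(\<tau>, w). Th a 0 \<tau> w) has_derivative (\<lambda>(t, u). A * t + B * u))
      (at ((\<lambda>x. (fst x, snd x $ i + c)) (\<tau>, z)))" by simp
  have 2: "((\<lambda>x. (fst x, snd x $ i + c)) has_derivative (\<lambda>h. (fst h, snd h $ i))) (at (\<tau>, z))"
    by (auto intro!: derivative_eq_intros has_derivative_Pair bounded_linear.has_derivative[OF bounded_linear_vec_nth])
  have "((\<lambda>x. Th a 0 (fst x) (snd x $ i + c)) has_derivative (\<lambda>h. A * fst h + B * (snd h $ i))) (at (\<tau>, z))"
    using has_derivative_compose[OF 2 1] by simp
  moreover have "\<forall>k t w. A * fst (k * t, k *s w) + B * (snd (k * t, k *s w) $ i) = k * (A * fst (t, w) + B * (snd (t, w) $ i))"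
    for w :: "complex^'b"
    by (simp add: algebra_simps)
  ultimately show ?thesis
    unfolding complex_differentiable_at_def
    by (intro exI[of _ "\<lambda>h. A * fst h + B * (snd h $ i)"]) (simp add: algebra_simps)
qed

lemma jacobi_holomorphicI:
  assumes "\<And>\<tau> z. Im \<tau> > 0 \<Longrightarrow> complex_differentiable_at (\<lambda>x. f (fst x) (snd x)) (\<tau>, z)"
    and "\<And>\<tau> z. Im \<tau> > 0 \<Longrightarrow> \<phi> \<tau> z = f \<tau> z"
  shows "jacobi_holomorphic \<phi>"
  unfolding jacobi_holomorphic_def
proof (intro ballI allI)
  fix \<tau> z assume \<tau>: "\<tau> \<in> upper_half_plane"
  then obtain D where D: "((\<lambda>x. f (fst x) (snd x)) has_derivative D) (at (\<tau>, z))" "\<forall>c t w. D (c * t, c *s w) = c * D (t, w)"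
    using assms(1)[of \<tau> z] unfolding complex_differentiable_at_def by auto
  have "((\<lambda>(t, w). \<phi> t w) has_derivative D) (at (\<tau>, z))"
    by (rule has_derivative_transform_within_open[OF D(1), of "upper_half_plane \<times> UNIV"])
       (use \<tau> assms(2) in \<open>auto intro!: open_Times open_upper_half_plane\<close>)
  with D(2) show "\<exists>D. ((\<lambda>(t, w). \<phi> t w) has_derivative D) (at (\<tau>, z)) \<and> (\<forall>c t w. D (c * t, c *s w) = c * D (t, w))"
    by blast
qed

lemma complex_differentiable_A:
  fixes z :: "complex^'n"
  assumes "Im \<tau> > 0"
  shows "complex_differentiable_at (\<lambda>x. A1 (fst x) (snd x)) (\<tau>, z)"
    "complex_differentiable_at (\<lambda>x. A2 (fst x) (snd x)) (\<tau>, z)"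
    "complex_differentiable_at (\<lambda>x. A3 (fst x) (snd x)) (\<tau>, z)"
    "complex_differentiable_at (\<lambda>x. A4 (fst x) (snd x)) (\<tau>, z)"
  unfolding A1_def A2_def A3_def A4_def
  using complex_differentiable_Th[OF assms, of _ _ 0] complex_differentiable_Th[OF assms]
  by (auto intro!: complex_differentiable_prod)

section \<open>Modular forms as functions on the disc\<close>

text \<open>
  A Fourier expansion with exponents \<open>\<ge> 0\<close> amounts to a holomorphic function of \<open>q\<close> on the whole disc; the
  missing value at \<open>q = 0\<close> is supplied by the constant coefficient.
\<close>

lemma modular_formsD:
  assumes "f \<in> modular_forms k"
  obtains F where "F holomorphic_on ball 0 1" "\<And>\<tau>. Im \<tau> > 0 \<Longrightarrow> f \<tau> = F (ee \<tau>)"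
proof -
  obtain a :: "nat \<Rightarrow> complex" where a: "\<And>\<tau>. Im \<tau> > 0 \<Longrightarrow> (\<lambda>m. a m * ee (of_nat m * \<tau>)) sums f \<tau>"
    using assms unfolding modular_forms_def by auto
  define F where "F x = (\<Sum>m. a m * x ^ m)" for x
  have sums: "(\<lambda>m. a m * x ^ m) sums F x" if x: "norm x < 1" for x
  proof (cases "x = 0")
    case True
    thus ?thesis using powser_sums_zero[of a] by (simp add: F_def)
  next
    case False
    then obtain \<tau> where \<tau>: "ee \<tau> = x" by (rule ee_surj)
    hence "Im \<tau> > 0" using x norm_ee_less_1[of \<tau>] by simp
    from a[OF this] show ?thesis by (simp add: ee_of_nat_mult \<tau> F_def sums_iff)
  qed
  show thesis
  proof (rule that)
    show "F holomorphic_on ball 0 1"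
      by (rule power_series_holomorphic[of _ _ a]) (use sums in simp)
    fix \<tau> :: complex assume \<tau>: "Im \<tau> > 0"
    show "f \<tau> = F (ee \<tau>)"
      using a[OF \<tau>] sums[of "ee \<tau>"] \<tau> by (simp add: ee_of_nat_mult sums_iff)
  qed
qed

lemma holomorphic_on_disc_ee:
  assumes "F holomorphic_on ball 0 1"
  shows "(\<lambda>\<tau>. F (ee \<tau>)) holomorphic_on upper_half_plane"
  by (rule holomorphic_on_compose_gen[OF holomorphic_on_ee[OF holomorphic_on_ident] assms, unfolded o_def]) auto

lemma modular_formsI:
  assumes F: "F holomorphic_on ball 0 1" and f: "\<And>\<tau>. f \<tau> = (if Im \<tau> > 0 then F (ee \<tau>) else 0)"
    and inv: "\<And>(a::int) b c d \<tau>. Im \<tau> > 0 \<Longrightarrow> a * d - b * c = 1 \<Longrightarrow>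
       f ((of_int a * \<tau> + of_int b) / (of_int c * \<tau> + of_int d)) * (of_int c * \<tau> + of_int d) powi (- k) = f \<tau>"
  shows "f \<in> modular_forms k"
proof -
  obtain a where a: "\<And>x. norm x < 1 \<Longrightarrow> ((\<lambda>n. a n * x ^ n) has_sum F x) UNIV"
    using holomorphic_abs_summable[OF F] by blast
  have "(\<lambda>m. a m * ee (of_nat m * \<tau>)) sums f \<tau>" if "Im \<tau> > 0" for \<tau>
    using has_sum_imp_sums[OF a[of "ee \<tau>"]] that by (simp add: ee_of_nat_mult f)
  moreover have "f holomorphic_on upper_half_plane"
    by (rule holomorphic_transform[OF holomorphic_on_disc_ee[OF F]]) (simp add: f)
  ultimately show ?thesis unfolding modular_forms_def using inv f by auto
qed

section \<open>Theta expansions\<close>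

text \<open>
  The fractional exponents 0, 1/2 and 5/8 are the numbers in \<open>[0, 1)\<close> that complete the half norms 0, 1/2
  and 3/8 of the vectors of each coset to integers, which makes the remaining coefficients power series
  in \<open>q\<close>.
\<close>

definition D3_expansion :: "(complex \<Rightarrow> complex^3 \<Rightarrow> complex) \<Rightarrow>
    (complex \<Rightarrow> complex) \<Rightarrow> (complex \<Rightarrow> complex) \<Rightarrow> (complex \<Rightarrow> complex) \<Rightarrow> (complex \<Rightarrow> complex) \<Rightarrow> bool" where
  "D3_expansion \<phi> G0 Gv Gs Gc \<longleftrightarrow> (\<forall>\<tau> z. Im \<tau> > 0 \<longrightarrow> \<phi> \<tau> z =
     G0 (ee \<tau>) * theta_sum lattice_D3 \<tau> z + ee (\<tau> / 2) * Gv (ee \<tau>) * theta_sum D3v \<tau> z +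
     ee (5 * \<tau> / 8) * (Gs (ee \<tau>) * theta_sum D3s \<tau> z + Gc (ee \<tau>) * theta_sum D3c \<tau> z))"

lemma bil_add: "bil (x + y) z = bil x z + bil y z" "bil x (y + z) = bil x y + bil x z"
  by (simp_all add: bil_def algebra_simps sum.distrib)

lemma bil_scale_right: "bil x (c *s y) = c * bil x y"
  by (simp add: bil_def sum_distrib_left mult_ac)

lemma bil_commute: "bil x y = bil y x"
  by (simp add: bil_def mult.commute)

lemma cvec_add: "cvec (x + y) = cvec x + cvec y" "cvec (x - y) = cvec x - cvec y" "cvec (- x) = - cvec x"
  by (simp_all add: cvec_def vec_eq_iff)

lemma bil_minus: "bil (- x) z = - bil x z" "bil x (- z) = - bil x z"
  by (simp_all add: bil_def sum_negf)

lemma Zpar_add: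
  assumes "r \<in> Zpar a b" "x \<in> Zpar c d"
  shows "r + x \<in> Zpar (a + c) (b + d)"
proof -
  have "r $ i + x $ i - (a + c) \<in> \<int>" for i
  proof -
    have "(r $ i - a) + (x $ i - c) \<in> \<int>" using assms by (intro Ints_add) (auto simp: Zpar_def Zvec_def Zs_def)
    thus ?thesis by (simp add: algebra_simps)
  qed
  moreover have "((\<Sum>i\<in>UNIV. (r + x) $ i) - (b + d)) / 2 \<in> \<int>"
  proof -
    have "((\<Sum>i\<in>UNIV. r $ i) - b) / 2 + ((\<Sum>i\<in>UNIV. x $ i) - d) / 2 \<in> \<int>"
      using assms by (intro Ints_add) (auto simp: Zpar_def)
    thus ?thesis by (simp add: sum.distrib add_divide_distrib diff_divide_distrib algebra_simps)
  qed
  ultimately show ?thesis by (simp add: Zpar_def Zvec_def Zs_def)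
qed

lemma Zpar_minus:
  assumes "r \<in> Zpar a b"
  shows "- r \<in> Zpar (- a) (- b)"
proof -
  have "- (r $ i - a) \<in> \<int>" for i using assms by (intro Ints_minus) (auto simp: Zpar_def Zvec_def Zs_def)
  moreover have "- (((\<Sum>i\<in>UNIV. r $ i) - b) / 2) \<in> \<int>"
    using assms by (intro Ints_minus) (auto simp: Zpar_def)
  moreover have "- (((\<Sum>i\<in>UNIV. r $ i) - b) / 2) = ((\<Sum>i\<in>UNIV. (- r) $ i) - - b) / 2"
    by (simp add: sum_negf minus_divide_left)
  ultimately show ?thesis by (simp add: Zpar_def Zvec_def Zs_def)
qed

lemma Zpar_subset_Zvec: "Zpar a b \<subseteq> Zvec a"
  by (auto simp: Zpar_def)

lemma dual_D3_partition:
  "dual_lattice lattice_D3 = (lattice_D3 \<union> D3v) \<union> (D3s \<union> D3c)"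
  "lattice_D3 \<inter> D3v = {}" "D3s \<inter> D3c = {}" "(lattice_D3 \<union> D3v) \<inter> (D3s \<union> D3c) = {}"
proof -
  have 1: "(Zvec 0 :: (real^3) set) = Zpar 0 0 \<union> Zpar 0 1" "(Zpar 0 0 :: (real^3) set) \<inter> Zpar 0 1 = {}"
    by (rule Zvec_split; simp)+
  have 2: "(Zvec (1 / 2) :: (real^3) set) = D3s \<union> D3c" "D3s \<inter> D3c = {}"
    by (rule Zvec_split; simp)+
  show "dual_lattice lattice_D3 = (lattice_D3 \<union> D3v) \<union> (D3s \<union> D3c)"
    unfolding dual_lattice_D3 unfolding 1 2 lattice_D3_eq ..
  show "lattice_D3 \<inter> D3v = {}" unfolding lattice_D3_eq by (rule 1)
  show "D3s \<inter> D3c = {}" by (rule 2)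
  have False if "r $ 1 \<in> \<int>" "r $ 1 - 1 / 2 \<in> \<int>" for r :: "real^3"
  proof -
    have "r $ 1 - (r $ 1 - 1 / 2) \<in> \<int>" using that by (rule Ints_diff)
    hence "1 / 2 \<in> (\<int> :: real set)" by simp
    then obtain n where "(1 / 2 :: real) = of_int n" by (elim Ints_cases)
    hence "of_int (2 * n) = (of_int 1 :: real)" by simp
    hence "2 * n = 1" by (simp only: of_int_eq_iff)
    thus False by presburger
  qed
  hence "Zvec 0 \<inter> (Zvec (1 / 2) :: (real^3) set) = {}" by (auto simp: Zvec_def Zs_def)
  thus "(lattice_D3 \<union> D3v) \<inter> (D3s \<union> D3c) = {}" unfolding lattice_D3_eq 1 2 .
qed

lemma D3v_norm: "r \<in> D3v \<Longrightarrow> 1 / 2 + r \<bullet> r / 2 \<in> \<int>"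
proof -
  assume r: "r \<in> D3v"
  have int: "r $ i \<in> \<int>" for i using r by (simp add: Zpar_def Zvec_def Zs_def)
  define k where "k = (r $ 1 + r $ 2 + r $ 3 - 1) / 2"
  have k: "k \<in> \<int>" using r by (simp add: Zpar_def sum_3 k_def)
  have "2 * k\<^sup>2 + 2 * k + 1 - (r $ 1 * r $ 2 + r $ 1 * r $ 3 + r $ 2 * r $ 3) \<in> \<int>"
    by (intro Ints_add Ints_diff Ints_mult Ints_power int k) auto
  also have "2 * k\<^sup>2 + 2 * k + 1 - (r $ 1 * r $ 2 + r $ 1 * r $ 3 + r $ 2 * r $ 3) = 1 / 2 + r \<bullet> r / 2"
    by (simp add: inner_vec_def sum_3 k_def power2_eq_square field_simps)
  finally show ?thesis .
qed

lemma half_integral_norm: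
  assumes "r \<in> (Zvec (1 / 2) :: (real^3) set)"
  shows "5 / 8 + r \<bullet> r / 2 \<in> \<int>"
proof -
  have 1: "(r $ i)\<^sup>2 / 2 - 1 / 8 \<in> \<int>" for i
  proof -
    have "r $ i - 1 / 2 \<in> \<int>" using assms by (simp add: Zvec_def Zs_def)
    then obtain n where n: "r $ i - 1 / 2 = of_int n" by (elim Ints_cases)
    have "even (n * (n + 1))" by simp
    then obtain l where "n * (n + 1) = 2 * l" by blast
    hence "of_int (n * (n + 1)) = (of_int (2 * l) :: real)" by (rule arg_cong)
    moreover have rn: "r $ i = of_int n + 1 / 2" using n by simp
    have "(r $ i)\<^sup>2 / 2 - 1 / 8 = of_int (n * (n + 1)) / 2"
      unfolding rn by (simp add: power2_eq_square field_simps)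
    ultimately have "(r $ i)\<^sup>2 / 2 - 1 / 8 = of_int l" by simp
    thus ?thesis by simp
  qed
  have "((r $ 1)\<^sup>2 / 2 - 1 / 8) + ((r $ 2)\<^sup>2 / 2 - 1 / 8) + ((r $ 3)\<^sup>2 / 2 - 1 / 8) + 1 \<in> \<int>"
    by (intro Ints_add 1) auto
  also have "((r $ 1)\<^sup>2 / 2 - 1 / 8) + ((r $ 2)\<^sup>2 / 2 - 1 / 8) + ((r $ 3)\<^sup>2 / 2 - 1 / 8) + 1 = 5 / 8 + r \<bullet> r / 2"
    by (simp add: inner_vec_def sum_3 power2_eq_square field_simps)
  finally show ?thesis .
qed

lemma lattice_D3_norm: "r \<in> lattice_D3 \<Longrightarrow> 0 + r \<bullet> r / 2 \<in> \<int>"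
  using even_lattice_D3 by (simp add: even_lattice_def)

lemma inner_dual_lattice: "r \<in> dual_lattice L \<Longrightarrow> x \<in> L \<Longrightarrow> r \<bullet> x \<in> \<int>"
  by (simp add: dual_lattice_def)

subsection \<open>From expansions to Jacobi forms\<close>

lemma theta_sum_coset_quasi_periodic:
  assumes \<tau>: "Im \<tau> > 0" and X: "Zpar a b \<subseteq> dual_lattice lattice_D3" and x: "x \<in> lattice_D3" and y: "y \<in> lattice_D3"
  shows "theta_sum (Zpar a b) \<tau> (z + \<tau> *s cvec x + cvec y) * ee (\<tau> * of_real (x \<bullet> x / 2) + bil (cvec x) z)
    = theta_sum (Zpar a b) \<tau> z"
proof -
  have bij: "bij_betw (\<lambda>r. r + x) (Zpar a b) (Zpar a b)"
  proof (rule bij_betwI[of _ _ _ "\<lambda>r. r + - x"])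
    show "(\<lambda>r. r + x) \<in> Zpar a b \<rightarrow> Zpar a b"
      using Zpar_add[of _ a b x 0 0] x by (auto simp: lattice_D3_eq)
    have "- x \<in> Zpar 0 0" using Zpar_minus[of x 0 0] x by (simp add: lattice_D3_eq)
    thus "(\<lambda>r. r + - x) \<in> Zpar a b \<rightarrow> Zpar a b"
      using Zpar_add[of _ a b "- x" 0 0] by auto
  qed auto
  have "lattice_term \<tau> (z + \<tau> *s cvec x + cvec y) r * ee (\<tau> * of_real (x \<bullet> x / 2) + bil (cvec x) z) = lattice_term \<tau> z (r + x)"
    if r: "r \<in> Zpar a b" for r
  proof -
    have "r \<bullet> y \<in> \<int>" using X r y inner_dual_lattice by blast
    then obtain n where n: "r \<bullet> y = of_int n" by (elim Ints_cases)
    have "bil (cvec r) (z + \<tau> *s cvec x + cvec y) = bil (cvec r) z + \<tau> * of_real (r \<bullet> x) + of_int n"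
      by (simp add: bil_add bil_scale_right bil_cvec n)
    hence "lattice_term \<tau> (z + \<tau> *s cvec x + cvec y) r * ee (\<tau> * of_real (x \<bullet> x / 2) + bil (cvec x) z) =
        ee (of_real (r \<bullet> r / 2) * \<tau> + (bil (cvec r) z + \<tau> * of_real (r \<bullet> x)) + (\<tau> * of_real (x \<bullet> x / 2) + bil (cvec x) z))"
      by (simp only: lattice_term_def ee_add ee_of_int mult_1_right)
    also have "of_real (r \<bullet> r / 2) * \<tau> + (bil (cvec r) z + \<tau> * of_real (r \<bullet> x)) + (\<tau> * of_real (x \<bullet> x / 2) + bil (cvec x) z)
        = of_real ((r + x) \<bullet> (r + x) / 2) * \<tau> + bil (cvec (r + x)) z"
      by (simp add: cvec_add bil_add inner_add_left inner_add_right inner_commute[of x r] field_simps)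
    finally show ?thesis by (simp only: lattice_term_def ee_add)
  qed
  hence "theta_sum (Zpar a b) \<tau> (z + \<tau> *s cvec x + cvec y) * ee (\<tau> * of_real (x \<bullet> x / 2) + bil (cvec x) z) =
      (\<Sum>\<^sub>\<infinity>r\<in>Zpar a b. lattice_term \<tau> z (r + x))"
    unfolding theta_sum_eq_infsum[OF \<tau>] infsum_cmult_left'[symmetric] by (intro infsum_cong) simp
  also have "\<dots> = theta_sum (Zpar a b) \<tau> z"
    unfolding theta_sum_eq_infsum[OF \<tau>] by (rule infsum_reindex_bij_betw[OF bij])
  finally show ?thesis .
qed

lemma has_sum_product_complex:
  fixes f :: "'a \<Rightarrow> complex" and g :: "'b \<Rightarrow> complex"
  assumes f: "(f has_sum s) A" and g: "(g has_sum t) B"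
  shows "((\<lambda>(x, y). f x * g y) has_sum s * t) (A \<times> B)"
proof (rule has_sum_SigmaI)
  show "((\<lambda>y. (case (x, y) of (x, y) \<Rightarrow> f x * g y)) has_sum f x * t) B" for x
    using has_sum_cmult_right[OF g] by simp
  show "((\<lambda>x. f x * t) has_sum s * t) A" by (rule has_sum_cmult_left[OF f])
  have fn: "(\<lambda>x. norm (f x)) summable_on A" and gn: "(\<lambda>x. norm (g x)) summable_on B"
    using has_sum_imp_summable[OF f] has_sum_imp_summable[OF g] by (simp_all only: summable_on_iff_abs_summable_on_complex)
  have "(\<lambda>p. norm (case p of (x, y) \<Rightarrow> f x * g y)) summable_on A \<times> B"
  proof (rule Infinite_Sum.abs_summable_on_Sigma_iff[THEN iffD2], intro conjI ballI)
    show "(\<lambda>y. norm (case (x, y) of (x, y) \<Rightarrow> f x * g y)) summable_on B" for x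
      unfolding prod.case norm_mult by (rule summable_on_cmult_right[OF gn])
    show "(\<lambda>x. norm (\<Sum>\<^sub>\<infinity>y\<in>B. norm (case (x, y) of (x, y) \<Rightarrow> f x * g y))) summable_on A"
      unfolding prod.case norm_mult infsum_cmult_right' real_norm_def abs_mult abs_norm_cancel
      by (rule summable_on_cmult_left[OF fn])
  qed
  thus "(\<lambda>(x, y). f x * g y) summable_on A \<times> B" by (rule abs_summable_summable)
qed

text \<open>
  The exponents of the component of a coset lie in \<^term>\<open>s + of_nat n\<close> with \<open>0 \<le> s < 1\<close>, and \<open>s\<close> is
  complementary to the norms of the coset modulo 1; so the pairs (exponent, vector) correspond
  exactly to the integers \<open>m\<close> above half the norm.
\<close>

lemma coset_fourier_expansion:
  fixes X :: "(real^'n) set" and a :: "nat \<Rightarrow> complex"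
  assumes \<tau>: "Im \<tau> > 0" and F: "((\<lambda>n. a n * ee \<tau> ^ n) has_sum F) UNIV" and X: "X \<subseteq> Zvec b"
    and s: "0 \<le> s" "s < 1" and int: "\<And>r. r \<in> X \<Longrightarrow> s + r \<bullet> r / 2 \<in> \<int>"
  shows "((\<lambda>(m, r). a (nat (m - \<lfloor>s + r \<bullet> r / 2\<rfloor>)) * ee (of_int m * \<tau>) * ee (bil z (cvec r))) has_sum
    ee (of_real s * \<tau>) * F * theta_sum X \<tau> z) {(m, r). r \<in> X \<and> of_int m \<ge> r \<bullet> r / 2}"
proof -
  have fl: "of_int \<lfloor>s + r \<bullet> r / 2\<rfloor> = s + r \<bullet> r / 2" if "r \<in> X" for r
    using int[OF that] by simp
  have "((\<lambda>n. ee (of_real s * \<tau>) * (a n * ee \<tau> ^ n)) has_sum ee (of_real s * \<tau>) * F) UNIV"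
    by (rule has_sum_cmult_right[OF F])
  from has_sum_product_complex[OF this lattice_term_has_sum[OF \<tau> X, of z]]
  have "((\<lambda>(n, r). ee (of_real s * \<tau>) * (a n * ee \<tau> ^ n) * lattice_term \<tau> z r) has_sum
      ee (of_real s * \<tau>) * F * theta_sum X \<tau> z) (UNIV \<times> X)" .
  also have "?this \<longleftrightarrow> ?thesis"
  proof (rule has_sum_reindex_bij_witness[of _ "\<lambda>(m, r). (nat (m - \<lfloor>s + r \<bullet> r / 2\<rfloor>), r)" "\<lambda>(n, r). (\<lfloor>s + r \<bullet> r / 2\<rfloor> + int n, r)"])
    fix p :: "nat \<times> (real^'n)" assume "p \<in> UNIV \<times> X"
    then obtain n r where p: "p = (n, r)" "r \<in> X" by auto
    show "(case case p of (n, r) \<Rightarrow> (\<lfloor>s + r \<bullet> r / 2\<rfloor> + int n, r) of (m, r) \<Rightarrow> (nat (m - \<lfloor>s + r \<bullet> r / 2\<rfloor>), r)) = p"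
      by (simp add: p)
    show "(case p of (n, r) \<Rightarrow> (\<lfloor>s + r \<bullet> r / 2\<rfloor> + int n, r)) \<in> {(m, r). r \<in> X \<and> of_int m \<ge> r \<bullet> r / 2}"
    proof -
      have "r \<bullet> r / 2 \<le> of_int (\<lfloor>s + r \<bullet> r / 2\<rfloor> + int n)"
        unfolding of_int_add of_int_of_nat_eq fl[OF p(2)] using s by simp
      thus ?thesis using p(2) by (simp only: p(1) prod.case mem_Collect_eq simp_thms)
    qed
    have "of_int (\<lfloor>s + r \<bullet> r / 2\<rfloor> + int n) * \<tau> = of_real s * \<tau> + of_nat n * \<tau> + of_real (r \<bullet> r / 2) * \<tau>"
    proof -
      have "complex_of_int (\<lfloor>s + r \<bullet> r / 2\<rfloor> + int n) = of_real (of_int \<lfloor>s + r \<bullet> r / 2\<rfloor> + of_nat n)" by simp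
      also have "of_int \<lfloor>s + r \<bullet> r / 2\<rfloor> + of_nat n = s + r \<bullet> r / 2 + of_nat n" by (simp only: fl[OF p(2)])
      finally show ?thesis by (simp add: algebra_simps)
    qed
    hence "ee (of_int (\<lfloor>s + r \<bullet> r / 2\<rfloor> + int n) * \<tau>) = ee (of_real s * \<tau>) * ee \<tau> ^ n * ee (of_real (r \<bullet> r / 2) * \<tau>)"
      by (simp only: ee_add ee_of_nat_mult)
    thus "(case case p of (n, r) \<Rightarrow> (\<lfloor>s + r \<bullet> r / 2\<rfloor> + int n, r) of
        (m, r) \<Rightarrow> a (nat (m - \<lfloor>s + r \<bullet> r / 2\<rfloor>)) * ee (of_int m * \<tau>) * ee (bil z (cvec r))) =
      (case p of (n, r) \<Rightarrow> ee (of_real s * \<tau>) * (a n * ee \<tau> ^ n) * lattice_term \<tau> z r)"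
      by (simp add: p(1) lattice_term_def bil_commute[of z])
  next
    fix p :: "int \<times> (real^'n)" assume "p \<in> {(m, r). r \<in> X \<and> of_int m \<ge> r \<bullet> r / 2}"
    then obtain m r where p: "p = (m, r)" "r \<in> X" "of_int m \<ge> r \<bullet> r / 2" by auto
    have "real_of_int \<lfloor>s + r \<bullet> r / 2\<rfloor> < of_int (m + 1)"
      unfolding fl[OF p(2)] using p(3) s by simp
    hence "\<lfloor>s + r \<bullet> r / 2\<rfloor> \<le> m" by (simp only: of_int_less_iff)
    thus "(case case p of (m, r) \<Rightarrow> (nat (m - \<lfloor>s + r \<bullet> r / 2\<rfloor>), r) of (n, r) \<Rightarrow> (\<lfloor>s + r \<bullet> r / 2\<rfloor> + int n, r)) = p"
      by (simp add: p(1))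
    show "(case p of (m, r) \<Rightarrow> (nat (m - \<lfloor>s + r \<bullet> r / 2\<rfloor>), r)) \<in> UNIV \<times> X" using p by simp
  qed (rule refl)
  finally show ?thesis .
qed

lemma D3_expansion_holomorphic:
  assumes G: "G0 holomorphic_on ball 0 1" "Gv holomorphic_on ball 0 1" "Gs holomorphic_on ball 0 1" "Gc holomorphic_on ball 0 1"
    and \<phi>: "D3_expansion \<phi> G0 Gv Gs Gc"
  shows "jacobi_holomorphic \<phi>"
proof (rule jacobi_holomorphicI)
  fix \<tau> :: complex and z :: "complex^3" assume \<tau>: "Im \<tau> > 0"
  show "\<phi> \<tau> z = G0 (ee \<tau>) * (1 / 2 * (A3 \<tau> z + A4 \<tau> z)) + ee (\<tau> / 2) * Gv (ee \<tau>) * (1 / 2 * (A3 \<tau> z + - 1 * A4 \<tau> z)) +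
     ee (5 * \<tau> / 8) * (Gs (ee \<tau>) * (1 / 2 * (A2 \<tau> z + \<i> * A1 \<tau> z)) + Gc (ee \<tau>) * (1 / 2 * (A2 \<tau> z + - \<i> * A1 \<tau> z)))"
    using \<phi> \<tau> by (simp add: D3_expansion_def theta_D3)
  have c: "complex_differentiable_at (\<lambda>x. c) (\<tau>, z)" for c :: complex
    using complex_differentiable_fst[OF holomorphic_on_const \<tau>] .
  have e: "complex_differentiable_at (\<lambda>x. ee (fst x / 2)) (\<tau>, z)" "complex_differentiable_at (\<lambda>x. ee (5 * fst x / 8)) (\<tau>, z)"
    by (rule complex_differentiable_fst[OF _ \<tau>], intro holomorphic_intros, simp)+
  note g = complex_differentiable_fst[OF holomorphic_on_disc_ee \<tau>]
  show "complex_differentiable_at (\<lambda>x. G0 (ee (fst x)) * (1 / 2 * (A3 (fst x) (snd x) + A4 (fst x) (snd x))) +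
      ee (fst x / 2) * Gv (ee (fst x)) * (1 / 2 * (A3 (fst x) (snd x) + - 1 * A4 (fst x) (snd x))) +
     ee (5 * fst x / 8) * (Gs (ee (fst x)) * (1 / 2 * (A2 (fst x) (snd x) + \<i> * A1 (fst x) (snd x))) +
       Gc (ee (fst x)) * (1 / 2 * (A2 (fst x) (snd x) + - \<i> * A1 (fst x) (snd x))))) (\<tau>, z)"
    by (intro complex_differentiable_add complex_differentiable_mult c e g G complex_differentiable_A \<tau>)
qed

lemma D3_expansion_quasi_periodic:
  assumes \<phi>: "D3_expansion \<phi> G0 Gv Gs Gc" and \<tau>: "Im \<tau> > 0" and x: "x \<in> lattice_D3" and y: "y \<in> lattice_D3"
  shows "\<phi> \<tau> (z + \<tau> *s cvec x + cvec y) * ee (\<tau> * of_real (x \<bullet> x / 2) + bil (cvec x) z) = \<phi> \<tau> z"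
proof -
  have E: "\<phi> \<tau> z = G0 (ee \<tau>) * theta_sum lattice_D3 \<tau> z + ee (\<tau> / 2) * Gv (ee \<tau>) * theta_sum D3v \<tau> z +
     ee (5 * \<tau> / 8) * (Gs (ee \<tau>) * theta_sum D3s \<tau> z + Gc (ee \<tau>) * theta_sum D3c \<tau> z)" for z
    using \<phi> \<tau> by (simp add: D3_expansion_def)
  define e where "e = ee (\<tau> * of_real (x \<bullet> x / 2) + bil (cvec x) z)"
  have t: "theta_sum (Zpar a b) \<tau> (z + \<tau> *s cvec x + cvec y) * e = theta_sum (Zpar a b) \<tau> z"
    if "Zpar a b \<subseteq> dual_lattice lattice_D3" for a b
    unfolding e_def by (rule theta_sum_coset_quasi_periodic[OF \<tau> that x y])
  have t4: "theta_sum lattice_D3 \<tau> (z + \<tau> *s cvec x + cvec y) * e = theta_sum lattice_D3 \<tau> z"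
    "theta_sum D3v \<tau> (z + \<tau> *s cvec x + cvec y) * e = theta_sum D3v \<tau> z"
    "theta_sum D3s \<tau> (z + \<tau> *s cvec x + cvec y) * e = theta_sum D3s \<tau> z"
    "theta_sum D3c \<tau> (z + \<tau> *s cvec x + cvec y) * e = theta_sum D3c \<tau> z"
    unfolding lattice_D3_eq by (rule t, simp only: dual_D3_partition(1)[unfolded lattice_D3_eq] lattice_D3_eq, blast)+
  show ?thesis unfolding E[of z] t4[symmetric] unfolding E e_def[symmetric] by (simp add: algebra_simps)
qed

lemma D3_expansion_fourier:
  assumes G: "G0 holomorphic_on ball 0 1" "Gv holomorphic_on ball 0 1" "Gs holomorphic_on ball 0 1" "Gc holomorphic_on ball 0 1"
    and \<phi>: "D3_expansion \<phi> G0 Gv Gs Gc"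
  shows "\<exists>c :: int \<Rightarrow> real^3 \<Rightarrow> complex. \<forall>\<tau>\<in>upper_half_plane. \<forall>z.
        ((\<lambda>(m, r). c m r * ee (of_int m * \<tau>) * ee (bil z (cvec r))) has_sum \<phi> \<tau> z)
          {(m, r). r \<in> dual_lattice lattice_D3 \<and> of_int m \<ge> r \<bullet> r / 2}"
proof -
  obtain a0 where a0: "\<And>x. norm x < 1 \<Longrightarrow> ((\<lambda>n. a0 n * x ^ n) has_sum G0 x) UNIV"
    using holomorphic_abs_summable[OF G(1)] by blast
  obtain av where av: "\<And>x. norm x < 1 \<Longrightarrow> ((\<lambda>n. av n * x ^ n) has_sum Gv x) UNIV"
    using holomorphic_abs_summable[OF G(2)] by blast
  obtain as where as: "\<And>x. norm x < 1 \<Longrightarrow> ((\<lambda>n. as n * x ^ n) has_sum Gs x) UNIV"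
    using holomorphic_abs_summable[OF G(3)] by blast
  obtain ac where ac: "\<And>x. norm x < 1 \<Longrightarrow> ((\<lambda>n. ac n * x ^ n) has_sum Gc x) UNIV"
    using holomorphic_abs_summable[OF G(4)] by blast
  define c where "c m r = (if r \<in> lattice_D3 then a0 (nat (m - \<lfloor>0 + r \<bullet> r / 2\<rfloor>))
    else if r \<in> D3v then av (nat (m - \<lfloor>1 / 2 + r \<bullet> r / 2\<rfloor>))
    else if r \<in> D3s then as (nat (m - \<lfloor>5 / 8 + r \<bullet> r / 2\<rfloor>)) else ac (nat (m - \<lfloor>5 / 8 + r \<bullet> r / 2\<rfloor>)))" for m and r :: "real^3"
  let ?S = "\<lambda>X. {(m::int, r::real^3). r \<in> X \<and> of_int m \<ge> r \<bullet> r / 2}"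
  have "((\<lambda>(m, r). c m r * ee (of_int m * \<tau>) * ee (bil z (cvec r))) has_sum \<phi> \<tau> z) (?S (dual_lattice lattice_D3))"
    if \<tau>: "Im \<tau> > 0" for \<tau> z
  proof -
    let ?t = "\<lambda>(m, r). c m r * ee (of_int m * \<tau>) * ee (bil z (cvec r))"
    have q: "norm (ee \<tau>) < 1" using \<tau> by simp
    note part = dual_D3_partition
    have 1: "(?t has_sum ee (of_real 0 * \<tau>) * G0 (ee \<tau>) * theta_sum lattice_D3 \<tau> z) (?S lattice_D3)"
    proof (rule has_sum_cong[THEN iffD1, OF _ coset_fourier_expansion[OF \<tau> a0[OF q], of lattice_D3 0 0]])
      show "lattice_D3 \<subseteq> Zvec 0" unfolding lattice_D3_eq by (rule Zpar_subset_Zvec)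
    qed (auto simp: c_def lattice_D3_norm[simplified])
    have 2: "(?t has_sum ee (of_real (1 / 2) * \<tau>) * Gv (ee \<tau>) * theta_sum D3v \<tau> z) (?S D3v)"
    proof (rule has_sum_cong[THEN iffD1, OF _ coset_fourier_expansion[OF \<tau> av[OF q] Zpar_subset_Zvec, of "1 / 2"]])
      show "1 / 2 + r \<bullet> r / 2 \<in> \<int>" if "r \<in> D3v" for r by (rule D3v_norm[OF that])
    qed (use part in \<open>auto simp: c_def\<close>)
    have 3: "(?t has_sum ee (of_real (5 / 8) * \<tau>) * Gs (ee \<tau>) * theta_sum D3s \<tau> z) (?S D3s)"
    proof (rule has_sum_cong[THEN iffD1, OF _ coset_fourier_expansion[OF \<tau> as[OF q] Zpar_subset_Zvec, of "5 / 8"]])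
      show "5 / 8 + r \<bullet> r / 2 \<in> \<int>" if "r \<in> D3s" for r
        using that Zpar_subset_Zvec by (intro half_integral_norm) blast
    qed (use part in \<open>auto simp: c_def\<close>)
    have 4: "(?t has_sum ee (of_real (5 / 8) * \<tau>) * Gc (ee \<tau>) * theta_sum D3c \<tau> z) (?S D3c)"
    proof (rule has_sum_cong[THEN iffD1, OF _ coset_fourier_expansion[OF \<tau> ac[OF q] Zpar_subset_Zvec, of "5 / 8"]])
      show "5 / 8 + r \<bullet> r / 2 \<in> \<int>" if "r \<in> D3c" for r
        using that Zpar_subset_Zvec by (intro half_integral_norm) blast
    qed (use part in \<open>auto simp: c_def\<close>)
    have "?S lattice_D3 \<inter> ?S D3v = {}" "?S D3s \<inter> ?S D3c = {}"
      "(?S lattice_D3 \<union> ?S D3v) \<inter> (?S D3s \<union> ?S D3c) = {}" using part(2-4) by auto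
    from has_sum_Un_disjoint[OF has_sum_Un_disjoint[OF 1 2 this(1)] has_sum_Un_disjoint[OF 3 4 this(2)] this(3)]
    have "(?t has_sum (ee (of_real 0 * \<tau>) * G0 (ee \<tau>) * theta_sum lattice_D3 \<tau> z + ee (of_real (1 / 2) * \<tau>) * Gv (ee \<tau>) * theta_sum D3v \<tau> z)
       + (ee (of_real (5 / 8) * \<tau>) * Gs (ee \<tau>) * theta_sum D3s \<tau> z + ee (of_real (5 / 8) * \<tau>) * Gc (ee \<tau>) * theta_sum D3c \<tau> z))
       ((?S lattice_D3 \<union> ?S D3v) \<union> (?S D3s \<union> ?S D3c))" .
    moreover have "(?S lattice_D3 \<union> ?S D3v) \<union> (?S D3s \<union> ?S D3c) = ?S (dual_lattice lattice_D3)"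
      unfolding part(1) by auto
    ultimately show ?thesis
      using \<phi> \<tau> by (simp add: D3_expansion_def algebra_simps)
  qed
  thus ?thesis by (intro exI[of _ c]) auto
qed

lemma jacobi_formsI:
  assumes G: "G0 holomorphic_on ball 0 1" "Gv holomorphic_on ball 0 1" "Gs holomorphic_on ball 0 1" "Gc holomorphic_on ball 0 1"
    and \<phi>: "D3_expansion \<phi> G0 Gv Gs Gc" and zero: "\<And>\<tau> z. Im \<tau> \<le> 0 \<Longrightarrow> \<phi> \<tau> z = 0"
    and inv: "\<And>a b c d. a * d - b * c = 1 \<Longrightarrow> jacobi_invariant k \<phi> a b c d"
  shows "\<phi> \<in> jacobi_forms k lattice_D3"
  unfolding jacobi_forms_def
  using zero D3_expansion_holomorphic[OF G \<phi>] D3_expansion_quasi_periodic[OF \<phi>] D3_expansion_fourier[OF G \<phi>]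
    inv[unfolded jacobi_invariant_def]
  by (intro CollectI conjI) (blast | simp)+

subsection \<open>From Jacobi forms to expansions\<close>

lemma dual_lattice_D3_2: "r \<in> dual_lattice lattice_D3 \<Longrightarrow> 2 * r $ i \<in> \<int>"
proof -
  assume "r \<in> dual_lattice lattice_D3"
  hence "r $ i \<in> \<int> \<or> r $ i - 1 / 2 \<in> \<int>" by (auto simp: dual_lattice_D3 Zvec_def Zs_def)
  thus ?thesis
  proof
    assume "r $ i - 1 / 2 \<in> \<int>"
    hence "2 * (r $ i - 1 / 2) + 1 \<in> \<int>" by (intro Ints_add Ints_mult) auto
    thus ?thesis by simp
  qed auto
qed

context
  fixes k :: int and \<phi> :: "complex \<Rightarrow> complex^3 \<Rightarrow> complex" and c :: "int \<Rightarrow> real^3 \<Rightarrow> complex"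
  assumes \<phi>: "\<phi> \<in> jacobi_forms k lattice_D3"
    and c: "\<And>\<tau> z. Im \<tau> > 0 \<Longrightarrow> ((\<lambda>(m, r). c m r * ee (of_int m * \<tau>) * ee (bil z (cvec r))) has_sum \<phi> \<tau> z)
          {(m, r). r \<in> dual_lattice lattice_D3 \<and> of_int m \<ge> r \<bullet> r / 2}"
begin

text \<open>
  The Fourier coefficient at \<open>r\<close> of \<open>\<phi>\<close> as a function of \<open>z\<close> alone.
\<close>

definition z_coeff :: "complex \<Rightarrow> real^3 \<Rightarrow> complex" where
  "z_coeff \<tau> r = (\<Sum>\<^sub>\<infinity>m\<in>{m. of_int m \<ge> r \<bullet> r / 2}. c m r * ee (of_int m * \<tau>))"

lemma fourier_Sigma:
  assumes "Im \<tau> > 0"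
  shows "((\<lambda>(r, m). c m r * ee (of_int m * \<tau>) * ee (bil z (cvec r))) has_sum \<phi> \<tau> z)
    (Sigma (dual_lattice lattice_D3) (\<lambda>r. {m. of_int m \<ge> r \<bullet> r / 2}))"
  by (rule has_sum_reindex_bij_witness[THEN iffD1, OF _ _ _ _ _ _ c[OF assms, of z],
        of "\<lambda>(m, r). (r, m)" "\<lambda>(r, m). (m, r)"]) auto

lemma coeff_summable:
  assumes \<tau>: "Im \<tau> > 0" and r: "r \<in> dual_lattice lattice_D3"
  shows "(\<lambda>m. c m r * ee (of_int m * \<tau>)) summable_on {m. of_int m \<ge> r \<bullet> r / 2}"
proof -
  have "(\<lambda>(r, m). c m r * ee (of_int m * \<tau>)) summable_on
    (Sigma (dual_lattice lattice_D3) (\<lambda>r. {m. of_int m \<ge> r \<bullet> r / 2}))"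
    using has_sum_imp_summable[OF fourier_Sigma[OF \<tau>, of 0]] by (simp add: bil_def)
  from summable_on_SigmaD1[OF this r] show ?thesis .
qed

lemma z_coeff_has_sum:
  assumes \<tau>: "Im \<tau> > 0"
  shows "((\<lambda>r. z_coeff \<tau> r * ee (bil (cvec r) z)) has_sum \<phi> \<tau> z) (dual_lattice lattice_D3)"
proof (rule has_sum_SigmaD[OF fourier_Sigma[OF \<tau>, of z]])
  fix r :: "real^3" assume r: "r \<in> dual_lattice lattice_D3"
  have "((\<lambda>m. c m r * ee (of_int m * \<tau>) * ee (bil (cvec r) z)) has_sum z_coeff \<tau> r * ee (bil (cvec r) z)) {m. of_int m \<ge> r \<bullet> r / 2}"
    unfolding z_coeff_def by (rule has_sum_cmult_left[OF has_sum_infsum[OF coeff_summable[OF \<tau> r]]])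
  thus "((\<lambda>m. case (r, m) of (r, m) \<Rightarrow> c m r * ee (of_int m * \<tau>) * ee (bil z (cvec r))) has_sum
      z_coeff \<tau> r * ee (bil (cvec r) z)) {m. of_int m \<ge> r \<bullet> r / 2}"
    by (simp add: bil_commute[of z])
qed

lemma z_coeff_abs_summable:
  assumes "Im \<tau> > 0"
  shows "(\<lambda>r. norm (z_coeff \<tau> r)) summable_on dual_lattice lattice_D3"
  using has_sum_imp_summable[OF z_coeff_has_sum[OF assms, of 0]]
  by (simp add: bil_def summable_on_iff_abs_summable_on_complex)

lemma z_coeff_unique:
  assumes \<tau>: "Im \<tau> > 0" and b: "(\<lambda>r. norm (b r)) summable_on dual_lattice lattice_D3"
    and sum: "\<And>z. ((\<lambda>r. b r * ee (bil (cvec r) z)) has_sum \<phi> \<tau> z) (dual_lattice lattice_D3)"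
    and r: "r \<in> dual_lattice lattice_D3"
  shows "z_coeff \<tau> r = b r"
proof -
  have "(\<lambda>r. z_coeff \<tau> r - b r) r = 0"
  proof (rule fourier_unique[OF dual_lattice_D3_2 _ _ r])
    show "(\<lambda>r. norm (z_coeff \<tau> r - b r)) summable_on dual_lattice lattice_D3"
      by (rule summable_on_comparison_test[OF summable_on_add[OF z_coeff_abs_summable[OF \<tau>] b]])
         (auto intro: norm_triangle_ineq4)
    show "((\<lambda>r. (z_coeff \<tau> r - b r) * ee (bil (cvec r) z)) has_sum 0) (dual_lattice lattice_D3)" for z
      using has_sum_add[OF z_coeff_has_sum[OF \<tau>, of z] has_sum_uminusI[OF sum[of z]]] by (simp add: algebra_simps)
  qed
  thus ?thesis by simp
qed

text \<open>
  Comparing coefficients in the quasi-periodicity law: up to the factor given by the norm, the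
  coefficient of \<open>r\<close> depends only on the coset of \<open>r\<close>.
\<close>

lemma z_coeff_translate:
  assumes \<tau>: "Im \<tau> > 0" and r: "r \<in> dual_lattice lattice_D3" and x: "x \<in> lattice_D3"
  shows "z_coeff \<tau> (r + x) = z_coeff \<tau> r * ee (of_real ((r + x) \<bullet> (r + x) / 2 - r \<bullet> r / 2) * \<tau>)"
proof -
  let ?D = "dual_lattice lattice_D3"
  have mem: "s + y \<in> ?D" if "s \<in> ?D" "y \<in> lattice_D3" for s y
  proof -
    have y: "y \<in> Zpar 0 0" using that(2) by (simp add: lattice_D3_eq)
    from that(1) have "s \<in> (Zpar 0 0 \<union> D3v) \<union> (D3s \<union> D3c)"
      unfolding dual_D3_partition(1) unfolding lattice_D3_eq .
    hence "s + y \<in> (Zpar 0 0 \<union> D3v) \<union> (D3s \<union> D3c)"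
      using Zpar_add[OF _ y, of s] by auto
    thus ?thesis unfolding dual_D3_partition(1) unfolding lattice_D3_eq .
  qed
  have x0: "0 \<in> lattice_D3" using even_lattice_D3 by (simp add: even_lattice_def)
  have mx: "- x \<in> lattice_D3" using Zpar_minus[of x 0 0] x by (simp add: lattice_D3_eq)
  have bij: "bij_betw (\<lambda>s. s + x) ?D ?D"
    by (rule bij_betwI[of _ _ _ "\<lambda>s. s + - x"]) (use mem[OF _ x] mem[OF _ mx] in auto)
  define b where "b s = z_coeff \<tau> (s - x) * ee (of_real (s \<bullet> s / 2 - (s - x) \<bullet> (s - x) / 2) * \<tau>)" for s
  have sum: "((\<lambda>s. b s * ee (bil (cvec s) z)) has_sum \<phi> \<tau> z) ?D" for z
  proof -
    define e where "e = ee (\<tau> * of_real (x \<bullet> x / 2) + bil (cvec x) z)"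
    have "\<phi> \<tau> (z + \<tau> *s cvec x + cvec 0) * e = \<phi> \<tau> z"
      using \<phi> \<tau> x x0 unfolding jacobi_forms_def e_def by blast
    hence "((\<lambda>s. z_coeff \<tau> s * ee (bil (cvec s) (z + \<tau> *s cvec x + cvec 0)) * e) has_sum \<phi> \<tau> z) ?D"
      using has_sum_cmult_left[OF z_coeff_has_sum[OF \<tau>, of "z + \<tau> *s cvec x + cvec 0"], of e] by simp
    moreover have "z_coeff \<tau> s * ee (bil (cvec s) (z + \<tau> *s cvec x + cvec 0)) * e = b (s + x) * ee (bil (cvec (s + x)) z)" for s
    proof -
      have "bil (cvec s) (z + \<tau> *s cvec x + cvec 0) + (\<tau> * of_real (x \<bullet> x / 2) + bil (cvec x) z) =
          of_real ((s + x) \<bullet> (s + x) / 2 - s \<bullet> s / 2) * \<tau> + bil (cvec (s + x)) z"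
        by (simp add: cvec_add bil_add bil_scale_right bil_cvec inner_add_left inner_add_right inner_commute[of x s] field_simps)
      hence "ee (bil (cvec s) (z + \<tau> *s cvec x + cvec 0)) * e = ee (of_real ((s + x) \<bullet> (s + x) / 2 - s \<bullet> s / 2) * \<tau>) * ee (bil (cvec (s + x)) z)"
        unfolding e_def ee_add[symmetric] by simp
      thus ?thesis by (simp add: b_def mult.assoc)
    qed
    ultimately have "((\<lambda>s. b (s + x) * ee (bil (cvec (s + x)) z)) has_sum \<phi> \<tau> z) ?D" by simp
    thus ?thesis using has_sum_reindex_bij_betw[OF bij, of "\<lambda>s. b s * ee (bil (cvec s) z)"] by simp
  qed
  have "(\<lambda>s. norm (b s)) summable_on ?D"
    using has_sum_imp_summable[OF sum[of 0]] by (simp add: bil_def summable_on_iff_abs_summable_on_complex)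
  from z_coeff_unique[OF \<tau> this sum mem[OF r x]] show ?thesis by (simp add: b_def)
qed

text \<open>
  The matrix \<open>-1\<close> fixes \<open>\<tau>\<close> and has automorphy factor \<open>(-1)^k\<close>.
\<close>

lemma phi_minus:
  assumes \<tau>: "Im \<tau> > 0"
  shows "\<phi> \<tau> (- z) = (if even k then 1 else - 1) * \<phi> \<tau> z"
proof -
  have inv: "\<forall>a b c d :: int. \<forall>\<tau>\<in>upper_half_plane. \<forall>z. a * d - b * c = 1 \<longrightarrow>
        \<phi> ((of_int a * \<tau> + of_int b) / (of_int c * \<tau> + of_int d)) ((1 / (of_int c * \<tau> + of_int d)) *s z)
          * ee (- of_int c * (bil z z / 2) / (of_int c * \<tau> + of_int d))
          * (of_int c * \<tau> + of_int d) powi (- k) = \<phi> \<tau> z"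
    using \<phi> unfolding jacobi_forms_def by blast
  have "(- 1) *s z = - z" by (simp add: vec_eq_iff)
  hence "\<phi> \<tau> (- z) * (- 1) powi (- k) = \<phi> \<tau> z"
    using inv[rule_format, of \<tau> "- 1" "- 1" 0 0 z] \<tau> by simp
  moreover have "(- 1 :: complex) powi (- k) = (if even k then 1 else - 1)"
    by (simp add: power_int_minus_left)
  ultimately show ?thesis by (cases "even k") (simp_all add: minus_equation_iff)
qed

lemma z_coeff_minus:
  assumes \<tau>: "Im \<tau> > 0" and r: "r \<in> dual_lattice lattice_D3"
  shows "z_coeff \<tau> (- r) = (if even k then 1 else - 1) * z_coeff \<tau> r"
proof -
  let ?D = "dual_lattice lattice_D3"
  define e where "e = (if even k then 1 else - 1 :: complex)"
  have e2: "e * e = 1" by (simp add: e_def)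
  have mem: "- s \<in> ?D" if "s \<in> ?D" for s
  proof -
    have "(- s) \<bullet> x \<in> \<int>" if "s \<bullet> x \<in> \<int>" for x using that by simp
    moreover have "\<exists>m::nat. m > 0 \<and> real m *\<^sub>R (- s) \<in> lattice_D3" if "\<exists>m::nat. m > 0 \<and> real m *\<^sub>R s \<in> lattice_D3"
      using that Zpar_minus[of _ 0 0] by (auto simp: lattice_D3_eq)
    ultimately show ?thesis using \<open>s \<in> ?D\<close> by (simp add: dual_lattice_def)
  qed
  have bij: "bij_betw uminus ?D ?D"
    by (rule bij_betwI[of _ _ _ uminus]) (use mem in auto)
  define b where "b s = e * z_coeff \<tau> (- s)" for s
  have sum: "((\<lambda>s. b s * ee (bil (cvec s) z)) has_sum \<phi> \<tau> z) ?D" for z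
  proof -
    have "((\<lambda>s. e * (z_coeff \<tau> s * ee (bil (cvec s) (- z)))) has_sum e * \<phi> \<tau> (- z)) ?D"
      by (rule has_sum_cmult_right[OF z_coeff_has_sum[OF \<tau>, of "- z"]])
    moreover have "e * \<phi> \<tau> (- z) = \<phi> \<tau> z"
      unfolding phi_minus[OF \<tau>] e_def[symmetric] mult.assoc[symmetric] e2 by simp
    ultimately have "((\<lambda>s. b (- s) * ee (bil (cvec (- s)) z)) has_sum \<phi> \<tau> z) ?D"
      by (simp add: b_def cvec_add bil_minus mult.assoc)
    thus ?thesis using has_sum_reindex_bij_betw[OF bij, of "\<lambda>s. b s * ee (bil (cvec s) z)"] by simp
  qed
  have "(\<lambda>s. norm (b s)) summable_on ?D"
    using has_sum_imp_summable[OF sum[of 0]] by (simp add: bil_def summable_on_iff_abs_summable_on_complex)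
  from z_coeff_unique[OF \<tau> this sum r] have "z_coeff \<tau> r = e * z_coeff \<tau> (- r)" by (simp add: b_def)
  hence "e * z_coeff \<tau> r = (e * e) * z_coeff \<tau> (- r)" by (simp add: mult.assoc)
  thus ?thesis unfolding e2 by (simp add: e_def)
qed

text \<open>
  The exponents \<open>m\<close> that occur are bounded below by the half norm of \<open>r\<close>, so a power of \<open>q\<close> splits off and
  a convergent power series remains.
\<close>

lemma z_coeff_power_series:
  fixes N :: nat
  assumes r: "r \<in> dual_lattice lattice_D3" and N: "\<And>m::int. of_int m \<ge> r \<bullet> r / 2 \<longleftrightarrow> m \<ge> int N"
  obtains G where "G holomorphic_on ball 0 1" "\<And>\<tau>. Im \<tau> > 0 \<Longrightarrow> z_coeff \<tau> r = ee \<tau> ^ N * G (ee \<tau>)"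
proof -
  define G where "G x = (\<Sum>n. c (int N + int n) r * x ^ n)" for x
  have bij: "bij_betw (\<lambda>n. int N + int n) UNIV {m. m \<ge> int N}"
    by (rule bij_betwI[of _ _ _ "\<lambda>m. nat (m - int N)"]) auto
  have sums: "(\<lambda>n. c (int N + int n) r * ee \<tau> ^ n) sums (z_coeff \<tau> r / ee \<tau> ^ N)" if \<tau>: "Im \<tau> > 0" for \<tau>
  proof -
    have "((\<lambda>m. c m r * ee (of_int m * \<tau>)) has_sum z_coeff \<tau> r) {m. m \<ge> int N}"
      using has_sum_infsum[OF coeff_summable[OF \<tau> r]] by (simp only: z_coeff_def N)
    hence "((\<lambda>n. c (int N + int n) r * ee (of_int (int N + int n) * \<tau>)) has_sum z_coeff \<tau> r) UNIV"
      using has_sum_reindex_bij_betw[OF bij, of "\<lambda>m. c m r * ee (of_int m * \<tau>)"] by simp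
    hence "((\<lambda>n. c (int N + int n) r * ee (of_int (int N + int n) * \<tau>) * inverse (ee \<tau> ^ N)) has_sum z_coeff \<tau> r * inverse (ee \<tau> ^ N)) UNIV"
      by (rule has_sum_cmult_left)
    moreover have "ee (of_int (int N + int n) * \<tau>) * inverse (ee \<tau> ^ N) = ee \<tau> ^ n" for n
    proof -
      have "of_int (int N + int n) * \<tau> = of_nat (N + n) * \<tau>" by simp
      hence "ee (of_int (int N + int n) * \<tau>) = ee \<tau> ^ N * ee \<tau> ^ n" by (simp only: ee_of_nat_mult power_add)
      thus ?thesis by simp
    qed
    ultimately have "((\<lambda>n. c (int N + int n) r * ee \<tau> ^ n) has_sum z_coeff \<tau> r / ee \<tau> ^ N) UNIV"
      by (simp only: mult.assoc divide_inverse)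
    thus ?thesis by (rule has_sum_imp_sums)
  qed
  show thesis
  proof (rule that)
    have "(\<lambda>n. c (int N + int n) r * x ^ n) sums G x" if x: "norm x < 1" for x
    proof (cases "x = 0")
      case True
      thus ?thesis using powser_sums_zero[of "\<lambda>n. c (int N + int n) r"] by (simp add: G_def)
    next
      case False
      then obtain \<tau> where \<tau>: "ee \<tau> = x" by (rule ee_surj)
      hence "Im \<tau> > 0" using x norm_ee_less_1[of \<tau>] by simp
      from sums[OF this] show ?thesis by (simp add: \<tau> G_def sums_iff)
    qed
    thus "G holomorphic_on ball 0 1"
      by (intro power_series_holomorphic[of _ _ "\<lambda>n. c (int N + int n) r"]) simp
    show "z_coeff \<tau> r = ee \<tau> ^ N * G (ee \<tau>)" if "Im \<tau> > 0" for \<tau>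
      using sums[OF that] by (simp add: G_def sums_iff)
  qed
qed

text \<open>
  By translation, one representative of a coset determines the coefficients at all its vectors; what
  remains is the theta series of the coset.
\<close>

lemma coset_component:
  fixes N :: nat
  assumes r0: "r0 \<in> Zpar a b" and sub: "Zpar a b \<subseteq> dual_lattice lattice_D3"
    and G: "\<forall>\<tau>. Im \<tau> > 0 \<longrightarrow> z_coeff \<tau> r0 = ee \<tau> ^ N * G (ee \<tau>)" and \<tau>: "Im \<tau> > 0"
  shows "r \<in> Zpar a b \<Longrightarrow> z_coeff \<tau> r = ee (of_real (real N - r0 \<bullet> r0 / 2) * \<tau>) * G (ee \<tau>) * ee (of_real (r \<bullet> r / 2) * \<tau>)"
    and "((\<lambda>r. z_coeff \<tau> r * ee (bil (cvec r) z)) has_sum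
      ee (of_real (real N - r0 \<bullet> r0 / 2) * \<tau>) * G (ee \<tau>) * theta_sum (Zpar a b) \<tau> z) (Zpar a b)"
proof -
  have 1: "z_coeff \<tau> r = ee (of_real (real N - r0 \<bullet> r0 / 2) * \<tau>) * G (ee \<tau>) * ee (of_real (r \<bullet> r / 2) * \<tau>)"
    if r: "r \<in> Zpar a b" for r
  proof -
    have x: "r - r0 \<in> lattice_D3"
      using Zpar_add[OF r Zpar_minus[OF r0]] by (simp add: lattice_D3_eq)
    have "z_coeff \<tau> r = z_coeff \<tau> r0 * ee (of_real (r \<bullet> r / 2 - r0 \<bullet> r0 / 2) * \<tau>)"
      using z_coeff_translate[OF \<tau> _ x, of r0] r0 sub by auto
    also have "\<dots> = G (ee \<tau>) * ee (of_nat N * \<tau> + of_real (r \<bullet> r / 2 - r0 \<bullet> r0 / 2) * \<tau>)"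
      by (simp add: G[rule_format, OF \<tau>] ee_add ee_of_nat_mult)
    also have "of_nat N * \<tau> + of_real (r \<bullet> r / 2 - r0 \<bullet> r0 / 2) * \<tau> =
        of_real (real N - r0 \<bullet> r0 / 2) * \<tau> + of_real (r \<bullet> r / 2) * \<tau>"
      by (simp add: algebra_simps)
    finally show ?thesis by (simp add: ee_add mult_ac)
  qed
  thus "r \<in> Zpar a b \<Longrightarrow> z_coeff \<tau> r = ee (of_real (real N - r0 \<bullet> r0 / 2) * \<tau>) * G (ee \<tau>) * ee (of_real (r \<bullet> r / 2) * \<tau>)" .
  have "((\<lambda>r. ee (of_real (real N - r0 \<bullet> r0 / 2) * \<tau>) * G (ee \<tau>) * lattice_term \<tau> z r) has_sum
      ee (of_real (real N - r0 \<bullet> r0 / 2) * \<tau>) * G (ee \<tau>) * theta_sum (Zpar a b) \<tau> z) (Zpar a b)"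
    by (rule has_sum_cmult_right[OF lattice_term_has_sum[OF \<tau> Zpar_subset_Zvec]])
  also have "?this \<longleftrightarrow> ((\<lambda>r. z_coeff \<tau> r * ee (bil (cvec r) z)) has_sum
      ee (of_real (real N - r0 \<bullet> r0 / 2) * \<tau>) * G (ee \<tau>) * theta_sum (Zpar a b) \<tau> z) (Zpar a b)"
    by (rule has_sum_cong) (simp add: 1 lattice_term_def mult.assoc)
  finally show "((\<lambda>r. z_coeff \<tau> r * ee (bil (cvec r) z)) has_sum
      ee (of_real (real N - r0 \<bullet> r0 / 2) * \<tau>) * G (ee \<tau>) * theta_sum (Zpar a b) \<tau> z) (Zpar a b)" .
qed

text \<open>
  The negative of a vector lies in the same coset if the vector is integral and in the other
  half-integral coset otherwise. Hence the two half-integral components agree up to the sign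
  \<open>(-1)^k\<close>, and in odd weight the integral components vanish.
\<close>

lemma jacobi_form_expansion:
  obtains G0 Gv Gs where "G0 holomorphic_on ball 0 1" "Gv holomorphic_on ball 0 1" "Gs holomorphic_on ball 0 1"
    "if even k then D3_expansion \<phi> G0 Gv Gs Gs else D3_expansion \<phi> (\<lambda>_. 0) (\<lambda>_. 0) Gs (\<lambda>x. - Gs x)"
proof -
  \<comment> \<open>vectors of minimal norm in the nontrivial cosets\<close>
  define rv :: "real^3" where "rv = vector [1, 0, 0]"
  define rs :: "real^3" where "rs = vector [1 / 2, 1 / 2, 1 / 2]"
  define rc :: "real^3" where "rc = vector [1 / 2, 1 / 2, - 1 / 2]"
  note defs = Zpar_def Zvec_def Zs_def forall_3 sum_3
  have m0: "0 \<in> Zpar 0 (0::real)" by (simp add: Zpar_def Zvec_def Zs_def)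
  have mv: "rv \<in> D3v" and ms: "rs \<in> D3s" and mc: "rc \<in> D3c"
    by (simp_all add: defs rv_def rs_def rc_def)
  have sub: "Zpar 0 0 \<subseteq> dual_lattice lattice_D3" "D3v \<subseteq> dual_lattice lattice_D3"
    "D3s \<subseteq> dual_lattice lattice_D3" "D3c \<subseteq> dual_lattice lattice_D3"
    by (simp only: dual_D3_partition(1)[unfolded lattice_D3_eq] lattice_D3_eq, blast)+
  have nv: "rv \<bullet> rv / 2 = 1 / 2" and ns: "rs \<bullet> rs / 2 = 3 / 8" and nc: "rc \<bullet> rc / 2 = 3 / 8"
    by (simp_all add: inner_vec_def sum_3 rv_def rs_def rc_def)
  have int1: "t \<le> real_of_int m \<longleftrightarrow> m \<ge> int 1" if "0 < t" "t \<le> 1" for t m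
  proof
    assume "t \<le> real_of_int m"
    hence "real_of_int m > 0" using that by linarith
    thus "m \<ge> int 1" by simp
  next
    assume "m \<ge> int 1"
    hence "real_of_int m \<ge> 1" by simp
    thus "t \<le> real_of_int m" using that by linarith
  qed
  obtain G0 where G0: "G0 holomorphic_on ball 0 1" "\<forall>\<tau>. Im \<tau> > 0 \<longrightarrow> z_coeff \<tau> 0 = ee \<tau> ^ 0 * G0 (ee \<tau>)"
    using z_coeff_power_series[of 0 0] m0 sub(1) by auto
  obtain Gv where Gv: "Gv holomorphic_on ball 0 1" "\<forall>\<tau>. Im \<tau> > 0 \<longrightarrow> z_coeff \<tau> rv = ee \<tau> ^ 1 * Gv (ee \<tau>)"
    using z_coeff_power_series[of rv 1] mv sub(2) int1[of "1 / 2"] unfolding nv by auto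
  obtain Gs where Gs: "Gs holomorphic_on ball 0 1" "\<forall>\<tau>. Im \<tau> > 0 \<longrightarrow> z_coeff \<tau> rs = ee \<tau> ^ 1 * Gs (ee \<tau>)"
    using z_coeff_power_series[of rs 1] ms sub(3) int1[of "3 / 8"] unfolding ns by auto
  obtain Gc where Gc: "Gc holomorphic_on ball 0 1" "\<forall>\<tau>. Im \<tau> > 0 \<longrightarrow> z_coeff \<tau> rc = ee \<tau> ^ 1 * Gc (ee \<tau>)"
    using z_coeff_power_series[of rc 1] mc sub(4) int1[of "3 / 8"] unfolding nc by auto
  have s: "of_real (real 1 - rv \<bullet> rv / 2) * \<tau> = \<tau> / 2" "of_real (real 1 - rs \<bullet> rs / 2) * \<tau> = 5 * \<tau> / 8"
    "of_real (real 1 - rc \<bullet> rc / 2) * \<tau> = 5 * \<tau> / 8" for \<tau> :: complex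
    unfolding nv ns nc by simp_all
  have s0: "of_real (real 0 - 0 \<bullet> (0 :: real^3) / 2) * \<tau> = 0" for \<tau> :: complex by simp
  note comp0 = coset_component[OF m0 sub(1) G0(2), unfolded s0 ee_0 mult_1_left]
  note compv = coset_component[OF mv sub(2) Gv(2), unfolded s]
  note comps = coset_component[OF ms sub(3) Gs(2), unfolded s]
  note compc = coset_component[OF mc sub(4) Gc(2), unfolded s]
  have D: "D3_expansion \<phi> G0 Gv Gs Gc"
    unfolding D3_expansion_def
  proof (intro allI impI)
    fix \<tau> z assume \<tau>: "Im \<tau> > 0"
    note part = dual_D3_partition[unfolded lattice_D3_eq]
    from has_sum_Un_disjoint[OF has_sum_Un_disjoint[OF comp0(2)[OF \<tau>] compv(2)[OF \<tau>] part(2)]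
        has_sum_Un_disjoint[OF comps(2)[OF \<tau>] compc(2)[OF \<tau>] part(3)] part(4)]
    have "((\<lambda>r. z_coeff \<tau> r * ee (bil (cvec r) z)) has_sum
       (G0 (ee \<tau>) * theta_sum (Zpar 0 0) \<tau> z + ee (\<tau> / 2) * Gv (ee \<tau>) * theta_sum D3v \<tau> z) +
       (ee (5 * \<tau> / 8) * Gs (ee \<tau>) * theta_sum D3s \<tau> z + ee (5 * \<tau> / 8) * Gc (ee \<tau>) * theta_sum D3c \<tau> z))
       (dual_lattice lattice_D3)"
      unfolding dual_D3_partition(1) unfolding lattice_D3_eq .
    from has_sum_unique[OF z_coeff_has_sum[OF \<tau>] this]
    show "\<phi> \<tau> z = G0 (ee \<tau>) * theta_sum lattice_D3 \<tau> z + ee (\<tau> / 2) * Gv (ee \<tau>) * theta_sum D3v \<tau> z +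
     ee (5 * \<tau> / 8) * (Gs (ee \<tau>) * theta_sum D3s \<tau> z + Gc (ee \<tau>) * theta_sum D3c \<tau> z)"
      by (simp add: lattice_D3_eq algebra_simps)
  qed
  define e where "e = (if even k then 1 else - 1 :: complex)"
  have par: "z_coeff \<tau> (- r) = e * z_coeff \<tau> r" if "Im \<tau> > 0" "r \<in> dual_lattice lattice_D3" for \<tau> r
    using z_coeff_minus[OF that] by (simp add: e_def)
  have eqs: "Gc (ee \<tau>) = e * Gs (ee \<tau>)" "G0 (ee \<tau>) = e * G0 (ee \<tau>)" "Gv (ee \<tau>) = e * Gv (ee \<tau>)" if \<tau>: "Im \<tau> > 0" for \<tau>
  proof -
    have "- rs \<in> D3c" "- rv \<in> D3v" by (simp_all add: defs rs_def rv_def)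
    have "z_coeff \<tau> (- rs) = e * z_coeff \<tau> rs" "z_coeff \<tau> (- rv) = e * z_coeff \<tau> rv" "z_coeff \<tau> (- 0) = e * z_coeff \<tau> 0"
      by (rule par[OF \<tau>], use ms mv m0 sub in blast)+
    note this[unfolded comps(1)[OF \<tau> ms] compc(1)[OF \<tau> \<open>- rs \<in> D3c\<close>] compv(1)[OF \<tau> \<open>- rv \<in> D3v\<close>] compv(1)[OF \<tau> mv]]
    thus "Gc (ee \<tau>) = e * Gs (ee \<tau>)" "Gv (ee \<tau>) = e * Gv (ee \<tau>)" "G0 (ee \<tau>) = e * G0 (ee \<tau>)"
      using G0(2) \<tau> by simp_all
  qed
  show thesis
  proof (rule that[OF G0(1) Gv(1) Gs(1)])
    show "if even k then D3_expansion \<phi> G0 Gv Gs Gs else D3_expansion \<phi> (\<lambda>_. 0) (\<lambda>_. 0) Gs (\<lambda>x. - Gs x)"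
    proof (cases "even k")
      case True
      hence "e = 1" by (simp add: e_def)
      thus ?thesis using D True eqs(1) unfolding D3_expansion_def by simp
    next
      case False
      hence e: "e = - 1" by (simp add: e_def)
      have "Gc (ee \<tau>) = - Gs (ee \<tau>)" "G0 (ee \<tau>) = 0" "Gv (ee \<tau>) = 0" if "Im \<tau> > 0" for \<tau>
        using eqs[OF that] by (simp_all add: e eq_neg_iff_add_eq_0)
      thus ?thesis using D False unfolding D3_expansion_def by simp
    qed
  qed
qed

end

section \<open>Theta components and the heat operator\<close>

lemma theta_D3_independent:
  assumes \<tau>: "Im \<tau> > 0"
    and zero: "\<And>z. d0 * theta_sum lattice_D3 \<tau> z + dv * theta_sum D3v \<tau> z + ds * theta_sum D3s \<tau> z + dc * theta_sum D3c \<tau> z = 0"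
  shows "d0 = 0" "dv = 0" "ds = 0" "dc = 0"
proof -
  note part = dual_D3_partition
  define d where "d r = (if r \<in> lattice_D3 then d0 else if r \<in> D3v then dv else if r \<in> D3s then ds else dc)" for r
  define a where "a r = d r * ee (of_real (r \<bullet> r / 2) * \<tau>)" for r
  have sum: "((\<lambda>r. a r * ee (bil (cvec r) z)) has_sum 0) (dual_lattice lattice_D3)" for z
  proof -
    let ?t = "\<lambda>r. a r * ee (bil (cvec r) z)"
    have piece: "(?t has_sum e * theta_sum X \<tau> z) X" if X: "X \<subseteq> Zvec b" and d: "\<And>r. r \<in> X \<Longrightarrow> d r = e" for X b e
    proof -
      have "((\<lambda>r. e * lattice_term \<tau> z r) has_sum e * theta_sum X \<tau> z) X"
        by (rule has_sum_cmult_right[OF lattice_term_has_sum[OF \<tau> X]])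
      also have "?this \<longleftrightarrow> ?thesis"
        by (rule has_sum_cong) (simp add: a_def d lattice_term_def mult.assoc)
      finally show ?thesis .
    qed
    have L: "lattice_D3 \<subseteq> Zvec 0" unfolding lattice_D3_eq by (rule Zpar_subset_Zvec)
    have p: "(?t has_sum d0 * theta_sum lattice_D3 \<tau> z) lattice_D3" "(?t has_sum dv * theta_sum D3v \<tau> z) D3v"
      "(?t has_sum ds * theta_sum D3s \<tau> z) D3s" "(?t has_sum dc * theta_sum D3c \<tau> z) D3c"
      by (rule piece[OF L] piece[OF Zpar_subset_Zvec], use part in \<open>auto simp: d_def\<close>)+
    from has_sum_Un_disjoint[OF has_sum_Un_disjoint[OF p(1,2) part(2)] has_sum_Un_disjoint[OF p(3,4) part(3)] part(4)]
    show ?thesis unfolding part(1) using zero[of z] by (simp add: add.assoc)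
  qed
  have summ: "(\<lambda>r. norm (a r)) summable_on dual_lattice lattice_D3"
    using has_sum_imp_summable[OF sum[of 0]] by (simp add: bil_def summable_on_iff_abs_summable_on_complex)
  have "a r = 0" if "r \<in> dual_lattice lattice_D3" for r
    by (rule fourier_unique[OF dual_lattice_D3_2 summ sum that])
  hence d: "d r = 0" if "r \<in> dual_lattice lattice_D3" for r
    using that by (simp add: a_def)
  note defs = Zpar_def Zvec_def Zs_def forall_3 sum_3
  have m: "0 \<in> lattice_D3" "vector [1, 0, 0] \<in> D3v" "vector [1 / 2, 1 / 2, 1 / 2] \<in> D3s" "vector [1 / 2, 1 / 2, - 1 / 2] \<in> D3c"
    by (simp_all add: lattice_D3_eq defs)
  show "d0 = 0" using d[of 0] m(1) part(1) by (auto simp: d_def)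
  show "dv = 0" using d[of "vector [1, 0, 0]"] m(2) part by (auto simp: d_def split: if_splits)
  show "ds = 0" using d[of "vector [1 / 2, 1 / 2, 1 / 2]"] m(3) part by (auto simp: d_def split: if_splits)
  show "dc = 0" using d[of "vector [1 / 2, 1 / 2, - 1 / 2]"] m(4) part by (auto simp: d_def split: if_splits)
qed

lemma discriminant_cosets_D3: "discriminant_cosets lattice_D3 = {lattice_D3, D3v, D3s, D3c}"
proof -
  have coset: "(+) r ` lattice_D3 = Zpar a b" if r: "r \<in> Zpar a b" for r :: "real^3" and a b
  proof (intro equalityI subsetI)
    fix x assume "x \<in> (+) r ` lattice_D3"
    then obtain y where "y \<in> Zpar 0 0" "x = r + y" by (auto simp: lattice_D3_eq)
    thus "x \<in> Zpar a b" using Zpar_add[OF r, of y 0 0] by simp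
  next
    fix x :: "real^3" assume "x \<in> Zpar a b"
    hence "x - r \<in> lattice_D3" using Zpar_add[OF _ Zpar_minus[OF r], of x a b] by (simp add: lattice_D3_eq)
    thus "x \<in> (+) r ` lattice_D3" by (intro image_eqI[of _ _ "x - r"]) auto
  qed
  note defs = Zpar_def Zvec_def Zs_def forall_3 sum_3
  have m: "0 \<in> Zpar 0 (0::real)" "vector [1, 0, 0] \<in> D3v" "vector [1 / 2, 1 / 2, 1 / 2] \<in> D3s" "vector [1 / 2, 1 / 2, - 1 / 2] \<in> D3c"
    by (simp_all add: defs)
  have "(\<lambda>r. (+) r ` lattice_D3) ` Zpar a b = {Zpar a b}" if "r \<in> Zpar a b" for a b and r :: "real^3"
    using coset that by (auto intro!: image_eqI[of _ _ r])
  note im = this[OF m(1), folded lattice_D3_eq] this[OF m(2)] this[OF m(3)] this[OF m(4)]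
  show ?thesis unfolding discriminant_cosets_def dual_D3_partition(1) image_Un im by auto
qed

lemma D3_cosets_distinct: "lattice_D3 \<noteq> D3v" "lattice_D3 \<noteq> D3s" "lattice_D3 \<noteq> D3c" "D3v \<noteq> D3s" "D3v \<noteq> D3c" "D3s \<noteq> D3c"
proof -
  note defs = Zpar_def Zvec_def Zs_def forall_3 sum_3
  have m: "0 \<in> lattice_D3" "vector [1, 0, 0] \<in> D3v" "vector [1 / 2, 1 / 2, 1 / 2] \<in> D3s"
    by (simp_all add: lattice_D3_eq defs)
  thus "lattice_D3 \<noteq> D3v" "lattice_D3 \<noteq> D3s" "lattice_D3 \<noteq> D3c" "D3v \<noteq> D3s" "D3v \<noteq> D3c" "D3s \<noteq> D3c"
    using dual_D3_partition(2-4) by blast+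
qed

lemma sum_D3_cosets:
  "(\<Sum>X\<in>discriminant_cosets lattice_D3. f X) = f lattice_D3 + f D3v + f D3s + f D3c" for f :: "_ \<Rightarrow> complex"
  unfolding discriminant_cosets_D3 using D3_cosets_distinct by (simp add: add.assoc)

text \<open>
  The heat operator is defined through a choice of components; by linear independence of the four
  theta series the chosen components agree with any given ones on the upper half plane.
\<close>

lemma heat_delta_D3:
  assumes h: "h0 holomorphic_on upper_half_plane" "hv holomorphic_on upper_half_plane"
      "hs holomorphic_on upper_half_plane" "hc holomorphic_on upper_half_plane"
    and \<phi>: "\<And>\<tau> z. Im \<tau> > 0 \<Longrightarrow> \<phi> \<tau> z = h0 \<tau> * theta_sum lattice_D3 \<tau> z + hv \<tau> * theta_sum D3v \<tau> z
        + hs \<tau> * theta_sum D3s \<tau> z + hc \<tau> * theta_sum D3c \<tau> z"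
    and \<tau>: "Im \<tau> > 0"
  shows "heat_delta 4 lattice_D3 \<phi> \<tau> z =
    (deriv h0 \<tau> * theta_sum lattice_D3 \<tau> z + deriv hv \<tau> * theta_sum D3v \<tau> z
      + deriv hs \<tau> * theta_sum D3s \<tau> z + deriv hc \<tau> * theta_sum D3c \<tau> z) / (2 * of_real pi * \<i>)
    - 5 / 24 * E2 \<tau> * \<phi> \<tau> z"
proof -
  define H where "H X = (if X = lattice_D3 then h0 else if X = D3v then hv else if X = D3s then hs else hc)" for X
  have H: "H lattice_D3 = h0" "H D3v = hv" "H D3s = hs" "H D3c = hc"
    using D3_cosets_distinct by (auto simp: H_def)
  have "is_theta_decomposition lattice_D3 \<phi> H"
    unfolding is_theta_decomposition_def sum_D3_cosets H using \<phi> h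
    by (auto simp: discriminant_cosets_D3 H)
  hence "is_theta_decomposition lattice_D3 \<phi> (theta_components lattice_D3 \<phi>)"
    unfolding theta_components_def by (rule someI[where P = "is_theta_decomposition lattice_D3 \<phi>"])
  hence C: "\<phi> \<tau> z = theta_components lattice_D3 \<phi> lattice_D3 \<tau> * theta_sum lattice_D3 \<tau> z
      + theta_components lattice_D3 \<phi> D3v \<tau> * theta_sum D3v \<tau> z
      + theta_components lattice_D3 \<phi> D3s \<tau> * theta_sum D3s \<tau> z
      + theta_components lattice_D3 \<phi> D3c \<tau> * theta_sum D3c \<tau> z" if "Im \<tau> > 0" for \<tau> z
    using that unfolding is_theta_decomposition_def sum_D3_cosets by simp
  let ?C = "theta_components lattice_D3 \<phi>"
  have eq: "?C lattice_D3 \<tau> = h0 \<tau>" "?C D3v \<tau> = hv \<tau>" "?C D3s \<tau> = hs \<tau>" "?C D3c \<tau> = hc \<tau>" if \<tau>: "Im \<tau> > 0" for \<tau>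
  proof -
    have "(?C lattice_D3 \<tau> - h0 \<tau>) * theta_sum lattice_D3 \<tau> z + (?C D3v \<tau> - hv \<tau>) * theta_sum D3v \<tau> z
      + (?C D3s \<tau> - hs \<tau>) * theta_sum D3s \<tau> z + (?C D3c \<tau> - hc \<tau>) * theta_sum D3c \<tau> z = 0" for z
      using C[OF \<tau>, of z] \<phi>[OF \<tau>, of z] by (simp add: algebra_simps)
    from theta_D3_independent[OF \<tau> this]
    show "?C lattice_D3 \<tau> = h0 \<tau>" "?C D3v \<tau> = hv \<tau>" "?C D3s \<tau> = hs \<tau>" "?C D3c \<tau> = hc \<tau>" by simp_all
  qed
  have "deriv f \<tau> = deriv g \<tau>" if "\<And>\<tau>. Im \<tau> > 0 \<Longrightarrow> f \<tau> = g \<tau>" for f g :: "complex \<Rightarrow> complex"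
  proof (rule deriv_cong_ev)
    show "\<forall>\<^sub>F x in nhds \<tau>. f x = g x"
      using eventually_nhds_in_open[OF open_upper_half_plane, of \<tau>] \<tau> that by (auto elim!: eventually_mono)
  qed simp
  note d = this[of "?C lattice_D3" h0] this[of "?C D3v" hv] this[of "?C D3s" hs] this[of "?C D3c" hc]
  show ?thesis
    unfolding heat_delta_def sum_D3_cosets using \<tau> eq d
    by (simp add: add_divide_distrib)
qed

section \<open>The generators\<close>

definition nome_data :: "(complex \<Rightarrow> complex) \<Rightarrow> (complex \<Rightarrow> complex) \<Rightarrow> bool" where
  "nome_data T U \<longleftrightarrow> T holomorphic_on ball 0 1 \<and> U holomorphic_on ball 0 1 \<and> T 0 = 1 \<and> deriv T 0 = 2 \<and> U 0 = 2 \<and>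
     (\<forall>\<tau>. Im \<tau> > 0 \<longrightarrow> t3 \<tau> = T (ee (\<tau> / 2)) \<and> t4 \<tau> = T (- ee (\<tau> / 2)) \<and> t2 \<tau> = ee (\<tau> / 8) * U (ee \<tau>))"

lemma nome_data_exists: obtains T U where "nome_data T U"
proof -
  obtain T where T: "T holomorphic_on ball 0 1" "T 0 = 1" "deriv T 0 = 2"
    "\<And>\<tau>. Im \<tau> > 0 \<Longrightarrow> Th 0 0 \<tau> 0 = T (ee (\<tau> / 2))"
    "\<And>\<tau>. Im \<tau> > 0 \<Longrightarrow> Th 0 0 \<tau> (1 / 2) = T (- ee (\<tau> / 2))"
    using Th_3_4_nome by blast
  obtain U where U: "U holomorphic_on ball 0 1" "U 0 = 2"
    "\<And>\<tau>. Im \<tau> > 0 \<Longrightarrow> Th (1 / 2) 0 \<tau> 0 = ee (\<tau> / 8) * U (ee \<tau>)"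
    using Th_2_nome by blast
  have "nome_data T U" unfolding nome_data_def using T U by blast
  thus thesis by (rule that)
qed

lemma ee_half_square: "(ee (\<tau> / 2))\<^sup>2 = ee \<tau>"
  using ee_of_nat_mult[of 2 "\<tau> / 2"] by simp

lemma norm_ee_half: "Im \<tau> > 0 \<Longrightarrow> norm (ee (\<tau> / 2)) < 1"
  by simp

lemma A_eq_theta:
  assumes "Im \<tau> > 0"
  shows "A3 \<tau> z = theta_sum lattice_D3 \<tau> z + theta_sum D3v \<tau> z"
    "A4 \<tau> z = theta_sum lattice_D3 \<tau> z - theta_sum D3v \<tau> z"
    "A2 \<tau> z = theta_sum D3s \<tau> z + theta_sum D3c \<tau> z"
    "\<i> * A1 \<tau> z = theta_sum D3s \<tau> z - theta_sum D3c \<tau> z"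
  using assms by (simp_all add: theta_D3 field_simps)

text \<open>
  The integral components are the even and odd parts of the fifth power of the series that represents
  \<open>t3\<close> and \<open>t4\<close>.
\<close>

lemma jacobi_E4_D3_expansion:
  obtains G0 Gv Gs where "G0 holomorphic_on ball 0 1" "Gv holomorphic_on ball 0 1" "Gs holomorphic_on ball 0 1"
    "G0 0 = 1" "Gv 0 = 10" "Gs 0 = 16" "D3_expansion jacobi_E4_D3 G0 Gv Gs Gs"
proof -
  obtain T U where "nome_data T U" by (rule nome_data_exists)
  hence T: "T holomorphic_on ball 0 1" "T 0 = 1" "deriv T 0 = 2" and U: "U holomorphic_on ball 0 1" "U 0 = 2"
    and t: "\<And>\<tau>. Im \<tau> > 0 \<Longrightarrow> t3 \<tau> = T (ee (\<tau> / 2))" "\<And>\<tau>. Im \<tau> > 0 \<Longrightarrow> t4 \<tau> = T (- ee (\<tau> / 2))"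
      "\<And>\<tau>. Im \<tau> > 0 \<Longrightarrow> t2 \<tau> = ee (\<tau> / 8) * U (ee \<tau>)"
    by (simp_all add: nome_data_def)
  have T5: "(\<lambda>x. T x ^ 5) holomorphic_on ball 0 1" by (intro holomorphic_intros T)
  have "(T has_field_derivative deriv T 0) (at 0)" by (rule holomorphic_derivI[OF T(1)]) auto
  hence "((\<lambda>x. T x ^ 5) has_field_derivative 10) (at 0)"
    by (auto intro!: derivative_eq_intros simp: T)
  hence d: "deriv (\<lambda>x. T x ^ 5) 0 = 10" by (rule DERIV_imp_deriv)
  obtain G H where GH: "G holomorphic_on ball 0 1" "H holomorphic_on ball 0 1" "G 0 = T 0 ^ 5"
    "H 0 = deriv (\<lambda>x. T x ^ 5) 0" "\<And>x. norm x < 1 \<Longrightarrow> T x ^ 5 = G (x\<^sup>2) + x * H (x\<^sup>2)"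
    using even_odd_parts[OF T5] by blast
  show thesis
  proof (rule that[of G H "\<lambda>x. U x ^ 5 / 2"])
    show "G holomorphic_on ball 0 1" "H holomorphic_on ball 0 1" by fact+
    show "(\<lambda>x. U x ^ 5 / 2) holomorphic_on ball 0 1" by (intro holomorphic_intros U) auto
    show "G 0 = 1" "H 0 = 10" "U 0 ^ 5 / 2 = 16" using GH T U d by simp_all
    show "D3_expansion jacobi_E4_D3 G H (\<lambda>x. U x ^ 5 / 2) (\<lambda>x. U x ^ 5 / 2)"
      unfolding D3_expansion_def
    proof (intro allI impI)
      fix \<tau> z assume \<tau>: "Im \<tau> > 0"
      define x where "x = ee (\<tau> / 2)"
      have x: "norm x < 1" "x\<^sup>2 = ee \<tau>" using norm_ee_half[OF \<tau>] ee_half_square by (simp_all add: x_def)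
      have 3: "t3 \<tau> ^ 5 = G (ee \<tau>) + x * H (ee \<tau>)" using GH(5)[of x] x t(1)[OF \<tau>] by (simp add: x_def)
      have 4: "t4 \<tau> ^ 5 = G (ee \<tau>) - x * H (ee \<tau>)" using GH(5)[of "- x"] x t(2)[OF \<tau>] by (simp add: x_def)
      have "ee (\<tau> / 8) ^ 5 = ee (5 * \<tau> / 8)" using ee_of_nat_mult[of 5 "\<tau> / 8"] by simp
      hence 2: "t2 \<tau> ^ 5 = ee (5 * \<tau> / 8) * U (ee \<tau>) ^ 5" using t(3)[OF \<tau>] by (simp add: power_mult_distrib)
      show "jacobi_E4_D3 \<tau> z = G (ee \<tau>) * theta_sum lattice_D3 \<tau> z + ee (\<tau> / 2) * H (ee \<tau>) * theta_sum D3v \<tau> z +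
         ee (5 * \<tau> / 8) * (U (ee \<tau>) ^ 5 / 2 * theta_sum D3s \<tau> z + U (ee \<tau>) ^ 5 / 2 * theta_sum D3c \<tau> z)"
        unfolding jacobi_E4_D3_eq[OF \<tau>] 3 4 2 A_eq_theta[OF \<tau>] x_def[symmetric] by (simp add: field_simps)
    qed
  qed
qed

text \<open>In \<open>q\<close> the heat operator acts on each component as \<open>s + q d/dq - (5/24) E2\<close>.\<close>

lemma jacobi_E6_D3_expansion:
  obtains G0 Gv Gs where "G0 holomorphic_on ball 0 1" "Gv holomorphic_on ball 0 1" "Gs holomorphic_on ball 0 1"
    "G0 0 = - 5 / 24" "Gv 0 = 70 / 24" "Gs 0 = 160 / 24" "D3_expansion jacobi_E6_D3 G0 Gv Gs Gs"
proof -
  obtain G0 Gv Gs where G: "G0 holomorphic_on ball 0 1" "Gv holomorphic_on ball 0 1" "Gs holomorphic_on ball 0 1"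
    and G_0: "G0 0 = 1" "Gv 0 = 10" "Gs 0 = 16" and D: "D3_expansion jacobi_E4_D3 G0 Gv Gs Gs"
    by (rule jacobi_E4_D3_expansion)
  define P where "P q = qpoch q q" for q
  have P: "P holomorphic_on ball 0 1" using euler_holomorphic by (simp add: P_def[abs_def])
  have Pnz: "P q \<noteq> 0" if "q \<in> ball 0 1" for q using that qpoch_q_nonzero by (simp add: P_def)
  define E where "E q = 1 + 24 * q * (deriv P q / P q)" for q
  have E: "E holomorphic_on ball 0 1" unfolding E_def by (intro holomorphic_intros P Pnz) auto
  have E2: "E2 \<tau> = E (ee \<tau>)" if "Im \<tau> > 0" for \<tau>
    using E2_eq_euler[OF that] by (simp add: E_def P_def[abs_def])
  define L where "L s G q = s * G q + q * deriv G q - 5 / 24 * E q * G q" for s :: complex and G and q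
  have L: "L s G holomorphic_on ball 0 1" if "G holomorphic_on ball 0 1" for s G
    unfolding L_def by (intro holomorphic_intros that E) auto
  have L0: "L s G 0 = (s - 5 / 24) * G 0" for s G by (simp add: L_def E_def algebra_simps)
  have dh: "((\<lambda>\<tau>. ee (s * \<tau>) * G (ee \<tau>)) has_field_derivative
      2 * of_real pi * \<i> * (ee (s * \<tau>) * (s * G (ee \<tau>) + ee \<tau> * deriv G (ee \<tau>)))) (at \<tau>)"
    if G: "G holomorphic_on ball 0 1" and \<tau>: "Im \<tau> > 0" for s G \<tau>
  proof -
    have "(G has_field_derivative deriv G (ee \<tau>)) (at (ee \<tau>))"
      by (rule holomorphic_derivI[OF G]) (use \<tau> in auto)
    moreover have "(ee has_field_derivative 2 * of_real pi * \<i> * 1 * ee \<tau>) (at \<tau>)"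
      by (rule has_field_derivative_ee[OF DERIV_ident])
    ultimately have "((\<lambda>\<tau>. G (ee \<tau>)) has_field_derivative deriv G (ee \<tau>) * (2 * of_real pi * \<i> * 1 * ee \<tau>)) (at \<tau>)"
      by (rule DERIV_chain2)
    moreover have "((\<lambda>\<tau>. ee (s * \<tau>)) has_field_derivative 2 * of_real pi * \<i> * (s * 1) * ee (s * \<tau>)) (at \<tau>)"
      by (intro has_field_derivative_ee DERIV_cmult DERIV_ident)
    ultimately have "((\<lambda>\<tau>. ee (s * \<tau>) * G (ee \<tau>)) has_field_derivative
        2 * of_real pi * \<i> * (s * 1) * ee (s * \<tau>) * G (ee \<tau>) + deriv G (ee \<tau>) * (2 * of_real pi * \<i> * 1 * ee \<tau>) * ee (s * \<tau>)) (at \<tau>)"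
      by (rule DERIV_mult[rotated])
    thus ?thesis by (simp add: algebra_simps)
  qed
  define h where "h s G \<tau> = ee (s * \<tau>) * G (ee \<tau>)" for s G \<tau>
  have h: "h s G holomorphic_on upper_half_plane" if "G holomorphic_on ball 0 1" for s G
    unfolding h_def by (intro holomorphic_intros holomorphic_on_disc_ee that)
  have dhh: "deriv (h s G) \<tau> = 2 * of_real pi * \<i> * (ee (s * \<tau>) * (s * G (ee \<tau>) + ee \<tau> * deriv G (ee \<tau>)))"
    if "G holomorphic_on ball 0 1" "Im \<tau> > 0" for s G \<tau>
    using DERIV_imp_deriv[OF dh[OF that]] by (simp add: h_def[abs_def])
  have eq: "jacobi_E4_D3 \<tau> z = h 0 G0 \<tau> * theta_sum lattice_D3 \<tau> z + h (1 / 2) Gv \<tau> * theta_sum D3v \<tau> z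
        + h (5 / 8) Gs \<tau> * theta_sum D3s \<tau> z + h (5 / 8) Gs \<tau> * theta_sum D3c \<tau> z" if "Im \<tau> > 0" for \<tau> z
    using D that by (simp add: D3_expansion_def h_def algebra_simps)
  show thesis
  proof (rule that[of "L 0 G0" "L (1 / 2) Gv" "L (5 / 8) Gs"])
    show "L 0 G0 holomorphic_on ball 0 1" "L (1 / 2) Gv holomorphic_on ball 0 1" "L (5 / 8) Gs holomorphic_on ball 0 1"
      by (intro L G)+
    show "L 0 G0 0 = - 5 / 24" "L (1 / 2) Gv 0 = 70 / 24" "L (5 / 8) Gs 0 = 160 / 24"
      unfolding L0 G_0 by simp_all
    show "D3_expansion jacobi_E6_D3 (L 0 G0) (L (1 / 2) Gv) (L (5 / 8) Gs) (L (5 / 8) Gs)"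
      unfolding D3_expansion_def
    proof (intro allI impI)
      fix \<tau> z assume \<tau>: "Im \<tau> > 0"
      have hd: "heat_delta 4 lattice_D3 jacobi_E4_D3 \<tau> z =
          (deriv (h 0 G0) \<tau> * theta_sum lattice_D3 \<tau> z + deriv (h (1 / 2) Gv) \<tau> * theta_sum D3v \<tau> z
            + deriv (h (5 / 8) Gs) \<tau> * theta_sum D3s \<tau> z + deriv (h (5 / 8) Gs) \<tau> * theta_sum D3c \<tau> z) / (2 * of_real pi * \<i>)
          - 5 / 24 * E2 \<tau> * jacobi_E4_D3 \<tau> z"
        by (rule heat_delta_D3[OF h[OF G(1)] h[OF G(2)] h[OF G(3)] h[OF G(3)] _ \<tau>]) (rule eq)
      have c: "2 * of_real pi * \<i> \<noteq> 0" by simp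
      have arith: "(c * (e0 * (s0 * g0 + q * g0')) * a + c * (ev * (sv * gv + q * gv')) * b
          + c * (es * (ss * gs + q * gs')) * u + c * (es * (ss * gs + q * gs')) * v) / c
          - 5 / 24 * E * (e0 * g0 * a + ev * gv * b + es * gs * u + es * gs * v)
        = e0 * (s0 * g0 + q * g0' - 5 / 24 * E * g0) * a + ev * (sv * gv + q * gv' - 5 / 24 * E * gv) * b
          + es * ((ss * gs + q * gs' - 5 / 24 * E * gs) * u + (ss * gs + q * gs' - 5 / 24 * E * gs) * v)"
        if "c \<noteq> 0" for c e0 s0 g0 q g0' a ev sv gv gv' b es ss gs gs' u v E :: complex
        using that by (simp add: add_divide_distrib algebra_simps)
      show "jacobi_E6_D3 \<tau> z = L 0 G0 (ee \<tau>) * theta_sum lattice_D3 \<tau> z + ee (\<tau> / 2) * L (1 / 2) Gv (ee \<tau>) * theta_sum D3v \<tau> z +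
         ee (5 * \<tau> / 8) * (L (5 / 8) Gs (ee \<tau>) * theta_sum D3s \<tau> z + L (5 / 8) Gs (ee \<tau>) * theta_sum D3c \<tau> z)"
        unfolding jacobi_E6_D3_def hd dhh[OF G(1) \<tau>] dhh[OF G(2) \<tau>] dhh[OF G(3) \<tau>] eq[OF \<tau>]
        unfolding h_def arith[OF c] E2[OF \<tau>] L_def by simp
    qed
  qed
qed

text \<open>
  The third even generator, of weight 8, and the odd generator, of weight 9. The numbers in the names
  are the exponents of eta.
\<close>

definition psi12 :: "complex \<Rightarrow> complex^3 \<Rightarrow> complex" where
  "psi12 \<tau> z = eta \<tau> ^ 12 * pullback iota2 (theta_ZN :: complex \<Rightarrow> complex^4 \<Rightarrow> complex) \<tau> z"

definition psi15 :: "complex \<Rightarrow> complex^3 \<Rightarrow> complex" where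
  "psi15 \<tau> z = eta \<tau> ^ 15 * pullback iota1 theta_ZN \<tau> z"

lemma eta_power:
  assumes "Im \<tau> > 0"
  shows "eta \<tau> ^ n = ee (of_nat n * (\<tau> / 24)) * qpoch (ee \<tau>) (ee \<tau>) ^ n"
  by (simp only: eta_eq_qpoch[OF assms] power_mult_distrib ee_of_nat_mult)

lemma psi12_eq:
  assumes "Im \<tau> > 0"
  shows "psi12 \<tau> z = eta \<tau> ^ 12 * ((t3 \<tau> * A3 \<tau> z - t4 \<tau> * A4 \<tau> z - t2 \<tau> * A2 \<tau> z) / 2)"
  by (simp only: psi12_def pullback_def theta_ZN_iota2[OF assms])

lemma psi15_eq:
  assumes "Im \<tau> > 0"
  shows "psi15 \<tau> z = eta \<tau> ^ 15 * (\<i> * A1 \<tau> z)"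
  by (simp only: psi15_def pullback_def iota1_id theta_ZN_3[OF assms])

lemma psi12_expansion:
  obtains G0 Gv Gs where "G0 holomorphic_on ball 0 1" "Gv holomorphic_on ball 0 1" "Gs holomorphic_on ball 0 1"
    "G0 0 = 0" "Gv 0 = 1" "Gs 0 = - 1" "D3_expansion psi12 G0 Gv Gs Gs"
proof -
  obtain T U where "nome_data T U" by (rule nome_data_exists)
  hence T: "T holomorphic_on ball 0 1" "T 0 = 1" "deriv T 0 = 2" and U: "U holomorphic_on ball 0 1" "U 0 = 2"
    and t: "\<And>\<tau>. Im \<tau> > 0 \<Longrightarrow> t3 \<tau> = T (ee (\<tau> / 2))" "\<And>\<tau>. Im \<tau> > 0 \<Longrightarrow> t4 \<tau> = T (- ee (\<tau> / 2))"
      "\<And>\<tau>. Im \<tau> > 0 \<Longrightarrow> t2 \<tau> = ee (\<tau> / 8) * U (ee \<tau>)"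
    by (simp_all add: nome_data_def)
  obtain G H where GH: "G holomorphic_on ball 0 1" "H holomorphic_on ball 0 1" "G 0 = T 0"
    "H 0 = deriv T 0" "\<And>x. norm x < 1 \<Longrightarrow> T x = G (x\<^sup>2) + x * H (x\<^sup>2)"
    using even_odd_parts[OF T(1)] by blast
  define P where "P q = qpoch q q" for q
  have P: "P holomorphic_on ball 0 1" using euler_holomorphic by (simp add: P_def[abs_def])
  have P0: "P 0 = 1"
    using qpoch_rec[of 0 0] prodinf_zero by (simp add: P_def qpoch_def)
  \<comment> \<open>The twelfth power of eta starts with the square root of \<open>q\<close>, so even and odd part change places.\<close>
  show thesis
  proof (rule that[of "\<lambda>q. q * P q ^ 12 * H q" "\<lambda>q. P q ^ 12 * G q" "\<lambda>q. - (P q ^ 12 * U q / 2)"])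
    show "(\<lambda>q. q * P q ^ 12 * H q) holomorphic_on ball 0 1" "(\<lambda>q. P q ^ 12 * G q) holomorphic_on ball 0 1"
      "(\<lambda>q. - (P q ^ 12 * U q / 2)) holomorphic_on ball 0 1"
      by (intro holomorphic_intros P GH U; simp)+
    show "0 * P 0 ^ 12 * H 0 = 0" "P 0 ^ 12 * G 0 = 1" "- (P 0 ^ 12 * U 0 / 2) = - 1"
      using GH T U P0 by simp_all
    show "D3_expansion psi12 (\<lambda>q. q * P q ^ 12 * H q) (\<lambda>q. P q ^ 12 * G q) (\<lambda>q. - (P q ^ 12 * U q / 2)) (\<lambda>q. - (P q ^ 12 * U q / 2))"
      unfolding D3_expansion_def
    proof (intro allI impI)
      fix \<tau> z assume \<tau>: "Im \<tau> > 0"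
      define x where "x = ee (\<tau> / 2)"
      have x: "norm x < 1" "x\<^sup>2 = ee \<tau>" "x * x = ee \<tau>"
        using norm_ee_half[OF \<tau>] ee_half_square[of \<tau>] by (simp_all add: x_def power2_eq_square)
      have 3: "t3 \<tau> = G (ee \<tau>) + x * H (ee \<tau>)" using GH(5)[of x] x t(1)[OF \<tau>] by (simp add: x_def)
      have 4: "t4 \<tau> = G (ee \<tau>) - x * H (ee \<tau>)" using GH(5)[of "- x"] x t(2)[OF \<tau>] by (simp add: x_def)
      have e: "eta \<tau> ^ 12 = x * P (ee \<tau>) ^ 12"
        using eta_power[OF \<tau>, of 12] by (simp add: x_def P_def)
      have e2: "ee (5 * \<tau> / 8) = x * ee (\<tau> / 8)"
        unfolding x_def ee_add[symmetric] by (rule arg_cong[of _ _ ee]) simp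
      show "psi12 \<tau> z = ee \<tau> * P (ee \<tau>) ^ 12 * H (ee \<tau>) * theta_sum lattice_D3 \<tau> z + ee (\<tau> / 2) * (P (ee \<tau>) ^ 12 * G (ee \<tau>)) * theta_sum D3v \<tau> z +
         ee (5 * \<tau> / 8) * (- (P (ee \<tau>) ^ 12 * U (ee \<tau>) / 2) * theta_sum D3s \<tau> z + - (P (ee \<tau>) ^ 12 * U (ee \<tau>) / 2) * theta_sum D3c \<tau> z)"
        unfolding psi12_eq[OF \<tau>] 3 4 t(3)[OF \<tau>] A_eq_theta[OF \<tau>] x_def[symmetric] e e2 x(3)[symmetric] by (simp add: field_simps)
    qed
  qed
qed

lemma psi15_expansion: "D3_expansion psi15 (\<lambda>_. 0) (\<lambda>_. 0) (\<lambda>q. qpoch q q ^ 15) (\<lambda>q. - (qpoch q q ^ 15))"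
  unfolding D3_expansion_def
proof (intro allI impI)
  fix \<tau> z assume \<tau>: "Im \<tau> > 0"
  have e: "eta \<tau> ^ 15 = ee (5 * \<tau> / 8) * qpoch (ee \<tau>) (ee \<tau>) ^ 15"
  proof -
    have "of_nat 15 * (\<tau> / 24) = 5 * \<tau> / 8" by simp
    thus ?thesis using eta_power[OF \<tau>, of 15] by (simp only:)
  qed
  show "psi15 \<tau> z = 0 * theta_sum lattice_D3 \<tau> z + ee (\<tau> / 2) * 0 * theta_sum D3v \<tau> z +
     ee (5 * \<tau> / 8) * (qpoch (ee \<tau>) (ee \<tau>) ^ 15 * theta_sum D3s \<tau> z + - (qpoch (ee \<tau>) (ee \<tau>) ^ 15) * theta_sum D3c \<tau> z)"
    unfolding psi15_eq[OF \<tau>] e A_eq_theta(4)[OF \<tau>] by (simp add: algebra_simps)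
qed

subsection \<open>Modular invariance of the generators\<close>

lemma theta_factor_powers:
  assumes "Im \<tau> > 0"
  shows "theta_factor \<tau> ^ 8 = \<tau> ^ 4" "(\<i> * theta_factor \<tau>) ^ 8 = \<tau> ^ 4"
proof -
  have "theta_factor \<tau> ^ 8 = (theta_factor \<tau> ^ 2) ^ 4" by (simp flip: power_mult)
  also have "\<dots> = \<tau> ^ 4" unfolding theta_factor_square[OF assms] by (simp add: power_mult_distrib)
  finally show 1: "theta_factor \<tau> ^ 8 = \<tau> ^ 4" .
  have "\<i> ^ 8 = (\<i> ^ 4) ^ 2" by (simp flip: power_mult)
  hence "\<i> ^ 8 = 1" by simp
  thus "(\<i> * theta_factor \<tau>) ^ 8 = \<tau> ^ 4" by (simp add: power_mult_distrib 1)
qed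

lemma t_inversion:
  assumes "Im \<tau> > 0"
  shows "t2 (- 1 / \<tau>) = \<i> * theta_factor \<tau> * t4 \<tau>" "t4 (- 1 / \<tau>) = \<i> * theta_factor \<tau> * t2 \<tau>"
    "t3 (- 1 / \<tau>) = \<i> * theta_factor \<tau> * t3 \<tau>"
  using Th_even_inversion[OF assms, of 0] by simp_all

lemma t_translation: "t2 (\<tau> + 1) = ee (1 / 8) * t2 \<tau>" "t3 (\<tau> + 1) = t4 \<tau>" "t4 (\<tau> + 1) = t3 \<tau>"
  using Th_0_plus_1[of 0 \<tau> 0] by (simp_all add: Th_half_tau_plus_1 Th_0_tau_plus_1)

text \<open>
  The Serre derivative of a theta constant, that is, the theta constant times the logarithmic
  derivative \<open>q d/dq\<close> of its quotient by eta; by the heat equation the derivative is again a theta series.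
\<close>

definition serre :: "real \<Rightarrow> complex \<Rightarrow> complex \<Rightarrow> complex" where
  "serre a w \<tau> = Th a 2 \<tau> w / 2 - E2 \<tau> * Th a 0 \<tau> w / 24"

lemma Th_0_has_field_derivative_tau:
  "Im \<tau> > 0 \<Longrightarrow> ((\<lambda>\<tau>. Th a 0 \<tau> w) has_field_derivative of_real pi * \<i> * Th a 2 \<tau> w) (at \<tau>)"
  using Th_has_field_derivative_tau[of \<tau> a 0 w] by (simp add: numeral_2_eq_2)

text \<open>
  The heat equation turns the derivative of the inversion formula of the theta constant into one for
  the second weighted series; its additive term cancels against that of \<^const>\<open>E2\<close>.
\<close>

lemma serre_inversion:
  assumes \<tau>: "Im \<tau> > 0" and inv: "\<And>\<tau>. Im \<tau> > 0 \<Longrightarrow> Th a 0 (- 1 / \<tau>) u = \<i> * theta_factor \<tau> * Th b 0 \<tau> v"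
  shows "serre a u (- 1 / \<tau>) = \<tau>\<^sup>2 * (\<i> * theta_factor \<tau>) * serre b v \<tau>"
proof -
  define C where "C = theta_factor \<tau>"
  define p where "p = of_real pi * \<i>"
  have nz: "\<tau> \<noteq> 0" and p: "p \<noteq> 0" using \<tau> by (auto simp: p_def)
  have "((\<lambda>\<tau>. Th a 0 (- 1 / \<tau>) u) has_field_derivative p * Th a 2 (- 1 / \<tau>) u / \<tau>\<^sup>2) (at \<tau>)"
    unfolding p_def
    by (rule has_field_derivative_compose_inversion[OF \<tau> Th_0_has_field_derivative_tau[OF Im_minus_inverse_pos[OF \<tau>]]])
  moreover have "((\<lambda>\<tau>. \<i> * theta_factor \<tau> * Th b 0 \<tau> v) has_field_derivative
      \<i> * (C / (2 * \<tau>)) * Th b 0 \<tau> v + p * Th b 2 \<tau> v * (\<i> * C)) (at \<tau>)"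
    unfolding C_def p_def
    by (rule DERIV_mult[OF DERIV_cmult[OF theta_factor_has_field_derivative[OF \<tau>]] Th_0_has_field_derivative_tau[OF \<tau>]])
  hence "((\<lambda>\<tau>. Th a 0 (- 1 / \<tau>) u) has_field_derivative
      \<i> * (C / (2 * \<tau>)) * Th b 0 \<tau> v + p * Th b 2 \<tau> v * (\<i> * C)) (at \<tau>)"
    by (rule has_field_derivative_transform_within_open[OF _ open_upper_half_plane])
       (use \<tau> inv in \<open>simp_all only: mem_Collect_eq\<close>)
  ultimately have "p * Th a 2 (- 1 / \<tau>) u / \<tau>\<^sup>2 = \<i> * (C / (2 * \<tau>)) * Th b 0 \<tau> v + p * Th b 2 \<tau> v * (\<i> * C)"
    by (rule DERIV_unique)
  hence "p * Th a 2 (- 1 / \<tau>) u = p * (\<i> * C * \<tau> * Th b 0 \<tau> v / (2 * p) + \<tau>\<^sup>2 * Th b 2 \<tau> v * (\<i> * C))"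
    using nz p by (simp add: field_simps power2_eq_square)
  hence 1: "Th a 2 (- 1 / \<tau>) u = \<i> * C * \<tau> * Th b 0 \<tau> v / (2 * p) + \<tau>\<^sup>2 * Th b 2 \<tau> v * (\<i> * C)"
    by (simp only: mult_left_cancel[OF p])
  have 2: "E2 (- 1 / \<tau>) = \<tau>\<^sup>2 * E2 \<tau> + 6 * \<tau> / p"
    using E2_inversion[OF \<tau>] by (simp add: p_def mult.assoc)
  show ?thesis unfolding serre_def 1 2 inv[OF \<tau>] C_def[symmetric]
    using p by (simp add: field_simps)
qed

lemma serre_t_inversion:
  assumes "Im \<tau> > 0"
  shows "serre (1 / 2) 0 (- 1 / \<tau>) = \<tau>\<^sup>2 * (\<i> * theta_factor \<tau>) * serre 0 (1 / 2) \<tau>"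
    "serre 0 (1 / 2) (- 1 / \<tau>) = \<tau>\<^sup>2 * (\<i> * theta_factor \<tau>) * serre (1 / 2) 0 \<tau>"
    "serre 0 0 (- 1 / \<tau>) = \<tau>\<^sup>2 * (\<i> * theta_factor \<tau>) * serre 0 0 \<tau>"
  by (rule serre_inversion[OF assms], erule t_inversion)+

lemma serre_t_translation:
  assumes "Im \<tau> > 0"
  shows "serre (1 / 2) 0 (\<tau> + 1) = ee (1 / 8) * serre (1 / 2) 0 \<tau>" "serre 0 0 (\<tau> + 1) = serre 0 (1 / 2) \<tau>"
    "serre 0 (1 / 2) (\<tau> + 1) = serre 0 0 \<tau>"
  using assms Th_0_plus_1[of _ \<tau> 0]
  by (simp_all add: serre_def Th_half_tau_plus_1 Th_0_tau_plus_1 E2_plus_1 right_diff_distrib)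

text \<open>
  The components of the weight 4 generator are fifth powers of theta constants, of weight
  \<open>4 - 3 / 2 = 5 / 2\<close>. So the heat operator is the Serre derivative on them, a derivation, and
  differentiating the fifth powers leaves the Serre derivative of one theta constant in each.
\<close>

lemma jacobi_E6_D3_eq:
  assumes \<tau>: "Im \<tau> > 0"
  shows "jacobi_E6_D3 \<tau> z = 5 / 2 * (t3 \<tau> ^ 4 * serre 0 0 \<tau> * A3 \<tau> z + t4 \<tau> ^ 4 * serre 0 (1 / 2) \<tau> * A4 \<tau> z
    + t2 \<tau> ^ 4 * serre (1 / 2) 0 \<tau> * A2 \<tau> z)"
proof -
  define h where "h a w \<tau> = Th a 0 \<tau> w ^ 5 / 2" for a w \<tau>
  have dh: "(h a w has_field_derivative 2 * of_real pi * \<i> * (5 / 4 * Th a 0 \<tau> w ^ 4 * Th a 2 \<tau> w)) (at \<tau>)"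
    if "Im \<tau> > 0" for a w \<tau>
    unfolding h_def[abs_def]
    by (rule derivative_eq_intros Th_0_has_field_derivative_tau[OF that] refl | simp)+
  have hol: "h a w holomorphic_on upper_half_plane" for a w
    unfolding holomorphic_on_open[OF open_upper_half_plane] using dh by blast
  have sum: "(\<lambda>\<tau>. h 0 0 \<tau> + h 0 (1 / 2) \<tau>) holomorphic_on upper_half_plane" "(\<lambda>\<tau>. h 0 0 \<tau> - h 0 (1 / 2) \<tau>) holomorphic_on upper_half_plane"
    by (intro holomorphic_intros hol)+
  have eq: "jacobi_E4_D3 \<tau> z = (h 0 0 \<tau> + h 0 (1 / 2) \<tau>) * theta_sum lattice_D3 \<tau> z + (h 0 0 \<tau> - h 0 (1 / 2) \<tau>) * theta_sum D3v \<tau> z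
        + h (1 / 2) 0 \<tau> * theta_sum D3s \<tau> z + h (1 / 2) 0 \<tau> * theta_sum D3c \<tau> z" if "Im \<tau> > 0" for \<tau> z
    unfolding jacobi_E4_D3_eq[OF that] A_eq_theta[OF that] h_def by (simp add: field_simps)
  have hd: "jacobi_E6_D3 \<tau> z =
    (deriv (\<lambda>\<tau>. h 0 0 \<tau> + h 0 (1 / 2) \<tau>) \<tau> * theta_sum lattice_D3 \<tau> z + deriv (\<lambda>\<tau>. h 0 0 \<tau> - h 0 (1 / 2) \<tau>) \<tau> * theta_sum D3v \<tau> z
      + deriv (h (1 / 2) 0) \<tau> * theta_sum D3s \<tau> z + deriv (h (1 / 2) 0) \<tau> * theta_sum D3c \<tau> z) / (2 * of_real pi * \<i>)
    - 5 / 24 * E2 \<tau> * jacobi_E4_D3 \<tau> z"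
    unfolding jacobi_E6_D3_def by (rule heat_delta_D3[OF sum hol hol _ \<tau>]) (rule eq)
  define c where "c = 2 * complex_of_real pi * \<i>"
  have c: "c \<noteq> 0" by (simp add: c_def)
  define d where "d a w = 5 / 4 * Th a 0 \<tau> w ^ 4 * Th a 2 \<tau> w" for a w
  note D = dh[OF \<tau>, folded c_def d_def]
  have "deriv (\<lambda>\<tau>. h 0 0 \<tau> + h 0 (1 / 2) \<tau>) \<tau> = c * d 0 0 + c * d 0 (1 / 2)"
    "deriv (\<lambda>\<tau>. h 0 0 \<tau> - h 0 (1 / 2) \<tau>) \<tau> = c * d 0 0 - c * d 0 (1 / 2)"
    "deriv (h (1 / 2) 0) \<tau> = c * d (1 / 2) 0"
    by (intro DERIV_imp_deriv DERIV_add DERIV_diff D)+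
  hence "jacobi_E6_D3 \<tau> z = ((c * d 0 0 + c * d 0 (1 / 2)) * theta_sum lattice_D3 \<tau> z + (c * d 0 0 - c * d 0 (1 / 2)) * theta_sum D3v \<tau> z
      + c * d (1 / 2) 0 * theta_sum D3s \<tau> z + c * d (1 / 2) 0 * theta_sum D3c \<tau> z) / c - 5 / 24 * E2 \<tau> * jacobi_E4_D3 \<tau> z"
    by (simp only: hd c_def)
  also have "\<dots> = d 0 0 * A3 \<tau> z + d 0 (1 / 2) * A4 \<tau> z + d (1 / 2) 0 * A2 \<tau> z - 5 / 24 * E2 \<tau> * jacobi_E4_D3 \<tau> z"
    unfolding A_eq_theta[OF \<tau>] using c by (simp add: field_simps)
  also have "\<dots> = 5 / 2 * (t3 \<tau> ^ 4 * serre 0 0 \<tau> * A3 \<tau> z + t4 \<tau> ^ 4 * serre 0 (1 / 2) \<tau> * A4 \<tau> z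
    + t2 \<tau> ^ 4 * serre (1 / 2) 0 \<tau> * A2 \<tau> z)"
    unfolding jacobi_E4_D3_eq[OF \<tau>] serre_def d_def by (simp add: field_simps eval_nat_numeral)
  finally show ?thesis .
qed

text \<open>
  Translation and inversion permute the theta constants together with the products \<open>A2\<close>, \<open>A3\<close>, \<open>A4\<close>, so
  they permute the three summands of each even generator. The factors that arise are eighth powers of
  the automorphy factor of a theta function, hence powers of \<open>\<tau>\<close>, and roots of unity that cancel.
\<close>

lemma jacobi_E4_D3_invariant:
  assumes "a * d - b * c = 1"
  shows "jacobi_invariant 4 jacobi_E4_D3 a b c d"
proof (rule jacobi_invariant_generators[OF _ _ assms])
  fix \<tau> :: complex and z :: "complex^3"
  show "jacobi_E4_D3 (\<tau> + 1) z = jacobi_E4_D3 \<tau> z"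
  proof (cases "Im \<tau> > 0")
    case True
    have "ee (1 / 8) ^ 5 * ee (3 / 8) = 1"
      using ee_of_nat_mult[of 5 "1 / 8"] ee_add[of "5 / 8" "3 / 8"] by simp
    hence "(ee (1 / 8) * t2 \<tau>) ^ 5 * (ee (3 / 8) * A2 \<tau> z) = t2 \<tau> ^ 5 * A2 \<tau> z"
      by (simp add: power_mult_distrib)
    thus ?thesis using True
      by (subst (1 2) jacobi_E4_D3_eq) (simp_all add: t_translation A_translation)
  qed (simp add: jacobi_E4_D3_def pullback_def theta_sum_def)
  assume \<tau>: "Im \<tau> > 0"
  define \<kappa> where "\<kappa> = \<i> * theta_factor \<tau>"
  define e where "e = ee (bil z z / 2 / \<tau>)"
  have "\<kappa> ^ 5 * \<kappa> ^ 3 = \<tau> ^ 4" using theta_factor_powers(2)[OF \<tau>] by (simp add: \<kappa>_def flip: power_add)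
  hence k: "(\<kappa> * t) ^ 5 * (\<kappa> ^ 3 * e * A) = \<tau> ^ 4 * e * (t ^ 5 * A)" for t A
    by (simp add: power_mult_distrib) (simp add: mult_ac)?
  show "jacobi_E4_D3 (- 1 / \<tau>) ((1 / \<tau>) *s z) = \<tau> powi 4 * ee (bil z z / 2 / \<tau>) * jacobi_E4_D3 \<tau> z"
    unfolding jacobi_E4_D3_eq[OF \<tau>] jacobi_E4_D3_eq[OF Im_minus_inverse_pos[OF \<tau>]] t_inversion[OF \<tau>] A_inversion[OF \<tau>]
      \<kappa>_def[symmetric] e_def[symmetric] k
    by (simp add: algebra_simps)
qed

lemma jacobi_E6_D3_invariant:
  assumes "a * d - b * c = 1"
  shows "jacobi_invariant 6 jacobi_E6_D3 a b c d"
proof (rule jacobi_invariant_generators[OF _ _ assms])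
  fix \<tau> :: complex and z :: "complex^3"
  show "jacobi_E6_D3 (\<tau> + 1) z = jacobi_E6_D3 \<tau> z"
  proof (cases "Im \<tau> > 0")
    case True
    have e: "ee (1 / 8) ^ 4 = - 1" "ee (1 / 8) * ee (3 / 8) = - 1"
      using ee_of_nat_mult[of 4 "1 / 8"] ee_add[of "1 / 8" "3 / 8"] by simp_all
    have "(ee (1 / 8) * t2 \<tau>) ^ 4 * (ee (1 / 8) * serre (1 / 2) 0 \<tau>) * (ee (3 / 8) * A2 \<tau> z) =
        (ee (1 / 8) ^ 4 * (ee (1 / 8) * ee (3 / 8))) * (t2 \<tau> ^ 4 * serre (1 / 2) 0 \<tau> * A2 \<tau> z)"
      by (simp only: power_mult_distrib mult_ac)
    hence "(ee (1 / 8) * t2 \<tau>) ^ 4 * (ee (1 / 8) * serre (1 / 2) 0 \<tau>) * (ee (3 / 8) * A2 \<tau> z) =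
        t2 \<tau> ^ 4 * serre (1 / 2) 0 \<tau> * A2 \<tau> z"
      unfolding e by simp
    thus ?thesis using True
      by (subst (1 2) jacobi_E6_D3_eq) (simp_all add: t_translation A_translation serre_t_translation)
  qed (simp add: jacobi_E6_D3_def heat_delta_def)
  assume \<tau>: "Im \<tau> > 0"
  define \<kappa> where "\<kappa> = \<i> * theta_factor \<tau>"
  define e where "e = ee (bil z z / 2 / \<tau>)"
  have k8: "\<kappa> ^ 8 = \<tau> ^ 4" using theta_factor_powers(2)[OF \<tau>] by (simp add: \<kappa>_def)
  have k: "(\<kappa> * t) ^ 4 * (\<tau>\<^sup>2 * \<kappa> * s) * (\<kappa> ^ 3 * e * A) = \<tau> ^ 6 * e * (t ^ 4 * s * A)" for t s A
  proof -
    have "(\<kappa> * t) ^ 4 * (\<tau>\<^sup>2 * \<kappa> * s) * (\<kappa> ^ 3 * e * A) = \<kappa> ^ 8 * \<tau>\<^sup>2 * e * (t ^ 4 * s * A)"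
      by (simp add: eval_nat_numeral mult_ac)
    thus ?thesis unfolding k8 by (simp add: eval_nat_numeral mult_ac)
  qed
  show "jacobi_E6_D3 (- 1 / \<tau>) ((1 / \<tau>) *s z) = \<tau> powi 6 * ee (bil z z / 2 / \<tau>) * jacobi_E6_D3 \<tau> z"
    unfolding jacobi_E6_D3_eq[OF \<tau>] jacobi_E6_D3_eq[OF Im_minus_inverse_pos[OF \<tau>]] t_inversion[OF \<tau>] A_inversion[OF \<tau>]
      serre_t_inversion[OF \<tau>] \<kappa>_def[symmetric] e_def[symmetric] k
    by (simp add: algebra_simps)
qed

lemma eta_power_translation:
  assumes "Im \<tau> > 0"
  shows "eta (\<tau> + 1) ^ n = ee (of_nat n / 24) * eta \<tau> ^ n"
proof -
  have "eta (\<tau> + 1) = ee (1 / 24) * eta \<tau>"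
    using assms by (simp add: eta_eq_qpoch ee_add add_divide_distrib)
  thus ?thesis using ee_of_nat_mult[of n "1 / 24"] by (simp add: power_mult_distrib)
qed

lemma eta_power_inversion:
  assumes "Im \<tau> > 0"
  shows "eta (- 1 / \<tau>) ^ (3 * n) = (\<tau> * theta_factor \<tau>) ^ n * eta \<tau> ^ (3 * n)"
  by (simp only: power_mult eta_cube_inversion[OF assms] power_mult_distrib)

lemma psi12_invariant:
  assumes "a * d - b * c = 1"
  shows "jacobi_invariant 8 psi12 a b c d"
proof (rule jacobi_invariant_generators[OF _ _ assms])
  fix \<tau> :: complex and z :: "complex^3"
  show "psi12 (\<tau> + 1) z = psi12 \<tau> z"
  proof (cases "Im \<tau> > 0")
    case True
    have e: "ee (1 / 8) * ee (3 / 8) = - 1"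
      using ee_add[of "1 / 8" "3 / 8"] by simp
    have "(ee (1 / 8) * t2 \<tau>) * (ee (3 / 8) * A2 \<tau> z) = (ee (1 / 8) * ee (3 / 8)) * (t2 \<tau> * A2 \<tau> z)"
      by (simp only: mult_ac)
    hence "(ee (1 / 8) * t2 \<tau>) * (ee (3 / 8) * A2 \<tau> z) = - (t2 \<tau> * A2 \<tau> z)"
      unfolding e by simp
    moreover have "eta (\<tau> + 1) ^ 12 = - (eta \<tau> ^ 12)"
      using eta_power_translation[OF True, of 12] by simp
    moreover have "psi12 (\<tau> + 1) z = eta (\<tau> + 1) ^ 12 *
        ((t4 \<tau> * A4 \<tau> z - t3 \<tau> * A3 \<tau> z - (ee (1 / 8) * t2 \<tau>) * (ee (3 / 8) * A2 \<tau> z)) / 2)"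
      using True by (subst psi12_eq) (simp_all only: t_translation A_translation plus_complex.sel one_complex.sel add_0_right)
    ultimately show ?thesis unfolding psi12_eq[OF True] by (simp only:) (simp add: field_simps)
  qed (simp add: psi12_def eta_def)
  assume \<tau>: "Im \<tau> > 0"
  define C where "C = theta_factor \<tau>"
  define e where "e = ee (bil z z / 2 / \<tau>)"
  have eta: "eta (- 1 / \<tau>) ^ 12 = (\<tau> * C) ^ 4 * eta \<tau> ^ 12"
    using eta_power_inversion[OF \<tau>, of 4] by (simp add: C_def)
  have k: "(\<i> * C * t) * ((\<i> * C) ^ 3 * e * A) = C ^ 4 * e * (t * A)" for t A
  proof -
    have "(\<i> * C * t) * ((\<i> * C) ^ 3 * e * A) = \<i> ^ 4 * C ^ 4 * e * (t * A)"
      by (simp only: power_mult_distrib) (simp add: eval_nat_numeral mult_ac)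
    thus ?thesis by simp
  qed
  have "(\<tau> * C) ^ 4 * C ^ 4 = \<tau> ^ 4 * C ^ 8" by (simp add: power_mult_distrib flip: power_add)
  hence c: "(\<tau> * C) ^ 4 * C ^ 4 = \<tau> ^ 8" using theta_factor_powers(1)[OF \<tau>] by (simp add: C_def flip: power_add)
  have "psi12 (- 1 / \<tau>) ((1 / \<tau>) *s z) = (\<tau> * C) ^ 4 * C ^ 4 * e * (eta \<tau> ^ 12 * ((t3 \<tau> * A3 \<tau> z - t2 \<tau> * A2 \<tau> z - t4 \<tau> * A4 \<tau> z) / 2))"
    unfolding psi12_eq[OF Im_minus_inverse_pos[OF \<tau>]] eta t_inversion[OF \<tau>] A_inversion[OF \<tau>]
      C_def[symmetric] e_def[symmetric] k by (simp add: field_simps)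
  thus "psi12 (- 1 / \<tau>) ((1 / \<tau>) *s z) = \<tau> powi 8 * ee (bil z z / 2 / \<tau>) * psi12 \<tau> z"
    unfolding c psi12_eq[OF \<tau>] by (simp add: e_def algebra_simps)
qed

lemma psi15_invariant:
  assumes "a * d - b * c = 1"
  shows "jacobi_invariant 9 psi15 a b c d"
proof (rule jacobi_invariant_generators[OF _ _ assms])
  fix \<tau> :: complex and z :: "complex^3"
  show "psi15 (\<tau> + 1) z = psi15 \<tau> z"
  proof (cases "Im \<tau> > 0")
    case True
    have "ee (of_nat 15 / 24) * ee (3 / 8) = 1" using ee_add[of "of_nat 15 / 24" "3 / 8"] by simp
    thus ?thesis using True
      by (subst (1 2) psi15_eq) (simp_all add: eta_power_translation A_translation)
  qed (simp add: psi15_def eta_def)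
  assume \<tau>: "Im \<tau> > 0"
  define C where "C = theta_factor \<tau>"
  have eta: "eta (- 1 / \<tau>) ^ 15 = (\<tau> * C) ^ 5 * eta \<tau> ^ 15"
    using eta_power_inversion[OF \<tau>, of 5] by (simp add: C_def)
  have "(\<tau> * C) ^ 5 * C ^ 3 = \<tau> ^ 5 * C ^ 8" by (simp add: power_mult_distrib flip: power_add)
  hence c: "(\<tau> * C) ^ 5 * C ^ 3 = \<tau> ^ 9" using theta_factor_powers(1)[OF \<tau>] by (simp add: C_def flip: power_add)
  have "psi15 (- 1 / \<tau>) ((1 / \<tau>) *s z) = (\<tau> * C) ^ 5 * C ^ 3 * ee (bil z z / 2 / \<tau>) * (eta \<tau> ^ 15 * (\<i> * A1 \<tau> z))"
    unfolding psi15_eq[OF Im_minus_inverse_pos[OF \<tau>]] eta A_inversion(4)[OF \<tau>] C_def[symmetric] by (simp only: mult_ac)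
  thus "psi15 (- 1 / \<tau>) ((1 / \<tau>) *s z) = \<tau> powi 9 * ee (bil z z / 2 / \<tau>) * psi15 \<tau> z"
    unfolding c psi15_eq[OF \<tau>] by simp
qed

subsection \<open>The determinant of the even generators\<close>

definition det3 :: "complex \<Rightarrow> complex \<Rightarrow> complex \<Rightarrow> complex \<Rightarrow> complex \<Rightarrow> complex \<Rightarrow> complex \<Rightarrow> complex \<Rightarrow> complex \<Rightarrow> complex" where
  "det3 a1 a2 a3 b1 b2 b3 c1 c2 c3 = a1 * (b2 * c3 - b3 * c2) - a2 * (b1 * c3 - b3 * c1) + a3 * (b1 * c2 - b2 * c1)"

lemma cramer3:
  "det3 h1 h2 h3 b1 b2 b3 c1 c2 c3 * a1 + det3 a1 a2 a3 h1 h2 h3 c1 c2 c3 * b1 + det3 a1 a2 a3 b1 b2 b3 h1 h2 h3 * c1 = det3 a1 a2 a3 b1 b2 b3 c1 c2 c3 * h1"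
  "det3 h1 h2 h3 b1 b2 b3 c1 c2 c3 * a2 + det3 a1 a2 a3 h1 h2 h3 c1 c2 c3 * b2 + det3 a1 a2 a3 b1 b2 b3 h1 h2 h3 * c2 = det3 a1 a2 a3 b1 b2 b3 c1 c2 c3 * h2"
  "det3 h1 h2 h3 b1 b2 b3 c1 c2 c3 * a3 + det3 a1 a2 a3 h1 h2 h3 c1 c2 c3 * b3 + det3 a1 a2 a3 b1 b2 b3 h1 h2 h3 * c3 = det3 a1 a2 a3 b1 b2 b3 c1 c2 c3 * h3"
  by (simp_all add: det3_def algebra_simps)

lemma det3_independent:
  assumes "det3 a1 a2 a3 b1 b2 b3 c1 c2 c3 \<noteq> 0"
    and "x * a1 + y * b1 + w * c1 = 0" "x * a2 + y * b2 + w * c2 = 0" "x * a3 + y * b3 + w * c3 = 0"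
  shows "x = 0 \<and> y = 0 \<and> w = 0"
proof -
  have "x * det3 a1 a2 a3 b1 b2 b3 c1 c2 c3 = det3 (x * a1 + y * b1 + w * c1) (x * a2 + y * b2 + w * c2) (x * a3 + y * b3 + w * c3) b1 b2 b3 c1 c2 c3"
    "y * det3 a1 a2 a3 b1 b2 b3 c1 c2 c3 = det3 a1 a2 a3 (x * a1 + y * b1 + w * c1) (x * a2 + y * b2 + w * c2) (x * a3 + y * b3 + w * c3) c1 c2 c3"
    "w * det3 a1 a2 a3 b1 b2 b3 c1 c2 c3 = det3 a1 a2 a3 b1 b2 b3 (x * a1 + y * b1 + w * c1) (x * a2 + y * b2 + w * c2) (x * a3 + y * b3 + w * c3)"
    by (simp_all add: det3_def algebra_simps)
  thus ?thesis using assms by (simp add: det3_def)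
qed

lemma D3_expansion_components:
  assumes D: "D3_expansion \<phi> G0 Gv Gs Gs" and \<tau>: "Im \<tau> > 0"
    and \<phi>: "\<And>z. \<phi> \<tau> z = g3 * A3 \<tau> z + g4 * A4 \<tau> z + g2 * A2 \<tau> z"
  shows "G0 (ee \<tau>) = g3 + g4" "ee (\<tau> / 2) * Gv (ee \<tau>) = g3 - g4" "ee (5 * \<tau> / 8) * Gs (ee \<tau>) = g2"
proof -
  have "(G0 (ee \<tau>) - (g3 + g4)) * theta_sum lattice_D3 \<tau> z + (ee (\<tau> / 2) * Gv (ee \<tau>) - (g3 - g4)) * theta_sum D3v \<tau> z
     + (ee (5 * \<tau> / 8) * Gs (ee \<tau>) - g2) * theta_sum D3s \<tau> z + (ee (5 * \<tau> / 8) * Gs (ee \<tau>) - g2) * theta_sum D3c \<tau> z = 0" for z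
    using D[unfolded D3_expansion_def, rule_format, OF \<tau>, of z] \<phi>[of z] unfolding A_eq_theta[OF \<tau>]
    by (simp add: algebra_simps)
  from theta_D3_independent[OF \<tau> this]
  show "G0 (ee \<tau>) = g3 + g4" "ee (\<tau> / 2) * Gv (ee \<tau>) = g3 - g4" "ee (5 * \<tau> / 8) * Gs (ee \<tau>) = g2" by simp_all
qed

text \<open>
  Up to a constant, the determinant of the coefficients of the three even generators with respect to
  \<open>A3\<close>, \<open>A4\<close>, \<open>A2\<close>.
\<close>

definition wronskian :: "complex \<Rightarrow> complex" where
  "wronskian \<tau> = eta \<tau> ^ 12 * det3 (t3 \<tau> ^ 5) (t4 \<tau> ^ 5) (t2 \<tau> ^ 5)
     (t3 \<tau> ^ 4 * serre 0 0 \<tau>) (t4 \<tau> ^ 4 * serre 0 (1 / 2) \<tau>) (t2 \<tau> ^ 4 * serre (1 / 2) 0 \<tau>) (t3 \<tau>) (- t4 \<tau>) (- t2 \<tau>)"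

lemma wronskian_inversion:
  assumes \<tau>: "Im \<tau> > 0"
  shows "wronskian (- 1 / \<tau>) ^ 8 / eta (- 1 / \<tau>) ^ 216 = wronskian \<tau> ^ 8 / eta \<tau> ^ 216"
proof -
  define C where "C = theta_factor \<tau>"
  define \<kappa> where "\<kappa> = \<i> * C"
  have C8: "C ^ 8 = \<tau> ^ 4" and k8: "\<kappa> ^ 8 = \<tau> ^ 4"
    using theta_factor_powers[OF \<tau>] by (simp_all add: C_def \<kappa>_def)
  have nz: "\<tau> \<noteq> 0" using \<tau> by auto
  have eta: "eta (- 1 / \<tau>) ^ 12 = (\<tau> * C) ^ 4 * eta \<tau> ^ 12" "eta (- 1 / \<tau>) ^ 216 = (\<tau> * C) ^ 72 * eta \<tau> ^ 216"
    using eta_power_inversion[OF \<tau>, of 4] eta_power_inversion[OF \<tau>, of 72] by (simp_all add: C_def)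
  have det: "det3 ((k * a) ^ 5) ((k * b) ^ 5) ((k * d) ^ 5) ((k * a) ^ 4 * (t * k * x)) ((k * b) ^ 4 * (t * k * y)) ((k * d) ^ 4 * (t * k * w))
       (k * a) (- (k * b)) (- (k * d)) = - (k ^ 11 * t * det3 (a ^ 5) (d ^ 5) (b ^ 5) (a ^ 4 * x) (d ^ 4 * w) (b ^ 4 * y) a (- d) (- b))" for k a b d t x y w
    by (simp add: det3_def power_mult_distrib) (simp add: eval_nat_numeral algebra_simps)
  have "wronskian (- 1 / \<tau>) = - ((\<tau> * C) ^ 4 * (\<kappa> ^ 11 * \<tau>\<^sup>2) * wronskian \<tau>)"
    unfolding wronskian_def t_inversion[OF \<tau>] serre_t_inversion[OF \<tau>] eta(1) C_def[symmetric] \<kappa>_def[symmetric] det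
    by simp
  hence "wronskian (- 1 / \<tau>) ^ 8 = ((\<tau> * C) ^ 4 * (\<kappa> ^ 11 * \<tau>\<^sup>2)) ^ 8 * wronskian \<tau> ^ 8"
    by (simp add: power_mult_distrib)
  also have "((\<tau> * C) ^ 4 * (\<kappa> ^ 11 * \<tau>\<^sup>2)) ^ 8 = (\<tau> * C) ^ 72"
  proof -
    have "((\<tau> * C) ^ 4 * (\<kappa> ^ 11 * \<tau>\<^sup>2)) ^ 8 = \<tau> ^ 48 * (C ^ 8) ^ 4 * (\<kappa> ^ 8) ^ 11"
      by (simp add: power_mult_distrib flip: power_mult power_add)
    also have "\<dots> = \<tau> ^ 108" unfolding C8 k8 by (simp flip: power_mult power_add)
    also have "\<dots> = \<tau> ^ 72 * (C ^ 8) ^ 9" unfolding C8 by (simp flip: power_mult power_add)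
    also have "\<dots> = (\<tau> * C) ^ 72" by (simp add: power_mult_distrib flip: power_mult)
    finally show ?thesis .
  qed
  finally have w: "wronskian (- 1 / \<tau>) ^ 8 = (\<tau> * C) ^ 72 * wronskian \<tau> ^ 8" .
  have "(\<tau> * C) ^ 72 \<noteq> 0" using nz C8 by auto
  thus ?thesis unfolding w eta(2) by simp
qed

text \<open>
  In \<open>q\<close> the determinant of the components is holomorphic on the disc with value \<open>-15\<close> at 0. Its
  eighth power over the 216th power of the Euler product is a modular function without poles, hence
  constant; so the determinant vanishes nowhere, and the three generators are independent at every
  point.
\<close>

lemma even_generators:
  obtains A0 Av As B0 Bv Bs C0 Cv Cs where
    "A0 holomorphic_on ball 0 1" "Av holomorphic_on ball 0 1" "As holomorphic_on ball 0 1"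
    "B0 holomorphic_on ball 0 1" "Bv holomorphic_on ball 0 1" "Bs holomorphic_on ball 0 1"
    "C0 holomorphic_on ball 0 1" "Cv holomorphic_on ball 0 1" "Cs holomorphic_on ball 0 1"
    "D3_expansion jacobi_E4_D3 A0 Av As As" "D3_expansion jacobi_E6_D3 B0 Bv Bs Bs" "D3_expansion psi12 C0 Cv Cs Cs"
    "\<And>q. norm q < 1 \<Longrightarrow> det3 (A0 q) (Av q) (As q) (B0 q) (Bv q) (Bs q) (C0 q) (Cv q) (Cs q) \<noteq> 0"
proof -
  obtain A0 Av As where A: "A0 holomorphic_on ball 0 1" "Av holomorphic_on ball 0 1" "As holomorphic_on ball 0 1"
    "A0 0 = 1" "Av 0 = 10" "As 0 = 16" "D3_expansion jacobi_E4_D3 A0 Av As As"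
    by (rule jacobi_E4_D3_expansion)
  obtain B0 Bv Bs where B: "B0 holomorphic_on ball 0 1" "Bv holomorphic_on ball 0 1" "Bs holomorphic_on ball 0 1"
    "B0 0 = - 5 / 24" "Bv 0 = 70 / 24" "Bs 0 = 160 / 24" "D3_expansion jacobi_E6_D3 B0 Bv Bs Bs"
    by (rule jacobi_E6_D3_expansion)
  obtain C0 Cv Cs where C: "C0 holomorphic_on ball 0 1" "Cv holomorphic_on ball 0 1" "Cs holomorphic_on ball 0 1"
    "C0 0 = 0" "Cv 0 = 1" "Cs 0 = - 1" "D3_expansion psi12 C0 Cv Cs Cs"
    by (rule psi12_expansion)
  define D where "D q = det3 (A0 q) (Av q) (As q) (B0 q) (Bv q) (Bs q) (C0 q) (Cv q) (Cs q)" for q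
  have D_hol: "D holomorphic_on ball 0 1"
    unfolding D_def det3_def by (intro holomorphic_intros A B C)
  have D0: "D 0 = - 15" by (simp add: D_def det3_def A B C)
  define P where "P q = qpoch q q" for q
  have P: "P holomorphic_on ball 0 1" using euler_holomorphic by (simp add: P_def[abs_def])
  have P_nz: "P q \<noteq> 0" if "norm q < 1" for q using that qpoch_q_nonzero by (simp add: P_def)
  define g where "g q = D q ^ 8 / P q ^ 216" for q
  have g: "g holomorphic_on ball 0 1"
    unfolding g_def by (intro holomorphic_intros D_hol P) (use P_nz in auto)
  have g_eq: "g (ee \<tau>) = (5 / 4) ^ 8 * (wronskian \<tau> ^ 8 / eta \<tau> ^ 216)" if \<tau>: "Im \<tau> > 0" for \<tau>
  proof -
    define x y where "x = ee (\<tau> / 2)" and "y = ee (5 * \<tau> / 8)"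
    have 1: "jacobi_E4_D3 \<tau> z = t3 \<tau> ^ 5 / 2 * A3 \<tau> z + t4 \<tau> ^ 5 / 2 * A4 \<tau> z + t2 \<tau> ^ 5 / 2 * A2 \<tau> z" for z
      unfolding jacobi_E4_D3_eq[OF \<tau>] by (simp add: add_divide_distrib)
    have 2: "jacobi_E6_D3 \<tau> z = 5 / 2 * (t3 \<tau> ^ 4 * serre 0 0 \<tau>) * A3 \<tau> z + 5 / 2 * (t4 \<tau> ^ 4 * serre 0 (1 / 2) \<tau>) * A4 \<tau> z
        + 5 / 2 * (t2 \<tau> ^ 4 * serre (1 / 2) 0 \<tau>) * A2 \<tau> z" for z
      unfolding jacobi_E6_D3_eq[OF \<tau>] by (simp add: algebra_simps)
    have 3: "psi12 \<tau> z = eta \<tau> ^ 12 * t3 \<tau> / 2 * A3 \<tau> z + (- (eta \<tau> ^ 12 * t4 \<tau> / 2)) * A4 \<tau> z + (- (eta \<tau> ^ 12 * t2 \<tau> / 2)) * A2 \<tau> z" for z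
      unfolding psi12_eq[OF \<tau>] by (simp add: field_simps)
    note cA = D3_expansion_components[OF A(7) \<tau> 1, folded x_def y_def]
    note cB = D3_expansion_components[OF B(7) \<tau> 2, folded x_def y_def]
    note cC = D3_expansion_components[OF C(7) \<tau> 3, folded x_def y_def]
    have lin: "x * y * det3 a1 a2 a3 b1 b2 b3 c1 c2 c3 = det3 a1 (x * a2) (y * a3) b1 (x * b2) (y * b3) c1 (x * c2) (y * c3)"
      for a1 a2 a3 b1 b2 b3 c1 c2 c3 by (simp add: det3_def algebra_simps)
    have det: "det3 (a3 / 2 + a4 / 2) (a3 / 2 - a4 / 2) (a2 / 2) (5 / 2 * b3 + 5 / 2 * b4) (5 / 2 * b3 - 5 / 2 * b4) (5 / 2 * b2)
        (e * c3 / 2 + - (e * c4 / 2)) (e * c3 / 2 - - (e * c4 / 2)) (- (e * c2 / 2)) = - (5 / 4) * (e * det3 a3 a4 a2 b3 b4 b2 c3 (- c4) (- c2))"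
      for a2 a3 a4 b2 b3 b4 c2 c3 c4 e by (simp add: det3_def field_simps)
    have "x * y * D (ee \<tau>) = - (5 / 4) * wronskian \<tau>"
      unfolding D_def lin cA cB cC det wronskian_def ..
    hence "(x * y * D (ee \<tau>)) ^ 8 = (- (5 / 4) * wronskian \<tau>) ^ 8" by (simp only:)
    moreover have "(- (5 / 4) * wronskian \<tau>) ^ 8 = (5 / 4) ^ 8 * wronskian \<tau> ^ 8"
      by (simp only: power_mult_distrib) simp
    moreover have "(x * y) ^ 8 = ee (9 * \<tau>)"
      unfolding x_def y_def ee_add[symmetric] ee_of_nat_mult[symmetric]
      by (rule arg_cong[of _ _ ee]) simp
    ultimately have w: "(5 / 4) ^ 8 * wronskian \<tau> ^ 8 = ee (9 * \<tau>) * D (ee \<tau>) ^ 8"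
      by (metis power_mult_distrib)
    have eta: "eta \<tau> ^ 216 = ee (9 * \<tau>) * P (ee \<tau>) ^ 216"
      using eta_power[OF \<tau>, of 216] by (simp add: P_def)
    have "g (ee \<tau>) = (ee (9 * \<tau>) * D (ee \<tau>) ^ 8) / (ee (9 * \<tau>) * P (ee \<tau>) ^ 216)"
      unfolding g_def by (rule mult_divide_mult_cancel_left[symmetric]) (simp add: ee_def)
    thus ?thesis unfolding w[symmetric] eta[symmetric] by simp
  qed
  have g_const: "g q = g 0" if "norm q < 1" for q
    by (rule weight_zero_constant[OF g _ that])
       (simp only: g_eq Im_minus_inverse_pos wronskian_inversion)
  have "g 0 \<noteq> 0" using P_nz[of 0] by (simp add: g_def D0)
  hence "D q \<noteq> 0" if "norm q < 1" for q
    using g_const[OF that] by (auto simp: g_def)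
  thus thesis using that[OF A(1-3) B(1-3) C(1-3) A(7) B(7) C(7)] by (simp add: D_def)
qed

section \<open>The module structure over the ring of modular forms\<close>

lemma jacobi_invariantI:
  assumes "\<phi> \<in> jacobi_forms k L" "a * d - b * c = 1"
  shows "jacobi_invariant k \<phi> a b c d"
  using assms unfolding jacobi_forms_def jacobi_invariant_def by blast

lemma jacobi_form_D3_expansion:
  assumes "\<phi> \<in> jacobi_forms k lattice_D3"
  obtains G0 Gv Gs where "G0 holomorphic_on ball 0 1" "Gv holomorphic_on ball 0 1" "Gs holomorphic_on ball 0 1"
    "if even k then D3_expansion \<phi> G0 Gv Gs Gs else D3_expansion \<phi> (\<lambda>_. 0) (\<lambda>_. 0) Gs (\<lambda>x. - Gs x)"
proof -
  obtain c where c: "\<forall>\<tau>\<in>upper_half_plane. \<forall>z. ((\<lambda>(m, r). c m r * ee (of_int m * \<tau>) * ee (bil z (cvec r))) has_sum \<phi> \<tau> z)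
          {(m, r). r \<in> dual_lattice lattice_D3 \<and> of_int m \<ge> r \<bullet> r / 2}"
    using assms unfolding jacobi_forms_def by blast
  show thesis by (rule jacobi_form_expansion[OF assms c[rule_format] that]) simp_all
qed

lemma jacobi_form_D3_expansion_ex:
  assumes "\<phi> \<in> jacobi_forms k lattice_D3"
  obtains G0 Gv Gs Gc where "G0 holomorphic_on ball 0 1" "Gv holomorphic_on ball 0 1" "Gs holomorphic_on ball 0 1"
    "Gc holomorphic_on ball 0 1" "D3_expansion \<phi> G0 Gv Gs Gc"
proof (rule jacobi_form_D3_expansion[OF assms])
  fix G0 Gv Gs
  assume G: "G0 holomorphic_on ball 0 1" "Gv holomorphic_on ball 0 1" "Gs holomorphic_on ball 0 1"
    and D: "if even k then D3_expansion \<phi> G0 Gv Gs Gs else D3_expansion \<phi> (\<lambda>_. 0) (\<lambda>_. 0) Gs (\<lambda>x. - Gs x)"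
  show thesis
  proof (cases "even k")
    case True
    thus ?thesis using that[OF G G(3)] D by simp
  next
    case False
    have "(\<lambda>x. - Gs x) holomorphic_on ball 0 1" "(\<lambda>_. 0 :: complex) holomorphic_on ball 0 1"
      by (intro holomorphic_intros G)+
    thus ?thesis using that[of "\<lambda>_. 0" "\<lambda>_. 0" Gs "\<lambda>x. - Gs x"] G(3) D False by simp
  qed
qed

lemma modular_times_jacobi:
  assumes f: "f \<in> modular_forms j" and \<phi>: "\<phi> \<in> jacobi_forms k lattice_D3"
  shows "(\<lambda>\<tau> z. f \<tau> * \<phi> \<tau> z) \<in> jacobi_forms (j + k) lattice_D3"
proof -
  obtain F where F: "F holomorphic_on ball 0 1" "\<And>\<tau>. Im \<tau> > 0 \<Longrightarrow> f \<tau> = F (ee \<tau>)"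
    by (rule modular_formsD[OF f]) (rule that; (assumption | simp))
  obtain G0 Gv Gs Gc where G: "G0 holomorphic_on ball 0 1" "Gv holomorphic_on ball 0 1" "Gs holomorphic_on ball 0 1"
    "Gc holomorphic_on ball 0 1" and D: "D3_expansion \<phi> G0 Gv Gs Gc"
    by (rule jacobi_form_D3_expansion_ex[OF \<phi>])
  show ?thesis
  proof (rule jacobi_formsI)
    show "D3_expansion (\<lambda>\<tau> z. f \<tau> * \<phi> \<tau> z) (\<lambda>q. F q * G0 q) (\<lambda>q. F q * Gv q) (\<lambda>q. F q * Gs q) (\<lambda>q. F q * Gc q)"
      using D unfolding D3_expansion_def by (simp add: F(2) algebra_simps)
    show "f \<tau> * \<phi> \<tau> z = 0" if "Im \<tau> \<le> 0" for \<tau> z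
      using f that by (simp add: modular_forms_def)
    fix a b c d :: int
    assume det: "a * d - b * c = 1"
    show "jacobi_invariant (j + k) (\<lambda>\<tau> z. f \<tau> * \<phi> \<tau> z) a b c d"
      unfolding jacobi_invariant_def
    proof (intro ballI allI)
      fix \<tau> :: complex and z :: "complex^3"
      assume \<tau>: "\<tau> \<in> upper_half_plane"
      define J M where "J = of_int c * \<tau> + of_int d" and "M = (of_int a * \<tau> + of_int b) / J"
      define e where "e = ee (- of_int c * (bil z z / 2) / J)"
      have J: "J \<noteq> 0" using moebius_denominator_nonzero[OF _ det] \<tau> by (simp add: J_def)
      have 1: "f M * J powi (- j) = f \<tau>" using f \<tau> det unfolding modular_forms_def M_def J_def by blast
      have 2: "\<phi> M ((1 / J) *s z) * e * J powi (- k) = \<phi> \<tau> z"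
        using jacobi_invariantI[OF \<phi> det] \<tau> unfolding jacobi_invariant_def M_def J_def e_def by blast
      have "J powi (- (j + k)) = J powi (- j) * J powi (- k)"
        using J by (simp flip: power_int_add)
      thus "f ((of_int a * \<tau> + of_int b) / (of_int c * \<tau> + of_int d)) *
           \<phi> ((of_int a * \<tau> + of_int b) / (of_int c * \<tau> + of_int d)) ((1 / (of_int c * \<tau> + of_int d)) *s z) *
          ee (- of_int c * (bil z z / 2) / (of_int c * \<tau> + of_int d)) *
          (of_int c * \<tau> + of_int d) powi - (j + k) = f \<tau> * \<phi> \<tau> z"
        unfolding J_def[symmetric] M_def[symmetric] e_def[symmetric] 1[symmetric] 2[symmetric]
        by (simp only: mult_ac)
    qed
  qed (intro holomorphic_intros F G)+
qed

lemma jacobi_forms_add: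
  assumes \<phi>: "\<phi> \<in> jacobi_forms k lattice_D3" and \<psi>: "\<psi> \<in> jacobi_forms k lattice_D3"
  shows "\<phi> + \<psi> \<in> jacobi_forms k lattice_D3"
proof -
  obtain G0 Gv Gs Gc where G: "G0 holomorphic_on ball 0 1" "Gv holomorphic_on ball 0 1" "Gs holomorphic_on ball 0 1"
    "Gc holomorphic_on ball 0 1" and D: "D3_expansion \<phi> G0 Gv Gs Gc"
    by (rule jacobi_form_D3_expansion_ex[OF \<phi>])
  obtain H0 Hv Hs Hc where H: "H0 holomorphic_on ball 0 1" "Hv holomorphic_on ball 0 1" "Hs holomorphic_on ball 0 1"
    "Hc holomorphic_on ball 0 1" and E: "D3_expansion \<psi> H0 Hv Hs Hc"
    by (rule jacobi_form_D3_expansion_ex[OF \<psi>])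
  show ?thesis
  proof (rule jacobi_formsI)
    show "D3_expansion (\<phi> + \<psi>) (\<lambda>q. G0 q + H0 q) (\<lambda>q. Gv q + Hv q) (\<lambda>q. Gs q + Hs q) (\<lambda>q. Gc q + Hc q)"
      using D E unfolding D3_expansion_def by (simp add: algebra_simps)
    show "(\<phi> + \<psi>) \<tau> z = 0" if "Im \<tau> \<le> 0" for \<tau> z
      using \<phi> \<psi> that by (simp add: jacobi_forms_def)
    fix a b c d :: int
    assume "a * d - b * c = 1"
    from this[THEN jacobi_invariantI[OF \<phi>]] this[THEN jacobi_invariantI[OF \<psi>]]
    show "jacobi_invariant k (\<phi> + \<psi>) a b c d"
      unfolding jacobi_invariant_def by (simp add: distrib_right)
  qed (intro holomorphic_intros G H)+
qed

lemma generators_are_jacobi_forms: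
  "jacobi_E4_D3 \<in> jacobi_forms 4 lattice_D3" "jacobi_E6_D3 \<in> jacobi_forms 6 lattice_D3"
  "psi12 \<in> jacobi_forms 8 lattice_D3" "psi15 \<in> jacobi_forms 9 lattice_D3"
proof -
  obtain A0 Av As B0 Bv Bs C0 Cv Cs where
    A: "A0 holomorphic_on ball 0 1" "Av holomorphic_on ball 0 1" "As holomorphic_on ball 0 1" and
    B: "B0 holomorphic_on ball 0 1" "Bv holomorphic_on ball 0 1" "Bs holomorphic_on ball 0 1" and
    C: "C0 holomorphic_on ball 0 1" "Cv holomorphic_on ball 0 1" "Cs holomorphic_on ball 0 1" and
    D: "D3_expansion jacobi_E4_D3 A0 Av As As" "D3_expansion jacobi_E6_D3 B0 Bv Bs Bs" "D3_expansion psi12 C0 Cv Cs Cs"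
    by (rule even_generators) (rule that; (assumption | simp))
  show "jacobi_E4_D3 \<in> jacobi_forms 4 lattice_D3"
    by (rule jacobi_formsI[OF A A(3) D(1) _ jacobi_E4_D3_invariant]) (simp add: jacobi_E4_D3_def pullback_def theta_sum_def)
  show "jacobi_E6_D3 \<in> jacobi_forms 6 lattice_D3"
    by (rule jacobi_formsI[OF B B(3) D(2) _ jacobi_E6_D3_invariant]) (simp add: jacobi_E6_D3_def heat_delta_def)
  show "psi12 \<in> jacobi_forms 8 lattice_D3"
    by (rule jacobi_formsI[OF C C(3) D(3) _ psi12_invariant]) (simp add: psi12_def eta_def)
  show "psi15 \<in> jacobi_forms 9 lattice_D3"
    by (rule jacobi_formsI[OF _ _ _ _ psi15_expansion _ psi15_invariant])
       (auto intro!: holomorphic_intros euler_holomorphic simp: psi15_def eta_def)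
qed

lemma even_generators_independent:
  assumes \<tau>: "Im \<tau> > 0"
    and zero: "\<And>z. x * jacobi_E4_D3 \<tau> z + y * jacobi_E6_D3 \<tau> z + w * psi12 \<tau> z = 0"
  shows "x = 0 \<and> y = 0 \<and> w = 0"
proof -
  obtain A0 Av As B0 Bv Bs C0 Cv Cs where
    "A0 holomorphic_on ball 0 1" "Av holomorphic_on ball 0 1" "As holomorphic_on ball 0 1"
    "B0 holomorphic_on ball 0 1" "Bv holomorphic_on ball 0 1" "Bs holomorphic_on ball 0 1"
    "C0 holomorphic_on ball 0 1" "Cv holomorphic_on ball 0 1" "Cs holomorphic_on ball 0 1" and
    D: "D3_expansion jacobi_E4_D3 A0 Av As As" "D3_expansion jacobi_E6_D3 B0 Bv Bs Bs" "D3_expansion psi12 C0 Cv Cs Cs" and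
    det: "\<And>q. norm q < 1 \<Longrightarrow> det3 (A0 q) (Av q) (As q) (B0 q) (Bv q) (Bs q) (C0 q) (Cv q) (Cs q) \<noteq> 0"
    by (rule even_generators) (rule that; (assumption | simp))
  let ?q = "ee \<tau>"
  define d0 dv ds where "d0 = x * A0 ?q + y * B0 ?q + w * C0 ?q" and "dv = x * Av ?q + y * Bv ?q + w * Cv ?q"
    and "ds = x * As ?q + y * Bs ?q + w * Cs ?q"
  note E = D[unfolded D3_expansion_def, rule_format, OF \<tau>]
  have "d0 * theta_sum lattice_D3 \<tau> z + (ee (\<tau> / 2) * dv) * theta_sum D3v \<tau> z
      + (ee (5 * \<tau> / 8) * ds) * theta_sum D3s \<tau> z + (ee (5 * \<tau> / 8) * ds) * theta_sum D3c \<tau> z = 0" for z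
    using zero[of z] unfolding E d0_def dv_def ds_def by (simp add: algebra_simps)
  from theta_D3_independent[OF \<tau> this] have "d0 = 0" "dv = 0" "ds = 0" by (simp_all add: ee_def)
  thus ?thesis unfolding d0_def dv_def ds_def by (rule det3_independent[OF det[OF norm_ee_less_1[THEN iffD2, OF \<tau>]]])
qed

lemma psi15_independent:
  assumes \<tau>: "Im \<tau> > 0" and zero: "\<And>z. x * psi15 \<tau> z = 0"
  shows "x = 0"
proof -
  define p where "p = ee (5 * \<tau> / 8) * qpoch (ee \<tau>) (ee \<tau>) ^ 15"
  have "0 * theta_sum lattice_D3 \<tau> z + 0 * theta_sum D3v \<tau> z + (x * p) * theta_sum D3s \<tau> z + (- (x * p)) * theta_sum D3c \<tau> z = 0" for z
    using zero[of z] psi15_expansion[unfolded D3_expansion_def, rule_format, OF \<tau>, of z] by (simp add: p_def algebra_simps)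
  from theta_D3_independent(3)[OF \<tau> this] show ?thesis
    using qpoch_q_nonzero[of "ee \<tau>"] \<tau> by (simp add: p_def ee_def)
qed

text \<open>
  Both sides of an identity of Jacobi forms transform alike, so pointwise linear independence of the
  generators forces every coefficient to transform like a modular form of the complementary weight.
\<close>

lemma coefficient_modular:
  fixes g :: "'i \<Rightarrow> complex \<Rightarrow> complex^'n \<Rightarrow> complex"
  assumes \<phi>: "\<And>a b c d. a * d - b * c = 1 \<Longrightarrow> jacobi_invariant k \<phi> a b c d"
    and g: "\<And>i a b c d. i \<in> I \<Longrightarrow> a * d - b * c = 1 \<Longrightarrow> jacobi_invariant (w i) (g i) a b c d"
    and indep: "\<And>x \<tau> i. Im \<tau> > 0 \<Longrightarrow> \<forall>z. (\<Sum>i\<in>I. x i * g i \<tau> z) = 0 \<Longrightarrow> i \<in> I \<Longrightarrow> x i = 0"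
    and F: "\<And>i. i \<in> I \<Longrightarrow> F i holomorphic_on ball 0 1"
    and eq: "\<And>\<tau> z. Im \<tau> > 0 \<Longrightarrow> \<phi> \<tau> z = (\<Sum>i\<in>I. F i (ee \<tau>) * g i \<tau> z)"
    and i: "i \<in> I"
  shows "(\<lambda>\<tau>. if Im \<tau> > 0 then F i (ee \<tau>) else 0) \<in> modular_forms (k - w i)"
proof (rule modular_formsI[OF F[OF i] refl])
  fix a b c d :: int and \<tau> :: complex
  assume \<tau>: "Im \<tau> > 0" and det: "a * d - b * c = 1"
  define J M where "J = of_int c * \<tau> + of_int d" and "M = (of_int a * \<tau> + of_int b) / J"
  have J: "J \<noteq> 0" using moebius_denominator_nonzero[OF \<tau> det] by (simp add: J_def)
  have M: "Im M > 0" unfolding M_def J_def by (rule Im_moebius_pos[OF \<tau> det])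
  define x where "x j = F j (ee M) * J powi (- (k - w j)) - F j (ee \<tau>)" for j
  have "x i = 0"
  proof (rule indep[OF \<tau> _ i], intro allI)
    fix z :: "complex^'n"
    define e where "e = ee (- of_int c * (bil z z / 2) / J)"
    have 1: "F j (ee M) * J powi (- (k - w j)) * g j \<tau> z = F j (ee M) * g j M ((1 / J) *s z) * (e * J powi (- k))"
      if j: "j \<in> I" for j
    proof -
      have 2: "g j \<tau> z = g j M ((1 / J) *s z) * e * J powi (- w j)"
        using g[OF j det] \<tau> unfolding jacobi_invariant_def M_def J_def e_def by auto
      have 3: "J powi (- k) = J powi (- (k - w j)) * J powi (- w j)"
        using J by (simp flip: power_int_add)
      show ?thesis unfolding 2 3 by (simp only: mult_ac)
    qed
    have "(\<Sum>j\<in>I. F j (ee M) * J powi (- (k - w j)) * g j \<tau> z) = \<phi> M ((1 / J) *s z) * (e * J powi (- k))"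
      unfolding eq[OF M] sum_distrib_right by (rule sum.cong[OF refl 1])
    also have "\<dots> = \<phi> \<tau> z"
      using \<phi>[OF det] \<tau> unfolding jacobi_invariant_def M_def J_def e_def by (auto simp: mult.assoc)
    finally show "(\<Sum>j\<in>I. x j * g j \<tau> z) = 0"
      unfolding eq[OF \<tau>] x_def by (simp add: left_diff_distrib sum_subtractf)
  qed
  thus "(if Im ((of_int a * \<tau> + of_int b) / (of_int c * \<tau> + of_int d)) > 0
       then F i (ee ((of_int a * \<tau> + of_int b) / (of_int c * \<tau> + of_int d))) else 0) *
      (of_int c * \<tau> + of_int d) powi - (k - w i) = (if Im \<tau> > 0 then F i (ee \<tau>) else 0)"
    unfolding J_def[symmetric] M_def[symmetric] using M \<tau> by (simp add: x_def)
qed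

text \<open>
  A form of odd weight has a single component. It is divisible by that of the generator because the
  Euler product has no zeros in the disc.
\<close>

lemma jacobi_odd_decomposition:
  assumes \<phi>: "\<phi> \<in> jacobi_forms k lattice_D3" and k: "odd k"
  shows "\<exists>f\<in>modular_forms (k - 9). \<phi> = (\<lambda>\<tau> z. f \<tau> * psi15 \<tau> z)"
proof -
  obtain G0 Gv Gs where G: "Gs holomorphic_on ball 0 1" and D: "D3_expansion \<phi> (\<lambda>_. 0) (\<lambda>_. 0) Gs (\<lambda>x. - Gs x)"
    using jacobi_form_D3_expansion[OF \<phi>] k by auto
  define F where "F q = Gs q / qpoch q q ^ 15" for q
  have F: "F holomorphic_on ball 0 1"
    unfolding F_def by (intro holomorphic_intros G euler_holomorphic) (auto simp: qpoch_q_nonzero)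
  define f where "f \<tau> = (if Im \<tau> > 0 then F (ee \<tau>) else 0)" for \<tau>
  have eq: "\<phi> \<tau> z = F (ee \<tau>) * psi15 \<tau> z" if \<tau>: "Im \<tau> > 0" for \<tau> z
  proof -
    have "Gs (ee \<tau>) = F (ee \<tau>) * qpoch (ee \<tau>) (ee \<tau>) ^ 15"
      using qpoch_q_nonzero[of "ee \<tau>"] \<tau> by (simp add: F_def)
    thus ?thesis
      unfolding D[unfolded D3_expansion_def, rule_format, OF \<tau>, of z] psi15_expansion[unfolded D3_expansion_def, rule_format, OF \<tau>, of z]
      by (simp add: algebra_simps)
  qed
  have "f \<in> modular_forms (k - (\<lambda>_::unit. 9) ())"
    unfolding f_def[abs_def]
  proof (rule coefficient_modular[where F = "\<lambda>_::unit. F" and I = UNIV and g = "\<lambda>_. psi15" and w = "\<lambda>_. 9" and \<phi> = \<phi>])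
    fix x :: "unit \<Rightarrow> complex" and \<tau> i
    assume \<tau>: "Im \<tau> > 0" and zero: "\<forall>z. (\<Sum>i\<in>UNIV. x i * psi15 \<tau> z) = 0"
    show "x i = 0" by (rule psi15_independent[OF \<tau>]) (use zero in \<open>auto simp: UNIV_unit\<close>)
  qed (use jacobi_invariantI[OF \<phi>] psi15_invariant F eq in \<open>auto simp: UNIV_unit\<close>)
  moreover have "\<phi> = (\<lambda>\<tau> z. f \<tau> * psi15 \<tau> z)"
  proof (intro ext)
    fix \<tau> z
    show "\<phi> \<tau> z = f \<tau> * psi15 \<tau> z"
      using \<phi> eq by (cases "Im \<tau> > 0") (auto simp: f_def jacobi_forms_def)
  qed
  ultimately show ?thesis by auto
qed

text \<open>
  By Cramer's rule, the coefficients are quotients of determinants, and the denominator never vanishes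
  on the disc, so that they are holomorphic at the cusp as well.
\<close>

lemma jacobi_even_decomposition:
  assumes \<phi>: "\<phi> \<in> jacobi_forms k lattice_D3" and k: "even k"
  shows "\<exists>f\<in>modular_forms (k - 4). \<exists>g\<in>modular_forms (k - 6). \<exists>h\<in>modular_forms (k - 8).
    \<phi> = (\<lambda>\<tau> z. f \<tau> * jacobi_E4_D3 \<tau> z + g \<tau> * jacobi_E6_D3 \<tau> z + h \<tau> * psi12 \<tau> z)"
proof -
  obtain A0 Av As B0 Bv Bs C0 Cv Cs where
    A: "A0 holomorphic_on ball 0 1" "Av holomorphic_on ball 0 1" "As holomorphic_on ball 0 1" and
    B: "B0 holomorphic_on ball 0 1" "Bv holomorphic_on ball 0 1" "Bs holomorphic_on ball 0 1" and
    C: "C0 holomorphic_on ball 0 1" "Cv holomorphic_on ball 0 1" "Cs holomorphic_on ball 0 1" and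
    D: "D3_expansion jacobi_E4_D3 A0 Av As As" "D3_expansion jacobi_E6_D3 B0 Bv Bs Bs" "D3_expansion psi12 C0 Cv Cs Cs" and
    det: "\<And>q. norm q < 1 \<Longrightarrow> det3 (A0 q) (Av q) (As q) (B0 q) (Bv q) (Bs q) (C0 q) (Cv q) (Cs q) \<noteq> 0"
    by (rule even_generators) (rule that; (assumption | simp))
  obtain G0 Gv Gs where G: "G0 holomorphic_on ball 0 1" "Gv holomorphic_on ball 0 1" "Gs holomorphic_on ball 0 1"
    and E: "D3_expansion \<phi> G0 Gv Gs Gs"
    using jacobi_form_D3_expansion[OF \<phi>] k by metis
  define d where "d q = det3 (A0 q) (Av q) (As q) (B0 q) (Bv q) (Bs q) (C0 q) (Cv q) (Cs q)" for q
  define F where "F = (!)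
    [\<lambda>q. det3 (G0 q) (Gv q) (Gs q) (B0 q) (Bv q) (Bs q) (C0 q) (Cv q) (Cs q) / d q,
     \<lambda>q. det3 (A0 q) (Av q) (As q) (G0 q) (Gv q) (Gs q) (C0 q) (Cv q) (Cs q) / d q,
     \<lambda>q. det3 (A0 q) (Av q) (As q) (B0 q) (Bv q) (Bs q) (G0 q) (Gv q) (Gs q) / d q]"
  define g where "g = (!) [jacobi_E4_D3, jacobi_E6_D3, psi12]"
  define w :: "nat \<Rightarrow> int" where "w = (!) [4, 6, 8]"
  have sum3: "(\<Sum>i<3. u i) = u 0 + u (Suc 0) + u (Suc (Suc 0))" for u :: "nat \<Rightarrow> complex"
    by (simp add: eval_nat_numeral)
  have less3: "i \<in> {..<3} \<longleftrightarrow> i = 0 \<or> i = Suc 0 \<or> i = Suc (Suc 0)" for i :: nat by auto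
  have d_nz: "d q \<noteq> 0" if "norm q < 1" for q using det that by (simp add: d_def)
  have d: "d holomorphic_on ball 0 1" unfolding d_def det3_def by (intro holomorphic_intros A B C)
  have F_hol: "F i holomorphic_on ball 0 1" if "i \<in> {..<3}" for i
    using that unfolding less3
    by (elim disjE; simp add: F_def det3_def) (intro holomorphic_intros A B C G d; use d_nz in auto)+
  have G_eq: "G0 q = F 0 q * A0 q + F (Suc 0) q * B0 q + F (Suc (Suc 0)) q * C0 q"
    "Gv q = F 0 q * Av q + F (Suc 0) q * Bv q + F (Suc (Suc 0)) q * Cv q"
    "Gs q = F 0 q * As q + F (Suc 0) q * Bs q + F (Suc (Suc 0)) q * Cs q" if "norm q < 1" for q
  proof -
    have r: "h = x / d q * a + y / d q * b + v / d q * c" if "x * a + y * b + v * c = d q * h" for x y v a b c h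
      using that d_nz[OF \<open>norm q < 1\<close>] by (simp add: field_simps)
    show "G0 q = F 0 q * A0 q + F (Suc 0) q * B0 q + F (Suc (Suc 0)) q * C0 q"
      "Gv q = F 0 q * Av q + F (Suc 0) q * Bv q + F (Suc (Suc 0)) q * Cv q"
      "Gs q = F 0 q * As q + F (Suc 0) q * Bs q + F (Suc (Suc 0)) q * Cs q"
      by (simp_all only: F_def nth_Cons_0 nth_Cons_Suc)
         (rule r, simp only: d_def cramer3)+
  qed
  have eq: "\<phi> \<tau> z = (\<Sum>i<3. F i (ee \<tau>) * g i \<tau> z)" if \<tau>: "Im \<tau> > 0" for \<tau> z
  proof -
    note X = D[unfolded D3_expansion_def, rule_format, OF \<tau>, of z] E[unfolded D3_expansion_def, rule_format, OF \<tau>, of z]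
    have q: "norm (ee \<tau>) < 1" using \<tau> by simp
    show ?thesis unfolding sum3 g_def nth_Cons_0 nth_Cons_Suc X G_eq[OF q] by (simp add: algebra_simps)
  qed
  define f where "f i \<tau> = (if Im \<tau> > 0 then F i (ee \<tau>) else 0)" for i \<tau>
  have "f i \<in> modular_forms (k - w i)" if i: "i \<in> {..<3}" for i
    unfolding f_def[abs_def]
  proof (rule coefficient_modular[where g = g and w = w and \<phi> = \<phi>])
    fix x :: "nat \<Rightarrow> complex" and \<tau> and j :: nat
    assume "Im \<tau> > 0" "\<forall>z. (\<Sum>i<3. x i * g i \<tau> z) = 0" and j: "j \<in> {..<3}"
    hence "x 0 = 0 \<and> x (Suc 0) = 0 \<and> x (Suc (Suc 0)) = 0"
      using even_generators_independent[of \<tau> "x 0" "x (Suc 0)" "x (Suc (Suc 0))"] by (simp add: sum3 g_def)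
    thus "x j = 0" using j unfolding less3 by auto
  next
    fix j :: nat and a b c d :: int
    assume "j \<in> {..<3}" "a * d - b * c = 1"
    thus "jacobi_invariant (w j) (g j) a b c d"
      unfolding less3 using jacobi_E4_D3_invariant jacobi_E6_D3_invariant psi12_invariant by (auto simp: w_def g_def)
  qed (use jacobi_invariantI[OF \<phi>] F_hol eq i in auto)
  from this[of 0] this[of "Suc 0"] this[of "Suc (Suc 0)"]
  have f: "f 0 \<in> modular_forms (k - 4)" "f (Suc 0) \<in> modular_forms (k - 6)" "f (Suc (Suc 0)) \<in> modular_forms (k - 8)"
    by (simp_all add: w_def)
  moreover have "\<phi> = (\<lambda>\<tau> z. f 0 \<tau> * jacobi_E4_D3 \<tau> z + f (Suc 0) \<tau> * jacobi_E6_D3 \<tau> z + f (Suc (Suc 0)) \<tau> * psi12 \<tau> z)"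
  proof (intro ext)
    fix \<tau> z
    show "\<phi> \<tau> z = f 0 \<tau> * jacobi_E4_D3 \<tau> z + f (Suc 0) \<tau> * jacobi_E6_D3 \<tau> z + f (Suc (Suc 0)) \<tau> * psi12 \<tau> z"
      using \<phi> eq[of \<tau> z] by (cases "Im \<tau> > 0") (auto simp: f_def jacobi_forms_def sum3 g_def)
  qed
  ultimately show ?thesis by blast
qed

subsection \<open>Sums over all weights\<close>

lemma family_sum_reindex:
  assumes "finite F" "inj g" "\<And>i. i \<in> F \<Longrightarrow> g i \<in> I \<and> v i \<in> V (g i)"
  shows "(\<Sum>i\<in>F. v i) \<in> family_sum I V"
proof -
  have "(\<Sum>i\<in>F. v i) = (\<Sum>j\<in>g ` F. v (inv g j))"
    using assms(2) by (subst sum.reindex) (auto simp: inj_on_def)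
  moreover have "\<forall>j\<in>g ` F. v (inv g j) \<in> V j" "g ` F \<subseteq> I" using assms by auto
  ultimately show ?thesis unfolding family_sum_def using assms(1) by blast
qed

lemma family_sum_add:
  assumes "x \<in> family_sum I V" "y \<in> family_sum I V"
    and add: "\<And>i a b. i \<in> I \<Longrightarrow> a \<in> V i \<Longrightarrow> b \<in> V i \<Longrightarrow> a + b \<in> V i"
  shows "x + y \<in> family_sum I V"
proof -
  obtain F v where F: "finite F" "F \<subseteq> I" "\<forall>i\<in>F. v i \<in> V i" "x = (\<Sum>i\<in>F. v i)"
    using assms(1) unfolding family_sum_def by auto
  obtain G u where G: "finite G" "G \<subseteq> I" "\<forall>i\<in>G. u i \<in> V i" "y = (\<Sum>i\<in>G. u i)"
    using assms(2) unfolding family_sum_def by auto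
  let ?s = "\<lambda>i. (if i \<in> F then v i else 0) + (if i \<in> G then u i else 0)"
  have "x = (\<Sum>i\<in>F \<union> G. if i \<in> F then v i else 0)" "y = (\<Sum>i\<in>F \<union> G. if i \<in> G then u i else 0)"
    unfolding F(4) G(4) using F(1) G(1) by (intro sum.mono_neutral_cong_left; auto)+
  hence "x + y = (\<Sum>i\<in>F \<union> G. ?s i)" by (simp add: sum.distrib)
  moreover have "\<forall>i\<in>F \<union> G. ?s i \<in> V i" using F G add by auto
  ultimately show ?thesis unfolding family_sum_def using F(1,2) G(1,2) by blast
qed

lemma sum_shifted_modular_forms:
  assumes "finite F" "\<And>k. k \<in> F \<Longrightarrow> even (k - w) \<and> f k \<in> modular_forms (k - w)"
  shows "(\<Sum>k\<in>F. f k) \<in> M_star"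
  unfolding M_star_def
  by (rule family_sum_reindex[where g = "\<lambda>k. k - w"]) (use assms in \<open>auto simp: inj_def\<close>)

lemma M_star_multiple_sum:
  assumes g: "g \<in> jacobi_forms w lattice_D3" and h: "h \<in> M_star_multiples g"
  shows "h \<in> family_sum {k. even (k - w)} (\<lambda>k. jacobi_forms k lattice_D3)"
proof -
  obtain f where f: "f \<in> M_star" "h = (\<lambda>\<tau> z. f \<tau> * g \<tau> z)" using h unfolding M_star_multiples_def by auto
  then obtain F v where F: "finite F" "F \<subseteq> {k. even k}" "\<forall>i\<in>F. v i \<in> modular_forms i" "f = (\<Sum>i\<in>F. v i)"
    unfolding M_star_def family_sum_def by auto
  have "h = (\<Sum>i\<in>F. (\<lambda>\<tau> z. v i \<tau> * g \<tau> z))"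
    unfolding f(2) F(4) by (intro ext) (simp add: sum_fun_apply1 sum_distrib_right)
  also have "\<dots> \<in> family_sum {k. even (k - w)} (\<lambda>k. jacobi_forms k lattice_D3)"
    by (rule family_sum_reindex[where g = "\<lambda>k. k + w"]) (use F modular_times_jacobi[OF _ g] in \<open>auto simp: inj_def\<close>)
  finally show ?thesis .
qed

lemma zero_in_M_star_multiples: "0 \<in> M_star_multiples g"
proof -
  have "0 \<in> M_star" unfolding M_star_def family_sum_def by (auto intro!: exI[of _ "{}"])
  thus ?thesis unfolding M_star_multiples_def by (auto simp: fun_eq_iff intro!: exI[of _ 0])
qed

lemma J_odd_D3: "J_odd lattice_D3 = M_star_multiples psi15"
proof (intro equalityI subsetI)
  fix \<phi> assume "\<phi> \<in> J_odd lattice_D3"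
  then obtain F v where F: "finite F" "F \<subseteq> {k. odd k}" "\<forall>k\<in>F. v k \<in> jacobi_forms k lattice_D3" "\<phi> = (\<Sum>k\<in>F. v k)"
    unfolding J_odd_def family_sum_def by auto
  have "\<forall>k\<in>F. \<exists>f. f \<in> modular_forms (k - 9) \<and> v k = (\<lambda>\<tau> z. f \<tau> * psi15 \<tau> z)"
    using F jacobi_odd_decomposition by blast
  then obtain f where f: "\<forall>k\<in>F. f k \<in> modular_forms (k - 9) \<and> v k = (\<lambda>\<tau> z. f k \<tau> * psi15 \<tau> z)" by metis
  have "(\<Sum>k\<in>F. f k) \<in> M_star"
    by (rule sum_shifted_modular_forms[where w = 9]) (use F f in auto)
  moreover have "\<phi> = (\<lambda>\<tau> z. (\<Sum>k\<in>F. f k) \<tau> * psi15 \<tau> z)"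
    using f unfolding F(4) by (intro ext) (simp add: sum_fun_apply1 sum_distrib_right)
  ultimately show "\<phi> \<in> M_star_multiples psi15" unfolding M_star_multiples_def by blast
next
  fix \<phi> assume "\<phi> \<in> M_star_multiples psi15"
  from M_star_multiple_sum[OF generators_are_jacobi_forms(4) this]
  show "\<phi> \<in> J_odd lattice_D3" by (simp add: J_odd_def)
qed

lemma J_even_D3:
  "J_even lattice_D3 = {a + b + c | a b c. a \<in> M_star_multiples jacobi_E4_D3 \<and> b \<in> M_star_multiples jacobi_E6_D3 \<and>
     c \<in> M_star_multiples psi12}" (is "_ = ?S")
proof (intro equalityI subsetI)
  fix \<phi> assume "\<phi> \<in> J_even lattice_D3"
  then obtain F v where F: "finite F" "F \<subseteq> {k. even k}" "\<forall>k\<in>F. v k \<in> jacobi_forms k lattice_D3" "\<phi> = (\<Sum>k\<in>F. v k)"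
    unfolding J_even_def family_sum_def by auto
  define R where "R k f g h \<longleftrightarrow> f \<in> modular_forms (k - 4) \<and> g \<in> modular_forms (k - 6) \<and> h \<in> modular_forms (k - 8) \<and>
      v k = (\<lambda>\<tau> z. f \<tau> * jacobi_E4_D3 \<tau> z + g \<tau> * jacobi_E6_D3 \<tau> z + h \<tau> * psi12 \<tau> z)" for k f g h
  have "\<forall>k\<in>F. \<exists>f g h. R k f g h"
  proof
    fix k assume "k \<in> F"
    with F have "v k \<in> jacobi_forms k lattice_D3" "even k" by auto
    from jacobi_even_decomposition[OF this] show "\<exists>f g h. R k f g h"
      by (elim bexE, intro exI) (simp only: R_def)
  qed
  then obtain f g h where "\<And>k. k \<in> F \<Longrightarrow> R k (f k) (g k) (h k)" by metis
  hence f: "\<And>k. k \<in> F \<Longrightarrow> f k \<in> modular_forms (k - 4)" and g: "\<And>k. k \<in> F \<Longrightarrow> g k \<in> modular_forms (k - 6)"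
    and h: "\<And>k. k \<in> F \<Longrightarrow> h k \<in> modular_forms (k - 8)"
    and v: "\<And>k. k \<in> F \<Longrightarrow> v k = (\<lambda>\<tau> z. f k \<tau> * jacobi_E4_D3 \<tau> z + g k \<tau> * jacobi_E6_D3 \<tau> z + h k \<tau> * psi12 \<tau> z)"
    by (simp_all add: R_def)
  have mem: "(\<Sum>k\<in>F. f k) \<in> M_star" "(\<Sum>k\<in>F. g k) \<in> M_star" "(\<Sum>k\<in>F. h k) \<in> M_star"
    by (rule sum_shifted_modular_forms[where w = 4] sum_shifted_modular_forms[where w = 6] sum_shifted_modular_forms[where w = 8];
        use F f g h in auto)+
  have "\<phi> = (\<lambda>\<tau> z. (\<Sum>k\<in>F. f k) \<tau> * jacobi_E4_D3 \<tau> z) + (\<lambda>\<tau> z. (\<Sum>k\<in>F. g k) \<tau> * jacobi_E6_D3 \<tau> z)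
      + (\<lambda>\<tau> z. (\<Sum>k\<in>F. h k) \<tau> * psi12 \<tau> z)"
    unfolding F(4) by (intro ext) (simp add: v sum_fun_apply1 sum_distrib_right sum.distrib)
  with mem show "\<phi> \<in> ?S" unfolding M_star_multiples_def by blast
next
  fix \<phi> assume "\<phi> \<in> ?S"
  then obtain a b c where abc: "a \<in> M_star_multiples jacobi_E4_D3" "b \<in> M_star_multiples jacobi_E6_D3"
    "c \<in> M_star_multiples psi12" "\<phi> = a + b + c" by blast
  have "a \<in> J_even lattice_D3" "b \<in> J_even lattice_D3" "c \<in> J_even lattice_D3"
    using M_star_multiple_sum[OF generators_are_jacobi_forms(1) abc(1)]
      M_star_multiple_sum[OF generators_are_jacobi_forms(2) abc(2)]
      M_star_multiple_sum[OF generators_are_jacobi_forms(3) abc(3)] by (simp_all add: J_even_def)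
  thus "\<phi> \<in> J_even lattice_D3"
    unfolding abc(4) J_even_def by (intro family_sum_add jacobi_forms_add)
qed

lemma even_multiples_independent:
  assumes "a \<in> M_star_multiples jacobi_E4_D3" "b \<in> M_star_multiples jacobi_E6_D3" "c \<in> M_star_multiples psi12"
    and sum: "a + b + c = 0"
  shows "a = 0 \<and> b = 0 \<and> c = 0"
proof -
  obtain f g h where f: "a = (\<lambda>\<tau> z. f \<tau> * jacobi_E4_D3 \<tau> z)" "b = (\<lambda>\<tau> z. g \<tau> * jacobi_E6_D3 \<tau> z)" "c = (\<lambda>\<tau> z. h \<tau> * psi12 \<tau> z)"
    using assms(1-3) unfolding M_star_multiples_def by blast
  have "a \<tau> z = 0 \<and> b \<tau> z = 0 \<and> c \<tau> z = 0" for \<tau> z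
  proof (cases "Im \<tau> > 0")
    case True
    have "f \<tau> * jacobi_E4_D3 \<tau> z + g \<tau> * jacobi_E6_D3 \<tau> z + h \<tau> * psi12 \<tau> z = 0" for z
      using fun_cong[OF fun_cong[OF sum], of \<tau> z] by (simp add: f)
    from even_generators_independent[OF True this] show ?thesis by (simp add: f)
  next
    case False
    thus ?thesis by (simp add: f jacobi_E4_D3_def pullback_def theta_sum_def jacobi_E6_D3_def heat_delta_def psi12_def eta_def)
  qed
  thus ?thesis by (auto simp: fun_eq_iff)
qed

theorem theorem5p3:
  shows "J_odd lattice_D3 = M_star_multiples (\<lambda>\<tau> z. eta \<tau> ^ 15 * pullback iota1 theta_ZN \<tau> z) \<and>
    internal_direct_sum {..<3}
      ((!) [M_star_multiples jacobi_E4_D3,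
            M_star_multiples jacobi_E6_D3,
            M_star_multiples (\<lambda>\<tau> z. eta \<tau> ^ 12 * pullback iota2 theta_ZN \<tau> z)])
      (J_even lattice_D3)"
  unfolding psi12_def[abs_def, symmetric] psi15_def[abs_def, symmetric]
    internal_direct_sum_3[OF zero_in_M_star_multiples zero_in_M_star_multiples zero_in_M_star_multiples]
  using J_odd_D3 J_even_D3 even_multiples_independent by blast

end
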